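(* Let $\Sigma$ be a $p$-dimensional $C^{1,1}$ submanifold of degree $d$ in the Engel group $\mathbb{E}$, where $1\le p\le4$. Then the restriction $\mathcal{S}^d\llcorner\Sigma$ of the $d$-dimensional spherical Hausdorff measure is equivalent to the intrinsic measure $|\tau^d_\Sigma|\,\tilde\mu_p\llcorner\Sigma$, that is, there exist constants $0<c\le C<\infty$ such that for every Borel set $A\subset\Sigma$ $$c\int_A|\tau^d_\Sigma(x)|\,d\tilde\mu_p(x)\ \le\ \mathcal{S}^d(A)\ \le\ C\int_A|\tau^d_\Sigma(x)|\,d\tilde\mu_p(x).$$
   Context: Engel group: $\mathbb{E}=\mathbb{R}^4$ with the Lie group structure having identity $0$ for which the vector fields $X_1=\partial_1$, $X_2=\partial_2+x_1\partial_3+\frac{x_1^2}{2}\partial_4$, $X_3=\partial_3+x_1\partial_4$, $X_4=\partial_4$ form a basis of the left invariant vector fields (the only nontrivial brackets are $[X_1,X_2]=X_3$ and $[X_1,X_3]=X_4$). The dilations $\delta_r(x)=(rx_1,rx_2,r^2x_3,r^3x_4)$, $r>0$, are group automorphisms. Fix a homogeneous distance $\rho$ on $\mathbb{R}^4$, that is, a continuous, left invariant distance with $\rho(\delta_rx,\delta_ry)=r\,\rho(x,y)$ for all $x,y$ and $r>0$ (for instance the Carnot-Carathéodory distance associated to $\mathrm{span}\{X_1,X_2\}$ and the left invariant Riemannian metric making $X_1,\dots,X_4$ orthonormal). $\mathcal{S}^d$ is the $d$-dimensional spherical Hausdorff measure of $\rho$, built from coverings by closed $\rho$-balls $D_{x,r}$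 of center $x$ and radius $r$ with size function $\zeta_d(D_{x,r})=r^d$. $C^{1,1}$ means locally parametrized by $C^1$ immersions with locally Lipschitz first derivatives. Degree: set $d_1=d_2=1$, $d_3=2$, $d_4=3$. The $p$-vector $X_{i_1}\wedge\dots\wedge X_{i_p}$, $i_1<\dots<i_p$, has degree $d_{i_1}+\dots+d_{i_p}$; a nonzero $p$-vector has degree equal to the maximum of the degrees of the basis elements $X_{i_1}\wedge\dots\wedge X_{i_p}$ appearing in it with nonzero coefficient. For $x\in\Sigma$, the pointwise degree $d_\Sigma(x)$ is the degree of a nonzero tangent $p$-vector of $\Sigma$ at $x$, written in terms of the $X_i$'s at $x$; the degree of $\Sigma$ is $\max_{x\in\Sigma}d_\Sigma(x)$. Intrinsic measure: an auxiliary Riemannian metric is fixed on the group. $\tilde\mu_p$ is the $p$-dimensional surface measure that this auxiliary metric induces on $\Sigma$; $\tau_\Sigma(x)$ is the tangent $p$-vector associated to $T_x\Sigma$ (wedge product of a basis of $T_x\Sigma$), of unit length with respect to the auxiliary metric; $\tau^d_\Sigma(x)$ is its component of degree $d$, i.e. the part of the expansion of $\tau_\Sigma(x)$ in the basis $X_{i_1}\wedge\dots\wedge X_{i_p}$ involving only basis elements of degree $d$; and $|\tau^d_\Sigma(x)|$ is its norm computed with respect to the same auxiliary metric.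
   Formalization: For an arbitrary auxiliary Riemannian metric uniform constants can fail on non-compact Σ (e.g. Σ=R^4, d=7); they are claimed for all Borel A⊂Σ if the metric is left invariant, and for every metric for Borel A⊂Σ∩K with constants depending on the compact K. *)

theory Defs
  imports "HOL-Analysis.Analysis"
begin

section \<open>The Engel group\<close>

lemma vector_4 [simp]:
  "(vector [a, b, c, d] :: 'a::zero ^ 4) $ 1 = a"
  "(vector [a, b, c, d] :: 'a::zero ^ 4) $ 2 = b"
  "(vector [a, b, c, d] :: 'a::zero ^ 4) $ 3 = c"
  "(vector [a, b, c, d] :: 'a::zero ^ 4) $ 4 = d"
  by (simp_all add: vector_def)

text \<open>
  The group law is determined by the requirements that \<open>0\<close> be the identity and that the
  vector fields \<open>engel_field i\<close> below be left invariant; see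
  \<open>engel_mult_unique\<close> and \<open>engel_field_left_invariant\<close>.
\<close>

definition engel_mult :: "real^4 \<Rightarrow> real^4 \<Rightarrow> real^4" where
  "engel_mult x y = vector
     [x$1 + y$1,
      x$2 + y$2,
      x$3 + y$3 + x$1 * y$2,
      x$4 + y$4 + x$1 * y$3 + (x$1)\<^sup>2 / 2 * y$2]"

definition engel_field :: "4 \<Rightarrow> real^4 \<Rightarrow> real^4" where
  "engel_field i x =
     (if i = 1 then axis 1 1
      else if i = 2 then axis 2 1 + x$1 *\<^sub>R axis 3 1 + ((x$1)\<^sup>2 / 2) *\<^sub>R axis 4 1
      else if i = 3 then axis 3 1 + x$1 *\<^sub>R axis 4 1
      else axis 4 1)"

definition engel_dilation :: "real \<Rightarrow> real^4 \<Rightarrow> real^4" where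
  "engel_dilation r x = vector [r * x$1, r * x$2, r^2 * x$3, r^3 * x$4]"

lemma engel_mult_0_left: "engel_mult 0 x = x"
  and engel_mult_0_right: "engel_mult x 0 = x"
  by (simp_all add: engel_mult_def vec_eq_iff forall_4)

lemma engel_mult_assoc: "engel_mult (engel_mult x y) z = engel_mult x (engel_mult y z)"
  by (simp add: engel_mult_def vec_eq_iff forall_4 algebra_simps power2_eq_square add_divide_distrib)

lemma engel_mult_inverse: "\<exists>y. engel_mult x y = 0 \<and> engel_mult y x = 0"
  by (rule exI[of _ "vector [- x$1, - x$2, - x$3 + x$1 * x$2,
        - x$4 + x$1 * x$3 - (x$1)\<^sup>2 / 2 * x$2]"])
     (simp add: engel_mult_def vec_eq_iff forall_4 field_simps power2_eq_square)

lemma engel_dilation_mult: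
  "engel_dilation r (engel_mult x y) = engel_mult (engel_dilation r x) (engel_dilation r y)"
  by (simp add: engel_mult_def engel_dilation_def vec_eq_iff forall_4 algebra_simps
      power2_eq_square power3_eq_cube)

lemma engel_mult_has_derivative:
  "(engel_mult x has_derivative
     (\<lambda>v. vector [v$1, v$2, v$3 + x$1 * v$2, v$4 + x$1 * v$3 + (x$1)\<^sup>2 / 2 * v$2])) (at y)"
proof -
  let ?D = "\<lambda>v::real^4. vector [v$1, v$2, v$3 + x$1 * v$2,
              v$4 + x$1 * v$3 + (x$1)\<^sup>2 / 2 * v$2] :: real^4"
  have "linear ?D"
    by (rule linearI) (simp_all add: vec_eq_iff forall_4 algebra_simps)
  then have "(?D has_derivative ?D) (at y)"
    by (intro bounded_linear_imp_has_derivative) (simp add: linear_conv_bounded_linear)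
  then have "((\<lambda>v. x + ?D v) has_derivative ?D) (at y)"
    using has_derivative_add[OF has_derivative_const] by fastforce
  moreover have "engel_mult x = (\<lambda>v. x + ?D v)"
    by (rule ext) (simp add: engel_mult_def vec_eq_iff forall_4)
  ultimately show ?thesis by simp
qed

lemma engel_field_left_invariant:
  "frechet_derivative (engel_mult x) (at y) (engel_field i y) = engel_field i (engel_mult x y)"
  unfolding frechet_derivative_at[OF engel_mult_has_derivative, symmetric]
  using exhaust_4[of i]
  by (auto simp: engel_field_def engel_mult_def vec_eq_iff forall_4 axis_def field_simps
      power2_eq_square)

lemma engel_field_coordinates:
  "v = (\<Sum>i\<in>UNIV. a $ i *\<^sub>R engel_field i x) \<longleftrightarrow>
   a = vector [v$1, v$2, v$3 - x$1 * v$2, v$4 - x$1 * v$3 + (x$1)\<^sup>2 / 2 * v$2]"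
proof -
  have "v = (\<Sum>i\<in>UNIV. a $ i *\<^sub>R engel_field i x) \<longleftrightarrow>
    v$1 = a$1 \<and> v$2 = a$2 \<and> v$3 = a$3 + x$1 * a$2 \<and>
    v$4 = a$4 + x$1 * a$3 + (x$1)\<^sup>2 / 2 * a$2"
    by (auto simp: sum_4 engel_field_def vec_eq_iff forall_4 axis_def)
  also have "\<dots> \<longleftrightarrow>
    a = vector [v$1, v$2, v$3 - x$1 * v$2, v$4 - x$1 * v$3 + (x$1)\<^sup>2 / 2 * v$2]"
  proof -
    have "v3 = a3 + t * v2 \<and> v4 = a4 + t * a3 + t\<^sup>2 / 2 * v2 \<longleftrightarrow>
          a3 = v3 - t * v2 \<and> a4 = v4 - t * v3 + t\<^sup>2 / 2 * v2" for t a3 a4 v2 v3 v4 :: real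
    proof -
      have "t * (a3 + t * v2) = t * a3 + t\<^sup>2 / 2 * v2 + t\<^sup>2 / 2 * v2"
        by (simp add: algebra_simps power2_eq_square)
      then have "v3 = a3 + t * v2 \<Longrightarrow>
          t * v3 = t * a3 + t\<^sup>2 / 2 * v2 + t\<^sup>2 / 2 * v2"
        by simp
      then show ?thesis by linarith
    qed
    from this[of "v$3" "a$3" "x$1" "v$2" "v$4" "a$4"] show ?thesis
      unfolding vec_eq_iff forall_4 vector_4 by metis
  qed
  finally show ?thesis .
qed

definition engel_coord :: "real^4 \<Rightarrow> real^4 \<Rightarrow> real^4" where
  "engel_coord x v = (THE a. v = (\<Sum>i\<in>UNIV. a $ i *\<^sub>R engel_field i x))"

lemma engel_coord_eq:
  "engel_coord x v = vector [v$1, v$2, v$3 - x$1 * v$2, v$4 - x$1 * v$3 + (x$1)\<^sup>2 / 2 * v$2]"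
  unfolding engel_coord_def engel_field_coordinates by simp

lemma engel_mult_unique:
  fixes m :: "real^4 \<Rightarrow> real^4 \<Rightarrow> real^4"
  assumes zero: "\<And>x. m x 0 = x"
    and diff: "\<And>x y. m x differentiable at y"
    and inv: "\<And>x y i. frechet_derivative (m x) (at y) (engel_field i y) = engel_field i (m x y)"
  shows "m = engel_mult"
proof (intro ext)
  fix x y :: "real^4"
  define D where "D y = frechet_derivative (m x) (at y)" for y
  have D: "(m x has_derivative D y) (at y)" for y
    using diff unfolding D_def by (simp add: frechet_derivative_works)
  have lin: "linear (D y)" for y
    using D by (rule has_derivative_linear)
  have Dv: "D y v = (\<Sum>i\<in>UNIV. engel_coord y v $ i *\<^sub>R engel_field i (m x y))" for y v
  proof -
    have v: "v = (\<Sum>i\<in>UNIV. engel_coord y v $ i *\<^sub>R engel_field i y)"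
      unfolding engel_field_coordinates engel_coord_eq ..
    have "D y (\<Sum>i\<in>UNIV. engel_coord y v $ i *\<^sub>R engel_field i y) =
          (\<Sum>i\<in>UNIV. engel_coord y v $ i *\<^sub>R D y (engel_field i y))"
      by (simp add: linear_sum[OF lin] linear_cmul[OF lin])
    then show ?thesis
      using v inv by (simp add: D_def)
  qed
  have comp: "D y v $ 1 = v$1" "D y v $ 2 = v$2"
    "D y v $ 3 = v$3 - y$1 * v$2 + m x y $ 1 * v$2"
    "D y v $ 4 = v$4 - y$1 * v$3 + (y$1)\<^sup>2 / 2 * v$2 + m x y $ 1 * (v$3 - y$1 * v$2)
       + (m x y $ 1)\<^sup>2 / 2 * v$2" for y v
    by (simp_all add: Dv sum_4 engel_coord_eq engel_field_def axis_def)
  have const: "f y = f 0" if "\<And>y. (f has_derivative (\<lambda>v. 0)) (at y)" for f :: "real^4 \<Rightarrow> real"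
    using has_derivative_zero_constant[of UNIV f] that by force
  have Dk: "((\<lambda>y. m x y $ k) has_derivative (\<lambda>v. D y v $ k)) (at y)" for k y
    by (rule bounded_linear.has_derivative[OF bounded_linear_vec_nth D])
  have Yk: "((\<lambda>y::real^4. y $ k) has_derivative (\<lambda>v. v $ k)) (at y)" for k y
    by (rule bounded_linear.has_derivative[OF bounded_linear_vec_nth has_derivative_ident])
  have k1: "m x y $ 1 = x$1 + y$1" for y
  proof -
    have "m x y $ 1 - y$1 = m x 0 $ 1 - (0::real^4)$1"
      by (rule has_derivative_zero_unique[OF convex_UNIV, of "\<lambda>y. m x y $ 1 - y $ 1"])
         (use has_derivative_diff[OF Dk[of 1] Yk[of 1]] in \<open>auto simp: comp\<close>)
    then show ?thesis by (simp add: zero)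
  qed
  have k2: "m x y $ 2 = x$2 + y$2" for y
  proof -
    have "m x y $ 2 - y$2 = m x 0 $ 2 - (0::real^4)$2"
      by (rule has_derivative_zero_unique[OF convex_UNIV, of "\<lambda>y. m x y $ 2 - y $ 2"])
         (use has_derivative_diff[OF Dk[of 2] Yk[of 2]] in \<open>auto simp: comp\<close>)
    then show ?thesis by (simp add: zero)
  qed
  have k3: "m x y $ 3 = x$3 + y$3 + x$1 * y$2" for y
  proof -
    have "m x y $ 3 - (y$3 + x$1 * y$2) = m x 0 $ 3 - ((0::real^4)$3 + x$1 * (0::real^4)$2)"
      by (rule has_derivative_zero_unique[OF convex_UNIV, of "\<lambda>y. m x y $ 3 - (y $ 3 + x$1 * y$2)"])
         (use has_derivative_diff[OF Dk[of 3] has_derivative_add[OF Yk[of 3]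
            has_derivative_mult_right[OF Yk[of 2], of "x$1"]]] in
           \<open>auto simp: comp k1 algebra_simps\<close>)
    then show ?thesis by (simp add: zero)
  qed
  have k4: "m x y $ 4 = x$4 + y$4 + x$1 * y$3 + (x$1)\<^sup>2 / 2 * y$2" for y
  proof -
    have "m x y $ 4 - (y$4 + x$1 * y$3 + (x$1)\<^sup>2 / 2 * y$2) =
          m x 0 $ 4 - ((0::real^4)$4 + x$1 * (0::real^4)$3 + (x$1)\<^sup>2 / 2 * (0::real^4)$2)"
      by (rule has_derivative_zero_unique[OF convex_UNIV,
            of "\<lambda>y. m x y $ 4 - (y$4 + x$1 * y$3 + (x$1)\<^sup>2 / 2 * y$2)"])
         (use has_derivative_diff[OF Dk[of 4] has_derivative_add[OF has_derivative_add[OF Yk[of 4]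
            has_derivative_mult_right[OF Yk[of 3], of "x$1"]]
            has_derivative_mult_right[OF Yk[of 2], of "(x$1)\<^sup>2 / 2"]]] in
           \<open>auto simp: comp k1 field_simps power2_eq_square\<close>)
    then show ?thesis by (simp add: zero)
  qed
  show "m x y = engel_mult x y"
    by (simp add: engel_mult_def vec_eq_iff forall_4 k1 k2 k3 k4)
qed

section \<open>Homogeneous distances and spherical Hausdorff measure\<close>

definition homogeneous_distance :: "(real^4 \<Rightarrow> real^4 \<Rightarrow> real) \<Rightarrow> bool" where
  "homogeneous_distance \<rho> \<longleftrightarrow>
     Metric_space UNIV \<rho> \<and>
     continuous_on UNIV (\<lambda>z. \<rho> (fst z) (snd z)) \<and>
     (\<forall>x y z. \<rho> (engel_mult z x) (engel_mult z y) = \<rho> x y) \<and>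
     (\<forall>r>0. \<forall>x y. \<rho> (engel_dilation r x) (engel_dilation r y) = r * \<rho> x y)"

text \<open>
  Caratheodory's construction from the closed balls, with size function \<open>r^d\<close> (no
  normalizing factor): a pair \<open>(x, r) \<in> G\<close> stands for the closed ball of center \<open>x\<close> and
  radius \<open>r\<close>, and the balls of a covering have diameter at most \<open>\<delta>\<close>.
\<close>

definition spherical_hausdorff ::
    "(real^4 \<Rightarrow> real^4 \<Rightarrow> real) \<Rightarrow> nat \<Rightarrow> (real^4) set \<Rightarrow> ennreal" where
  "spherical_hausdorff \<rho> d A =
     (SUP \<delta>\<in>{0<..}. INF G\<in>{G :: ((real^4) \<times> real) set.
          countable G \<and>
          (\<forall>(x, r)\<in>G. 0 < r \<and>
             (\<forall>y\<in>Metric_space.mcball UNIV \<rho> x r. \<forall>z\<in>Metric_space.mcball UNIV \<rho> x r. \<rho> y z \<le> \<delta>)) \<and>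
          A \<subseteq> (\<Union>(x, r)\<in>G. Metric_space.mcball UNIV \<rho> x r)}.
        \<Sum>\<^sub>\<infinity>(x, r)\<in>G. ennreal (r ^ d))"

section \<open>Submanifolds\<close>

definition C11_param ::
    "(real^'p::finite) set \<Rightarrow> (real^'p \<Rightarrow> real^4) \<Rightarrow> (real^4) set \<Rightarrow> bool" where
  "C11_param U \<phi> S \<longleftrightarrow>
     open U \<and>
     (\<exists>V. open V \<and> \<phi> ` U = S \<inter> V) \<and>
     (\<exists>\<psi>. homeomorphism U (\<phi> ` U) \<phi> \<psi>) \<and>
     (\<exists>\<phi>' :: real^'p \<Rightarrow> ((real^'p) \<Rightarrow>\<^sub>L (real^4)).
        (\<forall>u\<in>U. (\<phi> has_derivative blinfun_apply (\<phi>' u)) (at u) \<and> inj (blinfun_apply (\<phi>' u))) \<and>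
        (\<forall>u\<in>U. \<exists>e>0. \<exists>L. L-lipschitz_on (ball u e \<inter> U) \<phi>'))"

text \<open>The dimension of the submanifold is \<open>CARD('p)\<close>.\<close>

definition C11_submanifold :: "'p::finite itself \<Rightarrow> (real^4) set \<Rightarrow> bool" where
  "C11_submanifold _ S \<longleftrightarrow> (\<forall>x\<in>S. \<exists>(U :: (real^'p) set) \<phi>. C11_param U \<phi> S \<and> x \<in> \<phi> ` U)"

definition tangent_space :: "(real^4) set \<Rightarrow> real^4 \<Rightarrow> (real^4) set" where
  "tangent_space S x =
     {v. \<exists>\<gamma> :: real \<Rightarrow> real^4. \<gamma> 0 = x \<and> (\<forall>\<^sub>F t in nhds 0. \<gamma> t \<in> S) \<and>
           (\<gamma> has_vector_derivative v) (at 0)}"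

definition tangent_basis :: "(real^4) set \<Rightarrow> real^4 \<Rightarrow> ('p::finite \<Rightarrow> real^4)" where
  "tangent_basis S x =
     (SOME v. inj v \<and> independent (range v) \<and> span (range v) = tangent_space S x)"

section \<open>Multivectors and degree\<close>

text \<open>
  A \<open>p\<close>-vector at \<open>x\<close>, where \<open>p = CARD('p)\<close>, is given by its coefficients in the basis
  \<open>X\<^sub>I\<close>, the wedge product of the fields \<open>engel_field (I a)\<close> at \<open>x\<close> in increasing order of
  \<open>a :: 'p\<close>, where \<open>I :: 'p \<Rightarrow> 4\<close> is a strictly increasing multi-index. In the index type
  \<open>4\<close> one has \<open>4 = 0\<close>, so that the indices are ordered \<open>4 < 1 < 2 < 3\<close>; compared with the
  usual order this only changes the signs of some \<open>X\<^sub>I\<close>.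
\<close>

type_synonym 'p pvector = "('p \<Rightarrow> 4) \<Rightarrow> real"

definition multi_indices :: "('p::{finite,linorder} \<Rightarrow> 4) set" where
  "multi_indices = {I. strict_mono I}"

definition wedge :: "real^4 \<Rightarrow> ('p::{finite,linorder} \<Rightarrow> real^4) \<Rightarrow> 'p pvector" where
  "wedge x v = (\<lambda>I. det (\<chi> a b. engel_coord x (v a) $ I b))"

definition weight :: "4 \<Rightarrow> nat" where
  "weight i = (if i = 1 \<or> i = 2 then 1 else if i = 3 then 2 else 3)"

definition index_degree :: "('p::{finite,linorder} \<Rightarrow> 4) \<Rightarrow> nat" where
  "index_degree I = (\<Sum>a\<in>UNIV. weight (I a))"

definition pvector_degree :: "'p::{finite,linorder} pvector \<Rightarrow> nat" where
  "pvector_degree \<tau> = Max {index_degree I | I. I \<in> multi_indices \<and> \<tau> I \<noteq> 0}"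

definition degree_component ::
    "nat \<Rightarrow> 'p::{finite,linorder} pvector \<Rightarrow> 'p pvector" where
  "degree_component d \<tau> = (\<lambda>I. if index_degree I = d then \<tau> I else 0)"

definition pointwise_degree ::
    "'p::{finite,linorder} itself \<Rightarrow> (real^4) set \<Rightarrow> real^4 \<Rightarrow> nat" where
  "pointwise_degree _ S x = pvector_degree (wedge x (tangent_basis S x :: 'p \<Rightarrow> real^4))"

definition submanifold_degree :: "'p::{finite,linorder} itself \<Rightarrow> (real^4) set \<Rightarrow> nat" where
  "submanifold_degree P S = Max (pointwise_degree P S ` S)"

section \<open>The intrinsic measure\<close>

definition riemannian_metric :: "(real^4 \<Rightarrow> real^4 \<Rightarrow> real^4 \<Rightarrow> real) \<Rightarrow> bool" where
  "riemannian_metric g \<longleftrightarrow>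
     (\<forall>x. bilinear (g x) \<and> (\<forall>u v. g x u v = g x v u) \<and> (\<forall>v. v \<noteq> 0 \<longrightarrow> 0 < g x v v)) \<and>
     (\<forall>u v. continuous_on UNIV (\<lambda>x. g x u v))"

definition left_invariant_metric :: "(real^4 \<Rightarrow> real^4 \<Rightarrow> real^4 \<Rightarrow> real) \<Rightarrow> bool" where
  "left_invariant_metric g \<longleftrightarrow>
     (\<forall>x y u v. g (engel_mult x y) (frechet_derivative (engel_mult x) (at y) u)
                                   (frechet_derivative (engel_mult x) (at y) v) = g y u v)"

text \<open>
  The inner product induced on \<open>p\<close>-vectors at \<open>x\<close> is determined by
  \<open>\<langle>v\<^sub>1 \<and> \<dots> \<and> v\<^sub>p, w\<^sub>1 \<and> \<dots> \<and> w\<^sub>p\<rangle> = det (g x v\<^sub>a w\<^sub>b)\<close>.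
\<close>

definition pvector_norm ::
    "(real^4 \<Rightarrow> real^4 \<Rightarrow> real^4 \<Rightarrow> real) \<Rightarrow> real^4 \<Rightarrow> 'p::{finite,linorder} pvector \<Rightarrow> real" where
  "pvector_norm g x \<tau> =
     sqrt (\<Sum>I\<in>multi_indices. \<Sum>J\<in>multi_indices. \<tau> I * \<tau> J *
       det (\<chi> a b :: 'p. g x (engel_field (I a) x) (engel_field (J b) x)))"

definition unit_tangent_pvector ::
    "(real^4 \<Rightarrow> real^4 \<Rightarrow> real^4 \<Rightarrow> real) \<Rightarrow> (real^4) set \<Rightarrow> real^4 \<Rightarrow>
     'p::{finite,linorder} pvector" where
  "unit_tangent_pvector g S x =
     (let \<tau> = wedge x (tangent_basis S x :: 'p \<Rightarrow> real^4)
      in (\<lambda>I. \<tau> I / pvector_norm g x \<tau>))"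

text \<open>
  The Riemannian surface measure of a submanifold, as a Borel measure on the ambient space
  concentrated on \<open>S\<close>: the only one given by the area formula in every local parametrization.
\<close>

definition surface_measure ::
    "'p::finite itself \<Rightarrow> (real^4 \<Rightarrow> real^4 \<Rightarrow> real^4 \<Rightarrow> real) \<Rightarrow> (real^4) set \<Rightarrow>
     (real^4) measure" where
  "surface_measure _ g S =
     (THE \<mu>. sets \<mu> = sets borel \<and> emeasure \<mu> (- S) = 0 \<and>
        (\<forall>(U :: (real^'p) set) \<phi>. C11_param U \<phi> S \<longrightarrow>
          (\<forall>B\<in>sets borel. B \<subseteq> U \<longrightarrow>
             emeasure \<mu> (\<phi> ` B) =
               (\<integral>\<^sup>+u\<in>B. ennreal (sqrt (det (\<chi> a b :: 'p. g (\<phi> u)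
                  (frechet_derivative \<phi> (at u) (axis a 1))
                  (frechet_derivative \<phi> (at u) (axis b 1))))) \<partial>lborel))))"

definition intrinsic_measure ::
    "'p::{finite,linorder} itself \<Rightarrow> (real^4 \<Rightarrow> real^4 \<Rightarrow> real^4 \<Rightarrow> real) \<Rightarrow> nat \<Rightarrow>
     (real^4) set \<Rightarrow> (real^4) set \<Rightarrow> ennreal" where
  "intrinsic_measure P g d S A =
     (\<integral>\<^sup>+x\<in>A. ennreal (pvector_norm g x
        (degree_component d (unit_tangent_pvector g S x :: 'p pvector))) \<partial>surface_measure P g S)"

end

theory Submission
  imports Defs
begin

text \<open>
  The theorem follows from two-sided density estimates for the intrinsic measure \<open>m\<close> (called
  \<open>degree_measure\<close> below). If \<open>m\<close> of the ball of centre \<open>x\<close> and radius \<open>r\<close> is comparable with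
  \<open>r^d\<close> for small \<open>r\<close>, then a covering argument makes \<open>m\<close> comparable with the spherical Hausdorff
  measure: an upper density bound that holds uniformly near each point bounds \<open>m\<close> by the Hausdorff
  measure (\<open>measure_le_spherical_hausdorff\<close>), and a lower density bound gives the reverse
  inequality by Vitali's covering argument (\<open>spherical_hausdorff_le_of_density\<close>). So the points of
  \<open>S\<close> are divided into those of maximal pointwise degree \<open>d\<close>, where both bounds hold
  (\<open>upper_density\<close>, \<open>lower_density_maximal\<close>), and those of smaller degree. The latter are
  \<open>m\<close>-null by definition of \<open>m\<close>, and have to be shown to be null for the Hausdorff measure.

  Densities. A ball of radius \<open>r\<close> is comparable with the left translate of the box with sides
  \<open>r^weight i\<close> (\<open>ball_box\<close>). Let \<open>I\<close> be the multi-index of degree \<open>d\<close> with the largest coefficient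
  in the tangent \<open>p\<close>-vector at a point \<open>x0\<close> of maximal degree. Translate \<open>S\<close> by the inverse of a
  centre \<open>x\<close> and project it to the coordinates \<open>I\<close>. Near \<open>x0\<close> this projection is injective, and its
  Jacobian is nearly the coefficient \<open>I\<close> of the tangent \<open>p\<close>-vector, which dominates the density of
  \<open>m\<close>. As the image of the ball lies in a box of volume comparable with \<open>r^d\<close>, the upper bound
  follows. Since the coefficient cancels, the constant does not depend on the point. For
  the lower bound, \<open>S\<close> is parametrized by the coordinates \<open>I\<close>, and one shows that the part of \<open>S\<close>
  over a box with sides comparable with \<open>r^weight (I b)\<close> stays in the ball. Along the lift of a
  segment the velocity in the left invariant frame is a combination of its components \<open>I\<close>, by
  Cramer's rule, with quotients of coefficients of the tangent \<open>p\<close>-vector as factors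
  (\<open>frame_velocity_combination\<close>). The factors that would move a coordinate of larger weight are
  coefficients of degree larger than \<open>d\<close> and vanish (\<open>maximal_degree_box\<close>).

  Points of lower degree. At a point whose degree \<open>n\<close> is smaller than \<open>d\<close>, take for \<open>I\<close> a
  multi-index of degree \<open>n\<close> with a nonzero coefficient. The factors above that raise the degree
  need not vanish except at the point itself, but they are Lipschitz because \<open>S\<close> is of class \<open>C^{1,1}\<close>; this
  is where that regularity is used. In the Engel group this is enough to find, over the coordinates \<open>I\<close>, a
  box of volume much larger than \<open>r^d\<close> whose lift stays in the ball of radius \<open>r\<close>
  (\<open>lower_degree_box\<close>, \<open>lower_degree_thin_box\<close>). Therefore Lebesgue measure of the parameters has infinite lower
  \<open>d\<close>-density at these points (\<open>lower_density_infinite\<close>), and the covering argument shows that their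
  Hausdorff measure is zero.

  The constants depend on the distance and on the comparison of the norm of \<open>p\<close>-vectors with the
  sum of the absolute values of their coefficients. The latter is global for a left invariant metric,
  and uniform on compact sets in general.
\<close>

section \<open>Minors and the Cauchy-Binet formula\<close>

text \<open>Rows are indexed by \<open>'p\<close>, columns are selected by \<open>K\<close>. Since \<open>K\<close> need not be increasing or
  injective, a single column can be exchanged by a function update, as in Cramer's rule.\<close>

definition minor :: "('p::{finite,linorder} \<Rightarrow> 'n \<Rightarrow> real) \<Rightarrow> ('p \<Rightarrow> 'n) \<Rightarrow> real" where
  "minor M K = det (\<chi> a b. M a (K b))"

lemma card_less_strict_mono:
  fixes K :: "'p::{finite,linorder} \<Rightarrow> 'n::linorder"
  assumes "strict_mono K"
  shows "card {y \<in> range K. y < K p} = card {q. q < p}"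
proof -
  have "{y \<in> range K. y < K p} = K ` {q. q < p}"
    using assms by (auto simp: strict_mono_less)
  moreover have "inj K" using assms by (rule strict_mono_imp_inj_on)
  ultimately show ?thesis by (simp add: card_image inj_on_subset[OF \<open>inj K\<close>])
qed

lemma card_less_inject:
  fixes p q :: "'p::{finite,linorder}"
  assumes "card {r. r < p} = card {r. r < q}"
  shows "p = q"
proof (rule ccontr)
  assume "p \<noteq> q"
  then consider "p < q" | "q < p" by fastforce
  then show False
  proof cases
    case 1
    then have "{r. r < p} \<subset> {r. r < q}" by auto
    then have "card {r. r < p} < card {r. r < q}" by (simp add: psubset_card_mono)
    with assms show False by simp
  next
    case 2
    then have "{r. r < q} \<subset> {r. r < p}" by auto
    then have "card {r. r < q} < card {r. r < p}" by (simp add: psubset_card_mono)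
    with assms show False by simp
  qed
qed

lemma strict_mono_range_unique:
  fixes K L :: "'p::{finite,linorder} \<Rightarrow> 'n::linorder"
  assumes K: "strict_mono K" and L: "strict_mono L" and "range K = range L"
  shows "K = L"
proof
  fix p
  obtain q where q: "K p = L q" using \<open>range K = range L\<close> by blast
  have "card {r. r < p} = card {r. r < q}"
    using card_less_strict_mono[OF K, of p] card_less_strict_mono[OF L, of q] q assms(3) by simp
  then have "p = q" by (rule card_less_inject)
  with q show "K p = L p" by simp
qed

lemma strict_mono_enumeration:
  fixes f :: "'p::{finite,linorder} \<Rightarrow> 'n::linorder"
  assumes "inj f"
  obtains K :: "'p \<Rightarrow> 'n" where "strict_mono K" "range K = range f"
proof -
  define L where "L = sorted_list_of_set (range f)"
  define k where "k p = card {q. q < p}" for p :: 'p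
  have len: "length L = CARD('p)" using assms by (simp add: L_def card_image)
  have klt: "k p < length L" for p
  proof -
    have "{q. q < p} \<subset> UNIV" by auto
    then show ?thesis unfolding k_def len by (intro psubset_card_mono) auto
  qed
  have "inj k" unfolding k_def inj_def using card_less_inject by blast
  then have "k ` UNIV = {..<length L}"
    using klt len by (intro card_subset_eq) (auto simp: card_image)
  then have rng: "range (\<lambda>p. L ! k p) = set L"
    by (auto simp: set_conv_nth image_iff) (metis imageE lessThan_iff)
  have kmono: "k p < k q" if "p < q" for p q
    unfolding k_def using that by (intro psubset_card_mono) auto
  have "strict_mono (\<lambda>p. L ! k p)"
  proof
    fix p q :: 'p assume "p < q"
    then show "L ! k p < L ! k q"
      using kmono[OF \<open>p < q\<close>] klt strict_sorted_list_of_set[of "range f"]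
      by (auto simp: L_def intro: sorted_wrt_nth_less)
  qed
  then show thesis using that rng by (auto simp: L_def)
qed

lemma injective_sorted_factorization:
  fixes f :: "'p::{finite,linorder} \<Rightarrow> 'n::linorder"
  assumes "inj f"
  obtains K \<sigma> where "strict_mono K" "\<sigma> permutes UNIV" "f = K \<circ> \<sigma>"
proof -
  obtain K :: "'p \<Rightarrow> 'n" where K: "strict_mono K" "range K = range f"
    using strict_mono_enumeration[OF assms] .
  have iK: "inj K" using K(1) by (rule strict_mono_imp_inj_on)
  define \<sigma> where "\<sigma> = inv K \<circ> f"
  have f: "K (\<sigma> p) = f p" for p
    unfolding \<sigma>_def o_def by (metis K(2) f_inv_into_f rangeI)
  have "inj \<sigma>" using assms f by (metis injI injD)
  then have "bij \<sigma>" by (simp add: bij_def finite_UNIV_inj_surj)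
  then have "\<sigma> permutes UNIV" by (rule bij_imp_permutes) auto
  moreover have "f = K \<circ> \<sigma>" using f by auto
  ultimately show thesis using that K by blast
qed

text \<open>The Leibniz expansion of the determinant of a product runs over all selections of columns, and the
  non-injective ones contribute nothing. Sorting the others by their range gives the sum over
  increasing multi-indices.\<close>

lemma sum_all_functions_sorted:
  fixes h :: "('p::{finite,linorder} \<Rightarrow> 'n::{finite,linorder}) \<Rightarrow> 'a::comm_monoid_add"
  assumes "\<And>f. \<not> inj f \<Longrightarrow> h f = 0"
  shows "(\<Sum>f\<in>UNIV. h f) = (\<Sum>K | strict_mono K. \<Sum>\<sigma> | \<sigma> permutes UNIV. h (K \<circ> \<sigma>))"
proof -
  let ?P = "{K :: 'p \<Rightarrow> 'n. strict_mono K} \<times> {\<sigma> :: 'p \<Rightarrow> 'p. \<sigma> permutes UNIV}"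
  let ?c = "\<lambda>(K :: 'p \<Rightarrow> 'n, \<sigma> :: 'p \<Rightarrow> 'p). K \<circ> \<sigma>"
  have inj: "inj_on ?c ?P"
  proof (rule inj_onI, clarsimp)
    fix K L :: "'p \<Rightarrow> 'n" and \<sigma> \<tau> :: "'p \<Rightarrow> 'p"
    assume *: "strict_mono K" "\<sigma> permutes UNIV" "strict_mono L" "\<tau> permutes UNIV" "K \<circ> \<sigma> = L \<circ> \<tau>"
    have "range K = range (K \<circ> \<sigma>)" using permutes_image[OF *(2)] by (metis image_comp)
    moreover have "range L = range (L \<circ> \<tau>)" using permutes_image[OF *(4)] by (metis image_comp)
    ultimately have KL: "K = L" using * strict_mono_range_unique by metis
    have "inj K" using *(1) by (rule strict_mono_imp_inj_on)
    then have "\<sigma> = \<tau>" using *(5) KL by (auto simp: fun_eq_iff inj_eq)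
    with KL show "K = L \<and> \<sigma> = \<tau>" by simp
  qed
  have img: "?c ` ?P = {f. inj f}"
  proof (intro equalityI subsetI)
    fix f assume "f \<in> ?c ` ?P"
    then obtain K \<sigma> where *: "strict_mono K" "\<sigma> permutes UNIV" "f = K \<circ> \<sigma>" by auto
    have "inj K" using *(1) by (rule strict_mono_imp_inj_on)
    then have "inj (K \<circ> \<sigma>)" using permutes_inj[OF *(2)] by (rule inj_compose)
    then show "f \<in> {f. inj f}" using *(3) by simp
  next
    fix f :: "'p \<Rightarrow> 'n" assume "f \<in> {f. inj f}"
    then obtain K \<sigma> where "strict_mono K" "\<sigma> permutes UNIV" "f = K \<circ> \<sigma>"
      using injective_sorted_factorization by blast
    then show "f \<in> ?c ` ?P" by force
  qed
  have "(\<Sum>f\<in>UNIV. h f) = (\<Sum>f | inj f. h f)"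
    by (rule sum.mono_neutral_right) (use assms in auto)
  also have "\<dots> = (\<Sum>p\<in>?P. h (?c p))"
    unfolding img[symmetric] by (subst sum.reindex[OF inj]) simp
  also have "\<dots> = (\<Sum>K | strict_mono K. \<Sum>\<sigma> | \<sigma> permutes UNIV. h (K \<circ> \<sigma>))"
    by (simp add: sum.cartesian_product case_prod_beta)
  finally show ?thesis .
qed

lemma minor_compose_permutation:
  fixes M :: "'p::{finite,linorder} \<Rightarrow> 'n \<Rightarrow> real"
  assumes "\<sigma> permutes UNIV"
  shows "minor M (K \<circ> \<sigma>) = of_int (sign \<sigma>) * minor M K"
  using det_permute_columns[OF assms, of "\<chi> a b. M a (K b)"] by (simp add: minor_def)

lemma minor_not_inj:
  assumes "\<not> inj K"
  shows "minor M K = 0"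
proof -
  obtain i j where "i \<noteq> j" "K i = K j" using assms by (auto simp: inj_def)
  then show ?thesis unfolding minor_def
    by (intro det_identical_columns[of i j]) (auto simp: column_def)
qed

text \<open>An unsorted minor is, up to sign, the coefficient of an increasing multi-index; so bounds for the
  coefficients of a multivector apply to all minors.\<close>

lemma minor_sorted:
  fixes M :: "'p::{finite,linorder} \<Rightarrow> 'n::linorder \<Rightarrow> real"
  assumes "minor M K \<noteq> 0"
  obtains J \<sigma> where "strict_mono J" "\<sigma> permutes UNIV" "K = J \<circ> \<sigma>" "\<bar>minor M K\<bar> = \<bar>minor M J\<bar>"
proof -
  have "inj K" using assms minor_not_inj by blast
  then obtain J \<sigma> where J: "strict_mono J" "\<sigma> permutes UNIV" "K = J \<circ> \<sigma>"
    using injective_sorted_factorization by blast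
  then have "\<bar>minor M K\<bar> = \<bar>minor M J\<bar>"
    by (simp add: minor_compose_permutation abs_mult sign_def)
  with J that show thesis by blast
qed

theorem cauchy_binet:
  fixes A B :: "'p::{finite,linorder} \<Rightarrow> 'n::{finite,linorder} \<Rightarrow> real"
  shows "det (\<chi> a b. \<Sum>i\<in>UNIV. A a i * B b i) = (\<Sum>K | strict_mono K. minor A K * minor B K)"
proof -
  let ?h = "\<lambda>f :: 'p \<Rightarrow> 'n. (\<Prod>a\<in>UNIV. A a (f a)) * minor B f"
  have prod_sum: "(\<Prod>a\<in>UNIV. \<Sum>i\<in>UNIV. c a i) = (\<Sum>f\<in>UNIV. \<Prod>a\<in>UNIV. c a (f a))" for c :: "'p \<Rightarrow> 'n \<Rightarrow> real"
    using prod_sum_PiE[of "UNIV :: 'p set" "\<lambda>_. UNIV :: 'n set" c] by (simp add: PiE_UNIV_domain)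
  have "det (\<chi> a b. \<Sum>i\<in>UNIV. A a i * B b i) =
      (\<Sum>\<sigma> | \<sigma> permutes UNIV. of_int (sign \<sigma>) * (\<Prod>a\<in>UNIV. \<Sum>i\<in>UNIV. A a i * B (\<sigma> a) i))"
    by (simp add: det_def)
  also have "\<dots> = (\<Sum>\<sigma> | \<sigma> permutes UNIV. of_int (sign \<sigma>) * (\<Sum>f\<in>UNIV. \<Prod>a\<in>UNIV. A a (f a) * B (\<sigma> a) (f a)))"
    by (simp add: prod_sum)
  also have "\<dots> = (\<Sum>\<sigma> | \<sigma> permutes UNIV. \<Sum>f\<in>UNIV. (\<Prod>a\<in>UNIV. A a (f a)) * (of_int (sign \<sigma>) * (\<Prod>a\<in>UNIV. B (\<sigma> a) (f a))))"
    by (simp add: prod.distrib sum_distrib_left mult_ac)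
  also have "\<dots> = (\<Sum>f\<in>UNIV. \<Sum>\<sigma> | \<sigma> permutes UNIV. (\<Prod>a\<in>UNIV. A a (f a)) * (of_int (sign \<sigma>) * (\<Prod>a\<in>UNIV. B (\<sigma> a) (f a))))"
    by (rule sum.swap)
  also have "\<dots> = (\<Sum>f\<in>UNIV. ?h f)"
  proof (rule sum.cong[OF refl])
    fix f :: "'p \<Rightarrow> 'n"
    have "minor B f = det (transpose (\<chi> a b. B a (f b)))"
      by (simp add: minor_def det_transpose)
    also have "\<dots> = (\<Sum>\<sigma> | \<sigma> permutes UNIV. of_int (sign \<sigma>) * (\<Prod>a\<in>UNIV. B (\<sigma> a) (f a)))"
      by (simp add: det_def transpose_def)
    finally show "(\<Sum>\<sigma> | \<sigma> permutes UNIV. (\<Prod>a\<in>UNIV. A a (f a)) * (of_int (sign \<sigma>) * (\<Prod>a\<in>UNIV. B (\<sigma> a) (f a)))) = ?h f"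
      by (simp add: sum_distrib_left)
  qed
  also have "\<dots> = (\<Sum>K | strict_mono K. \<Sum>\<sigma> | \<sigma> permutes UNIV. ?h (K \<circ> \<sigma>))"
    by (rule sum_all_functions_sorted) (simp add: minor_not_inj)
  also have "\<dots> = (\<Sum>K | strict_mono K. minor A K * minor B K)"
  proof (rule sum.cong[OF refl])
    fix K :: "'p \<Rightarrow> 'n"
    have A: "minor A K = (\<Sum>\<sigma> | \<sigma> permutes UNIV. of_int (sign \<sigma>) * (\<Prod>a\<in>UNIV. A a (K (\<sigma> a))))"
      by (simp add: minor_def det_def)
    show "(\<Sum>\<sigma> | \<sigma> permutes UNIV. ?h (K \<circ> \<sigma>)) = minor A K * minor B K"
      unfolding A sum_distrib_right
      by (rule sum.cong[OF refl]) (simp add: minor_compose_permutation)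
  qed
  finally show ?thesis .
qed

lemma minor_transform_rows:
  fixes T :: "real^'p::{finite,linorder}^'p::_"
  shows "minor (\<lambda>a i. \<Sum>c\<in>UNIV. T $ a $ c * M c i) K = det T * minor M K"
proof -
  have "(\<chi> a b. \<Sum>c\<in>UNIV. T $ a $ c * M c (K b)) = T ** (\<chi> a b. M a (K b))"
    by (simp add: matrix_matrix_mult_def)
  then show ?thesis unfolding minor_def by (simp add: det_mul)
qed

text \<open>Cramer's rule. It expresses all components of a tangent vector by its components \<open>I\<close>, with
  quotients of coefficients of the tangent multivector as factors.\<close>

lemma minor_cramer:
  fixes M :: "'p::{finite,linorder} \<Rightarrow> 'n \<Rightarrow> real"
  assumes "minor M I \<noteq> 0"
  shows "M a j = (\<Sum>b\<in>UNIV. minor M (I(b := j)) / minor M I * M a (I b))"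
proof -
  let ?A = "\<chi> a b. M a (I b)" and ?y = "\<chi> a. M a j"
  let ?x = "\<chi> k. det (\<chi> i j. if j = k then ?y $ i else ?A $ i $ j) / det ?A"
  have d: "det ?A \<noteq> 0" using assms by (simp add: minor_def)
  have "?A *v ?x = ?y" using cramer[OF d, of ?x ?y] by blast
  then have "M a j = (\<Sum>b\<in>UNIV. ?A $ a $ b * ?x $ b)"
    by (simp add: matrix_vector_mult_def vec_eq_iff)
  also have "\<dots> = (\<Sum>b\<in>UNIV. minor M (I(b := j)) / minor M I * M a (I b))"
  proof (rule sum.cong[OF refl])
    fix b
    have "det (\<chi> i j'. if j' = b then ?y $ i else ?A $ i $ j') = minor M (I(b := j))"
      unfolding minor_def by (intro arg_cong[where f=det]) (simp add: vec_eq_iff)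
    then show "?A $ a $ b * ?x $ b = minor M (I(b := j)) / minor M I * M a (I b)"
      by (simp add: minor_def)
  qed
  finally show ?thesis .
qed

text \<open>By the Cauchy-Binet formula the Gram determinant of the rows is the sum of the squares of the
  minors, and it is nonzero when the rows are independent.\<close>

lemma minor_nonzero_exists:
  fixes M :: "'p::{finite,linorder} \<Rightarrow> 'n::{finite,linorder} \<Rightarrow> real"
  assumes indep: "\<And>v :: real^'p::_. (\<And>i. (\<Sum>a\<in>UNIV. v $ a * M a i) = 0) \<Longrightarrow> v = 0"
  obtains K where "strict_mono K" "minor M K \<noteq> 0"
proof -
  let ?G = "\<chi> a b. \<Sum>i\<in>UNIV. M a i * M b i"
  have "\<forall>v. ?G *v v = 0 \<longrightarrow> v = 0"
  proof (intro allI impI)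
    fix v :: "real^'p::_" assume "?G *v v = 0"
    then have "0 = (\<Sum>a\<in>UNIV. v $ a * (?G *v v) $ a)" by simp
    also have "\<dots> = (\<Sum>a\<in>UNIV. \<Sum>b\<in>UNIV. \<Sum>i\<in>UNIV. v $ a * M a i * (v $ b * M b i))"
      by (simp add: matrix_vector_mult_def sum_distrib_left sum_distrib_right mult_ac)
    also have "\<dots> = (\<Sum>a\<in>UNIV. \<Sum>i\<in>UNIV. \<Sum>b\<in>UNIV. v $ a * M a i * (v $ b * M b i))"
      by (rule sum.cong[OF refl], rule sum.swap)
    also have "\<dots> = (\<Sum>i\<in>UNIV. \<Sum>a\<in>UNIV. \<Sum>b\<in>UNIV. v $ a * M a i * (v $ b * M b i))"
      by (rule sum.swap)
    also have "\<dots> = (\<Sum>i\<in>UNIV. (\<Sum>a\<in>UNIV. v $ a * M a i)\<^sup>2)"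
      by (simp add: power2_eq_square sum_product)
    finally have "(\<Sum>i\<in>UNIV. (\<Sum>a\<in>UNIV. v $ a * M a i)\<^sup>2) = 0" by simp
    then have "(\<Sum>a\<in>UNIV. v $ a * M a i) = 0" for i
      by (simp add: sum_nonneg_eq_0_iff)
    then show "v = 0" by (rule indep)
  qed
  then have "det ?G \<noteq> 0"
    unfolding invertible_det_nz[symmetric] invertible_left_inverse matrix_left_invertible_ker .
  then have "(\<Sum>K | strict_mono K. minor M K * minor M K) \<noteq> 0"
    by (simp add: cauchy_binet)
  then obtain K where "strict_mono K" "minor M K * minor M K \<noteq> 0"
    by (metis (mono_tags, lifting) mem_Collect_eq sum.neutral)
  with that show thesis by auto
qed

section \<open>Norms of multivectors\<close>

text \<open>An orthonormal basis is built by the Gram-Schmidt procedure; \<open>E\<close> maps a vector to its coordinates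
  in that basis.\<close>

lemma inner_product_diagonalization:
  fixes B :: "real^'n \<Rightarrow> real^'n \<Rightarrow> real"
  assumes bil: "bilinear B" and sym: "\<And>u v. B u v = B v u" and pos: "\<And>v. v \<noteq> 0 \<Longrightarrow> 0 < B v v"
  obtains E :: "real^'n \<Rightarrow> real^'n" where "linear E" "inj E" "\<And>u v. B u v = (\<Sum>k\<in>UNIV. E u $ k * E v $ k)"
proof -
  have lin1: "linear (\<lambda>u. B u v)" and lin2: "linear (B u)" for u v
    using bil by (auto simp: bilinear_def)
  have Bsum: "B (\<Sum>i\<in>A. c i *\<^sub>R f i) v = (\<Sum>i\<in>A. c i * B (f i) v)" for A :: "'n set" and c f v
    using linear_sum[OF lin1] linear_cmul[OF lin1] by (simp add: linear_sum[OF lin1] o_def)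
  have "\<exists>e :: 'n \<Rightarrow> real^'n. \<forall>i\<in>A. \<forall>j\<in>A. B (e i) (e j) = (if i = j then 1 else 0)" for A
    using finite[of A]
  proof (induction A rule: finite_induct)
    case empty show ?case by simp
  next
    case (insert k A)
    then obtain e :: "'n \<Rightarrow> real^'n" where e: "\<And>i j. i \<in> A \<Longrightarrow> j \<in> A \<Longrightarrow> B (e i) (e j) = (if i = j then 1 else 0)"
      by blast
    have "dim (span (e ` A)) \<le> card (e ` A)" by (simp add: dim_le_card')
    also have "\<dots> \<le> card A" by (simp add: card_image_le)
    also have "\<dots> < CARD('n)" using insert by (intro psubset_card_mono) auto
    finally have "span (e ` A) \<noteq> UNIV" by (metis DIM_cart DIM_real dim_UNIV less_irrefl mult.right_neutral)
    then obtain v where v: "v \<notin> span (e ` A)" by blast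
    define w where "w = v - (\<Sum>i\<in>A. B v (e i) *\<^sub>R e i)"
    have "(\<Sum>i\<in>A. B v (e i) *\<^sub>R e i) \<in> span (e ` A)"
      by (intro span_sum span_scale span_base) auto
    then have "w \<noteq> 0" using v by (auto simp: w_def)
    then have wpos: "0 < B w w" by (rule pos)
    have orth: "B w (e j) = 0" if "j \<in> A" for j
    proof -
      have "B w (e j) = B v (e j) - (\<Sum>i\<in>A. B v (e i) * B (e i) (e j))"
        unfolding w_def by (simp add: linear_diff[OF lin1] Bsum)
      also have "(\<Sum>i\<in>A. B v (e i) * B (e i) (e j)) = (\<Sum>i\<in>A. if i = j then B v (e i) else 0)"
        using e that by (intro sum.cong) auto
      finally show ?thesis using that by simp
    qed
    define e' where "e' = e(k := w /\<^sub>R sqrt (B w w))"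
    have "B (e' i) (e' j) = (if i = j then 1 else 0)" if "i \<in> insert k A" "j \<in> insert k A" for i j
      using that insert(2) e orth wpos sym[of "e i" w]
      by (auto simp: e'_def linear_cmul[OF lin1] linear_cmul[OF lin2] real_sqrt_mult_self field_simps)
    then show ?case by blast
  qed
  from this[of UNIV] obtain e :: "'n \<Rightarrow> real^'n" where e: "\<And>i j. B (e i) (e j) = (if i = j then 1 else 0)"
    by auto
  define E where "E u = (\<chi> k. B u (e k))" for u
  have lE: "linear E"
    by (rule linearI) (simp_all add: E_def vec_eq_iff linear_add[OF lin1] linear_cmul[OF lin1])
  have "surj E"
  proof (rule surjI)
    fix c :: "real^'n"
    show "E (\<Sum>i\<in>UNIV. c $ i *\<^sub>R e i) = c"
      by (simp add: E_def vec_eq_iff Bsum e if_distrib cong: if_cong)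
  qed
  then have iE: "inj E" using lE by (simp add: linear_surjective_imp_injective)
  have "B u v = (\<Sum>k\<in>UNIV. E u $ k * E v $ k)" for u v
  proof -
    have "E (u - (\<Sum>i\<in>UNIV. E u $ i *\<^sub>R e i)) = 0"
      by (simp add: E_def vec_eq_iff linear_diff[OF lin1] Bsum e if_distrib cong: if_cong)
    then have "u = (\<Sum>i\<in>UNIV. E u $ i *\<^sub>R e i)"
      using iE lE by (metis eq_iff_diff_eq_0 linear_injective_0)
    then have "B u v = (\<Sum>i\<in>UNIV. E u $ i * B (e i) v)" using Bsum by metis
    then show ?thesis using sym by (simp add: E_def)
  qed
  with lE iE that show thesis by blast
qed

lemma engel_coord_linear: "linear (engel_coord x)"
  by (rule linearI) (simp_all add: engel_coord_eq vec_eq_iff forall_4 algebra_simps add_divide_distrib)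

lemma engel_coord_expansion: "v = (\<Sum>i\<in>UNIV. engel_coord x v $ i *\<^sub>R engel_field i x)"
  unfolding engel_field_coordinates engel_coord_eq ..

lemma wedge_minor: "wedge x v = minor (\<lambda>a i. engel_coord x (v a) $ i)"
  by (simp add: wedge_def minor_def fun_eq_iff)

lemma metric_at_coframe:
  assumes "riemannian_metric g"
  obtains E :: "real^4 \<Rightarrow> real^4" where "linear E" "inj E"
    "\<And>u v. g x u v = (\<Sum>k\<in>UNIV. E u $ k * E v $ k)"
proof -
  have "bilinear (g x)" "\<And>u v. g x u v = g x v u" "\<And>v. v \<noteq> 0 \<Longrightarrow> 0 < g x v v"
    using assms by (auto simp: riemannian_metric_def)
  then show thesis using inner_product_diagonalization[of "g x"] that by metis
qed

text \<open>In an orthonormal coframe the induced inner product of \<open>p\<close>-vectors becomes the Euclidean one, by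
  the Cauchy-Binet formula. Nonnegativity of the radicand and homogeneity can be read off here.\<close>

lemma pvector_norm_sum_of_squares:
  fixes \<tau> :: "'p::{finite,linorder} pvector"
  assumes E: "\<And>u v. g x u v = (\<Sum>k\<in>UNIV. E u $ k * E v $ k)"
  shows "pvector_norm g x \<tau> = sqrt (\<Sum>K\<in>multi_indices.
    (\<Sum>I\<in>multi_indices. \<tau> I * minor (\<lambda>a k. E (engel_field (I a) x) $ k) K)\<^sup>2)"
proof -
  let ?m = "\<lambda>I :: 'p \<Rightarrow> 4. minor (\<lambda>a k. E (engel_field (I a) x) $ k)"
  have "det (\<chi> a b :: 'p. g x (engel_field (I a) x) (engel_field (J b) x)) =
     (\<Sum>K\<in>multi_indices. ?m I K * ?m J K)" for I J :: "'p \<Rightarrow> 4"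
    unfolding E cauchy_binet multi_indices_def ..
  then have "(\<Sum>I\<in>multi_indices. \<Sum>J\<in>multi_indices. \<tau> I * \<tau> J *
       det (\<chi> a b :: 'p. g x (engel_field (I a) x) (engel_field (J b) x))) =
     (\<Sum>I\<in>multi_indices. \<Sum>J\<in>multi_indices. \<Sum>K\<in>multi_indices. \<tau> I * ?m I K * (\<tau> J * ?m J K))"
    by (simp add: sum_distrib_left mult_ac)
  also have "\<dots> = (\<Sum>I\<in>multi_indices. \<Sum>K\<in>multi_indices. \<Sum>J\<in>multi_indices. \<tau> I * ?m I K * (\<tau> J * ?m J K))"
    by (rule sum.cong[OF refl], rule sum.swap)
  also have "\<dots> = (\<Sum>K\<in>multi_indices. \<Sum>I\<in>multi_indices. \<Sum>J\<in>multi_indices. \<tau> I * ?m I K * (\<tau> J * ?m J K))"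
    by (rule sum.swap)
  also have "\<dots> = (\<Sum>K\<in>multi_indices. (\<Sum>I\<in>multi_indices. \<tau> I * ?m I K)\<^sup>2)"
    by (simp add: power2_eq_square sum_product)
  finally show ?thesis unfolding pvector_norm_def by simp
qed

text \<open>The norm of a simple \<open>p\<close>-vector is its Gram determinant, which is the integrand of the area
  formula.\<close>

lemma pvector_norm_wedge:
  fixes v :: "'p::{finite,linorder} \<Rightarrow> real^4"
  assumes "riemannian_metric g"
  shows "pvector_norm g x (wedge x v) = sqrt (det (\<chi> a b. g x (v a) (v b)))"
proof -
  obtain E :: "real^4 \<Rightarrow> real^4" where lE: "linear E" and E: "\<And>u v. g x u v = (\<Sum>k\<in>UNIV. E u $ k * E v $ k)"
    using metric_at_coframe[OF assms] by metis
  have Ev: "(\<Sum>i\<in>UNIV. engel_coord x u $ i * E (engel_field i x) $ k) = E u $ k" for u k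
  proof -
    have "E u = E (\<Sum>i\<in>UNIV. engel_coord x u $ i *\<^sub>R engel_field i x)"
      using engel_coord_expansion[of u x] by simp
    also have "\<dots> = (\<Sum>i\<in>UNIV. engel_coord x u $ i *\<^sub>R E (engel_field i x))"
      by (simp add: linear_sum[OF lE] linear_cmul[OF lE])
    finally show ?thesis by (simp add: sum_component)
  qed
  have "(\<Sum>I\<in>multi_indices. wedge x v I * minor (\<lambda>a k. E (engel_field (I a) x) $ k) K) =
      minor (\<lambda>a k. E (v a) $ k) K" for K :: "'p \<Rightarrow> 4"
  proof -
    have "minor (\<lambda>a k. E (engel_field (I a) x) $ k) K = minor (\<lambda>b i. E (engel_field i x) $ (K b)) I" for I
    proof -
      have "(\<chi> a b. E (engel_field (I a) x) $ K b) = transpose (\<chi> b a. E (engel_field (I a) x) $ (K b))"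
        by (simp add: transpose_def)
      then show ?thesis unfolding minor_def by (simp add: det_transpose)
    qed
    then have "(\<Sum>I\<in>multi_indices. wedge x v I * minor (\<lambda>a k. E (engel_field (I a) x) $ k) K) =
       det (\<chi> a b. \<Sum>i\<in>UNIV. engel_coord x (v a) $ i * E (engel_field i x) $ (K b))"
      by (simp add: wedge_minor cauchy_binet multi_indices_def)
    then show ?thesis by (simp add: Ev minor_def)
  qed
  then have "pvector_norm g x (wedge x v) = sqrt (\<Sum>K\<in>multi_indices. (minor (\<lambda>a k. E (v a) $ k) K)\<^sup>2)"
    by (simp add: pvector_norm_sum_of_squares[where E = E and g = g and x = x, OF E])
  also have "\<dots> = sqrt (det (\<chi> a b. g x (v a) (v b)))"
    unfolding E cauchy_binet by (simp add: multi_indices_def power2_eq_square)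
  finally show ?thesis .
qed

text \<open>The passage from the coefficients in the frame to those in an orthonormal coframe is the compound of
  an invertible matrix. The compound of its inverse, by the Cauchy-Binet formula, recovers the
  coefficients.\<close>

lemma pvector_norm_positive:
  fixes \<tau> :: "'p::{finite,linorder} pvector"
  assumes g: "riemannian_metric g" and J: "J \<in> multi_indices" "\<tau> J \<noteq> 0"
  shows "0 < pvector_norm g x \<tau>"
proof -
  obtain E :: "real^4 \<Rightarrow> real^4" where lE: "linear E" and iE: "inj E"
    and E: "\<And>u v. g x u v = (\<Sum>k\<in>UNIV. E u $ k * E v $ k)"
    using metric_at_coframe[OF g] by metis
  let ?m = "\<lambda>(I :: 'p \<Rightarrow> 4) K. minor (\<lambda>a k. E (engel_field (I a) x) $ k) K"
  let ?P = "\<chi> i k. E (engel_field i x) $ k"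
  have "\<forall>c. transpose ?P *v c = 0 \<longrightarrow> c = 0"
  proof (intro allI impI)
    fix c :: "real^4" assume *: "transpose ?P *v c = 0"
    have "E (\<Sum>i\<in>UNIV. c $ i *\<^sub>R engel_field i x) = (\<Sum>i\<in>UNIV. c $ i *\<^sub>R E (engel_field i x))"
      by (simp add: linear_sum[OF lE] linear_cmul[OF lE])
    also have "\<dots> = transpose ?P *v c"
      by (simp add: vec_eq_iff matrix_vector_mult_def transpose_def sum_component mult.commute)
    also have "\<dots> = 0" by (rule *)
    finally have "(\<Sum>i\<in>UNIV. c $ i *\<^sub>R engel_field i x) = 0"
      using lE iE by (metis linear_injective_0)
    then show "c = 0"
      using engel_field_coordinates[of "0::real^4" c x] by (simp add: vec_eq_iff forall_4)
  qed
  then have "invertible (transpose ?P)"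
    unfolding invertible_left_inverse matrix_left_invertible_ker .
  then obtain Q where Q: "?P ** Q = mat 1"
    using invertible_right_inverse transpose_invertible by fastforce
  have PQ: "(\<Sum>k\<in>UNIV. E (engel_field i x) $ k * Q $ k $ j) = (if i = j then 1 else 0)" for i j
    using Q by (auto simp: matrix_matrix_mult_def mat_def vec_eq_iff)
  have inv: "(\<Sum>K\<in>multi_indices. ?m I K * minor (\<lambda>b k. Q $ k $ J b) K) = (if I = J then 1 else 0)"
    if I: "I \<in> multi_indices" for I
  proof -
    have "(\<Sum>K\<in>multi_indices. ?m I K * minor (\<lambda>b k. Q $ k $ J b) K) =
      det (\<chi> a b. (if I a = J b then 1 else (0::real)))"
      unfolding multi_indices_def cauchy_binet[symmetric] PQ ..
    also have "\<dots> = (if I = J then 1 else 0)"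
    proof (cases "I = J")
      case True
      have "inj J" using J(1) by (simp add: multi_indices_def strict_mono_imp_inj_on)
      then have "(\<chi> a b. (if I a = J b then 1 else (0::real))) = mat 1"
        using True by (simp add: mat_def vec_eq_iff inj_eq)
      then show ?thesis using True by simp
    next
      case False
      have "range I \<noteq> range J"
        using False I J(1) strict_mono_range_unique by (auto simp: multi_indices_def)
      moreover have "card (range I) = card (range J)"
        using I J(1) by (simp add: multi_indices_def card_image strict_mono_imp_inj_on)
      ultimately have "\<not> range I \<subseteq> range J"
        by (metis card_subset_eq finite)
      then obtain a where a: "I a \<notin> range J" by blast
      then have "row a (\<chi> a b. (if I a = J b then 1 else (0::real))) = 0"
        by (auto simp: row_def vec_eq_iff)
      then show ?thesis using False by (simp add: det_zero_row(2))
    qed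
    finally show ?thesis .
  qed
  have "(\<Sum>K\<in>multi_indices. (\<Sum>I\<in>multi_indices. \<tau> I * ?m I K)\<^sup>2) \<noteq> 0"
  proof
    assume "(\<Sum>K\<in>multi_indices. (\<Sum>I\<in>multi_indices. \<tau> I * ?m I K)\<^sup>2) = 0"
    then have z: "(\<Sum>I\<in>multi_indices. \<tau> I * ?m I K) = 0" if "K \<in> multi_indices" for K
      using that by (simp add: sum_nonneg_eq_0_iff)
    have "\<tau> J = (\<Sum>I\<in>multi_indices. \<tau> I * (if I = J then 1 else 0))"
      using J(1) by (simp add: if_distrib cong: if_cong)
    also have "\<dots> = (\<Sum>I\<in>multi_indices. \<tau> I * (\<Sum>K\<in>multi_indices. ?m I K * minor (\<lambda>b k. Q $ k $ J b) K))"
      using inv by (intro sum.cong) auto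
    also have "\<dots> = (\<Sum>I\<in>multi_indices. \<Sum>K\<in>multi_indices. \<tau> I * ?m I K * minor (\<lambda>b k. Q $ k $ J b) K)"
      by (simp add: sum_distrib_left mult_ac)
    also have "\<dots> = (\<Sum>K\<in>multi_indices. (\<Sum>I\<in>multi_indices. \<tau> I * ?m I K) * minor (\<lambda>b k. Q $ k $ J b) K)"
      by (subst sum.swap) (simp add: sum_distrib_right)
    also have "\<dots> = 0" using z by simp
    finally show False using J(2) by simp
  qed
  moreover have "0 \<le> (\<Sum>K\<in>multi_indices. (\<Sum>I\<in>multi_indices. \<tau> I * ?m I K)\<^sup>2)"
    by (simp add: sum_nonneg)
  ultimately show ?thesis unfolding pvector_norm_sum_of_squares[where E = E and g = g and x = x, OF E] by simp
qed

definition coefficient_sum :: "'p::{finite,linorder} pvector \<Rightarrow> real" where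
  "coefficient_sum \<tau> = (\<Sum>I\<in>multi_indices. \<bar>\<tau> I\<bar>)"

lemma coefficient_sum_nonneg: "0 \<le> coefficient_sum \<tau>"
  by (simp add: coefficient_sum_def sum_nonneg)

lemma coefficient_le_sum: "I \<in> multi_indices \<Longrightarrow> \<bar>\<tau> I\<bar> \<le> coefficient_sum \<tau>"
  unfolding coefficient_sum_def by (rule member_le_sum) auto

lemma pvector_norm_scale: "pvector_norm g x (\<lambda>I. c * \<tau> I) = \<bar>c\<bar> * pvector_norm g x \<tau>"
proof -
  have "(\<Sum>I\<in>multi_indices. \<Sum>J\<in>multi_indices. c * \<tau> I * (c * \<tau> J) *
       det (\<chi> a b :: 'a. g x (engel_field (I a) x) (engel_field (J b) x))) =
    c\<^sup>2 * (\<Sum>I\<in>multi_indices. \<Sum>J\<in>multi_indices. \<tau> I * \<tau> J *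
       det (\<chi> a b :: 'a. g x (engel_field (I a) x) (engel_field (J b) x)))"
    by (simp add: sum_distrib_left power2_eq_square mult_ac)
  then show ?thesis by (simp add: pvector_norm_def real_sqrt_mult)
qed

lemma continuous_on_det:
  fixes A :: "'a::topological_space \<Rightarrow> real^'n^'n"
  assumes "\<And>i j. continuous_on S (\<lambda>x. A x $ i $ j)"
  shows "continuous_on S (\<lambda>x. det (A x))"
  unfolding det_def by (intro continuous_intros assms)

lemma continuous_on_engel_field: "continuous_on S (\<lambda>x. engel_field i x $ k)"
  unfolding engel_field_def
  by (cases "i = 1"; cases "i = 2"; cases "i = 3") (auto intro!: continuous_intros)

lemma continuous_on_metric_fields:
  assumes g: "riemannian_metric g"
  shows "continuous_on S (\<lambda>x. g x (engel_field i x) (engel_field j x))"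
proof -
  have gb: "bilinear (g x)" for x using g by (simp add: riemannian_metric_def)
  have l1: "linear (\<lambda>u. g x u v)" and l2: "linear (g x u)" for x u v
    using gb[of x] by (auto simp: bilinear_def)
  have e: "g x u v = (\<Sum>k\<in>UNIV. \<Sum>l\<in>UNIV. u $ k * v $ l * g x (axis k 1) (axis l 1))" for x u v
  proof -
    have u: "u = (\<Sum>k\<in>UNIV. u $ k *\<^sub>R axis k 1)" and v: "v = (\<Sum>l\<in>UNIV. v $ l *\<^sub>R axis l 1)"
      by (simp_all add: basis_expansion scalar_mult_eq_scaleR[symmetric])
    have "g x u v = (\<Sum>k\<in>UNIV. u $ k * g x (axis k 1) v)"
      by (subst u) (simp add: linear_sum[OF l1] linear_cmul[OF l1])
    also have "\<dots> = (\<Sum>k\<in>UNIV. u $ k * (\<Sum>l\<in>UNIV. v $ l * g x (axis k 1) (axis l 1)))"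
      by (subst v) (simp add: linear_sum[OF l2] linear_cmul[OF l2])
    finally show ?thesis by (simp add: sum_distrib_left mult_ac)
  qed
  have c: "continuous_on S (\<lambda>x. g x (axis k 1) (axis l 1))" for k l
    using g unfolding riemannian_metric_def by (meson continuous_on_subset subset_UNIV)
  show ?thesis
    by (subst e) (intro continuous_intros continuous_on_engel_field c)
qed

text \<open>On a compact set the norm of multivectors is comparable with the sum of the coefficients,
  since the two are continuous and positively homogeneous, and vanish only at zero.\<close>

lemma pvector_norm_bounds_compact:
  fixes g :: "real^4 \<Rightarrow> real^4 \<Rightarrow> real^4 \<Rightarrow> real"
  assumes g: "riemannian_metric g" and K: "compact K"
  obtains a b where "0 < a" "0 < b"
    "\<And>x (\<tau> :: 'p::{finite,linorder} pvector). x \<in> K \<Longrightarrow>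
       a * coefficient_sum \<tau> \<le> pvector_norm g x \<tau> \<and> pvector_norm g x \<tau> \<le> b * coefficient_sum \<tau>"
proof -
  define T where "T = {t :: real^('p \<Rightarrow> 4). coefficient_sum (($) t) = 1 \<and> (\<forall>I\<in>- multi_indices. t $ I = 0)}"
  define F where "F z = pvector_norm g (fst z) (($) (snd z) :: 'p pvector)" for z :: "(real^4) \<times> (real^('p \<Rightarrow> 4))"
  have "closed {t :: real^('p \<Rightarrow> 4). coefficient_sum (($) t) = 1}"
    unfolding coefficient_sum_def by (intro closed_Collect_eq continuous_intros)
  moreover have "closed {t :: real^('p \<Rightarrow> 4). \<forall>I\<in>- multi_indices. t $ I = 0}"
  proof -
    have "closed (\<Inter>I\<in>- multi_indices. {t :: real^('p \<Rightarrow> 4). t $ I = 0})"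
      by (intro closed_INT ballI closed_Collect_eq continuous_intros)
    moreover have "(\<Inter>I\<in>- multi_indices. {t :: real^('p \<Rightarrow> 4). t $ I = 0}) =
        {t. \<forall>I\<in>- multi_indices. t $ I = 0}" by auto
    ultimately show ?thesis by simp
  qed
  ultimately have "closed T"
    unfolding T_def Collect_conj_eq by (rule closed_Int)
  moreover have "bounded T"
  proof (rule boundedI)
    fix t assume t: "t \<in> T"
    have "\<bar>t $ I\<bar> \<le> 1" for I
      using t coefficient_le_sum[of I "($) t"] by (cases "I \<in> multi_indices") (auto simp: T_def)
    then have "(\<Sum>I\<in>UNIV. \<bar>t $ I\<bar>) \<le> (\<Sum>I\<in>(UNIV :: ('p \<Rightarrow> 4) set). 1)"
      by (intro sum_mono)
    then show "norm t \<le> real CARD('p \<Rightarrow> 4)"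
      using norm_le_l1_cart[of t] by simp
  qed
  ultimately have cKT: "compact (K \<times> T)"
    using K by (simp add: compact_eq_bounded_closed[of T] compact_Times)
  have contF: "continuous_on (K \<times> T) F"
    unfolding F_def pvector_norm_def
    by (intro continuous_intros continuous_on_det)
       (auto intro!: continuous_on_compose2[OF continuous_on_metric_fields[OF g, of UNIV]] continuous_intros)
  have posF: "0 < F z" if "z \<in> K \<times> T" for z
  proof -
    have "coefficient_sum (($) (snd z)) \<noteq> 0" using that by (auto simp: T_def)
    then obtain I :: "'p \<Rightarrow> 4" where "I \<in> multi_indices" "snd z $ I \<noteq> 0"
      unfolding coefficient_sum_def by (metis (mono_tags, lifting) abs_zero sum.neutral)
    then show ?thesis unfolding F_def by (rule pvector_norm_positive[OF g])
  qed
  have "\<exists>a b. 0 < a \<and> 0 < b \<and> (\<forall>z\<in>K \<times> T. a \<le> F z \<and> F z \<le> b)"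
  proof (cases "K \<times> T = {}")
    case True
    then show ?thesis by (intro exI[of _ 1]) auto
  next
    case False
    obtain z1 where z1: "z1 \<in> K \<times> T" "\<forall>z\<in>K \<times> T. F z1 \<le> F z"
      using continuous_attains_inf[OF cKT False contF] by blast
    obtain z2 where z2: "z2 \<in> K \<times> T" "\<forall>z\<in>K \<times> T. F z \<le> F z2"
      using continuous_attains_sup[OF cKT False contF] by blast
    show ?thesis using z1 z2 posF by (intro exI[of _ "F z1"] exI[of _ "F z2"]) auto
  qed
  then obtain a b where ab: "0 < a" "0 < b" "\<And>z. z \<in> K \<times> T \<Longrightarrow> a \<le> F z \<and> F z \<le> b" by blast
  have "a * coefficient_sum \<tau> \<le> pvector_norm g x \<tau> \<and> pvector_norm g x \<tau> \<le> b * coefficient_sum \<tau>"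
    if x: "x \<in> K" for x and \<tau> :: "'p pvector"
  proof (cases "coefficient_sum \<tau> = 0")
    case True
    then have "\<tau> I = 0" if "I \<in> multi_indices" for I
      using coefficient_le_sum[OF that, of \<tau>] by simp
    then have "pvector_norm g x \<tau> = 0" by (simp add: pvector_norm_def)
    with True show ?thesis by simp
  next
    case False
    define s where "s = coefficient_sum \<tau>"
    have s: "0 < s" using False coefficient_sum_nonneg[of \<tau>] by (simp add: s_def)
    define t :: "real^('p \<Rightarrow> 4)" where "t = (\<chi> I. if I \<in> multi_indices then \<tau> I / s else 0)"
    have "coefficient_sum (($) t) = (\<Sum>I\<in>multi_indices. \<bar>\<tau> I\<bar> / s)"
      unfolding coefficient_sum_def t_def using s by (intro sum.cong) (auto simp: abs_divide)
    also have "\<dots> = 1" using s by (simp add: sum_divide_distrib[symmetric] s_def coefficient_sum_def)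
    finally have "t \<in> T" by (simp add: T_def t_def)
    then have F: "a \<le> F (x, t) \<and> F (x, t) \<le> b" using x ab by blast
    have "pvector_norm g x \<tau> = pvector_norm g x (\<lambda>I. s * t $ I)"
      unfolding pvector_norm_def using s by (intro arg_cong[where f=sqrt] sum.cong refl) (simp add: t_def)
    also have "\<dots> = s * F (x, t)" using s by (simp add: pvector_norm_scale F_def)
    finally have "pvector_norm g x \<tau> = s * F (x, t)" .
    then show ?thesis using F s by (simp add: s_def mult.commute)
  qed
  with ab that show thesis by blast
qed

lemma left_invariant_pvector_norm:
  assumes "left_invariant_metric g"
  shows "pvector_norm g x \<tau> = pvector_norm g 0 \<tau>"
proof -
  have "g x (engel_field i x) (engel_field j x) = g 0 (engel_field i 0) (engel_field j 0)" for i j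
    using assms[unfolded left_invariant_metric_def, rule_format, of x 0 "engel_field i 0" "engel_field j 0"]
    by (simp add: engel_field_left_invariant engel_mult_0_right)
  then show ?thesis by (simp add: pvector_norm_def)
qed

section \<open>Balls of homogeneous distances\<close>

lemma weight_positive: "0 < weight i" and weight_le_3: "weight i \<le> 3"
  by (auto simp: weight_def)

lemma weight_simps [simp]: "weight 1 = 1" "weight 2 = 1" "weight 3 = 2" "weight 4 = 3"
  by (auto simp: weight_def)

lemma engel_dilation_nth: "engel_dilation r x $ i = r ^ weight i * x $ i"
  using exhaust_4[of i] by (auto simp: engel_dilation_def)

lemma engel_dilation_0: "engel_dilation r 0 = 0"
  by (simp add: vec_eq_iff engel_dilation_nth)

text \<open>The left translation by the inverse of \<open>x\<close> is affine with linear part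
  \<open>engel_coord x\<close>.\<close>

lemma engel_mult_coord: "engel_mult x (engel_coord x (z - x)) = z"
  by (simp add: engel_mult_def engel_coord_eq vec_eq_iff forall_4 algebra_simps power2_eq_square)

lemma engel_coord_coord:
  "engel_coord (engel_coord x (z - x)) (engel_coord x v) = engel_coord z v"
  by (simp add: engel_coord_eq vec_eq_iff forall_4 field_simps power2_eq_square)

lemma engel_coord_0: "engel_coord x 0 = 0"
  by (simp add: engel_coord_eq vec_eq_iff forall_4)

lemma norm_engel_displacement_le:
  assumes s: "0 < s" "s \<le> 1" and "\<And>i. \<bar>engel_coord x (z - x) $ i\<bar> \<le> s ^ weight i"
  shows "norm (z - x) \<le> 4 * (1 + \<bar>x $ 1\<bar> + (x $ 1)\<^sup>2) * s"
proof -
  define y where "y = engel_coord x (z - x)"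
  have y: "\<bar>y $ i\<bar> \<le> s" for i
  proof -
    have "\<bar>y $ i\<bar> \<le> s ^ weight i" using assms(3) by (simp add: y_def)
    also have "\<dots> \<le> s ^ 1" using s weight_positive[of i] by (intro power_decreasing) auto
    finally show ?thesis by simp
  qed
  have z: "z = engel_mult x y" by (simp add: y_def engel_mult_coord)
  define t where "t = \<bar>x $ 1\<bar>"
  have t: "0 \<le> t" "(x $ 1)\<^sup>2 = t\<^sup>2" by (auto simp: t_def)
  have ts: "0 \<le> t * s" "0 \<le> t\<^sup>2 * s" using t s by auto
  have c12: "\<bar>(z - x) $ 1\<bar> \<le> s" "\<bar>(z - x) $ 2\<bar> \<le> s"
    using y[of 1] y[of 2] by (simp_all add: z engel_mult_def)
  have xy: "\<bar>x $ 1 * y $ i\<bar> \<le> t * s" for i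
    using y[of i] by (simp add: abs_mult t_def mult_left_mono)
  have xxy: "\<bar>(x $ 1)\<^sup>2 / 2 * y $ 2\<bar> \<le> t\<^sup>2 * s"
  proof -
    have "\<bar>(x $ 1)\<^sup>2 / 2 * y $ 2\<bar> = t\<^sup>2 / 2 * \<bar>y $ 2\<bar>" by (simp add: abs_mult t_def)
    also have "\<dots> \<le> t\<^sup>2 * s" using y[of 2] by (intro mult_mono) auto
    finally show ?thesis .
  qed
  have c3: "\<bar>(z - x) $ 3\<bar> \<le> s + t * s"
    using y[of 3] xy[of 2] by (simp add: z engel_mult_def)
  have c4: "\<bar>(z - x) $ 4\<bar> \<le> s + t * s + t\<^sup>2 * s"
    using y[of 4] xy[of 3] xxy by (simp add: z engel_mult_def)
  have "norm (z - x) \<le> (\<Sum>i\<in>UNIV. \<bar>(z - x) $ i\<bar>)" by (rule norm_le_l1_cart)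
  also have "\<dots> \<le> s + s + (s + t * s) + (s + t * s + t\<^sup>2 * s)"
    unfolding sum_4 by (intro add_mono c12 c3 c4)
  also have "\<dots> \<le> 4 * (s + t * s + t\<^sup>2 * s)"
    using ts by (simp add: algebra_simps)
  also have "\<dots> = 4 * (1 + \<bar>x $ 1\<bar> + (x $ 1)\<^sup>2) * s" by (simp add: t(2)) (simp add: t_def algebra_simps)
  finally show ?thesis .
qed

locale homogeneous =
  fixes \<rho> :: "real^4 \<Rightarrow> real^4 \<Rightarrow> real"
  assumes homogeneous_distance: "homogeneous_distance \<rho>"
begin

definition hball :: "real^4 \<Rightarrow> real \<Rightarrow> (real^4) set" where
  "hball x r = {z. \<rho> x z \<le> r}"

lemma metric_space: "Metric_space UNIV \<rho>"
  using homogeneous_distance by (simp add: homogeneous_distance_def)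

lemma mcball_eq_hball: "Metric_space.mcball UNIV \<rho> x r = hball x r"
  by (simp add: Metric_space.mcball_def[OF metric_space] hball_def)

lemma rho_nonneg: "0 \<le> \<rho> x y"
  and rho_commute: "\<rho> x y = \<rho> y x"
  and rho_zero_iff: "\<rho> x y = 0 \<longleftrightarrow> x = y"
  and rho_triangle: "\<rho> x z \<le> \<rho> x y + \<rho> y z"
  using Metric_space.nonneg[OF metric_space] Metric_space.commute[OF metric_space]
    Metric_space.zero[OF metric_space, of x y] Metric_space.triangle[OF metric_space, of x y z] by auto

lemma rho_left_invariant: "\<rho> (engel_mult z x) (engel_mult z y) = \<rho> x y"
  using homogeneous_distance by (simp add: homogeneous_distance_def)

lemma rho_dilation: "0 < r \<Longrightarrow> \<rho> (engel_dilation r x) (engel_dilation r y) = r * \<rho> x y"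
  using homogeneous_distance by (simp add: homogeneous_distance_def)

lemma continuous_on_rho: "continuous_on S (\<rho> x)"
proof -
  have "continuous_on UNIV (\<lambda>z. \<rho> (fst z) (snd z))"
    using homogeneous_distance by (simp add: homogeneous_distance_def)
  then have "continuous_on S (\<lambda>y. (\<lambda>z. \<rho> (fst z) (snd z)) (x, y))"
    by (rule continuous_on_compose2) (auto intro!: continuous_intros)
  then show ?thesis by simp
qed

lemma rho_origin: "\<rho> x z = \<rho> 0 (engel_coord x (z - x))"
  using rho_left_invariant[of x 0 "engel_coord x (z - x)"]
  by (simp add: engel_mult_0_right engel_mult_coord)

lemma rho_origin_dilation: "0 < r \<Longrightarrow> \<rho> 0 (engel_dilation r y) = r * \<rho> 0 y"
  using rho_dilation[of r 0 y] engel_dilation_0 by simp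

text \<open>Every point other than the origin is a dilate of a point on the boundary of the unit box. There
  \<open>\<rho> 0\<close> is bounded and bounded away from zero by compactness, and both sides scale in the same
  way under dilations.\<close>

lemma ball_box_origin:
  obtains k where "1 \<le> k" "\<And>y i. \<bar>y $ i\<bar> \<le> (k * \<rho> 0 y) ^ weight i"
    "\<And>y s. 0 < s \<Longrightarrow> (\<And>i. \<bar>y $ i\<bar> \<le> s ^ weight i) \<Longrightarrow> \<rho> 0 y \<le> k * s"
proof -
  define B :: "(real^4) set" where "B = {y. \<forall>i. \<bar>y $ i\<bar> \<le> 1}"
  define Q :: "(real^4) set" where "Q = {y \<in> B. \<exists>i. \<bar>y $ i\<bar> = 1}"
  have "B = cbox (\<chi> i. -1) (\<chi> i. 1)"
    by (auto simp: B_def mem_box_cart abs_le_iff minus_le_iff)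
  then have cB: "compact B" by simp
  have Q: "Q = B \<inter> (\<Union>i\<in>UNIV. {y. \<bar>y $ i\<bar> = 1})" by (auto simp: Q_def)
  have "closed (\<Union>i\<in>UNIV. {y :: real^4. \<bar>y $ i\<bar> = 1})"
    by (intro closed_UN ballI finite closed_Collect_eq continuous_intros)
  then have cQ: "compact Q" unfolding Q using cB by (rule compact_Int_closed[rotated])
  have axQ: "axis 1 1 \<in> Q" by (auto simp: Q_def B_def axis_def intro!: exI[of _ 1])
  obtain q where q: "q \<in> Q" "\<And>y. y \<in> Q \<Longrightarrow> \<rho> 0 q \<le> \<rho> 0 y"
    using continuous_attains_inf[OF cQ _ continuous_on_rho] axQ by blast
  have "axis 1 1 \<in> B" using axQ by (simp add: Q_def)
  then obtain u where u: "\<And>y. y \<in> B \<Longrightarrow> \<rho> 0 y \<le> \<rho> 0 u"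
    using continuous_attains_sup[OF cB _ continuous_on_rho] by blast
  have "q \<noteq> 0" using q(1) by (auto simp: Q_def)
  then have m: "0 < \<rho> 0 q" using rho_nonneg rho_zero_iff by (metis less_le)
  define k where "k = max 1 (max (1 / \<rho> 0 q) (\<rho> 0 u))"
  have k: "1 \<le> k" "1 / \<rho> 0 q \<le> k" "\<rho> 0 u \<le> k" by (auto simp: k_def)
  show thesis
  proof
    show "1 \<le> k" by (rule k)
    fix y :: "real^4" and i
    show "\<bar>y $ i\<bar> \<le> (k * \<rho> 0 y) ^ weight i"
    proof (cases "y = 0")
      case True
      then show ?thesis using weight_positive[of i] rho_nonneg[of 0 y] k(1) by simp
    next
      case False
      define h where "h = Max (range (\<lambda>i. root (weight i) \<bar>y $ i\<bar>))"
      obtain j where j: "h = root (weight j) \<bar>y $ j\<bar>"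
        unfolding h_def by (metis (mono_tags, lifting) Max_in UNIV_not_empty empty_is_image finite finite_imageI imageE)
      have hge: "root (weight i) \<bar>y $ i\<bar> \<le> h" for i
        unfolding h_def by (intro Max_ge) auto
      have hp: "\<bar>y $ i\<bar> \<le> h ^ weight i" for i
      proof -
        have "\<bar>y $ i\<bar> = root (weight i) \<bar>y $ i\<bar> ^ weight i"
          using weight_positive[of i] by (simp add: real_root_pow_pos2)
        also have "\<dots> \<le> h ^ weight i" using hge weight_positive[of i] by (intro power_mono) auto
        finally show ?thesis .
      qed
      have hj: "\<bar>y $ j\<bar> = h ^ weight j"
        using weight_positive[of j] j by (simp add: real_root_pow_pos2)
      have "0 \<le> h" using weight_positive[of j] j by simp
      moreover have "h \<noteq> 0"
      proof
        assume "h = 0"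
        then have "y $ i = 0" for i using hp[of i] weight_positive[of i] by (simp add: zero_power)
        with False show False by (simp add: vec_eq_iff)
      qed
      ultimately have h: "0 < h" by simp
      define y' where "y' = (\<chi> i. y $ i / h ^ weight i)"
      have yy': "y = engel_dilation h y'" using h by (simp add: vec_eq_iff engel_dilation_nth y'_def)
      have "y' \<in> B" using hp h by (simp add: B_def y'_def abs_divide)
      moreover have "\<bar>y' $ j\<bar> = 1" using hj h by (simp add: y'_def abs_divide)
      ultimately have "y' \<in> Q" by (auto simp: Q_def)
      then have "\<rho> 0 q \<le> \<rho> 0 y'" by (rule q)
      then have "h * \<rho> 0 q \<le> \<rho> 0 y" using h by (simp add: yy' rho_origin_dilation)
      then have "h \<le> 1 / \<rho> 0 q * \<rho> 0 y" using m by (simp add: field_simps)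
      also have "\<dots> \<le> k * \<rho> 0 y" using k rho_nonneg by (intro mult_right_mono)
      finally have "h ^ weight i \<le> (k * \<rho> 0 y) ^ weight i" using h by (intro power_mono) auto
      with hp[of i] show ?thesis by linarith
    qed
  next
    fix y :: "real^4" and s :: real
    assume s: "0 < s" and y: "\<And>i. \<bar>y $ i\<bar> \<le> s ^ weight i"
    define y' where "y' = (\<chi> i. y $ i / s ^ weight i)"
    have yy': "y = engel_dilation s y'" using s by (simp add: vec_eq_iff engel_dilation_nth y'_def)
    have "y' \<in> B" using y s by (simp add: B_def y'_def abs_divide)
    then have "\<rho> 0 y' \<le> k" using u k by force
    then show "\<rho> 0 y \<le> k * s" using s by (simp add: yy' rho_origin_dilation mult.commute)
  qed
qed

text \<open>The ball-box theorem; left translation reduces it to balls centred at the origin.\<close>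

lemma ball_box:
  obtains k where "1 \<le> k"
    "\<And>x z r i. \<rho> x z \<le> r \<Longrightarrow> \<bar>engel_coord x (z - x) $ i\<bar> \<le> (k * r) ^ weight i"
    "\<And>x z s. 0 < s \<Longrightarrow> (\<And>i. \<bar>engel_coord x (z - x) $ i\<bar> \<le> s ^ weight i) \<Longrightarrow> \<rho> x z \<le> k * s"
proof -
  obtain k where k: "1 \<le> k" "\<And>y i. \<bar>y $ i\<bar> \<le> (k * \<rho> 0 y) ^ weight i"
    "\<And>y s. 0 < s \<Longrightarrow> (\<And>i. \<bar>y $ i\<bar> \<le> s ^ weight i) \<Longrightarrow> \<rho> 0 y \<le> k * s"
    using ball_box_origin by metis
  have "\<bar>engel_coord x (z - x) $ i\<bar> \<le> (k * r) ^ weight i" if "\<rho> x z \<le> r" for x z r i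
  proof -
    have "(k * \<rho> x z) ^ weight i \<le> (k * r) ^ weight i"
      using that k(1) rho_nonneg by (intro power_mono mult_left_mono) auto
    then show ?thesis using k(2)[of "engel_coord x (z - x)" i] rho_origin[of x z] by simp
  qed
  moreover have "\<rho> x z \<le> k * s" if "0 < s" "\<And>i. \<bar>engel_coord x (z - x) $ i\<bar> \<le> s ^ weight i" for x z s
    using k(3)[OF that] rho_origin[of x z] by simp
  ultimately show thesis using that k(1) by blast
qed

lemma closed_hball: "closed (hball x r)"
  unfolding hball_def by (intro closed_Collect_le continuous_on_rho continuous_intros)

lemma hball_borel [measurable]: "hball x r \<in> sets borel"
  using closed_hball by (rule borel_closed)

lemma centre_in_hball: "0 < r \<Longrightarrow> x \<in> hball x r"
  using rho_zero_iff[of x x] by (simp add: hball_def)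

lemma interior_hball_nonempty: "0 < r \<Longrightarrow> interior (hball x r) \<noteq> {}"
proof -
  assume r: "0 < r"
  have "open {z. \<rho> x z < r}" by (intro open_Collect_less continuous_on_rho continuous_intros)
  moreover have "{z. \<rho> x z < r} \<subseteq> hball x r" by (auto simp: hball_def)
  moreover have "x \<in> {z. \<rho> x z < r}" using r rho_zero_iff[of x x] by simp
  ultimately show ?thesis by (metis empty_iff interior_maximal subset_eq)
qed

text \<open>The distance induces the Euclidean topology, uniformly near a point: a short displacement in the
  frame coordinates is short in the Euclidean norm.\<close>

lemma hball_neighbourhood:
  assumes "open V" "x0 \<in> V"
  obtains N r0 where "open N" "x0 \<in> N" "0 < r0" "\<And>x r. x \<in> N \<Longrightarrow> r \<le> r0 \<Longrightarrow> hball x r \<subseteq> V"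
proof -
  obtain k where k: "1 \<le> k" "\<And>x z r i. \<rho> x z \<le> r \<Longrightarrow> \<bar>engel_coord x (z - x) $ i\<bar> \<le> (k * r) ^ weight i"
    using ball_box by metis
  obtain e where e: "0 < e" "ball x0 e \<subseteq> V" using assms open_contains_ball by blast
  define N where "N = ball x0 (min 1 (e / 2))"
  define R where "R = \<bar>x0 $ 1\<bar> + 1"
  define M where "M = 4 * (1 + R + R\<^sup>2)"
  have M: "0 < M" by (simp add: M_def R_def add_pos_nonneg)
  define r0 where "r0 = min (1 / k) (e / (2 * M * k)) / 2"
  have r0: "0 < r0" using k e M by (simp add: r0_def)
  have "hball x r \<subseteq> V" if x: "x \<in> N" and r: "r \<le> r0" for x r
  proof
    fix z assume "z \<in> hball x r"
    then have "\<rho> x z \<le> r0" using r by (simp add: hball_def)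
    then have i: "\<bar>engel_coord x (z - x) $ i\<bar> \<le> (k * r0) ^ weight i" for i by (rule k)
    have "k * r0 \<le> 1 / 2" using k(1) by (simp add: r0_def min_def field_simps)
    then have kr0: "0 < k * r0" "k * r0 \<le> 1" using k r0 by auto
    have nz: "norm (z - x) \<le> 4 * (1 + \<bar>x $ 1\<bar> + (x $ 1)\<^sup>2) * (k * r0)"
      by (rule norm_engel_displacement_le[OF kr0 i])
    have "\<bar>x $ 1 - x0 $ 1\<bar> \<le> norm (x - x0)" using component_le_norm_cart[of "x - x0" 1] by simp
    also have "\<dots> \<le> 1" using x by (simp add: N_def dist_norm norm_minus_commute)
    finally have x1: "\<bar>x $ 1\<bar> \<le> R" by (simp add: R_def)
    then have "\<bar>x $ 1\<bar>\<^sup>2 \<le> R\<^sup>2" by (intro power_mono) auto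
    with x1 have "4 * (1 + \<bar>x $ 1\<bar> + (x $ 1)\<^sup>2) \<le> M" by (simp add: M_def)
    then have "4 * (1 + \<bar>x $ 1\<bar> + (x $ 1)\<^sup>2) * (k * r0) \<le> M * (k * r0)"
      using kr0 by (intro mult_right_mono) auto
    also have "\<dots> \<le> M * (k * (e / (2 * M * k) / 2))"
      using M k(1) by (intro mult_left_mono) (auto simp: r0_def)
    also have "\<dots> < e / 2" using M k(1) e by simp
    finally have "dist z x < e / 2" using nz by (simp add: dist_norm)
    moreover have "dist x0 x < e / 2" using x by (simp add: N_def)
    ultimately have "dist x0 z < e" by (metis dist_commute dist_triangle_half_l)
    then show "z \<in> V" using e by auto
  qed
  moreover have "open N" "x0 \<in> N" using e by (auto simp: N_def)
  ultimately show thesis using that r0 by blast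
qed

text \<open>Distances take all positive values along a dilation orbit, so the radius of a ball is bounded by its
  diameter. This turns the bound on diameters in the definition of the Hausdorff measure into a
  bound on radii.\<close>

lemma exists_at_distance:
  assumes "0 < r"
  obtains z where "\<rho> x z = r"
proof -
  define q :: "real^4" where "q = axis 1 1"
  have "q \<noteq> 0" by (simp add: q_def axis_eq_0_iff)
  then have m: "0 < \<rho> 0 q" using rho_nonneg rho_zero_iff by (metis less_le)
  have "\<rho> 0 (engel_dilation (r / \<rho> 0 q) q) = r" using assms m by (subst rho_origin_dilation) auto
  then have "\<rho> x (engel_mult x (engel_dilation (r / \<rho> 0 q) q)) = r"
    using rho_left_invariant[of x 0] by (simp add: engel_mult_0_right)
  with that show thesis .
qed

end

section \<open>Spherical Hausdorff measures\<close>

lemma infsum_ennreal_eq_nn_integral: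
  fixes f :: "'a \<Rightarrow> ennreal"
  assumes "countable G"
  shows "infsum f G = (\<integral>\<^sup>+x. f x \<partial>count_space G)"
proof (cases "finite G")
  case True
  then show ?thesis by (simp add: nn_integral_count_space_finite)
next
  case False
  note bij = bij_betw_from_nat_into[OF assms False]
  have "infsum f G = infsum (\<lambda>n. f (from_nat_into G n)) UNIV"
    using infsum_reindex_bij_betw[OF bij] by metis
  also have "\<dots> = (\<Sum>n. f (from_nat_into G n))"
  proof -
    have "(\<lambda>n. f (from_nat_into G n)) summable_on UNIV" by (rule nonneg_summable_on_complete) simp
    then have "(\<lambda>n. f (from_nat_into G n)) sums infsum (\<lambda>n. f (from_nat_into G n)) UNIV"
      by (intro has_sum_imp_sums has_sum_infsum)
    then show ?thesis by (simp add: sums_iff)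
  qed
  also have "\<dots> = (\<integral>\<^sup>+n. f (from_nat_into G n) \<partial>count_space UNIV)"
    by (simp add: nn_integral_count_space_nat)
  also have "\<dots> = (\<integral>\<^sup>+x. f x \<partial>count_space G)"
    by (rule nn_integral_bij_count_space[OF bij])
  finally show ?thesis .
qed

context homogeneous
begin

definition fine_cover :: "real \<Rightarrow> (real^4) set \<Rightarrow> ((real^4) \<times> real) set \<Rightarrow> bool" where
  "fine_cover \<delta> A G \<longleftrightarrow> countable G \<and>
     (\<forall>(x, r)\<in>G. 0 < r \<and> (\<forall>y\<in>hball x r. \<forall>z\<in>hball x r. \<rho> y z \<le> \<delta>)) \<and>
     A \<subseteq> (\<Union>(x, r)\<in>G. hball x r)"

definition cover_cost :: "nat \<Rightarrow> ((real^4) \<times> real) set \<Rightarrow> ennreal" where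
  "cover_cost d G = (\<integral>\<^sup>+i. ennreal (snd i ^ d) \<partial>count_space G)"

definition premeasure :: "nat \<Rightarrow> real \<Rightarrow> (real^4) set \<Rightarrow> ennreal" where
  "premeasure d \<delta> A = (INF G\<in>{G. fine_cover \<delta> A G}. cover_cost d G)"

lemma spherical_hausdorff_eq:
  "spherical_hausdorff \<rho> d A = (SUP \<delta>\<in>{0<..}. premeasure d \<delta> A)"
proof -
  have "(\<Sum>\<^sub>\<infinity>(x, r)\<in>G. ennreal (r ^ d)) = cover_cost d G" if "fine_cover \<delta> A G" for G \<delta>
    using that unfolding fine_cover_def cover_cost_def
    by (subst infsum_ennreal_eq_nn_integral) (auto simp: case_prod_unfold)
  then show ?thesis
    unfolding spherical_hausdorff_def premeasure_def mcball_eq_hball fine_cover_def[symmetric]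
    by (intro SUP_cong INF_cong refl) simp
qed

lemma premeasure_le_spherical_hausdorff:
  "0 < \<delta> \<Longrightarrow> premeasure d \<delta> A \<le> spherical_hausdorff \<rho> d A"
  unfolding spherical_hausdorff_eq by (rule SUP_upper) simp

lemma spherical_hausdorff_leI:
  "(\<And>\<delta>. 0 < \<delta> \<Longrightarrow> premeasure d \<delta> A \<le> c) \<Longrightarrow> spherical_hausdorff \<rho> d A \<le> c"
  unfolding spherical_hausdorff_eq by (rule SUP_least) auto

lemma premeasure_mono: "A \<subseteq> B \<Longrightarrow> premeasure d \<delta> A \<le> premeasure d \<delta> B"
  unfolding premeasure_def by (rule INF_superset_mono) (unfold fine_cover_def, blast, rule order_refl)

lemma spherical_hausdorff_mono:
  "A \<subseteq> B \<Longrightarrow> spherical_hausdorff \<rho> d A \<le> spherical_hausdorff \<rho> d B"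
  by (rule spherical_hausdorff_leI)
     (rule order_trans[OF premeasure_mono premeasure_le_spherical_hausdorff])

text \<open>Nearly optimal coverings of the sets \<open>B n\<close>, with errors \<open>e / 2 ^ Suc n\<close>, together cover the union.\<close>

lemma premeasure_countably_subadditive:
  assumes "A \<subseteq> (\<Union>n::nat. B n)"
  shows "premeasure d \<delta> A \<le> (\<Sum>n. premeasure d \<delta> (B n))"
proof (rule ennreal_le_epsilon)
  fix e :: real assume fin: "(\<Sum>n. premeasure d \<delta> (B n)) < top" and e: "0 < e"
  have "\<exists>G. fine_cover \<delta> (B n) G \<and> cover_cost d G \<le> premeasure d \<delta> (B n) + ennreal (e / 2 ^ Suc n)" for n
  proof -
    have "premeasure d \<delta> (B n) < top"
      using fin ennreal_suminf_lessD by blast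
    define X where "X = premeasure d \<delta> (B n) + ennreal (e / 2 ^ Suc n)"
    have "premeasure d \<delta> (B n) < X"
      unfolding X_def using \<open>premeasure d \<delta> (B n) < top\<close>
      using e by (cases "premeasure d \<delta> (B n)") (auto simp: ennreal_less_iff simp flip: ennreal_plus)
    then obtain F where "fine_cover \<delta> (B n) F" "cover_cost d F < X"
      unfolding premeasure_def INF_less_iff by blast
    then show ?thesis unfolding X_def by (auto intro: less_imp_le)
  qed
  then obtain G where G: "\<And>n. fine_cover \<delta> (B n) (G n)"
    "\<And>n. cover_cost d (G n) \<le> premeasure d \<delta> (B n) + ennreal (e / 2 ^ Suc n)" by metis
  have cover: "fine_cover \<delta> A (\<Union>n. G n)"
    unfolding fine_cover_def
  proof (intro conjI)
    show "countable (\<Union>n. G n)" using G(1) by (auto simp: fine_cover_def)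
    show "\<forall>(x, r)\<in>\<Union>n. G n. 0 < r \<and> (\<forall>y\<in>hball x r. \<forall>z\<in>hball x r. \<rho> y z \<le> \<delta>)"
      using G(1) unfolding fine_cover_def by blast
    show "A \<subseteq> (\<Union>(x, r)\<in>\<Union>n. G n. hball x r)"
    proof
      fix a assume "a \<in> A"
      then obtain n where "a \<in> B n" using assms by blast
      then obtain i where "i \<in> G n" "a \<in> hball (fst i) (snd i)"
        using G(1)[of n] unfolding fine_cover_def by fastforce
      then show "a \<in> (\<Union>(x, r)\<in>\<Union>n. G n. hball x r)" by force
    qed
  qed
  have "cover_cost d (\<Union>n. G n) \<le> (\<Sum>n. cover_cost d (G n))"
  proof -
    have "cover_cost d (\<Union>n. G n) =
        (\<integral>\<^sup>+i. ennreal (snd i ^ d) * indicator (\<Union>n. G n) i \<partial>count_space UNIV)"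
      unfolding cover_cost_def by (cases "(\<Union>n. G n) = UNIV")
        (simp_all add: nn_integral_count_space_indicator)
    also have "\<dots> \<le> (\<integral>\<^sup>+i. (\<Sum>n. ennreal (snd i ^ d) * indicator (G n) i) \<partial>count_space UNIV)"
    proof (rule nn_integral_mono)
      fix i :: "(real^4) \<times> real"
      show "ennreal (snd i ^ d) * indicator (\<Union>n. G n) i \<le> (\<Sum>n. ennreal (snd i ^ d) * indicator (G n) i)"
      proof (cases "i \<in> (\<Union>n. G n)")
        case True
        then obtain n where n: "i \<in> G n" by blast
        have "ennreal (snd i ^ d) * indicator (G n) i \<le> (\<Sum>n. ennreal (snd i ^ d) * indicator (G n) i)"
          by (rule sum_le_suminf[of _ "{n}", simplified]) (auto intro: summableI)
        with n True show ?thesis by simp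
      qed simp
    qed
    also have "\<dots> = (\<Sum>n. \<integral>\<^sup>+i. ennreal (snd i ^ d) * indicator (G n) i \<partial>count_space UNIV)"
      by (rule nn_integral_suminf) simp
    also have "\<dots> = (\<Sum>n. cover_cost d (G n))"
    proof (rule suminf_cong)
      fix n
      show "(\<integral>\<^sup>+i. ennreal (snd i ^ d) * indicator (G n) i \<partial>count_space UNIV) = cover_cost d (G n)"
        unfolding cover_cost_def by (cases "G n = UNIV") (simp_all add: nn_integral_count_space_indicator)
    qed
    finally show ?thesis .
  qed
  also have "\<dots> \<le> (\<Sum>n. premeasure d \<delta> (B n) + ennreal (e / 2 ^ Suc n))"
    using G(2) by (intro suminf_le) auto
  also have "\<dots> = (\<Sum>n. premeasure d \<delta> (B n)) + (\<Sum>n. ennreal (e / 2 ^ Suc n))"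
    by (rule suminf_add[symmetric]) auto
  also have "(\<Sum>n. ennreal (e / 2 ^ Suc n)) = ennreal e"
  proof (rule suminf_ennreal_eq)
    show "(\<lambda>n. e / 2 ^ Suc n) sums e"
      using sums_mult[OF power_half_series, of e] by (simp add: power_divide)
  qed (use e in simp)
  finally have "cover_cost d (\<Union>n. G n) \<le> (\<Sum>n. premeasure d \<delta> (B n)) + ennreal e" .
  moreover have "premeasure d \<delta> A \<le> cover_cost d (\<Union>n. G n)"
    unfolding premeasure_def by (rule INF_lower) (simp add: cover)
  ultimately show "premeasure d \<delta> A \<le> (\<Sum>n. premeasure d \<delta> (B n)) + ennreal e" by (rule order_trans[rotated])
qed

lemma spherical_hausdorff_countably_subadditive:
  assumes "A \<subseteq> (\<Union>n::nat. B n)"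
  shows "spherical_hausdorff \<rho> d A \<le> (\<Sum>n. spherical_hausdorff \<rho> d (B n))"
proof (rule spherical_hausdorff_leI)
  fix \<delta> :: real assume "0 < \<delta>"
  then have "(\<Sum>n. premeasure d \<delta> (B n)) \<le> (\<Sum>n. spherical_hausdorff \<rho> d (B n))"
    by (intro suminf_le premeasure_le_spherical_hausdorff) auto
  with premeasure_countably_subadditive[OF assms]
  show "premeasure d \<delta> A \<le> (\<Sum>n. spherical_hausdorff \<rho> d (B n))" by (rule order_trans)
qed

lemma spherical_hausdorff_empty: "spherical_hausdorff \<rho> d {} = 0"
proof -
  have "spherical_hausdorff \<rho> d {} \<le> 0"
  proof (rule spherical_hausdorff_leI)
    fix \<delta> :: real
    have "premeasure d \<delta> {} \<le> cover_cost d {}"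
      unfolding premeasure_def by (rule INF_lower) (simp add: fine_cover_def)
    then show "premeasure d \<delta> {} \<le> 0" by (simp add: cover_cost_def nn_integral_empty)
  qed
  then show ?thesis by simp
qed

lemma spherical_hausdorff_Un:
  "spherical_hausdorff \<rho> d (A \<union> B) \<le> spherical_hausdorff \<rho> d A + spherical_hausdorff \<rho> d B"
proof -
  let ?B = "\<lambda>n::nat. if n = 0 then A else if n = 1 then B else {}"
  have "A \<union> B \<subseteq> (\<Union>n. ?B n)" by (auto intro: exI[of _ 0] exI[of _ 1])
  then have "spherical_hausdorff \<rho> d (A \<union> B) \<le> (\<Sum>n. spherical_hausdorff \<rho> d (?B n))"
    by (rule spherical_hausdorff_countably_subadditive)
  also have "\<dots> = (\<Sum>n\<in>{0, 1}. spherical_hausdorff \<rho> d (?B n))"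
    by (rule suminf_finite) (auto simp: spherical_hausdorff_empty)
  finally show ?thesis by simp
qed

text \<open>The interiors of the balls are nonempty, disjoint and open in a separable space.\<close>

lemma hball_disjoint_family_countable:
  assumes "\<And>i. i \<in> C \<Longrightarrow> 0 < snd i"
    and "pairwise (\<lambda>i j. disjnt (hball (fst i) (snd i)) (hball (fst j) (snd j))) C"
  shows "countable C"
proof -
  let ?D = "\<lambda>i. hball (fst i) (snd i)"
  have ne: "?D i \<noteq> {}" if "i \<in> C" for i using assms(1)[OF that] centre_in_hball by blast
  have inj: "inj_on ?D C"
    using assms(2) ne unfolding inj_on_def pairwise_def disjnt_def by fastforce
  have "countable (?D ` C)"
  proof (rule countable_disjoint_nonempty_interior_subsets)
    show "pairwise disjnt (?D ` C)"
      using assms(2) unfolding pairwise_def by auto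
    fix S assume "S \<in> ?D ` C" "interior S = {}"
    then show "S = {}" using assms(1) interior_hball_nonempty by fastforce
  qed
  then show ?thesis using inj by (rule countable_image_inj_on)
qed

text \<open>Vitali's selection. Zorn's lemma is applied to the disjoint subfamilies with the property that
  every ball of the family meeting a selected ball meets a selected one of at least half its radius.
  A ball missed by a maximal such subfamily would allow adding a missed ball of nearly maximal
  radius.\<close>

lemma vitali_selection:
  fixes K :: "((real^4) \<times> real) set"
  assumes K: "\<And>i. i \<in> K \<Longrightarrow> 0 < snd i \<and> snd i \<le> R"
  shows "\<exists>C\<subseteq>K. pairwise (\<lambda>i j. disjnt (hball (fst i) (snd i)) (hball (fst j) (snd j))) C \<and>
    (\<forall>i\<in>K. \<exists>j\<in>C. \<not> disjnt (hball (fst i) (snd i)) (hball (fst j) (snd j)) \<and> snd i \<le> 2 * snd j)"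
proof -
  let ?D = "\<lambda>i. hball (fst i) (snd i)"
  let ?meets = "\<lambda>i j. \<not> disjnt (?D i) (?D j)"
  define \<A> where "\<A> = {C. C \<subseteq> K \<and> pairwise (\<lambda>i j. disjnt (?D i) (?D j)) C \<and>
    (\<forall>i\<in>K. (\<exists>j\<in>C. ?meets i j) \<longrightarrow> (\<exists>j\<in>C. ?meets i j \<and> snd i \<le> 2 * snd j))}"
  have "\<forall>Ch\<in>chains \<A>. \<Union>Ch \<in> \<A>"
  proof
    fix Ch assume "Ch \<in> chains \<A>"
    then have sub: "Ch \<subseteq> \<A>" and ch: "\<And>X Y. X \<in> Ch \<Longrightarrow> Y \<in> Ch \<Longrightarrow> X \<subseteq> Y \<or> Y \<subseteq> X"
      by (auto simp: chains_def chain_subset_def)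
    have "\<Union>Ch \<subseteq> K" using sub by (auto simp: \<A>_def)
    moreover have "pairwise (\<lambda>i j. disjnt (?D i) (?D j)) (\<Union>Ch)"
    proof (rule pairwiseI)
      fix i j assume ij: "i \<in> \<Union>Ch" "j \<in> \<Union>Ch" "i \<noteq> j"
      then obtain X1 X2 where "X1 \<in> Ch" "i \<in> X1" "X2 \<in> Ch" "j \<in> X2" by blast
      then obtain X where X: "X \<in> Ch" "i \<in> X" "j \<in> X" using ch[of X1 X2] by blast
      then have "pairwise (\<lambda>i j. disjnt (?D i) (?D j)) X" using sub by (auto simp: \<A>_def)
      then show "disjnt (?D i) (?D j)" using X ij unfolding pairwise_def by blast
    qed
    moreover have "\<exists>j\<in>\<Union>Ch. ?meets i j \<and> snd i \<le> 2 * snd j" if i: "i \<in> K" "\<exists>j\<in>\<Union>Ch. ?meets i j" for i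
    proof -
      from i obtain j X where X: "X \<in> Ch" "j \<in> X" "?meets i j" by blast
      then have "\<exists>j\<in>X. ?meets i j \<and> snd i \<le> 2 * snd j"
        using sub i(1) unfolding \<A>_def by blast
      then show ?thesis using X(1) by blast
    qed
    ultimately show "\<Union>Ch \<in> \<A>" unfolding \<A>_def by blast
  qed
  from Zorn_Lemma[OF this] obtain C where C: "C \<in> \<A>" "\<And>X. X \<in> \<A> \<Longrightarrow> C \<subseteq> X \<Longrightarrow> X = C" by blast
  have CK: "C \<subseteq> K" and Cd: "pairwise (\<lambda>i j. disjnt (?D i) (?D j)) C"
    and Ch: "\<And>i. i \<in> K \<Longrightarrow> \<exists>j\<in>C. ?meets i j \<Longrightarrow> \<exists>j\<in>C. ?meets i j \<and> snd i \<le> 2 * snd j"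
    using C(1) unfolding \<A>_def by blast+
  have "\<exists>j\<in>C. ?meets i j" if i: "i \<in> K" for i
  proof (rule ccontr)
    assume no: "\<not> (\<exists>j\<in>C. ?meets i j)"
    define K' where "K' = {i\<in>K. \<not> (\<exists>j\<in>C. ?meets i j)}"
    have "i \<in> K'" using i no by (simp add: K'_def)
    have bdd: "bdd_above (snd ` K')" using K by (intro bdd_aboveI2[of _ _ R]) (auto simp: K'_def)
    define s where "s = Sup (snd ` K')"
    have sle: "snd k \<le> s" if "k \<in> K'" for k
      unfolding s_def using bdd that by (intro cSup_upper) auto
    have "0 < snd i" using K i by blast
    then have s: "0 < s" using sle[OF \<open>i \<in> K'\<close>] by simp
    then have "s / 2 < Sup (snd ` K')" by (simp add: s_def)
    then obtain k where k: "k \<in> K'" "s / 2 < snd k"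
      using less_cSupE[of "s / 2" "snd ` K'"] \<open>i \<in> K'\<close> by blast
    have kK: "k \<in> K" and kC: "\<And>j. j \<in> C \<Longrightarrow> disjnt (?D k) (?D j)" using k(1) by (auto simp: K'_def)
    have kk: "?meets k k" using K[OF kK] centre_in_hball[of "snd k" "fst k"] by (auto simp: disjnt_def)
    have "insert k C \<in> \<A>"
      unfolding \<A>_def
    proof (intro CollectI conjI ballI impI)
      show "insert k C \<subseteq> K" using CK kK by simp
      show "pairwise (\<lambda>i j. disjnt (?D i) (?D j)) (insert k C)"
        using Cd kC by (auto simp: pairwise_insert disjnt_sym)
      fix l assume l: "l \<in> K" "\<exists>j\<in>insert k C. ?meets l j"
      show "\<exists>j\<in>insert k C. ?meets l j \<and> snd l \<le> 2 * snd j"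
      proof (cases "\<exists>j\<in>C. ?meets l j")
        case True
        then show ?thesis using Ch[OF l(1)] by blast
      next
        case False
        then have "?meets l k" "l \<in> K'" using l by (auto simp: K'_def)
        moreover have "snd l \<le> 2 * snd k" using sle[OF \<open>l \<in> K'\<close>] k(2) by simp
        ultimately show ?thesis by blast
      qed
    qed
    then have "k \<in> C" using C(2) by blast
    then show False using kC kk by blast
  qed
  then show ?thesis using CK Cd Ch by blast
qed

text \<open>Choose disjoint balls centred on \<open>A\<close> by Vitali's selection. Enlarging them by the factor 3 covers
  \<open>A\<close>, which accounts for \<open>3 ^ d\<close>, and their \<open>\<nu>\<close>-measures add up to at most \<open>\<nu> V\<close>.\<close>

lemma spherical_hausdorff_le_of_density:
  assumes sets: "sets \<nu> = sets borel" and V: "open V" and A: "A \<subseteq> V" and c: "0 < c"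
    and dens: "\<And>x. x \<in> A \<Longrightarrow> \<exists>r0>0. \<forall>r. 0 < r \<longrightarrow> r < r0 \<longrightarrow> ennreal (c * r ^ d) \<le> emeasure \<nu> (hball x r)"
  shows "spherical_hausdorff \<rho> d A \<le> ennreal (3 ^ d / c) * emeasure \<nu> V"
proof (rule spherical_hausdorff_leI)
  fix \<delta> :: real assume \<delta>: "0 < \<delta>"
  let ?D = "\<lambda>i. hball (fst i) (snd i)"
  define K where "K = {i. fst i \<in> A \<and> 0 < snd i \<and> 6 * snd i \<le> \<delta> \<and> ?D i \<subseteq> V \<and>
    ennreal (c * snd i ^ d) \<le> emeasure \<nu> (?D i)}"
  have K_cover: "\<exists>r. (x, r) \<in> K" if x: "x \<in> A" for x
  proof -
    obtain r0 where r0: "0 < r0" "\<And>r. 0 < r \<Longrightarrow> r < r0 \<Longrightarrow> ennreal (c * r ^ d) \<le> emeasure \<nu> (hball x r)"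
      using dens[OF x] by blast
    obtain N r1 where N: "open N" "x \<in> N" "0 < r1" "\<And>y r. y \<in> N \<Longrightarrow> r \<le> r1 \<Longrightarrow> hball y r \<subseteq> V"
      using hball_neighbourhood[OF V] A x by (metis subsetD)
    define r where "r = min (min (\<delta> / 6) r1) (r0 / 2)"
    have r: "0 < r" "r < r0" "r \<le> r1" "r \<le> \<delta> / 6"
      using r0(1) N(3) \<delta> by (auto simp: r_def min_less_iff_disj)
    have "(x, r) \<in> K" using r r0(2)[OF r(1,2)] N(4)[OF N(2) r(3)] x by (simp add: K_def)
    then show ?thesis ..
  qed
  have "0 < snd i \<and> snd i \<le> \<delta>" if "i \<in> K" for i using that by (auto simp: K_def)
  from vitali_selection[OF this] obtain C where C': "C \<subseteq> K \<and> pairwise (\<lambda>i j. disjnt (?D i) (?D j)) C \<and>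
    (\<forall>i\<in>K. \<exists>j\<in>C. \<not> disjnt (?D i) (?D j) \<and> snd i \<le> 2 * snd j)" ..
  have C: "C \<subseteq> K" "pairwise (\<lambda>i j. disjnt (?D i) (?D j)) C"
    "\<And>i. i \<in> K \<Longrightarrow> \<exists>j\<in>C. \<not> disjnt (?D i) (?D j) \<and> snd i \<le> 2 * snd j"
    using C' by blast+
  have Cpos: "0 < snd i" if "i \<in> C" for i using that C(1) by (auto simp: K_def)
  have cC: "countable C" using Cpos C(2) by (rule hball_disjoint_family_countable)
  let ?e = "\<lambda>i :: (real^4) \<times> real. (fst i, 3 * snd i)"
  have inj: "inj_on ?e C" by (auto simp: inj_on_def)
  have "fine_cover \<delta> A (?e ` C)"
    unfolding fine_cover_def
  proof (intro conjI)
    show "countable (?e ` C)" using cC by simp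
    have "\<rho> y z \<le> \<delta>" if "i \<in> C" "y \<in> hball (fst i) (3 * snd i)" "z \<in> hball (fst i) (3 * snd i)" for i y z
    proof -
      have "6 * snd i \<le> \<delta>" using that(1) C(1) by (auto simp: K_def)
      then show ?thesis
        using that(2,3) rho_triangle[of y z "fst i"] rho_commute[of y "fst i"] by (simp add: hball_def)
    qed
    then show "\<forall>(x, r)\<in>?e ` C. 0 < r \<and> (\<forall>y\<in>hball x r. \<forall>z\<in>hball x r. \<rho> y z \<le> \<delta>)"
      using Cpos by auto
    show "A \<subseteq> (\<Union>(x, r)\<in>?e ` C. hball x r)"
    proof
      fix x assume "x \<in> A"
      then obtain r where xr: "(x, r) \<in> K" using K_cover by blast
      then obtain j w where j: "j \<in> C" "w \<in> hball x r" "w \<in> ?D j" "r \<le> 2 * snd j"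
        using C(3)[OF xr] by (auto simp: disjnt_def)
      have "\<rho> (fst j) x \<le> 3 * snd j"
        using j rho_triangle[of "fst j" x w] rho_commute[of w x] by (simp add: hball_def)
      then have "x \<in> hball (fst j) (3 * snd j)" by (simp add: hball_def)
      then show "x \<in> (\<Union>(x, r)\<in>?e ` C. hball x r)" using j(1) by force
    qed
  qed
  then have "premeasure d \<delta> A \<le> cover_cost d (?e ` C)"
    unfolding premeasure_def by (intro INF_lower) simp
  also have "\<dots> = (\<integral>\<^sup>+i. ennreal ((3 * snd i) ^ d) \<partial>count_space C)"
    unfolding cover_cost_def
    using nn_integral_bij_count_space[OF inj_on_imp_bij_betw[OF inj], of "\<lambda>i. ennreal (snd i ^ d)"] by simp
  also have "\<dots> \<le> (\<integral>\<^sup>+i. ennreal (3 ^ d / c) * emeasure \<nu> (?D i) \<partial>count_space C)"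
  proof (rule nn_integral_mono)
    fix i assume "i \<in> space (count_space C)"
    then have i: "i \<in> C" by simp
    have "ennreal ((3 * snd i) ^ d) = ennreal (3 ^ d / c) * ennreal (c * snd i ^ d)"
      using c Cpos[OF i] by (simp add: power_mult_distrib flip: ennreal_mult)
    also have "\<dots> \<le> ennreal (3 ^ d / c) * emeasure \<nu> (?D i)"
      using i C(1) by (intro mult_left_mono) (auto simp: K_def)
    finally show "ennreal ((3 * snd i) ^ d) \<le> ennreal (3 ^ d / c) * emeasure \<nu> (?D i)" .
  qed
  also have "\<dots> = ennreal (3 ^ d / c) * (\<integral>\<^sup>+i. emeasure \<nu> (?D i) \<partial>count_space C)"
    by (rule nn_integral_cmult) simp
  also have "(\<integral>\<^sup>+i. emeasure \<nu> (?D i) \<partial>count_space C) = emeasure \<nu> (\<Union>i\<in>C. ?D i)"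
    using C(2) cC sets
    by (intro emeasure_UN_countable[symmetric])
       (auto simp: disjoint_family_on_def pairwise_def disjnt_def)
  also have "ennreal (3 ^ d / c) * emeasure \<nu> (\<Union>i\<in>C. ?D i) \<le> ennreal (3 ^ d / c) * emeasure \<nu> V"
    using C(1) V sets by (intro mult_left_mono emeasure_mono) (auto simp: K_def)
  finally show "premeasure d \<delta> A \<le> ennreal (3 ^ d / c) * emeasure \<nu> V" .
qed

text \<open>A ball of radius \<open>r\<close> of a covering need not be centred on \<open>A\<close>, but where it meets \<open>A\<close> it lies in a ball of
  radius \<open>2 * r\<close> centred there, which accounts for \<open>2 ^ d\<close>. The radii for which the bound holds are not uniform
  on \<open>A\<close>, so that \<open>A\<close> is exhausted by the sets \<open>A \<inter> G n\<close> on which they are.\<close>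

lemma measure_le_spherical_hausdorff:
  assumes sets: "sets \<nu> = sets borel" and A: "A \<in> sets borel" and c: "0 < c"
    and dens: "\<And>x. x \<in> A \<Longrightarrow> \<exists>N r0. open N \<and> x \<in> N \<and> 0 < r0 \<and>
      (\<forall>y\<in>N. \<forall>r. 0 < r \<longrightarrow> r < r0 \<longrightarrow> emeasure \<nu> (hball y r) \<le> ennreal (c * r ^ d))"
  shows "emeasure \<nu> A \<le> ennreal (c * 2 ^ d) * spherical_hausdorff \<rho> d A"
proof -
  define P where "P n N \<longleftrightarrow> open N \<and> (\<forall>y\<in>N. \<forall>r. 0 < r \<longrightarrow> r < 1 / real (Suc n) \<longrightarrow> emeasure \<nu> (hball y r) \<le> ennreal (c * r ^ d))"
    for n N
  define G where "G n = \<Union>{N. P n N}" for n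
  have oG: "open (G n)" for n unfolding G_def P_def by auto
  have Gd: "emeasure \<nu> (hball y r) \<le> ennreal (c * r ^ d)" if "y \<in> G n" "0 < r" "r < 1 / real (Suc n)" for y r n
    using that unfolding G_def P_def by blast
  have "P n N \<Longrightarrow> m \<ge> n \<Longrightarrow> P m N" for n m N
    unfolding P_def by (meson dual_order.strict_trans1 frac_le less_eq_real_def of_nat_0_less_iff of_nat_le_iff
        Suc_le_mono zero_less_Suc zero_le_one order_refl)
  then have "incseq G" unfolding incseq_def G_def by blast
  then have inc: "incseq (\<lambda>n. A \<inter> G n)" by (auto simp: incseq_def)
  have "A \<subseteq> (\<Union>n. G n)"
  proof
    fix x assume "x \<in> A"
    then obtain N r0 where N: "open N" "x \<in> N" "0 < r0"
      "\<And>y r. y \<in> N \<Longrightarrow> 0 < r \<Longrightarrow> r < r0 \<Longrightarrow> emeasure \<nu> (hball y r) \<le> ennreal (c * r ^ d)"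
      using dens by meson
    obtain n where n: "1 / real (Suc n) < r0" using nat_approx_posE[OF N(3)] by blast
    then have "P n N" using N by (auto simp: P_def)
    then show "x \<in> (\<Union>n. G n)" using N(2) by (auto simp: G_def)
  qed
  then have UA: "(\<Union>n. A \<inter> G n) = A" by auto
  have "emeasure \<nu> (A \<inter> G n) \<le> ennreal (c * 2 ^ d) * spherical_hausdorff \<rho> d A" for n
  proof -
    \<comment> \<open>Balls of diameter at most \<open>\<delta>\<close> have radius at most \<open>\<delta>\<close>, and the doubled radius has to be less than
      \<open>1 / real (Suc n)\<close>.\<close>
    define \<delta> where "\<delta> = 1 / (4 * real (Suc n))"
    have \<delta>: "0 < \<delta>" "2 * \<delta> < 1 / real (Suc n)" by (auto simp: \<delta>_def field_simps)
    have "ennreal (1 / (c * 2 ^ d)) * emeasure \<nu> (A \<inter> G n) \<le> premeasure d \<delta> A"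
      unfolding premeasure_def
    proof (rule INF_greatest)
      fix F assume "F \<in> {F. fine_cover \<delta> A F}"
      then have F: "countable F" "\<And>x r. (x, r) \<in> F \<Longrightarrow> 0 < r"
        "\<And>x r y z. (x, r) \<in> F \<Longrightarrow> y \<in> hball x r \<Longrightarrow> z \<in> hball x r \<Longrightarrow> \<rho> y z \<le> \<delta>"
        "A \<subseteq> (\<Union>(x, r)\<in>F. hball x r)" by (auto simp: fine_cover_def)
      let ?X = "\<lambda>i. A \<inter> G n \<inter> hball (fst i) (snd i)"
      have X: "?X i \<in> sets \<nu>" for i using A oG sets by auto
      have "emeasure \<nu> (A \<inter> G n) = (\<integral>\<^sup>+x. indicator (A \<inter> G n) x \<partial>\<nu>)" using A oG sets by simp
      also have "\<dots> \<le> (\<integral>\<^sup>+x. \<integral>\<^sup>+i. indicator (?X i) x \<partial>count_space F \<partial>\<nu>)"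
      proof (rule nn_integral_mono)
        fix x
        show "indicator (A \<inter> G n) x \<le> (\<integral>\<^sup>+i. indicator (?X i) x \<partial>count_space F)"
        proof (cases "x \<in> A \<inter> G n")
          case True
          then obtain i where i: "i \<in> F" "x \<in> ?X i" using F(4) by fastforce
          have "indicator (?X i) x \<le> (\<integral>\<^sup>+i. indicator (?X i) x \<partial>count_space F)"
            using i(1) by (rule nn_integral_ge_point)
          then show ?thesis using i(2) by (simp add: indicator_def split: if_splits)
        qed simp
      qed
      also have "\<dots> = (\<integral>\<^sup>+i. \<integral>\<^sup>+x. indicator (?X i) x \<partial>\<nu> \<partial>count_space F)"
        using X by (intro nn_integral_count_space_nn_integral F(1)) auto
      also have "\<dots> = (\<integral>\<^sup>+i. emeasure \<nu> (?X i) \<partial>count_space F)"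
        using X by (intro nn_integral_cong nn_integral_indicator)
      also have "\<dots> \<le> (\<integral>\<^sup>+i. ennreal (c * 2 ^ d) * ennreal (snd i ^ d) \<partial>count_space F)"
      proof (rule nn_integral_mono)
        fix i assume "i \<in> space (count_space F)"
        then have i: "(fst i, snd i) \<in> F" by simp
        define r where "r = snd i"
        have r: "0 < r" using F(2)[OF i] by (simp add: r_def)
        show "emeasure \<nu> (?X i) \<le> ennreal (c * 2 ^ d) * ennreal (snd i ^ d)"
        proof (cases "?X i = {}")
          case True
          then show ?thesis by (simp only: emeasure_empty) simp
        next
          case False
          then obtain x where x: "x \<in> G n" "x \<in> hball (fst i) r" by (auto simp: r_def)
          obtain z where z: "\<rho> (fst i) z = r" using exists_at_distance[OF r] .
          have "\<rho> (fst i) z \<le> \<delta>"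
            using F(3)[OF i, of "fst i" z] z r centre_in_hball[of r "fst i"] by (simp add: r_def hball_def)
          then have "2 * r < 1 / real (Suc n)" using z \<delta>(2) by simp
          then have "emeasure \<nu> (hball x (2 * r)) \<le> ennreal (c * (2 * r) ^ d)" using r x(1) by (intro Gd) auto
          moreover have "?X i \<subseteq> hball x (2 * r)"
          proof
            fix y assume "y \<in> ?X i"
            then have "\<rho> (fst i) y \<le> r" "\<rho> (fst i) x \<le> r" using x by (auto simp: hball_def r_def)
            then show "y \<in> hball x (2 * r)"
              using rho_triangle[of x y "fst i"] rho_commute[of x "fst i"] by (simp add: hball_def)
          qed
          then have "emeasure \<nu> (?X i) \<le> emeasure \<nu> (hball x (2 * r))"
            using sets by (intro emeasure_mono) auto
          ultimately have "emeasure \<nu> (?X i) \<le> ennreal (c * (2 * r) ^ d)" by (rule order_trans[rotated])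
          also have "\<dots> = ennreal (c * 2 ^ d) * ennreal (snd i ^ d)"
            using c r by (simp add: power_mult_distrib r_def mult_ac flip: ennreal_mult)
          finally show ?thesis .
        qed
      qed
      also have "\<dots> = ennreal (c * 2 ^ d) * cover_cost d F"
        unfolding cover_cost_def by (rule nn_integral_cmult) simp
      finally have "ennreal (1 / (c * 2 ^ d)) * emeasure \<nu> (A \<inter> G n) \<le>
          ennreal (1 / (c * 2 ^ d)) * (ennreal (c * 2 ^ d) * cover_cost d F)"
        by (rule mult_left_mono) simp
      also have "\<dots> = cover_cost d F"
        using c by (simp add: mult.assoc[symmetric] flip: ennreal_mult)
      finally show "ennreal (1 / (c * 2 ^ d)) * emeasure \<nu> (A \<inter> G n) \<le> cover_cost d F" .
    qed
    also have "\<dots> \<le> spherical_hausdorff \<rho> d A" using \<delta>(1) by (rule premeasure_le_spherical_hausdorff)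
    finally have "ennreal (c * 2 ^ d) * (ennreal (1 / (c * 2 ^ d)) * emeasure \<nu> (A \<inter> G n)) \<le>
        ennreal (c * 2 ^ d) * spherical_hausdorff \<rho> d A"
      by (rule mult_left_mono) simp
    then show ?thesis using c by (simp add: mult.assoc[symmetric] flip: ennreal_mult)
  qed
  then have "(SUP n. emeasure \<nu> (A \<inter> G n)) \<le> ennreal (c * 2 ^ d) * spherical_hausdorff \<rho> d A"
    by (rule SUP_least)
  moreover have "(SUP n. emeasure \<nu> (A \<inter> G n)) = emeasure \<nu> A"
    using SUP_emeasure_incseq[OF _ inc, of \<nu>] A oG sets UA by (auto simp: image_subset_iff)
  ultimately show ?thesis by simp
qed

end

section \<open>Change of variables for nonnegative functions\<close>

lemma det_reindex:
  fixes A :: "real^'n^'n" and f :: "'m::finite \<Rightarrow> 'n::finite"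
  assumes f: "bij f"
  shows "det (\<chi> i j. A $ f i $ f j) = det A"
proof -
  have inv: "inv f (f i) = i" "f (inv f k) = k" for i k
    using f by (auto simp: bij_is_inj bij_is_surj surj_f_inv_f)
  have prm: "f \<circ> p \<circ> inv f permutes UNIV" if "p permutes UNIV" for p
    using that f by (intro bij_imp_permutes) (auto intro!: bij_comp simp: bij_imp_bij_inv permutes_bij)
  have prm': "inv f \<circ> q \<circ> f permutes UNIV" if "q permutes UNIV" for q
    using that f by (intro bij_imp_permutes) (auto intro!: bij_comp simp: bij_imp_bij_inv permutes_bij)
  have sgn: "sign (f \<circ> p \<circ> inv f) = sign p" if p: "p permutes UNIV" for p
  proof -
    have "map_permutation UNIV f p = f \<circ> p \<circ> inv f"
      using f by (auto simp: map_permutation_def restrict_id_def bij_is_surj fun_eq_iff)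
    then show ?thesis using sign_map_permutation[of f UNIV p] p f by (simp add: bij_is_inj)
  qed
  show ?thesis
    unfolding det_def
  proof (rule sum.reindex_bij_witness[where j = "\<lambda>p. f \<circ> p \<circ> inv f" and i = "\<lambda>q. inv f \<circ> q \<circ> f"])
    fix p :: "'m \<Rightarrow> 'm" assume "p \<in> {p. p permutes UNIV}"
    then have p: "p permutes UNIV" by simp
    have "(\<Prod>k\<in>UNIV. A $ k $ (f \<circ> p \<circ> inv f) k) = (\<Prod>i\<in>UNIV. A $ f i $ (f \<circ> p \<circ> inv f) (f i))"
      by (rule prod.reindex_bij_betw[symmetric, OF f])
    then show "of_int (sign (f \<circ> p \<circ> inv f)) * (\<Prod>i\<in>UNIV. A $ i $ (f \<circ> p \<circ> inv f) i) =
       of_int (sign p) * (\<Prod>i\<in>UNIV. (\<chi> i j. A $ f i $ f j) $ i $ p i)"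
      by (simp add: sgn[OF p] inv)
  qed (auto simp: fun_eq_iff inv prm prm')
qed

lemma absolutely_integrable_iff_nn_integral:
  fixes F :: "'a::euclidean_space \<Rightarrow> real"
  assumes F: "(\<lambda>x. indicator A x * F x) \<in> borel_measurable borel" and nn: "\<And>x. x \<in> A \<Longrightarrow> 0 \<le> F x" and b: "0 \<le> b"
  shows "F absolutely_integrable_on A \<and> integral A F = b \<longleftrightarrow>
    (\<integral>\<^sup>+x. ennreal (indicator A x * F x) \<partial>lborel) = ennreal b"
proof
  assume "F absolutely_integrable_on A \<and> integral A F = b"
  then have "(F has_integral b) A"
    using set_lebesgue_integral_eq_integral(1) by (auto simp: has_integral_iff)
  then show "(\<integral>\<^sup>+x. ennreal (indicator A x * F x) \<partial>lborel) = ennreal b"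
    using nn_integral_has_integral_lebesgue[of A F b] nn by simp
next
  assume *: "(\<integral>\<^sup>+x. ennreal (indicator A x * F x) \<partial>lborel) = ennreal b"
  have "((\<lambda>x. indicator A x * F x) has_integral b) UNIV"
    by (rule nn_integral_has_integral[OF F _ * b]) (use nn in \<open>auto simp: indicator_def\<close>)
  moreover have "(\<lambda>x. indicator A x * F x) = (\<lambda>x. if x \<in> A then F x else 0)" by (auto simp: indicator_def)
  ultimately have "(F has_integral b) A" by (simp add: has_integral_restrict_UNIV)
  then show "F absolutely_integrable_on A \<and> integral A F = b"
    using nn by (auto intro!: nonnegative_absolutely_integrable_1 simp: has_integral_iff)
qed

text \<open>The formula for absolutely integrable functions determines the nonnegative integrals when one
  of them is finite. As it is an equivalence, it also shows that both are infinite or both are finite.\<close>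

lemma nn_integral_change_of_variables_wellorder:
  fixes h :: "real^'m::{finite,wellorder} \<Rightarrow> real^'m::_" and f :: "real^'m::_ \<Rightarrow> real"
  assumes W: "W \<in> sets borel"
    and der: "\<And>x. x \<in> W \<Longrightarrow> (h has_derivative h' x) (at x)" and inj: "inj_on h W"
    and f: "(\<lambda>y. indicator (h ` W) y * f y) \<in> borel_measurable borel" and nn: "\<And>y. y \<in> h ` W \<Longrightarrow> 0 \<le> f y"
    and D: "(\<lambda>x. indicator W x * (\<bar>det (matrix (h' x))\<bar> * f (h x))) \<in> borel_measurable borel"
  shows "(\<integral>\<^sup>+y. ennreal (indicator (h ` W) y * f y) \<partial>lborel) =
    (\<integral>\<^sup>+x. ennreal (indicator W x * (\<bar>det (matrix (h' x))\<bar> * f (h x))) \<partial>lborel)"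
proof -
  have W': "W \<in> sets lebesgue" using W by simp
  have der': "\<And>x. x \<in> W \<Longrightarrow> (h has_derivative h' x) (at x within W)"
    using der by (rule has_derivative_at_withinI)
  have cv: "(\<lambda>x. \<bar>det (matrix (h' x))\<bar> * f (h x)) absolutely_integrable_on W \<and>
      integral W (\<lambda>x. \<bar>det (matrix (h' x))\<bar> * f (h x)) = b \<longleftrightarrow>
      f absolutely_integrable_on h ` W \<and> integral (h ` W) f = b" for b
  proof -
    have i1: "F absolutely_integrable_on A \<and> integral A F = vec b \<longleftrightarrow>
        (\<lambda>x. F x $ 1) absolutely_integrable_on A \<and> integral A (\<lambda>x. F x $ 1) = b"
      for F :: "real^'m::_ \<Rightarrow> real^1" and A
      unfolding absolutely_integrable_on_1_iff integral_on_1_eq[of A F] by (auto simp: vec_eq_iff)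
    show ?thesis
      using has_absolute_integral_change_of_variables[OF W' der' inj, of "\<lambda>x. vec (f x) :: real^1" "vec b"]
      unfolding i1 by (simp add: vec_def)
  qed
  have eq: "(\<integral>\<^sup>+y. ennreal (indicator (h ` W) y * f y) \<partial>lborel) = ennreal b \<longleftrightarrow>
    (\<integral>\<^sup>+x. ennreal (indicator W x * (\<bar>det (matrix (h' x))\<bar> * f (h x))) \<partial>lborel) = ennreal b" if "0 \<le> b" for b
    using absolutely_integrable_iff_nn_integral[OF f nn that] absolutely_integrable_iff_nn_integral[OF D _ that]
      cv[of b] nn by auto
  show ?thesis
    by (metis (no_types, lifting) eq ennreal_cases)
qed

text \<open>Every finite linear order is a wellorder. The copy of the type carries this fact as a class
  instance, and relabelling the coordinates preserves Lebesgue measure, determinants and derivatives;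
  so the formula for wellordered index types carries over.\<close>

typedef 'a well_copy = "UNIV :: 'a set"
  morphisms of_copy to_copy by auto

instantiation well_copy :: (linorder) linorder
begin
definition "x \<le> y \<longleftrightarrow> of_copy x \<le> of_copy y"
definition "x < y \<longleftrightarrow> of_copy x < of_copy y"
instance
  by intro_classes (auto simp: less_eq_well_copy_def less_well_copy_def of_copy_inject[symmetric])
end

lemma bij_of_copy: "bij of_copy"
  by (metis UNIV_I bij_betw_def inj_onI of_copy_inject surjI to_copy_inverse)

instance well_copy :: (finite) finite
proof
  show "finite (UNIV :: 'a well_copy set)"
    using bij_of_copy by (metis bij_betw_finite finite)
qed

instance well_copy :: ("{finite,linorder}") wellorder
proof -
  have "wf {(x :: 'a well_copy, y). x < y}"
    by (auto simp: trancl_def tranclp_less intro!: finite_acyclic_wf acyclicI)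
  then show "OFCLASS('a well_copy, wellorder_class)"
    by (rule wf_wellorderI) intro_classes
qed

definition copy_vec :: "real^'p \<Rightarrow> real^('p well_copy)" where
  "copy_vec x = (\<chi> i. x $ of_copy i)"

definition uncopy_vec :: "real^('p well_copy) \<Rightarrow> real^'p" where
  "uncopy_vec y = (\<chi> i. y $ to_copy i)"

lemma uncopy_copy [simp]: "uncopy_vec (copy_vec x) = x"
  and copy_uncopy [simp]: "copy_vec (uncopy_vec y) = y"
  by (simp_all add: copy_vec_def uncopy_vec_def vec_eq_iff to_copy_inverse of_copy_inverse)

lemma linear_copy_vec: "linear (copy_vec :: real^'p::finite \<Rightarrow> _)"
  and linear_uncopy_vec: "linear (uncopy_vec :: _ \<Rightarrow> real^'p::finite)"
  by (auto intro!: linearI simp: copy_vec_def uncopy_vec_def vec_eq_iff)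

lemma borel_measurable_copy [measurable]:
  "(copy_vec :: real^'p::finite \<Rightarrow> _) \<in> borel_measurable borel"
  "(uncopy_vec :: _ \<Rightarrow> real^'p::finite) \<in> borel_measurable borel"
  using linear_copy_vec linear_uncopy_vec
  by (auto intro!: borel_measurable_continuous_onI linear_continuous_on simp: linear_conv_bounded_linear)

lemma prod_Basis_cart: "(\<Prod>b\<in>Basis. f b) = (\<Prod>i\<in>UNIV. f (axis i (1::real) :: real^'n))"
proof -
  have B: "Basis = range (\<lambda>i. axis i 1 :: real^'n)" by (auto simp: Basis_vec_def)
  have "inj (\<lambda>i. axis i 1 :: real^'n)" by (auto simp: inj_def axis_eq_axis)
  then show ?thesis unfolding B by (simp add: prod.reindex)
qed

lemma lborel_copy: "distr lborel borel (copy_vec :: real^'p::finite \<Rightarrow> _) = lborel"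
proof (rule lborel_eqI[symmetric])
  fix l u :: "real^('p well_copy)"
  assume le: "\<And>b. b \<in> Basis \<Longrightarrow> l \<bullet> b \<le> u \<bullet> b"
  then have le': "l $ i \<le> u $ i" for i
    using le[of "axis i 1"] by (auto simp: inner_axis)
  have pre: "copy_vec -` box l u = box (uncopy_vec l) (uncopy_vec u)"
    by (auto simp: mem_box_cart copy_vec_def uncopy_vec_def) (metis of_copy_inverse to_copy_inverse UNIV_I)+
  have "emeasure (distr lborel borel copy_vec) (box l u) = emeasure lborel (box (uncopy_vec l) (uncopy_vec u))"
    by (subst emeasure_distr) (auto simp: pre)
  also have "\<dots> = (\<Prod>i\<in>UNIV. (uncopy_vec u - uncopy_vec l) $ i)"
  proof (subst emeasure_lborel_box)
    show "uncopy_vec l \<bullet> b \<le> uncopy_vec u \<bullet> b" if "b \<in> Basis" for b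
      using le' that by (auto simp: Basis_vec_def inner_axis uncopy_vec_def)
  qed (simp add: prod_Basis_cart inner_axis)
  also have "(\<Prod>i\<in>UNIV. (uncopy_vec u - uncopy_vec l) $ i) = (\<Prod>i\<in>UNIV. (uncopy_vec u - uncopy_vec l) $ of_copy i)"
    by (rule prod.reindex_bij_betw[symmetric, OF bij_of_copy])
  also have "\<dots> = (\<Prod>b\<in>Basis. (u - l) \<bullet> b)"
    by (simp add: prod_Basis_cart inner_axis uncopy_vec_def of_copy_inverse)
  finally show "emeasure (distr lborel borel copy_vec) (box l u) = ennreal (\<Prod>b\<in>Basis. (u - l) \<bullet> b)" .
qed simp

lemma nn_integral_copy:
  assumes [measurable]: "F \<in> borel_measurable borel"
  shows "(\<integral>\<^sup>+y. F y \<partial>lborel) = (\<integral>\<^sup>+x. F (copy_vec x) \<partial>(lborel :: (real^'p::finite) measure))"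
  unfolding lborel_copy[symmetric] by (subst nn_integral_distr) auto

theorem nn_integral_change_of_variables:
  fixes h :: "real^'p::{finite,linorder} \<Rightarrow> real^'p::_" and f :: "real^'p::_ \<Rightarrow> real"
  assumes W: "W \<in> sets borel"
    and der: "\<And>x. x \<in> W \<Longrightarrow> (h has_derivative h' x) (at x)" and inj: "inj_on h W"
    and f: "(\<lambda>y. indicator (h ` W) y * f y) \<in> borel_measurable borel" and nn: "\<And>y. y \<in> h ` W \<Longrightarrow> 0 \<le> f y"
    and D: "(\<lambda>x. indicator W x * (\<bar>det (matrix (h' x))\<bar> * f (h x))) \<in> borel_measurable borel"
  shows "(\<integral>\<^sup>+y. ennreal (indicator (h ` W) y * f y) \<partial>lborel) =
    (\<integral>\<^sup>+x. ennreal (indicator W x * (\<bar>det (matrix (h' x))\<bar> * f (h x))) \<partial>lborel)"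
proof -
  let ?C = "copy_vec :: real^'p::_ \<Rightarrow> _" and ?D = "uncopy_vec :: _ \<Rightarrow> real^'p::_"
  define H where "H = ?C \<circ> h \<circ> ?D"
  define H' where "H' y = ?C \<circ> h' (?D y) \<circ> ?D" for y
  have W2: "?C ` X = ?D -` X" for X
    by (rule set_eqI) (metis copy_uncopy image_iff uncopy_copy vimage_eq)
  have HW2: "H ` (?C ` W) = ?D -` (h ` W)"
    unfolding W2[of "h ` W", symmetric] by (simp add: H_def image_image)
  have bC: "bounded_linear ?C" and bD: "bounded_linear ?D"
    using linear_copy_vec linear_uncopy_vec by (auto simp: linear_conv_bounded_linear)
  have detH: "det (matrix (H' y)) = det (matrix (h' (?D y)))" for y
  proof -
    have "?D (axis j 1) = axis (of_copy j) 1" for j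
      by (auto simp: uncopy_vec_def axis_def vec_eq_iff of_copy_inverse to_copy_inverse)
    then have "matrix (H' y) = (\<chi> i j. matrix (h' (?D y)) $ of_copy i $ of_copy j)"
      by (simp add: matrix_def H'_def copy_vec_def)
    then show ?thesis by (simp add: det_reindex[OF bij_of_copy])
  qed
  have "(\<integral>\<^sup>+y. ennreal (indicator (h ` W) y * f y) \<partial>lborel) =
      (\<integral>\<^sup>+y. ennreal (indicator (H ` (?C ` W)) y * f (?D y)) \<partial>lborel)"
    unfolding HW2 using f
    by (subst nn_integral_copy) (auto simp: indicator_def intro!: measurable_compose[OF borel_measurable_copy(2)])
  also have "\<dots> = (\<integral>\<^sup>+x. ennreal (indicator (?C ` W) x * (\<bar>det (matrix (H' x))\<bar> * f (?D (H x)))) \<partial>lborel)"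
  proof (rule nn_integral_change_of_variables_wellorder)
    show "?C ` W \<in> sets borel" unfolding W2
      using measurable_sets[OF borel_measurable_copy(2) W] by simp
    show "(H has_derivative H' x) (at x)" if "x \<in> ?C ` W" for x
    proof -
      have "?D x \<in> W" using that by auto
      from der[OF this] have "(h \<circ> ?D has_derivative h' (?D x) \<circ> ?D) (at x)"
        by (intro diff_chain_at bounded_linear_imp_has_derivative bD)
      then have "(?C \<circ> (h \<circ> ?D) has_derivative ?C \<circ> (h' (?D x) \<circ> ?D)) (at x)"
        by (rule diff_chain_at) (rule bounded_linear_imp_has_derivative[OF bC])
      then show ?thesis by (simp add: H_def H'_def o_assoc)
    qed
    show "inj_on H (?C ` W)"
      using inj by (auto simp: inj_on_def H_def) (metis uncopy_copy)
    show "(\<lambda>y. indicator (H ` ?C ` W) y * f (?D y)) \<in> borel_measurable borel"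
      unfolding HW2 using measurable_compose[OF borel_measurable_copy(2) f]
      by (simp add: indicator_def vimage_def)
    show "0 \<le> f (?D y)" if "y \<in> H ` ?C ` W" for y
      using that nn unfolding HW2 by simp
    show "(\<lambda>x. indicator (?C ` W) x * (\<bar>det (matrix (H' x))\<bar> * f (?D (H x)))) \<in> borel_measurable borel"
      unfolding W2 detH using measurable_compose[OF borel_measurable_copy(2) D]
      by (simp add: indicator_def vimage_def H_def)
  qed
  also have "\<dots> = (\<integral>\<^sup>+x. ennreal (indicator W x * (\<bar>det (matrix (h' x))\<bar> * f (h x))) \<partial>lborel)"
    unfolding W2 detH
  proof (subst nn_integral_copy)
    have "(\<lambda>x. indicator (?D -` W) x * (\<bar>det (matrix (h' (?D x)))\<bar> * f (?D (H x)))) \<in> borel_measurable borel"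
      using measurable_compose[OF borel_measurable_copy(2) D]
      by (simp add: indicator_def vimage_def H_def)
    then show "(\<lambda>x. ennreal (indicator (?D -` W) x * (\<bar>det (matrix (h' (?D x)))\<bar> * f (?D (H x))))) \<in> borel_measurable borel"
      by simp
  qed (simp add: H_def indicator_def)
  finally show ?thesis .
qed

section \<open>Charts\<close>

text \<open>A continuous map \<open>h\<close> inherits differentiability from \<open>\<phi> \<circ> h\<close> when \<open>\<phi>\<close> is an immersion: the
  increments of \<open>h\<close> are first bounded linearly, then recovered by a left inverse of the
  derivative of \<open>\<phi>\<close>.\<close>

lemma has_derivative_through_immersion:
  fixes \<phi> :: "'a::euclidean_space \<Rightarrow> 'b::euclidean_space" and h :: "'c::euclidean_space \<Rightarrow> 'a"
  assumes \<phi>: "(\<phi> has_derivative A) (at (h a))" and inj: "inj A" and h: "isCont h a"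
    and comp: "((\<lambda>t. \<phi> (h t)) has_derivative D) (at a)"
  obtains L where "(h has_derivative L) (at a)" "\<And>v. A (L v) = D v"
proof -
  have lA: "linear A" using \<phi> by (rule has_derivative_linear)
  obtain B where B: "linear B" "B \<circ> A = id" using linear_injective_left_inverse[OF lA inj] by blast
  have BA: "B (A v) = v" for v using B(2) by (metis comp_apply id_apply)
  have bB: "bounded_linear B" using B(1) by (simp add: linear_conv_bounded_linear)
  obtain b where b: "0 < b" "\<And>v. norm (B v) \<le> norm v * b" using bounded_linear.pos_bounded[OF bB] by blast
  have bD: "bounded_linear D" using comp by (rule has_derivative_bounded_linear)
  obtain M where M: "0 < M" "\<And>v. norm (D v) \<le> norm v * M" using bounded_linear.pos_bounded[OF bD] by blast
  define C where "C = 2 * b * (M + 1)"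
  have C: "0 < C" using b M by (simp add: C_def)
  have E1: "\<exists>d>0. \<forall>t. norm (t - a) < d \<longrightarrow>
      norm (\<phi> (h t) - \<phi> (h a) - A (h t - h a)) \<le> e * norm (h t - h a)" if e: "0 < e" for e
  proof -
    obtain d1 where d1: "0 < d1" "\<And>y. norm (y - h a) < d1 \<Longrightarrow>
        norm (\<phi> y - \<phi> (h a) - A (y - h a)) \<le> e * norm (y - h a)"
      using \<phi> e unfolding has_derivative_at_alt by metis
    obtain d where "0 < d" "\<And>t. dist t a < d \<Longrightarrow> dist (h t) (h a) < d1"
      using h d1(1) unfolding continuous_at_eps_delta by metis
    with d1(2) show ?thesis by (auto simp: dist_norm)
  qed
  have E2: "\<exists>d>0. \<forall>t. norm (t - a) < d \<longrightarrow>
      norm (\<phi> (h t) - \<phi> (h a) - D (t - a)) \<le> e * norm (t - a)" if "0 < e" for e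
    using comp that unfolding has_derivative_at_alt by metis
  obtain d1 where d1: "0 < d1" "\<And>t. norm (t - a) < d1 \<Longrightarrow>
      norm (\<phi> (h t) - \<phi> (h a) - A (h t - h a)) \<le> 1 / (2 * b) * norm (h t - h a)"
    using E1[of "1 / (2 * b)"] b by auto
  obtain d2 where d2: "0 < d2" "\<And>t. norm (t - a) < d2 \<Longrightarrow>
      norm (\<phi> (h t) - \<phi> (h a) - D (t - a)) \<le> norm (t - a)"
    using E2[of 1] by auto
  have lip: "norm (h t - h a) \<le> C * norm (t - a)" if t: "norm (t - a) < min d1 d2" for t
  proof -
    let ?H = "h t - h a" and ?F = "\<phi> (h t) - \<phi> (h a)"
    have "norm ?F \<le> norm (?F - D (t - a)) + norm (D (t - a))" by norm
    also have "\<dots> \<le> (M + 1) * norm (t - a)"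
      using d2(2)[of t] M(2)[of "t - a"] t by (simp add: algebra_simps)
    finally have F: "norm ?F \<le> (M + 1) * norm (t - a)" .
    have "norm (A ?H) \<le> norm ?F + norm (?F - A ?H)" by norm
    also have "\<dots> \<le> (M + 1) * norm (t - a) + 1 / (2 * b) * norm ?H"
      using F d1(2)[of t] t by simp
    finally have "norm (A ?H) * b \<le> ((M + 1) * norm (t - a) + 1 / (2 * b) * norm ?H) * b"
      using b by (intro mult_right_mono) auto
    also have "\<dots> = C / 2 * norm (t - a) + norm ?H / 2" using b by (simp add: C_def field_simps)
    finally have "norm ?H \<le> C / 2 * norm (t - a) + norm ?H / 2"
      using b(2)[of "A ?H"] BA by simp
    then show ?thesis by simp
  qed
  have der: "(h has_derivative (\<lambda>v. B (D v))) (at a)"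
    unfolding has_derivative_at_alt
  proof (intro conjI allI impI)
    show "bounded_linear (\<lambda>v. B (D v))" using bB bD by (rule bounded_linear_compose)
    fix e :: real assume e: "0 < e"
    obtain d3 where d3: "0 < d3" "\<And>t. norm (t - a) < d3 \<Longrightarrow>
        norm (\<phi> (h t) - \<phi> (h a) - A (h t - h a)) \<le> e / (2 * b * C) * norm (h t - h a)"
      using E1[of "e / (2 * b * C)"] b C e by auto
    obtain d4 where d4: "0 < d4" "\<And>t. norm (t - a) < d4 \<Longrightarrow>
        norm (\<phi> (h t) - \<phi> (h a) - D (t - a)) \<le> e / (2 * b) * norm (t - a)"
      using E2[of "e / (2 * b)"] b e by auto
    define d where "d = min (min d1 d2) (min d3 d4)"
    have "norm (h t - h a - B (D (t - a))) \<le> e * norm (t - a)" if t: "norm (t - a) < d" for t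
    proof -
      let ?H = "h t - h a" and ?F = "\<phi> (h t) - \<phi> (h a)"
      have eq: "?H - B (D (t - a)) = B ((?F - D (t - a)) - (?F - A ?H))"
        using B(1) BA by (simp add: linear_diff)
      have "norm ((?F - D (t - a)) - (?F - A ?H)) \<le> norm (?F - D (t - a)) + norm (?F - A ?H)" by norm
      also have "\<dots> \<le> e / (2 * b) * norm (t - a) + e / (2 * b * C) * norm ?H"
        using d3(2)[of t] d4(2)[of t] t by (simp add: d_def)
      also have "\<dots> \<le> e / (2 * b) * norm (t - a) + e / (2 * b * C) * (C * norm (t - a))"
        using lip[of t] t b C e by (intro add_left_mono mult_left_mono) (auto simp: d_def)
      also have "\<dots> = e / b * norm (t - a)" using b C by (simp add: field_simps)
      finally have "norm ((?F - D (t - a)) - (?F - A ?H)) * b \<le> e / b * norm (t - a) * b"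
        using b by (intro mult_right_mono) auto
      then have "norm (B ((?F - D (t - a)) - (?F - A ?H))) \<le> e / b * norm (t - a) * b"
        using b(2) order_trans by blast
      then show ?thesis unfolding eq using b by simp
    qed
    then show "\<exists>d>0. \<forall>t. norm (t - a) < d \<longrightarrow> norm (h t - h a - B (D (t - a))) \<le> e * norm (t - a)"
      using d1 d2 d3 d4 by (intro exI[of _ d]) (auto simp: d_def)
  qed
  have "((\<lambda>t. \<phi> (h t)) has_derivative (\<lambda>v. A (B (D v)))) (at a)"
    using diff_chain_at[OF der \<phi>] by (simp add: o_def)
  then have "(\<lambda>v. A (B (D v))) = D" using comp by (rule has_derivative_unique)
  then have "A (B (D v)) = D v" for v by (rule fun_cong)
  with der that show thesis by blast
qed

text \<open>A local parametrization together with the data that \<open>C11_param\<close> only asserts to exist.\<close>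

locale chart =
  fixes S :: "(real^4) set" and U :: "(real^'p::{finite,linorder}) set" and \<phi> :: "real^'p::_ \<Rightarrow> real^4"
    and V :: "(real^4) set" and \<psi> :: "real^4 \<Rightarrow> real^'p::_" and \<phi>' :: "real^'p::_ \<Rightarrow> ((real^'p::_) \<Rightarrow>\<^sub>L (real^4))"
  assumes openU: "open U" and openV: "open V" and image: "\<phi> ` U = S \<inter> V"
    and homeo: "homeomorphism U (\<phi> ` U) \<phi> \<psi>"
    and deriv: "\<And>u. u \<in> U \<Longrightarrow> (\<phi> has_derivative blinfun_apply (\<phi>' u)) (at u)"
    and immersion: "\<And>u. u \<in> U \<Longrightarrow> inj (blinfun_apply (\<phi>' u))"
    and lipschitz: "\<And>u. u \<in> U \<Longrightarrow> \<exists>e>0. \<exists>L. L-lipschitz_on (ball u e \<inter> U) \<phi>'"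

lemma C11_param_iff_chart: "C11_param U \<phi> S \<longleftrightarrow> (\<exists>V \<psi> \<phi>'. chart S U \<phi> V \<psi> \<phi>')"
  unfolding C11_param_def chart_def by blast

context chart
begin

definition frame :: "real^'p::_ \<Rightarrow> 'p \<Rightarrow> real^4" where
  "frame u a = \<phi>' u (axis a 1)"

definition tangent :: "real^'p::_ \<Rightarrow> 'p pvector" where
  "tangent u = wedge (\<phi> u) (frame u)"

definition jacobian :: "(real^4 \<Rightarrow> real^4 \<Rightarrow> real^4 \<Rightarrow> real) \<Rightarrow> real^'p::_ \<Rightarrow> real" where
  "jacobian g u = sqrt (det (\<chi> a b. g (\<phi> u) (frame u a) (frame u b)))"

lemma psi_phi: "u \<in> U \<Longrightarrow> \<psi> (\<phi> u) = u"
  and phi_psi: "x \<in> \<phi> ` U \<Longrightarrow> \<phi> (\<psi> x) = x"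
  and psi_in: "x \<in> \<phi> ` U \<Longrightarrow> \<psi> x \<in> U"
  and cont_phi: "continuous_on U \<phi>" and cont_psi: "continuous_on (\<phi> ` U) \<psi>"
  using homeo by (auto simp: homeomorphism_def)

lemma inj_phi: "inj_on \<phi> U"
  by (metis inj_onI psi_phi)

lemma cont_phi': "continuous_on U \<phi>'"
  unfolding continuous_on_eq_continuous_at[OF openU]
proof
  fix u assume u: "u \<in> U"
  then obtain e L where e: "0 < e" "L-lipschitz_on (ball u e \<inter> U) \<phi>'" using lipschitz by blast
  then have "continuous_on (ball u e \<inter> U) \<phi>'" by (intro lipschitz_on_continuous_on)
  moreover have "open (ball u e \<inter> U)" using openU by auto
  ultimately show "isCont \<phi>' u" using u e(1) by (simp add: continuous_on_eq_continuous_at)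
qed

lemma cont_frame: "continuous_on U (\<lambda>u. frame u a)"
  unfolding frame_def by (intro continuous_intros cont_phi')

lemma phi'_expansion: "\<phi>' u v = (\<Sum>a\<in>UNIV. v $ a *\<^sub>R frame u a)"
proof -
  have "v = (\<Sum>a\<in>UNIV. v $ a *\<^sub>R axis a 1)"
    by (simp add: basis_expansion scalar_mult_eq_scaleR[symmetric])
  then have "\<phi>' u v = \<phi>' u (\<Sum>a\<in>UNIV. v $ a *\<^sub>R axis a 1)" by simp
  then show ?thesis by (simp add: blinfun.sum_right blinfun.scaleR_right frame_def)
qed

lemma frechet_frame: "u \<in> U \<Longrightarrow> frechet_derivative \<phi> (at u) (axis a 1) = frame u a"
  using frechet_derivative_at[OF deriv] by (simp add: frame_def)

lemma coord_frame_cont: "continuous_on U (\<lambda>u. engel_coord (\<phi> u) (frame u a) $ i)"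
proof -
  have f: "continuous_on U (\<lambda>u. frame u a $ j)" and p: "continuous_on U (\<lambda>u. \<phi> u $ j)" for j
    by (intro continuous_intros cont_frame cont_phi)+
  show ?thesis
    using exhaust_4[of i] by (elim disjE; simp add: engel_coord_eq; intro continuous_intros f p cont_frame cont_phi; simp)
qed

lemma cont_tangent: "continuous_on U (\<lambda>u. tangent u K)"
  unfolding tangent_def wedge_def by (intro continuous_on_det) (simp add: coord_frame_cont)

lemma cont_pvector_norm:
  assumes g: "riemannian_metric g" and \<tau>: "\<And>I. continuous_on U (\<lambda>u. \<tau> u I)"
  shows "continuous_on U (\<lambda>u. pvector_norm g (\<phi> u) (\<tau> u))"
  unfolding pvector_norm_def
  by (intro continuous_intros continuous_on_det \<tau>)
     (auto intro!: continuous_on_compose2[OF continuous_on_metric_fields[OF g, of UNIV]] cont_phi)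

lemma cont_degree_component_norm:
  assumes g: "riemannian_metric g"
  shows "continuous_on U (\<lambda>u. pvector_norm g (\<phi> u) (degree_component d (tangent u)))"
  unfolding degree_component_def
proof (rule cont_pvector_norm[OF g])
  show "continuous_on U (\<lambda>u. if index_degree I = d then tangent u I else 0)" for I
    by (cases "index_degree I = d") (simp_all add: cont_tangent)
qed

lemma jacobian_eq_norm: "riemannian_metric g \<Longrightarrow> jacobian g u = pvector_norm g (\<phi> u) (tangent u)"
  by (simp add: jacobian_def tangent_def pvector_norm_wedge)

lemma cont_jacobian: "riemannian_metric g \<Longrightarrow> continuous_on U (jacobian g)"
  by (simp add: jacobian_eq_norm cont_pvector_norm cont_tangent cong: continuous_on_cong)

text \<open>The frame coordinates of independent tangent vectors form a matrix of full rank.\<close>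

lemma tangent_nonzero:
  assumes u: "u \<in> U"
  obtains K where "K \<in> multi_indices" "tangent u K \<noteq> 0"
proof -
  have ind: "v = 0" if *: "\<And>i. (\<Sum>a\<in>UNIV. v $ a * engel_coord (\<phi> u) (frame u a) $ i) = 0" for v :: "real^'p::_"
  proof -
    have "engel_coord (\<phi> u) (\<phi>' u v) = (\<Sum>a\<in>UNIV. v $ a *\<^sub>R engel_coord (\<phi> u) (frame u a))"
      by (simp add: phi'_expansion linear_sum[OF engel_coord_linear] linear_cmul[OF engel_coord_linear])
    also have "\<dots> = 0" using * by (simp add: vec_eq_iff sum_component)
    finally have "\<phi>' u v = 0"
      using engel_coord_expansion[of "\<phi>' u v" "\<phi> u"] by simp
    then show "v = 0" using immersion[OF u] by (metis blinfun.zero_right injD)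
  qed
  show thesis
  proof (rule minor_nonzero_exists[of "\<lambda>a i. engel_coord (\<phi> u) (frame u a) $ i"])
    show "v = 0" if "\<And>i. (\<Sum>a\<in>UNIV. v $ a * engel_coord (\<phi> u) (frame u a) $ i) = 0" for v :: "real^'p::_"
      using that by (rule ind)
    show thesis if "strict_mono K" "minor (\<lambda>a i. engel_coord (\<phi> u) (frame u a) $ i) K \<noteq> 0" for K
      using \<open>\<And>K. K \<in> multi_indices \<Longrightarrow> tangent u K \<noteq> 0 \<Longrightarrow> thesis\<close>[of K] that
      by (simp add: multi_indices_def tangent_def wedge_minor)
  qed
qed

lemma jacobian_pos: "riemannian_metric g \<Longrightarrow> u \<in> U \<Longrightarrow> 0 < jacobian g u"
  by (metis jacobian_eq_norm pvector_norm_positive tangent_nonzero)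

lemma image_in_borel:
  assumes B: "B \<in> sets borel" "B \<subseteq> U"
  shows "\<phi> ` B \<in> sets borel"
proof -
  obtain C where C: "\<And>n::nat. compact (C n)" "\<And>n. C n \<subseteq> U" "\<Union>(range C) = U"
    using open_Union_compact_subsets[OF openU] by metis
  have "compact (\<phi> ` C n)" for n
    using C by (intro compact_continuous_image continuous_on_subset[OF cont_phi])
  then have "\<phi> ` C n \<in> sets borel" for n by (intro borel_closed compact_imp_closed)
  then have "(\<Union>n. \<phi> ` C n) \<in> sets borel" by (intro sets.countable_UN) auto
  moreover have "\<phi> ` U = (\<Union>n. \<phi> ` C n)" using C(3) by blast
  ultimately have iU: "\<phi> ` U \<in> sets borel" by simp
  have "\<psi> \<in> borel_measurable (restrict_space borel (\<phi> ` U))"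
    using cont_psi by (rule borel_measurable_continuous_on_restrict)
  then have "\<psi> -` B \<inter> space (restrict_space borel (\<phi> ` U)) \<in> sets (restrict_space borel (\<phi> ` U))"
    using B(1) by (rule measurable_sets)
  then have "\<psi> -` B \<inter> \<phi> ` U \<in> sets borel"
    using iU by (simp add: space_restrict_space sets_restrict_space_iff)
  moreover have "\<phi> ` B = \<psi> -` B \<inter> \<phi> ` U" using B(2) psi_phi by force
  ultimately show ?thesis by simp
qed

lemma preimage_in_borel:
  assumes A: "A \<in> sets borel"
  shows "U \<inter> \<phi> -` A \<in> sets borel"
proof -
  have "\<phi> \<in> borel_measurable (restrict_space borel U)"
    using cont_phi by (rule borel_measurable_continuous_on_restrict)
  then have "\<phi> -` A \<inter> space (restrict_space borel U) \<in> sets (restrict_space borel U)"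
    using A by (rule measurable_sets)
  then show ?thesis
    using openU by (simp add: space_restrict_space sets_restrict_space_iff Int_commute)
qed

text \<open>A curve in \<open>S\<close> stays in the chart for small times. Its lift \<open>\<psi> \<circ> \<gamma>\<close> is continuous, and so
  differentiable by \<open>has_derivative_through_immersion\<close>. Conversely, lines in \<open>U\<close> give curves with any
  velocity in the range.\<close>

lemma tangent_space_eq:
  assumes u: "u \<in> U"
  shows "tangent_space S (\<phi> u) = range (\<phi>' u)"
proof (intro equalityI subsetI)
  fix v assume "v \<in> tangent_space S (\<phi> u)"
  then obtain \<gamma> where \<gamma>: "\<gamma> 0 = \<phi> u" "\<forall>\<^sub>F t in nhds (0::real). \<gamma> t \<in> S" "(\<gamma> has_vector_derivative v) (at 0)"
    unfolding tangent_space_def by blast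
  have "isCont \<gamma> 0" using \<gamma>(3) by (rule has_vector_derivative_continuous)
  moreover have "\<phi> u \<in> V" using u image by auto
  ultimately have "\<forall>\<^sub>F t in at 0. \<gamma> t \<in> V"
    using openV \<gamma>(1) unfolding isCont_def by (metis topological_tendstoD)
  then have "\<forall>\<^sub>F t in nhds 0. \<gamma> t \<in> V"
    using \<open>\<phi> u \<in> V\<close> \<gamma>(1) by (simp add: eventually_nhds_conv_at)
  with \<gamma>(2) have "\<forall>\<^sub>F t in nhds 0. \<gamma> t \<in> \<phi> ` U"
    unfolding image by eventually_elim auto
  then obtain T where T: "open T" "0 \<in> T" "\<And>t. t \<in> T \<Longrightarrow> \<gamma> t \<in> \<phi> ` U"
    unfolding eventually_nhds by blast
  define h where "h = \<psi> \<circ> \<gamma>"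
  have h0: "h 0 = u" using u by (simp add: h_def \<gamma>(1) psi_phi)
  have "isCont h 0"
    unfolding h_def isCont_def
  proof -
    have "((\<lambda>t. \<psi> (\<gamma> t)) \<longlongrightarrow> \<psi> (\<phi> u)) (at 0)"
    proof (rule continuous_on_tendsto_compose[OF cont_psi])
      show "(\<gamma> \<longlongrightarrow> \<phi> u) (at 0)" using \<open>isCont \<gamma> 0\<close> \<gamma>(1) by (simp add: isCont_def)
      show "\<phi> u \<in> \<phi> ` U" using u by simp
      show "\<forall>\<^sub>F t in at 0. \<gamma> t \<in> \<phi> ` U"
        using \<open>\<forall>\<^sub>F t in nhds 0. \<gamma> t \<in> \<phi> ` U\<close> by (simp add: eventually_at_filter eventually_mono)
    qed
    then show "(\<psi> \<circ> \<gamma>) \<midarrow>0\<rightarrow> (\<psi> \<circ> \<gamma>) 0" by (simp add: o_def \<gamma>(1))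
  qed
  moreover have "((\<lambda>t. \<phi> (h t)) has_derivative (\<lambda>t. t *\<^sub>R v)) (at 0)"
    using T(1,2)
  proof (rule has_derivative_transform_within_open[rotated])
    show "(\<gamma> has_derivative (\<lambda>t. t *\<^sub>R v)) (at 0)"
      using \<gamma>(3) by (simp add: has_vector_derivative_def)
    show "\<gamma> t = \<phi> (h t)" if "t \<in> T" for t using T(3)[OF that] phi_psi by (simp add: h_def)
  qed
  ultimately obtain L where "\<And>t. \<phi>' u (L t) = t *\<^sub>R v"
    using has_derivative_through_immersion[of \<phi> "\<phi>' u" h 0] deriv[OF u] immersion[OF u] h0 by metis
  from this[of 1] show "v \<in> range (\<phi>' u)" by (metis rangeI scaleR_one)
next
  fix v assume "v \<in> range (\<phi>' u)"
  then obtain t where t: "v = \<phi>' u t" by blast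
  define \<gamma> where "\<gamma> s = \<phi> (u + s *\<^sub>R t)" for s :: real
  have "((\<lambda>s. u + s *\<^sub>R t) has_derivative (\<lambda>s. s *\<^sub>R t)) (at 0)"
    by (auto intro!: derivative_eq_intros)
  then have "(\<phi> \<circ> (\<lambda>s. u + s *\<^sub>R t) has_derivative \<phi>' u \<circ> (\<lambda>s. s *\<^sub>R t)) (at 0)"
    by (rule diff_chain_at) (simp add: deriv[OF u])
  then have "(\<gamma> has_vector_derivative v) (at 0)"
    by (simp add: has_vector_derivative_def \<gamma>_def[abs_def] o_def t blinfun.scaleR_right)
  moreover have "\<forall>\<^sub>F s in nhds 0. \<gamma> s \<in> S"
  proof -
    have "open ((\<lambda>s::real. u + s *\<^sub>R t) -` U)"
      by (intro open_vimage openU continuous_intros)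
    then have "\<forall>\<^sub>F s in nhds 0. s \<in> (\<lambda>s::real. u + s *\<^sub>R t) -` U"
      using u by (intro eventually_nhds_in_open) auto
    then show ?thesis
      by eventually_elim (use image in \<open>auto simp: \<gamma>_def\<close>)
  qed
  ultimately show "v \<in> tangent_space S (\<phi> u)"
    unfolding tangent_space_def by (auto intro!: exI[of _ \<gamma>] simp: \<gamma>_def)
qed

text \<open>Whatever basis of the tangent space is chosen, its wedge product differs from that of the frame by the
  determinant of the change of basis.\<close>

lemma wedge_tangent_basis:
  assumes u: "u \<in> U"
  obtains c where "c \<noteq> 0" "wedge (\<phi> u) (tangent_basis S (\<phi> u) :: 'p \<Rightarrow> real^4) = (\<lambda>K. c * tangent u K)"
proof -
  let ?P = "\<lambda>v :: 'p \<Rightarrow> real^4. inj v \<and> independent (range v) \<and> span (range v) = tangent_space S (\<phi> u)"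
  have lin: "linear (\<phi>' u)" by (rule bounded_linear.linear[OF blinfun.bounded_linear_right])
  have fr: "range (frame u) = \<phi>' u ` Basis" by (auto simp: frame_def Basis_vec_def)
  have "inj (\<lambda>a. axis a 1 :: real^'p::_)" by (auto simp: inj_def axis_eq_axis)
  then have "inj (frame u)"
    using immersion[OF u] unfolding frame_def by (auto simp: inj_def)
  moreover have "independent (range (frame u))"
    unfolding fr by (rule linear_independent_injective_image[OF lin independent_Basis inj_on_subset[OF immersion[OF u] subset_UNIV]])
  moreover have "span (range (frame u)) = tangent_space S (\<phi> u)"
    unfolding fr tangent_space_eq[OF u] by (simp add: linear_span_image[OF lin])
  ultimately have Pf: "?P (frame u)" by blast
  have P: "?P (tangent_basis S (\<phi> u) :: 'p \<Rightarrow> real^4)"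
    unfolding tangent_basis_def by (rule someI[of ?P, OF Pf])
  define v where "v = (tangent_basis S (\<phi> u) :: 'p \<Rightarrow> real^4)"
  have v: "inj v" "independent (range v)" "span (range v) = range (\<phi>' u)"
    using P tangent_space_eq[OF u] by (auto simp: v_def)
  have "v a \<in> range (\<phi>' u)" for a unfolding v(3)[symmetric] by (intro span_base) auto
  then have "\<forall>a. \<exists>s. v a = \<phi>' u s" by blast
  from choice[OF this] obtain t where t: "\<And>a. v a = \<phi>' u (t a)" by blast
  define T where "T = (\<chi> a c. t a $ c)"
  have "wedge (\<phi> u) v = minor (\<lambda>a i. \<Sum>c\<in>UNIV. T $ a $ c * engel_coord (\<phi> u) (frame u c) $ i)"
    unfolding wedge_minor
    by (intro arg_cong[where f = minor] ext)
       (simp add: t phi'_expansion linear_sum[OF engel_coord_linear] linear_cmul[OF engel_coord_linear] T_def)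
  then have w: "wedge (\<phi> u) v = (\<lambda>K. det T * tangent u K)"
    by (simp add: fun_eq_iff minor_transform_rows tangent_def wedge_minor)
  have "\<forall>z. transpose T *v z = 0 \<longrightarrow> z = 0"
  proof (intro allI impI)
    fix z :: "real^'p::_" assume "transpose T *v z = 0"
    then have "(\<Sum>a\<in>UNIV. z $ a *\<^sub>R t a) = 0"
      by (simp add: matrix_vector_mult_def transpose_def T_def vec_eq_iff sum_component mult.commute)
    then have "\<phi>' u (\<Sum>a\<in>UNIV. z $ a *\<^sub>R t a) = 0" by simp
    then have s: "(\<Sum>a\<in>UNIV. z $ a *\<^sub>R v a) = 0"
      by (simp add: blinfun.sum_right blinfun.scaleR_right t)
    have "(\<Sum>x\<in>range v. z $ inv v x *\<^sub>R x) = 0"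
      using s v(1) by (subst sum.reindex) (auto simp: inv_f_f)
    then have "z $ inv v (v a) = 0" for a
      using independentD[OF v(2), of "range v" "\<lambda>x. z $ inv v x" "v a"] by auto
    then show "z = 0" using v(1) by (simp add: vec_eq_iff inv_f_f)
  qed
  then have "invertible (transpose T)"
    unfolding invertible_left_inverse matrix_left_invertible_ker .
  then have "det T \<noteq> 0" by (simp add: invertible_det_nz det_transpose)
  with w that show thesis by (simp add: v_def)
qed

lemma pointwise_degree_eq:
  assumes u: "u \<in> U"
  shows "pointwise_degree TYPE('p) S (\<phi> u) = pvector_degree (tangent u)"
proof -
  obtain c where "c \<noteq> 0" "wedge (\<phi> u) (tangent_basis S (\<phi> u) :: 'p \<Rightarrow> real^4) = (\<lambda>K. c * tangent u K)"
    using wedge_tangent_basis[OF u] .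
  then show ?thesis by (simp add: pointwise_degree_def pvector_degree_def)
qed

text \<open>The normalization of the tangent \<open>p\<close>-vector cancels against the Jacobian of the area formula, because
  the Jacobian is the norm of the wedge product of the frame.\<close>

lemma degree_density_eq:
  assumes g: "riemannian_metric g" and u: "u \<in> U"
  shows "pvector_norm g (\<phi> u) (degree_component d (unit_tangent_pvector g S (\<phi> u) :: 'p pvector)) * jacobian g u =
    pvector_norm g (\<phi> u) (degree_component d (tangent u))"
proof -
  obtain c where c: "c \<noteq> 0" "wedge (\<phi> u) (tangent_basis S (\<phi> u) :: 'p \<Rightarrow> real^4) = (\<lambda>K. c * tangent u K)"
    using wedge_tangent_basis[OF u] .
  define J where "J = jacobian g u"
  have J: "0 < J" using jacobian_pos[OF g u] by (simp add: J_def)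
  have "unit_tangent_pvector g S (\<phi> u) = (\<lambda>I. c * tangent u I / (\<bar>c\<bar> * J))"
    unfolding unit_tangent_pvector_def Let_def c(2) pvector_norm_scale J_def jacobian_eq_norm[OF g] ..
  moreover define k where "k = c / (\<bar>c\<bar> * J)"
  ultimately have "degree_component d (unit_tangent_pvector g S (\<phi> u)) = (\<lambda>I. k * degree_component d (tangent u) I)"
    by (auto simp: degree_component_def fun_eq_iff)
  moreover have "\<bar>k\<bar> * J = 1" using J c(1) by (simp add: k_def abs_mult)
  ultimately show ?thesis unfolding J_def[symmetric] by (simp add: pvector_norm_scale mult.commute mult.assoc)
qed

end

section \<open>Surface measure and intrinsic measure in charts\<close>

context chart
begin

text \<open>Outside \<open>U\<close> the density vanishes, and \<open>\<phi>\<close> is replaced by a constant to make the map Borel.\<close>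

definition chart_measure :: "(real^4 \<Rightarrow> real^4 \<Rightarrow> real^4 \<Rightarrow> real) \<Rightarrow> (real^4) measure" where
  "chart_measure g = distr (density lborel (\<lambda>u. ennreal (indicator U u * jacobian g u))) borel
     (\<lambda>u. if u \<in> U then \<phi> u else 0)"

lemma sets_chart_measure [simp, measurable_cong]: "sets (chart_measure g) = sets borel"
  by (simp add: chart_measure_def)

lemma borel_indicator_times:
  fixes F :: "real^'p::_ \<Rightarrow> real"
  assumes "continuous_on U F" "B \<in> sets borel" "B \<subseteq> U"
  shows "(\<lambda>u. indicator B u * F u) \<in> borel_measurable borel"
proof -
  have "(\<lambda>u. indicator B u *\<^sub>R F u) \<in> borel_measurable borel"
    using assms by (intro borel_measurable_continuous_on_indicator continuous_on_subset[OF assms(1)]) auto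
  then show ?thesis by simp
qed

lemma borel_extension: "(\<lambda>u. if u \<in> U then \<phi> u else 0) \<in> borel_measurable borel"
proof -
  have "(\<lambda>u. indicator U u *\<^sub>R \<phi> u) \<in> borel_measurable borel"
    using openU cont_phi by (intro borel_measurable_continuous_on_indicator) auto
  moreover have "(\<lambda>u. indicator U u *\<^sub>R \<phi> u) = (\<lambda>u. if u \<in> U then \<phi> u else 0)" by auto
  ultimately show ?thesis by simp
qed

lemma nn_integral_chart_measure:
  assumes g: "riemannian_metric g" and F: "F \<in> borel_measurable borel"
  shows "(\<integral>\<^sup>+x. F x \<partial>chart_measure g) = (\<integral>\<^sup>+u. ennreal (indicator U u * jacobian g u) * F (\<phi> u) \<partial>lborel)"
proof -
  have J: "(\<lambda>u. indicator U u * jacobian g u) \<in> borel_measurable borel"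
    using openU by (intro borel_indicator_times cont_jacobian g) auto
  have [measurable]: "(\<lambda>u. if u \<in> U then \<phi> u else 0) \<in> borel_measurable borel" by (rule borel_extension)
  note F[measurable] J[measurable]
  have "(\<integral>\<^sup>+x. F x \<partial>chart_measure g) =
      (\<integral>\<^sup>+u. ennreal (indicator U u * jacobian g u) * F (if u \<in> U then \<phi> u else 0) \<partial>lborel)"
    unfolding chart_measure_def by (simp add: nn_integral_distr nn_integral_density)
  also have "\<dots> = (\<integral>\<^sup>+u. ennreal (indicator U u * jacobian g u) * F (\<phi> u) \<partial>lborel)"
    by (rule nn_integral_cong) (simp add: indicator_def)
  finally show ?thesis .
qed

lemma emeasure_chart_measure:
  assumes g: "riemannian_metric g" and A: "A \<in> sets borel"
  shows "emeasure (chart_measure g) A = (\<integral>\<^sup>+u. ennreal (indicator (U \<inter> \<phi> -` A) u * jacobian g u) \<partial>lborel)"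
proof -
  have "emeasure (chart_measure g) A = (\<integral>\<^sup>+x. indicator A x \<partial>chart_measure g)"
    using A by simp
  also have "\<dots> = (\<integral>\<^sup>+u. ennreal (indicator U u * jacobian g u) * indicator A (\<phi> u) \<partial>lborel)"
    using A by (intro nn_integral_chart_measure g) auto
  also have "\<dots> = (\<integral>\<^sup>+u. ennreal (indicator (U \<inter> \<phi> -` A) u * jacobian g u) \<partial>lborel)"
    by (rule nn_integral_cong) (simp add: indicator_def)
  finally show ?thesis .
qed

lemma area_formula_integrand:
  assumes "B \<subseteq> U"
  shows "(\<integral>\<^sup>+u\<in>B. ennreal (sqrt (det (\<chi> a b :: 'p. g (\<phi> u)
                  (frechet_derivative \<phi> (at u) (axis a 1))
                  (frechet_derivative \<phi> (at u) (axis b 1))))) \<partial>lborel) =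
    (\<integral>\<^sup>+u. ennreal (indicator B u * jacobian g u) \<partial>lborel)"
proof (rule nn_integral_cong)
  fix u
  show "ennreal (sqrt (det (\<chi> a b :: 'p. g (\<phi> u)
                  (frechet_derivative \<phi> (at u) (axis a 1))
                  (frechet_derivative \<phi> (at u) (axis b 1))))) * indicator B u =
    ennreal (indicator B u * jacobian g u)"
  proof (cases "u \<in> B")
    case True
    with assms have "u \<in> U" by blast
    then show ?thesis using True by (simp add: frechet_frame jacobian_def)
  qed simp
qed

end

text \<open>The measures of two charts agree where both are defined: the transition map is
  differentiable, and its Jacobian is the quotient of the two area factors.\<close>

lemma chart_measure_transition:
  fixes U1 U2 :: "(real^'p::{finite,linorder}) set"
  assumes chart1: "chart S U1 \<phi>1 V1 \<psi>1 \<phi>1'" and chart2: "chart S U2 \<phi>2 V2 \<psi>2 \<phi>2'"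
    and g: "riemannian_metric g" and A: "A \<in> sets borel" "A \<subseteq> \<phi>1 ` U1" "A \<subseteq> \<phi>2 ` U2"
  shows "emeasure (chart.chart_measure U1 \<phi>1 \<phi>1' g) A = emeasure (chart.chart_measure U2 \<phi>2 \<phi>2' g) A"
proof -
  interpret c1: chart S U1 \<phi>1 V1 \<psi>1 \<phi>1' by (rule chart1)
  interpret c2: chart S U2 \<phi>2 V2 \<psi>2 \<phi>2' by (rule chart2)
  define h where "h = \<psi>2 \<circ> \<phi>1"
  define Q where "Q = U1 \<inter> \<phi>1 -` V2"
  define W where "W = U1 \<inter> \<phi>1 -` A"
  have oQ: "open Q"
    unfolding Q_def using c1.openU c2.openV c1.cont_phi by (simp add: continuous_open_preimage)
  have \<phi>Q: "\<phi>1 u \<in> \<phi>2 ` U2" if "u \<in> Q" for u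
  proof -
    have "\<phi>1 u \<in> S" using that c1.image by (auto simp: Q_def)
    then show ?thesis using that c2.image by (auto simp: Q_def)
  qed
  have WQ: "W \<subseteq> Q" using A(3) c2.image by (auto simp: W_def Q_def)
  have \<phi>h: "\<phi>2 (h u) = \<phi>1 u" and hU: "h u \<in> U2" if "u \<in> Q" for u
    using \<phi>Q[OF that] c2.phi_psi c2.psi_in by (auto simp: h_def)
  have ch: "continuous_on Q h"
    unfolding h_def
    by (intro continuous_on_compose continuous_on_subset[OF c1.cont_phi] continuous_on_subset[OF c2.cont_psi])
       (use \<phi>Q in \<open>auto simp: Q_def\<close>)
  have "\<exists>L. (h has_derivative L) (at u) \<and> (\<forall>v. \<phi>2' (h u) (L v) = \<phi>1' u v)" if u: "u \<in> Q" for u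
  proof -
    have uU: "u \<in> U1" using u by (simp add: Q_def)
    have "((\<lambda>t. \<phi>2 (h t)) has_derivative \<phi>1' u) (at u)"
      by (rule has_derivative_transform_within_open[OF c1.deriv[OF uU] oQ u]) (simp add: \<phi>h)
    moreover have "isCont h u" using ch oQ u by (simp add: continuous_on_eq_continuous_at)
    ultimately obtain L where "(h has_derivative L) (at u)" "\<And>v. \<phi>2' (h u) (L v) = \<phi>1' u v"
      using has_derivative_through_immersion[where h = h and a = u and \<phi> = \<phi>2,
          OF c2.deriv[OF hU[OF u]] c2.immersion[OF hU[OF u]]] by metis
    then show ?thesis by blast
  qed
  then have "\<forall>u\<in>Q. \<exists>L. (h has_derivative L) (at u) \<and> (\<forall>v. \<phi>2' (h u) (L v) = \<phi>1' u v)" by blast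
  from bchoice[OF this] obtain h' where h': "\<And>u. u \<in> Q \<Longrightarrow> (h has_derivative h' u) (at u)"
    "\<And>u v. u \<in> Q \<Longrightarrow> \<phi>2' (h u) (h' u v) = \<phi>1' u v" by blast
  have jac: "c1.jacobian g u = \<bar>det (matrix (h' u))\<bar> * c2.jacobian g (h u)" if u: "u \<in> Q" for u
  proof -
    let ?T = "transpose (matrix (h' u))"
    have fr: "c1.frame u a = (\<Sum>c\<in>UNIV. ?T $ a $ c *\<^sub>R c2.frame (h u) c)" for a
    proof -
      have "c1.frame u a = \<phi>2' (h u) (h' u (axis a 1))"
        unfolding c1.frame_def h'(2)[OF u] ..
      then show ?thesis by (simp add: c2.phi'_expansion transpose_def matrix_def)
    qed
    have "c1.tangent u = minor (\<lambda>a i. \<Sum>c\<in>UNIV. ?T $ a $ c * engel_coord (\<phi>1 u) (c2.frame (h u) c) $ i)"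
      unfolding c1.tangent_def wedge_minor fr linear_sum[OF engel_coord_linear] linear_cmul[OF engel_coord_linear]
      by (intro arg_cong[where f = minor] ext) (simp add: sum_component)
    then have "c1.tangent u = (\<lambda>K. det (matrix (h' u)) * c2.tangent (h u) K)"
      by (simp add: fun_eq_iff minor_transform_rows c2.tangent_def wedge_minor \<phi>h[OF u] det_transpose)
    then show ?thesis
      by (simp add: c1.jacobian_eq_norm[OF g] c2.jacobian_eq_norm[OF g] pvector_norm_scale \<phi>h[OF u])
  qed
  have Wb: "W \<in> sets borel" unfolding W_def using A(1) by (rule c1.preimage_in_borel)
  have hW: "h ` W = U2 \<inter> \<phi>2 -` A"
  proof (intro equalityI subsetI)
    fix w assume "w \<in> h ` W"
    then obtain u where u: "u \<in> W" "w = h u" by blast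
    then have "u \<in> Q" using WQ by blast
    then show "w \<in> U2 \<inter> \<phi>2 -` A" using u hU \<phi>h by (auto simp: W_def)
  next
    fix w assume w: "w \<in> U2 \<inter> \<phi>2 -` A"
    then obtain u where u: "u \<in> U1" "\<phi>1 u = \<phi>2 w" using A(2) by force
    then have "u \<in> W" "h u = w" using w c2.psi_phi by (auto simp: W_def h_def)
    then show "w \<in> h ` W" by blast
  qed
  have injh: "inj_on h W"
  proof (rule inj_onI)
    fix u v assume "u \<in> W" "v \<in> W" "h u = h v"
    then have "\<phi>1 u = \<phi>1 v" using WQ \<phi>h by (metis subsetD)
    then show "u = v" using \<open>u \<in> W\<close> \<open>v \<in> W\<close> c1.inj_phi by (auto simp: W_def inj_on_def)
  qed
  have b2: "(\<lambda>y. indicator (h ` W) y * c2.jacobian g y) \<in> borel_measurable borel"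
    unfolding hW by (intro c2.borel_indicator_times c2.cont_jacobian g c2.preimage_in_borel A(1)) auto
  have eq1: "indicator W u * (\<bar>det (matrix (h' u))\<bar> * c2.jacobian g (h u)) = indicator W u * c1.jacobian g u" for u
    using jac[of u] WQ by (auto simp: indicator_def)
  have b1: "(\<lambda>u. indicator W u * c1.jacobian g u) \<in> borel_measurable borel"
    by (intro c1.borel_indicator_times c1.cont_jacobian g Wb) (auto simp: W_def)
  have "(\<integral>\<^sup>+y. ennreal (indicator (h ` W) y * c2.jacobian g y) \<partial>lborel) =
      (\<integral>\<^sup>+u. ennreal (indicator W u * (\<bar>det (matrix (h' u))\<bar> * c2.jacobian g (h u))) \<partial>lborel)"
  proof (rule nn_integral_change_of_variables[OF Wb _ injh b2])
    show "(h has_derivative h' u) (at u)" if "u \<in> W" for u using that WQ h'(1) by blast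
    show "0 \<le> c2.jacobian g y" if "y \<in> h ` W" for y
      using that c2.jacobian_pos[OF g, of y] unfolding hW by simp
    show "(\<lambda>u. indicator W u * (\<bar>det (matrix (h' u))\<bar> * c2.jacobian g (h u))) \<in> borel_measurable borel"
      unfolding eq1 by (rule b1)
  qed
  then show ?thesis
    unfolding eq1 hW unfolding c1.emeasure_chart_measure[OF g A(1)] c2.emeasure_chart_measure[OF g A(1)] W_def by simp
qed

text \<open>The empty chart makes every countable family of charts, even an empty one, a sequence.\<close>

lemma chart_empty: "chart S {} \<phi> {} \<psi> \<phi>'"
  by unfold_locales (auto simp: homeomorphism_def)

text \<open>Countably many of the open sets \<open>V\<close> of charts cover \<open>S\<close>, by the Lindelof property.\<close>

lemma countable_atlas:
  assumes "C11_submanifold TYPE('p::{finite,linorder}) S"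
  shows "\<exists>(U :: nat \<Rightarrow> (real^'p::{finite,linorder}) set) \<phi> V \<psi> \<phi>'.
    (\<forall>i. chart S (U i) (\<phi> i) (V i) (\<psi> i) (\<phi>' i)) \<and> S = (\<Union>i. \<phi> i ` U i)"
proof -
  define \<V> where "\<V> = {V. \<exists>(U :: (real^'p::{finite,linorder}) set) \<phi> \<psi> \<phi>'. chart S U \<phi> V \<psi> \<phi>'}"
  have op: "open V" if "V \<in> \<V>" for V using that by (auto simp: \<V>_def chart_def)
  have cov: "S \<subseteq> \<Union>\<V>"
  proof
    fix x assume "x \<in> S"
    then obtain U :: "(real^'p::{finite,linorder}) set" and \<phi> where "C11_param U \<phi> S" and x: "x \<in> \<phi> ` U"
      using assms unfolding C11_submanifold_def by blast
    then obtain V \<psi> \<phi>' where c: "chart S U \<phi> V \<psi> \<phi>'" unfolding C11_param_iff_chart by blast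
    then have "V \<in> \<V>" by (auto simp: \<V>_def)
    moreover have "x \<in> V" using x chart.image[OF c] by auto
    ultimately show "x \<in> \<Union>\<V>" by blast
  qed
  obtain \<V>' where V': "\<V>' \<subseteq> \<V>" "countable \<V>'" "\<Union>\<V>' = \<Union>\<V>" using Lindelof[of \<V>] op by metis
  define \<W> where "\<W> = insert {} \<V>'"
  have "{} \<in> \<V>" unfolding \<V>_def using chart_empty by blast
  then have W: "\<W> \<subseteq> \<V>" "countable \<W>" "\<W> \<noteq> {}" "\<Union>\<W> = \<Union>\<V>" using V' by (auto simp: \<W>_def)
  define V where "V = from_nat_into \<W>"
  have rV: "range V = \<W>" unfolding V_def using W by (intro range_from_nat_into)
  have "\<forall>i. \<exists>U :: (real^'p::{finite,linorder}) set. \<exists>\<phi> \<psi> \<phi>'. chart S U \<phi> (V i) \<psi> \<phi>'"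
    using rV W(1) unfolding \<V>_def by blast
  then obtain U :: "nat \<Rightarrow> (real^'p::{finite,linorder}) set" and \<phi> \<psi> \<phi>' where c: "\<And>i. chart S (U i) (\<phi> i) (V i) (\<psi> i) (\<phi>' i)"
    by metis
  have "(\<Union>i. \<phi> i ` U i) = (\<Union>i. S \<inter> V i)" using chart.image[OF c] by simp
  also have "\<dots> = S" using cov W(4) rV by auto
  finally have "S = (\<Union>i. \<phi> i ` U i)" ..
  with c show ?thesis by blast
qed

text \<open>The measures of the charts of a countable atlas agree on overlaps, so they can be glued along a disjoint
  Borel decomposition of \<open>S\<close> subordinate to the atlas. The same decomposition shows uniqueness.\<close>

lemma surface_measure_unique_existence:
  assumes S: "C11_submanifold TYPE('p::{finite,linorder}) S" and g: "riemannian_metric g"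
  shows "\<exists>!\<mu>. sets \<mu> = sets borel \<and> emeasure \<mu> (- S) = 0 \<and>
    (\<forall>(U :: (real^'p::{finite,linorder}) set) \<phi> V \<psi> \<phi>'. chart S U \<phi> V \<psi> \<phi>' \<longrightarrow>
       (\<forall>A\<in>sets borel. A \<subseteq> \<phi> ` U \<longrightarrow> emeasure \<mu> A = emeasure (chart.chart_measure U \<phi> \<phi>' g) A))"
    (is "\<exists>!\<mu>. ?P \<mu>")
proof -
  obtain U :: "nat \<Rightarrow> (real^'p::{finite,linorder}) set" and \<phi> V \<psi> \<phi>' where
    c0: "\<forall>i. chart S (U i) (\<phi> i) (V i) (\<psi> i) (\<phi>' i)" and SU: "S = (\<Union>i. \<phi> i ` U i)"
    using countable_atlas[OF S] by blast
  have c: "chart S (U i) (\<phi> i) (V i) (\<psi> i) (\<phi>' i)" for i using c0 by blast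
  define \<nu> where "\<nu> i = chart.chart_measure (U i) (\<phi> i) (\<phi>' i) g" for i
  define E where "E = disjointed (\<lambda>i. \<phi> i ` U i)"
  have s\<nu>: "sets (\<nu> i) = sets borel" for i
    unfolding \<nu>_def using chart.sets_chart_measure[OF c] .
  have \<phi>U: "\<phi> i ` U i \<in> sets borel" for i
    using chart.image_in_borel[OF c[of i], of "U i"] chart.openU[OF c[of i]] by simp
  have Eb: "E i \<in> sets borel" for i
    using sets.range_disjointed_sets[of "\<lambda>i. \<phi> i ` U i" borel] \<phi>U unfolding E_def by blast
  have Esub: "E i \<subseteq> \<phi> i ` U i" for i unfolding E_def by (rule disjointed_subset)
  have Edis: "disjoint_family E" unfolding E_def by (rule disjoint_family_disjointed)
  have SE: "S = (\<Union>i. E i)" unfolding E_def SU by (rule UN_disjointed_eq[symmetric])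
  have Sb: "S \<in> sets borel" unfolding SE using Eb by blast
  define m where "m A = (\<Sum>i. emeasure (\<nu> i) (A \<inter> E i))" for A
  have split: "emeasure \<mu> A = (\<Sum>i. emeasure \<mu> (A \<inter> E i))"
    if "sets \<mu> = sets borel" "A \<in> sets borel" "A \<subseteq> S" for \<mu> :: "(real^4) measure" and A
  proof -
    have "(\<Sum>i. emeasure \<mu> (A \<inter> E i)) = emeasure \<mu> (\<Union>i. A \<inter> E i)"
    proof (rule suminf_emeasure)
      show "range (\<lambda>i. A \<inter> E i) \<subseteq> sets \<mu>" using that Eb by auto
      show "disjoint_family (\<lambda>i. A \<inter> E i)" by (rule disjoint_family_subset[OF Edis]) auto
    qed
    moreover have "(\<Union>i. A \<inter> E i) = A" using that(3) SE by auto
    ultimately show ?thesis by simp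
  qed
  have "countably_additive (sets borel) m"
    unfolding countably_additive_def
  proof (intro allI impI)
    fix F :: "nat \<Rightarrow> (real^4) set"
    assume F: "range F \<subseteq> sets borel" "disjoint_family F" "\<Union>(range F) \<in> sets borel"
    have "(\<Sum>n. m (F n)) = (\<Sum>n. \<integral>\<^sup>+i. emeasure (\<nu> i) (F n \<inter> E i) \<partial>count_space UNIV)"
      by (simp add: m_def nn_integral_count_space_nat)
    also have "\<dots> = (\<integral>\<^sup>+i. (\<Sum>n. emeasure (\<nu> i) (F n \<inter> E i)) \<partial>count_space UNIV)"
      by (rule nn_integral_suminf[symmetric]) simp
    also have "\<dots> = (\<integral>\<^sup>+i. emeasure (\<nu> i) (\<Union>(range F) \<inter> E i) \<partial>count_space UNIV)"
    proof (rule nn_integral_cong)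
      fix i
      have "(\<Sum>n. emeasure (\<nu> i) (F n \<inter> E i)) = emeasure (\<nu> i) (\<Union>n. F n \<inter> E i)"
      proof (rule suminf_emeasure)
        show "range (\<lambda>n. F n \<inter> E i) \<subseteq> sets (\<nu> i)" using F(1) Eb s\<nu> by auto
        show "disjoint_family (\<lambda>n. F n \<inter> E i)" by (rule disjoint_family_subset[OF F(2)]) auto
      qed
      then show "(\<Sum>n. emeasure (\<nu> i) (F n \<inter> E i)) = emeasure (\<nu> i) (\<Union>(range F) \<inter> E i)" by simp
    qed
    also have "\<dots> = m (\<Union>(range F))" by (simp add: m_def nn_integral_count_space_nat)
    finally show "(\<Sum>n. m (F n)) = m (\<Union>(range F))" .
  qed
  moreover have "positive (sets borel) m" by (simp add: positive_def m_def)
  moreover have "sigma_algebra UNIV (sets borel :: (real^4) set set)"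
    using sets.sigma_algebra_axioms[of "borel :: (real^4) measure"] by simp
  ultimately have em: "emeasure (measure_of UNIV (sets borel) m) A = m A" if "A \<in> sets borel" for A
    using that by (intro emeasure_measure_of_sigma)
  define \<mu> where "\<mu> = measure_of UNIV (sets borel :: (real^4) set set) m"
  have s\<mu>: "sets \<mu> = sets borel" unfolding \<mu>_def by (simp add: sets.sigma_sets_eq[of borel, simplified])
  have P: "?P \<mu>"
  proof (intro conjI allI impI ballI)
    show "sets \<mu> = sets borel" by (rule s\<mu>)
    have "- S \<inter> E i = {}" for i using SE by auto
    then show "emeasure \<mu> (- S) = 0" using Sb by (simp add: \<mu>_def em m_def)
    fix U0 :: "(real^'p::{finite,linorder}) set" and \<phi>0 V0 \<psi>0 \<phi>0' A
    assume c0: "chart S U0 \<phi>0 V0 \<psi>0 \<phi>0'" and A: "A \<in> sets borel" "A \<subseteq> \<phi>0 ` U0"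
    have AS: "A \<subseteq> S" using A(2) chart.image[OF c0] by auto
    have "emeasure (\<nu> i) (A \<inter> E i) = emeasure (chart.chart_measure U0 \<phi>0 \<phi>0' g) (A \<inter> E i)" for i
      unfolding \<nu>_def using A Eb[of i] Esub[of i] by (intro chart_measure_transition[OF c c0 g]) auto
    then have "emeasure \<mu> A = (\<Sum>i. emeasure (chart.chart_measure U0 \<phi>0 \<phi>0' g) (A \<inter> E i))"
      using A by (simp add: \<mu>_def em m_def)
    also have "\<dots> = emeasure (chart.chart_measure U0 \<phi>0 \<phi>0' g) A"
      using split[OF chart.sets_chart_measure[OF c0] A(1) AS] by simp
    finally show "emeasure \<mu> A = emeasure (chart.chart_measure U0 \<phi>0 \<phi>0' g) A" .
  qed
  moreover have "\<mu>' = \<mu>" if P': "?P \<mu>'" for \<mu>'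
  proof (rule measure_eqI)
    have s': "sets \<mu>' = sets borel" using P' by blast
    then show "sets \<mu>' = sets \<mu>" using s\<mu> by simp
    fix A assume "A \<in> sets \<mu>'"
    then have A: "A \<in> sets borel" using s' by simp
    have on_S: "emeasure \<kappa> A = m A" if "?P \<kappa>" for \<kappa>
    proof -
      have s: "sets \<kappa> = sets borel" and z: "emeasure \<kappa> (- S) = 0" using that by blast+
      have "emeasure \<kappa> (A - S) \<le> emeasure \<kappa> (- S)" using s Sb by (intro emeasure_mono) auto
      then have "emeasure \<kappa> (A - S) = 0" using z by simp
      moreover have "emeasure \<kappa> A = emeasure \<kappa> (A \<inter> S) + emeasure \<kappa> (A - S)"
        using s A Sb plus_emeasure[of "A \<inter> S" \<kappa> "A - S"] by (simp add: Int_Diff_Un Int_Diff_disjoint)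
      ultimately have "emeasure \<kappa> A = emeasure \<kappa> (A \<inter> S)" by simp
      also have "\<dots> = (\<Sum>i. emeasure \<kappa> (A \<inter> S \<inter> E i))" using split[OF s, of "A \<inter> S"] A Sb by simp
      also have "\<dots> = m A" unfolding m_def
      proof (rule suminf_cong)
        fix i
        have "A \<inter> S \<inter> E i = A \<inter> E i" using SE by auto
        moreover have "emeasure \<kappa> (A \<inter> E i) = emeasure (\<nu> i) (A \<inter> E i)"
          using that c[of i] A Eb[of i] Esub[of i] unfolding \<nu>_def by blast
        ultimately show "emeasure \<kappa> (A \<inter> S \<inter> E i) = emeasure (\<nu> i) (A \<inter> E i)" by simp
      qed
      finally show ?thesis .
    qed
    show "emeasure \<mu>' A = emeasure \<mu> A" using on_S[OF P'] on_S[OF P] by simp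
  qed
  ultimately show ?thesis by (rule ex1I)
qed

lemma surface_measure_properties:
  assumes S: "C11_submanifold TYPE('p::{finite,linorder}) S" and g: "riemannian_metric g"
  shows "sets (surface_measure TYPE('p) g S) = sets borel"
    and "chart S U \<phi> V \<psi> \<phi>' \<Longrightarrow> A \<in> sets borel \<Longrightarrow> A \<subseteq> \<phi> ` (U :: (real^'p::{finite,linorder}) set) \<Longrightarrow>
       emeasure (surface_measure TYPE('p) g S) A = emeasure (chart.chart_measure U \<phi> \<phi>' g) A"
proof -
  let ?P = "\<lambda>\<mu>. sets \<mu> = sets borel \<and> emeasure \<mu> (- S) = 0 \<and>
    (\<forall>(U :: (real^'p::{finite,linorder}) set) \<phi> V \<psi> \<phi>'. chart S U \<phi> V \<psi> \<phi>' \<longrightarrow>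
       (\<forall>A\<in>sets borel. A \<subseteq> \<phi> ` U \<longrightarrow> emeasure \<mu> A = emeasure (chart.chart_measure U \<phi> \<phi>' g) A))"
  let ?Q = "\<lambda>\<mu>. sets \<mu> = sets borel \<and> emeasure \<mu> (- S) = 0 \<and>
        (\<forall>(U :: (real^'p::{finite,linorder}) set) \<phi>. C11_param U \<phi> S \<longrightarrow>
          (\<forall>B\<in>sets borel. B \<subseteq> U \<longrightarrow>
             emeasure \<mu> (\<phi> ` B) =
               (\<integral>\<^sup>+u\<in>B. ennreal (sqrt (det (\<chi> a b :: 'p. g (\<phi> u)
                  (frechet_derivative \<phi> (at u) (axis a 1))
                  (frechet_derivative \<phi> (at u) (axis b 1))))) \<partial>lborel)))"
  have inner: "(\<forall>A\<in>sets borel. A \<subseteq> \<phi> ` U \<longrightarrow> emeasure \<mu> A = emeasure (chart.chart_measure U \<phi> \<phi>' g) A) \<longleftrightarrow>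
      (\<forall>B\<in>sets borel. B \<subseteq> U \<longrightarrow>
             emeasure \<mu> (\<phi> ` B) =
               (\<integral>\<^sup>+u\<in>B. ennreal (sqrt (det (\<chi> a b :: 'p. g (\<phi> u)
                  (frechet_derivative \<phi> (at u) (axis a 1))
                  (frechet_derivative \<phi> (at u) (axis b 1))))) \<partial>lborel))" (is "?L \<longleftrightarrow> ?R")
    if ch: "chart S U \<phi> V \<psi> \<phi>'" for U :: "(real^'p::{finite,linorder}) set" and \<phi> V \<psi> \<phi>' and \<mu> :: "(real^4) measure"
  proof -
    interpret chart S U \<phi> V \<psi> \<phi>' by (rule ch)
    have e: "emeasure (chart_measure g) (\<phi> ` B) = (\<integral>\<^sup>+u\<in>B. ennreal (sqrt (det (\<chi> a b :: 'p. g (\<phi> u)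
                  (frechet_derivative \<phi> (at u) (axis a 1))
                  (frechet_derivative \<phi> (at u) (axis b 1))))) \<partial>lborel)" if "B \<in> sets borel" "B \<subseteq> U" for B
    proof -
      have "U \<inter> \<phi> -` (\<phi> ` B) = B" using that(2) inj_phi by (auto simp: inj_on_def)
      then show ?thesis
        unfolding area_formula_integrand[OF that(2)] emeasure_chart_measure[OF g image_in_borel[OF that]] by simp
    qed
    show ?thesis
    proof
      assume L: ?L
      show ?R
      proof (intro ballI impI)
        fix B assume B: "B \<in> sets borel" "B \<subseteq> U"
        have "\<phi> ` B \<subseteq> \<phi> ` U" using B(2) by blast
        then show "emeasure \<mu> (\<phi> ` B) = (\<integral>\<^sup>+u\<in>B. ennreal (sqrt (det (\<chi> a b :: 'p. g (\<phi> u)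
                  (frechet_derivative \<phi> (at u) (axis a 1))
                  (frechet_derivative \<phi> (at u) (axis b 1))))) \<partial>lborel)"
          unfolding e[OF B, symmetric] using L image_in_borel[OF B] by blast
      qed
    next
      assume R: ?R
      show ?L
      proof (intro ballI impI)
        fix A assume A: "A \<in> sets borel" "A \<subseteq> \<phi> ` U"
        note B = preimage_in_borel[OF A(1)]
        have "emeasure \<mu> (\<phi> ` (U \<inter> \<phi> -` A)) = emeasure (chart_measure g) (\<phi> ` (U \<inter> \<phi> -` A))"
          unfolding e[OF B Int_lower1] by (rule R[rule_format, OF B Int_lower1])
        moreover have "\<phi> ` (U \<inter> \<phi> -` A) = A" using A(2) by auto
        ultimately show "emeasure \<mu> A = emeasure (chart_measure g) A" by simp
      qed
    qed
  qed
  have PQ: "?P = ?Q"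
  proof (rule ext)
    fix \<mu>
    show "?P \<mu> = ?Q \<mu>"
    proof (intro conj_cong refl iffI allI impI)
      fix U :: "(real^'p::{finite,linorder}) set" and \<phi>
      assume *: "\<forall>(U :: (real^'p::{finite,linorder}) set) \<phi> V \<psi> \<phi>'. chart S U \<phi> V \<psi> \<phi>' \<longrightarrow>
       (\<forall>A\<in>sets borel. A \<subseteq> \<phi> ` U \<longrightarrow> emeasure \<mu> A = emeasure (chart.chart_measure U \<phi> \<phi>' g) A)"
        and "C11_param U \<phi> S"
      then obtain V \<psi> \<phi>' where c: "chart S U \<phi> V \<psi> \<phi>'" unfolding C11_param_iff_chart by blast
      with * have "\<forall>A\<in>sets borel. A \<subseteq> \<phi> ` U \<longrightarrow> emeasure \<mu> A = emeasure (chart.chart_measure U \<phi> \<phi>' g) A"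
        by blast
      then show "\<forall>B\<in>sets borel. B \<subseteq> U \<longrightarrow>
             emeasure \<mu> (\<phi> ` B) =
               (\<integral>\<^sup>+u\<in>B. ennreal (sqrt (det (\<chi> a b :: 'p. g (\<phi> u)
                  (frechet_derivative \<phi> (at u) (axis a 1))
                  (frechet_derivative \<phi> (at u) (axis b 1))))) \<partial>lborel)"
        unfolding inner[OF c] .
    next
      fix U :: "(real^'p::{finite,linorder}) set" and \<phi> V \<psi> \<phi>'
      assume *: "\<forall>(U :: (real^'p::{finite,linorder}) set) \<phi>. C11_param U \<phi> S \<longrightarrow>
          (\<forall>B\<in>sets borel. B \<subseteq> U \<longrightarrow>
             emeasure \<mu> (\<phi> ` B) =
               (\<integral>\<^sup>+u\<in>B. ennreal (sqrt (det (\<chi> a b :: 'p. g (\<phi> u)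
                  (frechet_derivative \<phi> (at u) (axis a 1))
                  (frechet_derivative \<phi> (at u) (axis b 1))))) \<partial>lborel))"
        and c: "chart S U \<phi> V \<psi> \<phi>'"
      have "C11_param U \<phi> S" unfolding C11_param_iff_chart using c by blast
      with * show "\<forall>A\<in>sets borel. A \<subseteq> \<phi> ` U \<longrightarrow> emeasure \<mu> A = emeasure (chart.chart_measure U \<phi> \<phi>' g) A"
        unfolding inner[OF c] by blast
    qed
  qed
  have "surface_measure TYPE('p) g S = (THE \<mu>. ?P \<mu>)"
    unfolding surface_measure_def PQ ..
  then have P: "?P (surface_measure TYPE('p) g S)"
    using theI'[OF surface_measure_unique_existence[OF S g]] by simp
  then show "sets (surface_measure TYPE('p) g S) = sets borel" by blast
  show "emeasure (surface_measure TYPE('p) g S) A = emeasure (chart.chart_measure U \<phi> \<phi>' g) A"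
    if "chart S U \<phi> V \<psi> \<phi>'" "A \<in> sets borel" "A \<subseteq> \<phi> ` (U :: (real^'p::{finite,linorder}) set)"
    using P that by blast
qed

definition degree_density ::
    "'p::{finite,linorder} itself \<Rightarrow> (real^4 \<Rightarrow> real^4 \<Rightarrow> real^4 \<Rightarrow> real) \<Rightarrow> nat \<Rightarrow> (real^4) set \<Rightarrow> real^4 \<Rightarrow> real" where
  "degree_density _ g d S x = pvector_norm g x (degree_component d (unit_tangent_pvector g S x :: 'p pvector))"

lemma submanifold_borel:
  assumes S: "C11_submanifold TYPE('p::{finite,linorder}) S"
  shows "S \<in> sets borel"
proof -
  obtain U :: "nat \<Rightarrow> (real^'p::{finite,linorder}) set" and \<phi> V \<psi> \<phi>' where
    c0: "\<forall>i. chart S (U i) (\<phi> i) (V i) (\<psi> i) (\<phi>' i)" and SU: "S = (\<Union>i. \<phi> i ` U i)"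
    using countable_atlas[OF S] by blast
  have c: "chart S (U i) (\<phi> i) (V i) (\<psi> i) (\<phi>' i)" for i using c0 by blast
  have "\<phi> i ` U i \<in> sets borel" for i
    using chart.image_in_borel[OF c[of i], of "U i"] chart.openU[OF c[of i]] by simp
  then show ?thesis unfolding SU by blast
qed

lemma (in chart) cont_degree_density:
  assumes g: "riemannian_metric g"
  shows "continuous_on (\<phi> ` U) (degree_density TYPE('p) g d S)"
proof -
  have "continuous_on U (\<lambda>u. pvector_norm g (\<phi> u) (degree_component d (tangent u)) / jacobian g u)"
    using jacobian_pos[OF g] by (intro continuous_on_divide cont_degree_component_norm cont_jacobian g) force
  then have "continuous_on (\<phi> ` U) (\<lambda>x. pvector_norm g (\<phi> (\<psi> x)) (degree_component d (tangent (\<psi> x))) / jacobian g (\<psi> x))"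
    by (rule continuous_on_compose2) (auto simp: cont_psi psi_in)
  moreover have "degree_density TYPE('p) g d S x =
      pvector_norm g (\<phi> (\<psi> x)) (degree_component d (tangent (\<psi> x))) / jacobian g (\<psi> x)" if "x \<in> \<phi> ` U" for x
  proof -
    have u: "\<psi> x \<in> U" "\<phi> (\<psi> x) = x" using that psi_in phi_psi by auto
    then show ?thesis
      using degree_density_eq[OF g u(1), of d] jacobian_pos[OF g u(1)]
      by (simp add: degree_density_def field_simps)
  qed
  ultimately show ?thesis by (simp cong: continuous_on_cong)
qed

lemma degree_density_borel:
  assumes S: "C11_submanifold TYPE('p::{finite,linorder}) S" and g: "riemannian_metric g"
  shows "(\<lambda>x. indicator S x * degree_density TYPE('p) g d S x) \<in> borel_measurable borel"
proof -
  obtain U :: "nat \<Rightarrow> (real^'p::{finite,linorder}) set" and \<phi> V \<psi> \<phi>' where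
    c0: "\<forall>i. chart S (U i) (\<phi> i) (V i) (\<psi> i) (\<phi>' i)" and SU: "S = (\<Union>i. \<phi> i ` U i)"
    using countable_atlas[OF S] by blast
  have c: "chart S (U i) (\<phi> i) (V i) (\<psi> i) (\<phi>' i)" for i using c0 by blast
  let ?f = "\<lambda>x. indicator S x * degree_density TYPE('p) g d S x"
  let ?C = "insert (- S) (range (\<lambda>i. \<phi> i ` U i))"
  have "\<phi> i ` U i \<in> sets borel" for i
    using chart.image_in_borel[OF c[of i], of "U i"] chart.openU[OF c[of i]] by simp
  moreover have "- S \<in> sets borel" using submanifold_borel[OF S] by simp
  ultimately have Cb: "\<Omega> \<in> sets borel" if "\<Omega> \<in> ?C" for \<Omega> using that by blast
  show ?thesis
  proof (rule measurable_piecewise_restrict[of ?C])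
    show "countable ?C" by simp
    show "\<Omega> \<inter> space borel \<in> sets borel" if "\<Omega> \<in> ?C" for \<Omega> using Cb[OF that] by simp
    show "space borel \<subseteq> \<Union>?C" using SU by auto
    fix \<Omega> assume "\<Omega> \<in> ?C"
    then show "?f \<in> borel_measurable (restrict_space borel \<Omega>)"
    proof
      assume \<Omega>: "\<Omega> = - S"
      have "(\<lambda>x. 0) \<in> borel_measurable (restrict_space borel (- S))" by simp
      then show ?thesis unfolding \<Omega>
        by (rule measurable_cong[THEN iffD1, rotated]) (auto simp: space_restrict_space)
    next
      assume "\<Omega> \<in> range (\<lambda>i. \<phi> i ` U i)"
      then obtain i where \<Omega>: "\<Omega> = \<phi> i ` U i" by blast
      have "degree_density TYPE('p) g d S \<in> borel_measurable (restrict_space borel (\<phi> i ` U i))"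
        by (intro borel_measurable_continuous_on_restrict chart.cont_degree_density[OF c g])
      then show ?thesis unfolding \<Omega>
        by (rule measurable_cong[THEN iffD1, rotated]) (auto simp: space_restrict_space SU indicator_def)
    qed
  qed
qed

text \<open>The Borel measure whose values on Borel subsets of \<open>S\<close> are \<open>intrinsic_measure\<close>. It is defined on
  the whole space in order to be evaluated on balls.\<close>

definition degree_measure ::
    "'p::{finite,linorder} itself \<Rightarrow> (real^4 \<Rightarrow> real^4 \<Rightarrow> real^4 \<Rightarrow> real) \<Rightarrow> nat \<Rightarrow> (real^4) set \<Rightarrow> (real^4) measure" where
  "degree_measure P g d S =
     density (surface_measure P g S) (\<lambda>x. ennreal (indicator S x * degree_density P g d S x))"

context
  fixes S :: "(real^4) set" and g :: "real^4 \<Rightarrow> real^4 \<Rightarrow> real^4 \<Rightarrow> real"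
  assumes S: "C11_submanifold TYPE('p::{finite,linorder}) S" and g: "riemannian_metric g"
begin

lemma sets_degree_measure: "sets (degree_measure TYPE('p) g d S) = sets borel"
  by (simp add: degree_measure_def surface_measure_properties(1)[OF S g])

lemma emeasure_degree_measure:
  assumes A: "A \<in> sets borel"
  shows "emeasure (degree_measure TYPE('p) g d S) A =
    (\<integral>\<^sup>+x. ennreal (indicator S x * degree_density TYPE('p) g d S x) * indicator A x \<partial>surface_measure TYPE('p) g S)"
proof -
  have "(\<lambda>x. ennreal (indicator S x * degree_density TYPE('p) g d S x)) \<in> borel_measurable (surface_measure TYPE('p) g S)"
    using degree_density_borel[OF S g, of d]
    by (simp add: measurable_cong_sets[OF surface_measure_properties(1)[OF S g] refl])
  then show ?thesis
    unfolding degree_measure_def using A surface_measure_properties(1)[OF S g] by (simp add: emeasure_density)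
qed

lemma intrinsic_measure_eq:
  assumes A: "A \<in> sets borel" "A \<subseteq> S"
  shows "intrinsic_measure TYPE('p) g d S A = emeasure (degree_measure TYPE('p) g d S) A"
  unfolding intrinsic_measure_def emeasure_degree_measure[OF A(1)]
  by (rule nn_integral_cong) (use A(2) in \<open>auto simp: indicator_def degree_density_def\<close>)

lemma degree_measure_in_chart:
  assumes c: "chart S U \<phi> V \<psi> \<phi>'" and A: "A \<in> sets borel" "A \<subseteq> \<phi> ` (U :: (real^'p::{finite,linorder}) set)"
  shows "emeasure (degree_measure TYPE('p) g d S) A =
    (\<integral>\<^sup>+u. ennreal (indicator (U \<inter> \<phi> -` A) u * pvector_norm g (\<phi> u) (degree_component d (chart.tangent \<phi> \<phi>' u))) \<partial>lborel)"
proof -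
  interpret chart S U \<phi> V \<psi> \<phi>' by (rule c)
  let ?\<mu> = "surface_measure TYPE('p) g S"
  let ?f = "\<lambda>x. ennreal (indicator S x * degree_density TYPE('p) g d S x)"
  have s: "sets ?\<mu> = sets borel" by (rule surface_measure_properties(1)[OF S g])
  have Ub: "\<phi> ` U \<in> sets borel" using image_in_borel[of U] openU by simp
  have f: "?f \<in> borel_measurable borel" using degree_density_borel[OF S g, of d] by simp
  have eq: "density ?\<mu> (indicator (\<phi> ` U)) = chart_measure g"
  proof (rule measure_eqI)
    show "sets (density ?\<mu> (indicator (\<phi> ` U))) = sets (chart_measure g)" using s by simp
    fix B assume "B \<in> sets (density ?\<mu> (indicator (\<phi> ` U)))"
    then have B: "B \<in> sets borel" using s by simp
    have "emeasure (density ?\<mu> (indicator (\<phi> ` U))) B = emeasure ?\<mu> (\<phi> ` U \<inter> B)"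
      using B Ub s by (subst emeasure_density) (auto simp: indicator_inter_arith[symmetric] measurable_cong_sets[OF s refl])
    also have "\<dots> = emeasure (chart_measure g) (\<phi> ` U \<inter> B)"
      using B Ub by (intro surface_measure_properties(2)[OF S g c]) auto
    also have "\<dots> = emeasure (chart_measure g) B"
    proof -
      have "U \<inter> \<phi> -` (\<phi> ` U \<inter> B) = U \<inter> \<phi> -` B" by auto
      then show ?thesis using B Ub by (simp add: emeasure_chart_measure[OF g])
    qed
    finally show "emeasure (density ?\<mu> (indicator (\<phi> ` U))) B = emeasure (chart_measure g) B" .
  qed
  have "emeasure (degree_measure TYPE('p) g d S) A = (\<integral>\<^sup>+x. indicator (\<phi> ` U) x * (?f x * indicator A x) \<partial>?\<mu>)"
    unfolding emeasure_degree_measure[OF A(1)]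
    by (rule nn_integral_cong) (use A(2) in \<open>auto simp: indicator_def\<close>)
  also have "\<dots> = (\<integral>\<^sup>+x. ?f x * indicator A x \<partial>density ?\<mu> (indicator (\<phi> ` U)))"
    using f A(1) Ub by (intro nn_integral_density[symmetric]) (auto simp: measurable_cong_sets[OF s refl])
  also have "\<dots> = (\<integral>\<^sup>+u. ennreal (indicator U u * jacobian g u) * (?f (\<phi> u) * indicator A (\<phi> u)) \<partial>lborel)"
    unfolding eq using f A(1) by (intro nn_integral_chart_measure g) auto
  also have "\<dots> = (\<integral>\<^sup>+u. ennreal (indicator (U \<inter> \<phi> -` A) u * pvector_norm g (\<phi> u) (degree_component d (tangent u))) \<partial>lborel)"
  proof (rule nn_integral_cong)
    fix u
    show "ennreal (indicator U u * jacobian g u) * (?f (\<phi> u) * indicator A (\<phi> u)) =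
      ennreal (indicator (U \<inter> \<phi> -` A) u * pvector_norm g (\<phi> u) (degree_component d (tangent u)))"
    proof (cases "u \<in> U \<inter> \<phi> -` A")
      case True
      then have u: "u \<in> U" "\<phi> u \<in> A" "\<phi> u \<in> S" using image by auto
      have "ennreal (jacobian g u) * ennreal (degree_density TYPE('p) g d S (\<phi> u)) =
          ennreal (degree_density TYPE('p) g d S (\<phi> u) * jacobian g u)"
        using jacobian_pos[OF g u(1)] by (simp add: ennreal_mult' mult.commute)
      then show ?thesis
        using u degree_density_eq[OF g u(1), of d] by (simp add: degree_density_def)
    qed (auto simp: indicator_def)
  qed
  finally show ?thesis .
qed

end

section \<open>Upper density\<close>

definition project :: "('p \<Rightarrow> 4) \<Rightarrow> real^4 \<Rightarrow> real^'p" where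
  "project I y = (\<chi> b. y $ I b)"

lemma project_nth [simp]: "project I y $ b = y $ I b"
  by (simp add: project_def)

lemma linear_project_coord: "linear (\<lambda>v. project I (engel_coord x v) :: real^'p::finite)"
  by (rule linearI) (simp_all add: vec_eq_iff linear_add[OF engel_coord_linear] linear_cmul[OF engel_coord_linear])

text \<open>For \<open>s b = r ^ weight (I b)\<close> this box has volume comparable with \<open>r ^ index_degree I\<close>, which is how
  the degree of a multi-index enters the estimates.\<close>

definition anisotropic_box :: "('p::finite \<Rightarrow> real) \<Rightarrow> (real^'p) set" where
  "anisotropic_box s = {q. \<forall>b. \<bar>q $ b\<bar> \<le> s b}"

lemma anisotropic_box_eq_cbox: "anisotropic_box s = cbox (\<chi> b. - s b) (\<chi> b. s b)"
  by (auto simp: anisotropic_box_def mem_box_cart abs_le_iff minus_le_iff)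

lemma emeasure_anisotropic_box:
  assumes "\<And>b. 0 \<le> s b"
  shows "emeasure lborel (anisotropic_box (s :: 'p::finite \<Rightarrow> real)) = ennreal (\<Prod>b\<in>UNIV. 2 * s b)"
proof -
  have "(\<chi> b. - s b) \<bullet> a \<le> (\<chi> b. s b) \<bullet> a" if "a \<in> Basis" for a
    using that assms by (auto simp: Basis_vec_def inner_axis)
  then show ?thesis
    unfolding anisotropic_box_eq_cbox by (subst emeasure_lborel_cbox) (auto simp: prod_Basis_cart inner_axis)
qed

lemma prod_power_weight:
  "(\<Prod>b\<in>UNIV. c * r ^ weight (I b)) = c ^ CARD('p) * r ^ index_degree (I :: 'p::{finite,linorder} \<Rightarrow> 4)" for c r :: real
  by (simp add: prod.distrib index_degree_def power_sum)

lemma linear_lower_bound_perturbation: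
  fixes f h :: "real^'n \<Rightarrow> real^'n"
  assumes "\<And>v. c * norm v \<le> norm (f v)" "\<And>v. norm (h v - f v) \<le> c / 2 * norm v"
  shows "c / 2 * norm v \<le> norm (h v)"
proof -
  have "norm (f v) \<le> norm (h v) + norm (h v - f v)" by norm
  then show ?thesis using assms(1)[of v] assms(2)[of v] by simp
qed

context chart
begin

text \<open>\<open>translate I x\<close> reads the coordinates \<open>I\<close> of the submanifold translated by the inverse
  of \<open>x\<close>; its Jacobian at \<open>x = \<phi> u\<close> is the coefficient \<open>tangent u I\<close>.\<close>

definition translate :: "('p \<Rightarrow> 4) \<Rightarrow> real^4 \<Rightarrow> real^'p::_ \<Rightarrow> real^'p::_" where
  "translate I x u = project I (engel_coord x (\<phi> u - x))"

definition translate' :: "('p \<Rightarrow> 4) \<Rightarrow> real^4 \<Rightarrow> real^'p::_ \<Rightarrow> real^'p::_ \<Rightarrow> real^'p::_" where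
  "translate' I x u v = project I (engel_coord x (\<phi>' u v))"

definition coord_minor :: "real^4 \<Rightarrow> real^'p::_ \<Rightarrow> ('p \<Rightarrow> 4) \<Rightarrow> real" where
  "coord_minor x u = minor (\<lambda>a i. engel_coord x (frame u a) $ i)"

lemma tangent_eq_coord_minor: "tangent u = coord_minor (\<phi> u) u"
  by (simp add: tangent_def wedge_minor coord_minor_def)

lemma translate_has_derivative:
  assumes "u \<in> U"
  shows "(translate I x has_derivative translate' I x u) (at u)"
proof -
  have bl: "bounded_linear (\<lambda>v. project I (engel_coord x v) :: real^'p::_)"
    using linear_project_coord by (simp add: linear_conv_bounded_linear)
  have "((\<lambda>u. \<phi> u - x) has_derivative \<phi>' u) (at u)"
    using has_derivative_diff[OF deriv[OF assms] has_derivative_const[of x]] by simp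
  from bounded_linear.has_derivative[OF bl this]
  show ?thesis by (simp add: translate_def[abs_def] translate'_def[abs_def])
qed

lemma cont_translate: "continuous_on U (translate I x)"
  using translate_has_derivative by (meson continuous_at_imp_continuous_on has_derivative_continuous)

lemma translate'_linear: "linear (translate' I x u)"
  unfolding translate'_def[abs_def]
  by (rule linear_compose[OF bounded_linear.linear[OF blinfun.bounded_linear_right] linear_project_coord, unfolded o_def])

lemma det_translate': "det (matrix (translate' I x u)) = coord_minor x u I"
proof -
  have "matrix (translate' I x u) = transpose (\<chi> a b. engel_coord x (frame u a) $ I b)"
    by (simp add: matrix_def transpose_def translate'_def frame_def vec_eq_iff)
  then show ?thesis by (simp add: coord_minor_def minor_def det_transpose)
qed

lemma translate'_expansion:
  "translate' I x u v $ b = (\<Sum>a\<in>UNIV. v $ a * engel_coord x (frame u a) $ I b)"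
  by (simp add: translate'_def phi'_expansion linear_sum[OF engel_coord_linear]
      linear_cmul[OF engel_coord_linear] sum_component)

lemma tendsto_coord_frame:
  assumes u0: "u0 \<in> U"
  shows "((\<lambda>z. engel_coord (fst z) (frame (snd z) a) $ i) \<longlongrightarrow> engel_coord x0 (frame u0 a) $ i) (nhds (x0, u0))"
proof -
  have "isCont (\<lambda>u. frame u a) u0"
    using cont_frame openU u0 by (simp add: continuous_on_eq_continuous_at)
  then have "((\<lambda>u. frame u a) \<longlongrightarrow> frame u0 a) (nhds u0)"
    unfolding isCont_def by (rule tendsto_at_iff_tendsto_nhds[THEN iffD1])
  moreover have "(snd \<longlongrightarrow> snd (x0, u0)) (nhds (x0, u0))" by (intro tendsto_snd filterlim_ident)
  then have "filterlim snd (nhds u0) (nhds (x0, u0))" by simp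
  ultimately have f: "((\<lambda>z. frame (snd z) a) \<longlongrightarrow> frame u0 a) (nhds (x0, u0))"
    by (rule filterlim_compose)
  have x: "((\<lambda>z. fst z $ j) \<longlongrightarrow> x0 $ j) (nhds (x0, u0))" for j
  proof -
    have "(fst \<longlongrightarrow> fst (x0, u0)) (nhds (x0, u0))" by (intro tendsto_fst filterlim_ident)
    from tendsto_vec_nth[OF this, of j] show ?thesis by simp
  qed
  note fj = tendsto_vec_nth[OF f]
  show ?thesis
    using exhaust_4[of i] by (elim disjE; simp add: engel_coord_eq; intro tendsto_intros f fj x; simp)
qed

lemma tendsto_coord_minor:
  assumes u0: "u0 \<in> U"
  shows "((\<lambda>z. coord_minor (fst z) (snd z) K) \<longlongrightarrow> coord_minor x0 u0 K) (nhds (x0, u0))"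
  unfolding coord_minor_def minor_def det_def
  by (intro tendsto_sum tendsto_mult tendsto_prod tendsto_const) (simp add: tendsto_coord_frame[OF u0])

lemma translate'_lower_bound:
  assumes "coord_minor x u I \<noteq> 0"
  obtains c where "0 < c" "\<And>v. c * norm v \<le> norm (translate' I x u v)"
proof -
  have "inj (translate' I x u)"
    using assms det_translate'[of I x u] translate'_linear[of I x u] det_nz_iff_inj by metis
  then show thesis
    using linear_inj_bounded_below_pos[OF translate'_linear] that by metis
qed

text \<open>Near a base point where the coefficient does not vanish, all the maps \<open>translate I x\<close> are
  uniformly close to an invertible linear map.\<close>

lemma translate'_uniformly_close:
  assumes u0: "u0 \<in> U" and c: "0 < c"
  shows "\<forall>\<^sub>F z in nhds (x0, u0). \<forall>v. norm (translate' I (fst z) (snd z) v - translate' I x0 u0 v) \<le> c * norm v"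
proof -
  define e where "e = c / (real CARD('p) * real CARD('p))"
  have e: "0 < e" using c by (simp add: e_def)
  have "\<forall>\<^sub>F z in nhds (x0, u0). dist (engel_coord (fst z) (frame (snd z) a) $ i) (engel_coord x0 (frame u0 a) $ i) < e" for a i
    using tendsto_coord_frame[OF u0] e by (rule tendstoD)
  then have "\<forall>\<^sub>F z in nhds (x0, u0). \<forall>a i. dist (engel_coord (fst z) (frame (snd z) a) $ i) (engel_coord x0 (frame u0 a) $ i) < e"
    by (intro eventually_all_finite)
  then show ?thesis
  proof eventually_elim
    case (elim z)
    show ?case
    proof
      fix v :: "real^'p::_"
      let ?d = "translate' I (fst z) (snd z) v - translate' I x0 u0 v"
      have "\<bar>?d $ b\<bar> \<le> real CARD('p) * (e * norm v)" for b
      proof -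
        have "?d $ b = (\<Sum>a\<in>UNIV. v $ a * (engel_coord (fst z) (frame (snd z) a) $ I b - engel_coord x0 (frame u0 a) $ I b))"
          by (simp add: translate'_expansion right_diff_distrib sum_subtractf)
        also have "\<bar>\<dots>\<bar> \<le> (\<Sum>a\<in>UNIV. \<bar>v $ a * (engel_coord (fst z) (frame (snd z) a) $ I b - engel_coord x0 (frame u0 a) $ I b)\<bar>)"
          by (rule sum_abs)
        also have "\<dots> \<le> (\<Sum>a\<in>(UNIV :: 'p set). e * norm v)"
        proof (rule sum_mono)
          fix a
          have "\<bar>engel_coord (fst z) (frame (snd z) a) $ I b - engel_coord x0 (frame u0 a) $ I b\<bar> \<le> e"
            using elim by (simp add: dist_real_def less_imp_le)
          then show "\<bar>v $ a * (engel_coord (fst z) (frame (snd z) a) $ I b - engel_coord x0 (frame u0 a) $ I b)\<bar> \<le> e * norm v"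
            unfolding abs_mult using component_le_norm_cart[of v a] e
            by (metis abs_ge_zero mult.commute mult_mono norm_ge_zero)
        qed
        finally show ?thesis by simp
      qed
      then have "(\<Sum>b\<in>UNIV. \<bar>?d $ b\<bar>) \<le> (\<Sum>b\<in>(UNIV :: 'p set). real CARD('p) * (e * norm v))" by (intro sum_mono)
      also have "\<dots> = c * norm v" by (simp add: e_def)
      finally show "norm ?d \<le> c * norm v" using norm_le_l1_cart[of ?d] by simp
    qed
  qed
qed

text \<open>A map whose derivatives on a convex set are close to one invertible linear map is injective there. The
  closeness does not involve the centre \<open>x\<close>, hence one set \<open>W\<close> serves all nearby centres.\<close>

lemma translate_inj_on:
  assumes W: "convex W" "W \<subseteq> U" and c: "0 < c"
    and low: "\<And>v. c * norm v \<le> norm (translate' I x0 u0 v)"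
    and close: "\<And>u v. u \<in> W \<Longrightarrow> norm (translate' I x u v - translate' I x0 u0 v) \<le> c / 2 * norm v"
  shows "inj_on (translate I x) W"
proof (rule inj_onI, rule ccontr)
  fix u v assume uv: "u \<in> W" "v \<in> W" "translate I x u = translate I x v" "u \<noteq> v"
  let ?D = "translate' I x0 u0"
  have lD: "linear ?D" by (rule translate'_linear)
  then have bD: "bounded_linear ?D" by (simp add: linear_conv_bounded_linear)
  have "norm ((translate I x u - ?D u) - (translate I x v - ?D v)) \<le> c / 2 * norm (u - v)"
  proof (rule differentiable_bound[OF W(1) _ _ uv(1,2)])
    show "((\<lambda>u. translate I x u - ?D u) has_derivative (\<lambda>v. translate' I x w v - ?D v)) (at w within W)" if "w \<in> W" for w
    proof -
      have "w \<in> U" using that W(2) by blast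
      show ?thesis
        by (rule has_derivative_at_withinI[OF has_derivative_diff[OF translate_has_derivative[OF \<open>w \<in> U\<close>]
              bounded_linear_imp_has_derivative[OF bD]]])
    qed
    show "onorm (\<lambda>v. translate' I x w v - ?D v) \<le> c / 2" if "w \<in> W" for w
      using close[OF that] by (rule onorm_le)
  qed
  then have "norm (?D (u - v)) \<le> c / 2 * norm (u - v)"
    using uv(3) by (simp add: linear_diff[OF lD] norm_minus_commute)
  moreover have "c * norm (u - v) \<le> norm (?D (u - v))" by (rule low)
  moreover have "0 < c * norm (u - v)" using c uv(4) by simp
  ultimately show False by simp
qed

lemma relatively_open_image:
  assumes "open W" "W \<subseteq> U"
  obtains T where "open T" "\<phi> ` W = S \<inter> T"
proof -
  have "openin (top_of_set (\<phi> ` U)) (\<phi> ` U \<inter> \<psi> -` W)"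
    using cont_psi assms(1) by (rule continuous_openin_preimage_gen)
  then obtain T where T: "open T" "\<phi> ` U \<inter> \<psi> -` W = \<phi> ` U \<inter> T"
    by (auto simp: openin_open)
  have "\<phi> ` W = \<phi> ` U \<inter> \<psi> -` W" using assms(2) psi_phi by force
  then have "\<phi> ` W = S \<inter> (V \<inter> T)" using T image by auto
  with that T(1) openV show thesis by blast
qed

text \<open>The set \<open>W \<inter> \<phi> -` H\<close> is relatively closed in an open set and hence \<open>\<sigma>\<close>-compact, so that continuous
  images of it are Borel.\<close>

lemma translate_image_borel:
  assumes "open W" "W \<subseteq> U" "closed H"
  shows "translate I x ` (W \<inter> \<phi> -` H) \<in> sets borel"
proof -
  obtain C where C: "\<And>n::nat. compact (C n)" "\<And>n. C n \<subseteq> W" "\<Union>(range C) = W"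
    using open_Union_compact_subsets[OF assms(1)] by metis
  have "compact (translate I x ` (C n \<inter> \<phi> -` H))" for n
  proof (rule compact_continuous_image)
    have CU: "C n \<subseteq> U" using C(2) assms(2) by blast
    then show "continuous_on (C n \<inter> \<phi> -` H) (translate I x)"
      by (intro continuous_on_subset[OF cont_translate]) auto
    have "closed (C n \<inter> \<phi> -` H)"
      using CU by (intro continuous_closed_preimage[OF continuous_on_subset[OF cont_phi]] compact_imp_closed C(1) assms(3))
    then show "compact (C n \<inter> \<phi> -` H)" using compact_Int_closed[OF C(1)[of n]] by (metis inf.left_idem)
  qed
  then have "translate I x ` (C n \<inter> \<phi> -` H) \<in> sets borel" for n
    by (intro borel_closed compact_imp_closed)
  then have "(\<Union>n. translate I x ` (C n \<inter> \<phi> -` H)) \<in> sets borel" by (intro sets.countable_UN) auto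
  moreover have "translate I x ` (W \<inter> \<phi> -` H) = (\<Union>n. translate I x ` (C n \<inter> \<phi> -` H))" using C(3) by blast
  ultimately show ?thesis by simp
qed

lemma emeasure_translate_image:
  assumes P: "P \<in> sets borel" "P \<subseteq> U" and img: "translate I x ` P \<in> sets borel" and inj: "inj_on (translate I x) P"
  shows "emeasure lborel (translate I x ` P) = (\<integral>\<^sup>+u. ennreal (indicator P u * \<bar>coord_minor x u I\<bar>) \<partial>lborel)"
proof -
  have cc: "continuous_on U (\<lambda>u. coord_minor x u I)"
    unfolding coord_minor_def minor_def
  proof (intro continuous_on_det)
    fix a b
    have f: "continuous_on U (\<lambda>u. frame u a $ j)" for j
      by (intro continuous_intros cont_frame)
    show "continuous_on U (\<lambda>u. (\<chi> a b. engel_coord x (frame u a) $ I b) $ a $ b)"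
      using exhaust_4[of "I b"] by (elim disjE; simp add: engel_coord_eq; intro continuous_intros f cont_frame; simp)
  qed
  have "emeasure lborel (translate I x ` P) = (\<integral>\<^sup>+y. ennreal (indicator (translate I x ` P) y * 1) \<partial>lborel)"
    using img by (simp add: nn_integral_indicator[symmetric] ennreal_indicator del: nn_integral_indicator)
  also have "\<dots> = (\<integral>\<^sup>+u. ennreal (indicator P u * (\<bar>det (matrix (translate' I x u))\<bar> * 1)) \<partial>lborel)"
  proof (rule nn_integral_change_of_variables[OF P(1) _ inj])
    show "(translate I x has_derivative translate' I x u) (at u)" if "u \<in> P" for u
      using that P(2) translate_has_derivative by blast
    show "(\<lambda>y. indicator (translate I x ` P) y * (1::real)) \<in> borel_measurable borel" using img by simp
    have "continuous_on U (\<lambda>u. \<bar>coord_minor x u I\<bar>)" by (intro continuous_intros cc)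
    then show "(\<lambda>u. indicator P u * (\<bar>det (matrix (translate' I x u))\<bar> * 1)) \<in> borel_measurable borel"
      unfolding det_translate' using borel_indicator_times[OF _ P] by simp
  qed simp
  finally show ?thesis by (simp add: det_translate')
qed

end

text \<open>The projection of the translated submanifold to the coordinates \<open>I\<close> maps the part in the ball
  injectively into a box of volume comparable with \<open>r ^ d\<close>. Its Jacobian is at least \<open>L / 2\<close>, where \<open>L\<close> is the
  absolute value of the coefficient \<open>I\<close> at the base point, while the density of \<open>M\<close> is at most a
  multiple of \<open>L\<close>, since no coefficient of degree \<open>d\<close> exceeds \<open>L\<close> there. The
  factor \<open>L\<close> cancels, and the constant does not depend on the point. The bound has to hold for all
  centres \<open>x\<close> near the base point, on \<open>S\<close> or not.\<close>

lemma (in chart) upper_density: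
  assumes h: "homogeneous \<rho>" and k: "0 < k"
    "\<And>x z r i. \<rho> x z \<le> r \<Longrightarrow> \<bar>engel_coord x (z - x) $ i\<bar> \<le> (k * r) ^ weight i"
    and u0: "u0 \<in> U" and deg: "index_degree I = d" and nz: "tangent u0 I \<noteq> 0"
    and top: "\<And>J. J \<in> multi_indices \<Longrightarrow> index_degree J = d \<Longrightarrow> \<bar>tangent u0 J\<bar> \<le> \<bar>tangent u0 I\<bar>"
    and \<Omega>: "open \<Omega>" "\<phi> u0 \<in> \<Omega>"
    and b: "0 < b" "\<And>x (\<tau> :: 'p pvector). x \<in> \<Omega> \<Longrightarrow> pvector_norm g x \<tau> \<le> b * coefficient_sum \<tau>"
    and M: "\<And>A. A \<in> sets borel \<Longrightarrow> A \<subseteq> \<phi> ` U \<Longrightarrow> emeasure M A =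
      (\<integral>\<^sup>+u. ennreal (indicator (U \<inter> \<phi> -` A) u * pvector_norm g (\<phi> u) (degree_component d (tangent u))) \<partial>lborel)"
    and MS: "\<And>A. A \<in> sets borel \<Longrightarrow> emeasure M A = emeasure M (A \<inter> S)"
    and S: "S \<in> sets borel"
  shows "\<exists>N r0. open N \<and> \<phi> u0 \<in> N \<and> 0 < r0 \<and> (\<forall>x\<in>N. \<forall>r. 0 < r \<longrightarrow> r < r0 \<longrightarrow>
    emeasure M (homogeneous.hball \<rho> x r) \<le>
      ennreal (4 * b * real (card (multi_indices :: ('p \<Rightarrow> 4) set)) * (2 ^ CARD('p) * k ^ d) * r ^ d))"
proof -
  interpret homogeneous \<rho> by (rule h)
  define L where "L = \<bar>tangent u0 I\<bar>"
  have L: "0 < L" using nz by (simp add: L_def)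
  let ?x0 = "\<phi> u0"
  let ?n = "real (card (multi_indices :: ('p \<Rightarrow> 4) set))"
  have nz': "coord_minor ?x0 u0 I \<noteq> 0" using nz by (simp add: tangent_eq_coord_minor)
  obtain c where c: "0 < c" "\<And>v. c * norm v \<le> norm (translate' I ?x0 u0 v)"
    using translate'_lower_bound[OF nz'] by blast
  have c2: "0 < c / 2" using c(1) by simp
  have ev1: "\<forall>\<^sub>F z in nhds (?x0, u0). \<forall>v. norm (translate' I (fst z) (snd z) v - translate' I ?x0 u0 v) \<le> c / 2 * norm v"
    by (rule translate'_uniformly_close[OF u0 c2])
  have "((\<lambda>z. \<bar>coord_minor (fst z) (snd z) I\<bar>) \<longlongrightarrow> L) (nhds (?x0, u0))"
    unfolding L_def tangent_eq_coord_minor by (intro tendsto_intros tendsto_coord_minor[OF u0])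
  then have ev2: "\<forall>\<^sub>F z in nhds (?x0, u0). L / 2 < \<bar>coord_minor (fst z) (snd z) I\<bar>"
    using L by (intro order_tendstoD) auto
  obtain T where T: "open T" "(?x0, u0) \<in> T" "\<And>z. z \<in> T \<Longrightarrow> L / 2 < \<bar>coord_minor (fst z) (snd z) I\<bar> \<and>
      (\<forall>v. norm (translate' I (fst z) (snd z) v - translate' I ?x0 u0 v) \<le> c / 2 * norm v)"
    using eventually_conj[OF ev2 ev1] unfolding eventually_nhds by auto
  obtain N1 B where N1B: "open N1" "open B" "(?x0, u0) \<in> N1 \<times> B" "N1 \<times> B \<subseteq> T"
    using open_prod_elim[OF T(1,2)] .
  have ct: "isCont (\<lambda>u. tangent u J) u0" and cp: "isCont \<phi> u0" for J
    using cont_tangent cont_phi openU u0 by (simp_all add: continuous_on_eq_continuous_at)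
  have "\<forall>\<^sub>F u in nhds u0. J \<in> multi_indices \<longrightarrow> index_degree J = d \<longrightarrow> \<bar>tangent u J\<bar> < 2 * L" for J
  proof (cases "J \<in> multi_indices \<and> index_degree J = d")
    case True
    then have "\<bar>tangent u0 J\<bar> < 2 * L" using top[of J] L by (simp add: L_def)
    moreover have "((\<lambda>u. \<bar>tangent u J\<bar>) \<longlongrightarrow> \<bar>tangent u0 J\<bar>) (nhds u0)"
      using ct[of J] unfolding isCont_def by (intro tendsto_intros tendsto_at_iff_tendsto_nhds[THEN iffD1])
    ultimately show ?thesis by (auto intro: eventually_mono[OF order_tendstoD(2)])
  qed auto
  then have "\<forall>\<^sub>F u in nhds u0. \<forall>J. J \<in> multi_indices \<longrightarrow> index_degree J = d \<longrightarrow> \<bar>tangent u J\<bar> < 2 * L"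
    by (intro eventually_all_finite)
  moreover have "\<forall>\<^sub>F u in nhds u0. u \<in> U" using openU u0 by (rule eventually_nhds_in_open)
  moreover have "\<forall>\<^sub>F u in nhds u0. \<phi> u \<in> \<Omega>"
    using topological_tendstoD[OF _ \<Omega>] cp unfolding isCont_def by (metis tendsto_at_iff_tendsto_nhds)
  moreover have "\<forall>\<^sub>F u in nhds u0. u \<in> B" using N1B by (intro eventually_nhds_in_open) auto
  ultimately have "\<forall>\<^sub>F u in nhds u0. u \<in> U \<and> \<phi> u \<in> \<Omega> \<and> u \<in> B \<and>
      (\<forall>J. J \<in> multi_indices \<longrightarrow> index_degree J = d \<longrightarrow> \<bar>tangent u J\<bar> < 2 * L)"
    by eventually_elim auto
  then obtain B' where B': "open B'" "u0 \<in> B'" "\<And>u. u \<in> B' \<Longrightarrow> u \<in> U \<and> \<phi> u \<in> \<Omega> \<and> u \<in> B \<and>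
      (\<forall>J. J \<in> multi_indices \<longrightarrow> index_degree J = d \<longrightarrow> \<bar>tangent u J\<bar> < 2 * L)"
    unfolding eventually_nhds by auto
  obtain s where s: "0 < s" "ball u0 s \<subseteq> B'" using B' open_contains_ball by blast
  define W where "W = ball u0 s"
  have W: "open W" "convex W" "u0 \<in> W" "W \<subseteq> U" using s B' by (auto simp: W_def)
  have WU: "u \<in> U" "\<phi> u \<in> \<Omega>" "u \<in> B" "\<And>J. J \<in> multi_indices \<Longrightarrow> index_degree J = d \<Longrightarrow> \<bar>tangent u J\<bar> \<le> 2 * L"
    if "u \<in> W" for u
  proof -
    have "u \<in> B'" using that s(2) by (auto simp: W_def)
    note u = B'(3)[OF this]
    show "u \<in> U" "\<phi> u \<in> \<Omega>" "u \<in> B" using u by blast+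
    show "\<bar>tangent u J\<bar> \<le> 2 * L" if "J \<in> multi_indices" "index_degree J = d" for J
    proof -
      have "\<bar>tangent u J\<bar> < 2 * L" using u that by blast
      then show ?thesis by simp
    qed
  qed
  \<comment> \<open>Parts of \<open>S\<close> outside the chart are kept out of small balls because the chart is relatively open.\<close>
  obtain T' where T': "open T'" "\<phi> ` W = S \<inter> T'" using relatively_open_image[OF W(1,4)] .
  have "\<phi> u0 \<in> T'" using W(3) T'(2) by auto
  obtain N2 r0 where N2: "open N2" "\<phi> u0 \<in> N2" "0 < r0" "\<And>x r. x \<in> N2 \<Longrightarrow> r \<le> r0 \<Longrightarrow> hball x r \<subseteq> T'"
    using hball_neighbourhood[OF T'(1) \<open>\<phi> u0 \<in> T'\<close>] by metis
  have density: "pvector_norm g (\<phi> u) (degree_component d (tangent u)) \<le> b * (?n * (2 * L))" if u: "u \<in> W" for u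
  proof -
    have "coefficient_sum (degree_component d (tangent u)) \<le> (\<Sum>J\<in>(multi_indices :: ('p \<Rightarrow> 4) set). 2 * L)"
      unfolding coefficient_sum_def degree_component_def
      using WU(4)[OF u] L by (intro sum_mono) auto
    then have "b * coefficient_sum (degree_component d (tangent u)) \<le> b * (?n * (2 * L))"
      using b(1) by (intro mult_left_mono) auto
    with b(2)[OF WU(2)[OF u], of "degree_component d (tangent u)"] show ?thesis by linarith
  qed
  have bound: "emeasure M (hball x r) \<le> ennreal (4 * b * ?n * (2 ^ CARD('p) * k ^ d) * r ^ d)"
    if x: "x \<in> N1 \<inter> N2" and r: "0 < r" "r < r0" for x r
  proof -
    let ?D = "hball x r"
    define P where "P = U \<inter> \<phi> -` (?D \<inter> S)"
    have "?D \<subseteq> T'" using N2(4)[of x r] x r by auto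
    then have "?D \<inter> S \<subseteq> \<phi> ` W" using T'(2) by auto
    then have PW: "P = W \<inter> \<phi> -` ?D"
      using inj_phi W(4) image by (auto simp: P_def inj_on_def) blast+
    have Pb: "P \<in> sets borel" unfolding P_def using S by (intro preimage_in_borel) auto
    have PWs: "P \<subseteq> W" using PW by blast
    have inj: "inj_on (translate I x) P"
    proof (rule inj_on_subset[OF translate_inj_on PWs])
      show "convex W" "W \<subseteq> U" "0 < c" "\<And>v. c * norm v \<le> norm (translate' I ?x0 u0 v)"
        using W c by auto
      show "norm (translate' I x u v - translate' I ?x0 u0 v) \<le> c / 2 * norm v" if "u \<in> W" for u v
        using T(3)[of "(x, u)"] N1B x WU(3)[OF that] by auto
    qed
    have img: "translate I x ` P \<in> sets borel" unfolding PW by (rule translate_image_borel[OF W(1,4) closed_hball])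
    have lower: "L / 2 \<le> \<bar>coord_minor x u I\<bar>" if "u \<in> P" for u
    proof -
      have "u \<in> W" using that PWs by blast
      then have "(x, u) \<in> T" using N1B(4) x WU(3) by blast
      then show ?thesis using T(3) by fastforce
    qed
    have "ennreal (L / 2) * emeasure lborel P = (\<integral>\<^sup>+u. ennreal (L / 2) * indicator P u \<partial>lborel)"
      using Pb by (simp add: nn_integral_cmult_indicator)
    also have "\<dots> \<le> (\<integral>\<^sup>+u. ennreal (indicator P u * \<bar>coord_minor x u I\<bar>) \<partial>lborel)"
      using lower by (intro nn_integral_mono) (auto simp: indicator_def intro: ennreal_leI)
    also have "\<dots> = emeasure lborel (translate I x ` P)"
      using PWs W(4) by (intro emeasure_translate_image[symmetric] Pb img inj) auto
    also have "\<dots> \<le> emeasure lborel (anisotropic_box (\<lambda>b :: 'p. (k * r) ^ weight (I b)))"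
    proof (rule emeasure_mono)
      show "translate I x ` P \<subseteq> anisotropic_box (\<lambda>b. (k * r) ^ weight (I b))"
      proof
        fix y assume "y \<in> translate I x ` P"
        then obtain u where u: "u \<in> P" "y = translate I x u" by blast
        then have "\<rho> x (\<phi> u) \<le> r" by (simp add: P_def hball_def)
        from k(2)[OF this] show "y \<in> anisotropic_box (\<lambda>b. (k * r) ^ weight (I b))"
          by (simp add: anisotropic_box_def u(2) translate_def)
      qed
    qed (simp add: anisotropic_box_eq_cbox)
    also have "\<dots> = ennreal (2 ^ CARD('p) * (k * r) ^ d)"
      using k(1) r by (subst emeasure_anisotropic_box) (simp_all add: prod_power_weight deg)
    finally have P: "ennreal (L / 2) * emeasure lborel P \<le> ennreal (2 ^ CARD('p) * (k * r) ^ d)" .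
    have "emeasure M ?D = emeasure M (?D \<inter> S)" by (rule MS) simp
    also have "\<dots> = (\<integral>\<^sup>+u. ennreal (indicator P u * pvector_norm g (\<phi> u) (degree_component d (tangent u))) \<partial>lborel)"
      unfolding P_def using S \<open>?D \<inter> S \<subseteq> \<phi> ` W\<close> W(4) by (intro M) auto
    also have "\<dots> \<le> (\<integral>\<^sup>+u. ennreal (b * (?n * (2 * L))) * indicator P u \<partial>lborel)"
      using density PWs by (intro nn_integral_mono) (auto simp: indicator_def intro!: ennreal_leI)
    also have "\<dots> = ennreal (b * (?n * (2 * L))) * emeasure lborel P"
      using Pb by (simp add: nn_integral_cmult_indicator)
    also have "b * (?n * (2 * L)) = (4 * b * ?n) * (L / 2)" by simp
    also have "ennreal ((4 * b * ?n) * (L / 2)) * emeasure lborel P = ennreal (4 * b * ?n) * (ennreal (L / 2) * emeasure lborel P)"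
      using b L by (subst ennreal_mult) (auto simp: mult.assoc)
    also have "\<dots> \<le> ennreal (4 * b * ?n) * ennreal (2 ^ CARD('p) * (k * r) ^ d)"
      using P by (rule mult_left_mono) simp
    also have "\<dots> = ennreal (4 * b * ?n * (2 ^ CARD('p) * k ^ d) * r ^ d)"
      using b k r by (subst ennreal_mult[symmetric]) (auto simp: power_mult_distrib mult_ac)
    finally show ?thesis .
  qed
  have "open (N1 \<inter> N2)" "\<phi> u0 \<in> N1 \<inter> N2" using N1B N2 by auto
  with N2(3) bound show ?thesis by blast
qed

section \<open>Functions Lipschitz at a point\<close>

text \<open>The Lipschitz condition is anchored at \<open>a\<close>: this weaker property is closed under products and quotients
  without further bounds, and only the comparison with the value at one point is needed later.\<close>

definition lip_at :: "('a::metric_space \<Rightarrow> real) \<Rightarrow> 'a \<Rightarrow> bool" where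
  "lip_at f a \<longleftrightarrow> (\<exists>L\<ge>0. \<forall>\<^sub>F u in nhds a. \<bar>f u - f a\<bar> \<le> L * dist u a)"

lemma eventually_dist_less: "0 < e \<Longrightarrow> \<forall>\<^sub>F u in nhds a. dist u a < e"
  by (auto simp: eventually_nhds_metric)

lemma lip_at_const: "lip_at (\<lambda>_. c) a"
  unfolding lip_at_def by (intro exI[of _ 0]) auto

lemma lip_at_add: "lip_at f a \<Longrightarrow> lip_at g a \<Longrightarrow> lip_at (\<lambda>u. f u + g u) a"
  unfolding lip_at_def
proof clarify
  fix L M assume L: "0 \<le> L" "\<forall>\<^sub>F u in nhds a. \<bar>f u - f a\<bar> \<le> L * dist u a"
    and M: "0 \<le> M" "\<forall>\<^sub>F u in nhds a. \<bar>g u - g a\<bar> \<le> M * dist u a"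
  from L(2) M(2) have "\<forall>\<^sub>F u in nhds a. \<bar>f u + g u - (f a + g a)\<bar> \<le> (L + M) * dist u a"
    by eventually_elim (auto simp: algebra_simps)
  then show "\<exists>L\<ge>0. \<forall>\<^sub>F u in nhds a. \<bar>f u + g u - (f a + g a)\<bar> \<le> L * dist u a"
    using \<open>0 \<le> L\<close> \<open>0 \<le> M\<close> by (intro exI[of _ "L + M"]) auto
qed

lemma lip_at_mult: "lip_at f a \<Longrightarrow> lip_at g a \<Longrightarrow> lip_at (\<lambda>u. f u * g u) a"
  unfolding lip_at_def
proof clarify
  fix L M assume L: "0 \<le> L" "\<forall>\<^sub>F u in nhds a. \<bar>f u - f a\<bar> \<le> L * dist u a"
    and M: "0 \<le> M" "\<forall>\<^sub>F u in nhds a. \<bar>g u - g a\<bar> \<le> M * dist u a"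
  have "\<forall>\<^sub>F u in nhds a. dist u a < 1" by (rule eventually_dist_less) simp
  with L(2) M(2) have "\<forall>\<^sub>F u in nhds a. \<bar>f u * g u - f a * g a\<bar> \<le> (L * (\<bar>g a\<bar> + M) + \<bar>f a\<bar> * M) * dist u a"
  proof eventually_elim
    case (elim u)
    have "M * dist u a \<le> M * 1" using M(1) elim by (intro mult_left_mono) auto
    then have g: "\<bar>g u\<bar> \<le> \<bar>g a\<bar> + M" using elim by linarith
    have "f u * g u - f a * g a = (f u - f a) * g u + f a * (g u - g a)" by (simp add: algebra_simps)
    also have "\<bar>\<dots>\<bar> \<le> \<bar>f u - f a\<bar> * \<bar>g u\<bar> + \<bar>f a\<bar> * \<bar>g u - g a\<bar>"
      by (metis abs_mult abs_triangle_ineq)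
    also have "\<dots> \<le> (L * dist u a) * (\<bar>g a\<bar> + M) + \<bar>f a\<bar> * (M * dist u a)"
      using elim g L(1) by (intro add_mono mult_mono) auto
    finally show ?case by (simp add: algebra_simps)
  qed
  then show "\<exists>L\<ge>0. \<forall>\<^sub>F u in nhds a. \<bar>f u * g u - f a * g a\<bar> \<le> L * dist u a"
    using L(1) M(1) by (intro exI[of _ "L * (\<bar>g a\<bar> + M) + \<bar>f a\<bar> * M"]) auto
qed

lemma lip_at_inverse:
  assumes "lip_at g a" "g a \<noteq> 0"
  shows "lip_at (\<lambda>u. inverse (g u)) a"
proof -
  obtain M where M: "0 \<le> M" "\<forall>\<^sub>F u in nhds a. \<bar>g u - g a\<bar> \<le> M * dist u a"
    using assms(1) unfolding lip_at_def by blast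
  let ?e = "\<bar>g a\<bar> / (2 * (M + 1))"
  have "0 < ?e" using assms(2) M(1) by (intro divide_pos_pos) auto
  then have "\<forall>\<^sub>F u in nhds a. dist u a < ?e" by (rule eventually_dist_less)
  with M(2) have "\<forall>\<^sub>F u in nhds a. \<bar>inverse (g u) - inverse (g a)\<bar> \<le> (2 * M / (g a)\<^sup>2) * dist u a"
  proof eventually_elim
    case (elim u)
    have "M * dist u a \<le> (M + 1) * ?e" using elim M(1) by (intro mult_mono) auto
    also have "\<dots> = \<bar>g a\<bar> / 2" using M(1) by (simp add: field_simps)
    finally have gu: "\<bar>g a\<bar> / 2 \<le> \<bar>g u\<bar>" using elim(1) by linarith
    then have gu0: "g u \<noteq> 0" using assms(2) by auto
    have "inverse (g u) - inverse (g a) = (g a - g u) / (g u * g a)"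
      using gu0 assms(2) by (simp add: field_simps)
    then have "\<bar>inverse (g u) - inverse (g a)\<bar> = \<bar>g u - g a\<bar> / (\<bar>g u\<bar> * \<bar>g a\<bar>)"
      by (simp add: abs_mult abs_minus_commute)
    also have "\<dots> \<le> (M * dist u a) / (\<bar>g a\<bar> / 2 * \<bar>g a\<bar>)"
    proof (rule frac_le)
      show "0 < \<bar>g a\<bar> / 2 * \<bar>g a\<bar>" using assms(2) by (intro mult_pos_pos) auto
      show "\<bar>g a\<bar> / 2 * \<bar>g a\<bar> \<le> \<bar>g u\<bar> * \<bar>g a\<bar>" using gu by (intro mult_right_mono) auto
    qed (use elim(1) M(1) in auto)
    also have "\<dots> = (2 * M / (g a)\<^sup>2) * dist u a"
      by (simp add: power2_eq_square abs_mult[symmetric])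
    finally show ?case .
  qed
  then show ?thesis unfolding lip_at_def using M(1) by (intro exI[of _ "2 * M / (g a)\<^sup>2"]) auto
qed

lemma lip_at_sum: "(\<And>i. i \<in> I \<Longrightarrow> lip_at (f i) a) \<Longrightarrow> lip_at (\<lambda>u. \<Sum>i\<in>I. f i u) a"
  by (induction I rule: infinite_finite_induct) (auto intro: lip_at_const lip_at_add)

lemma lip_at_prod: "(\<And>i. i \<in> I \<Longrightarrow> lip_at (f i) a) \<Longrightarrow> lip_at (\<lambda>u. \<Prod>i\<in>I. f i u) a"
  by (induction I rule: infinite_finite_induct) (auto intro: lip_at_const lip_at_mult)

lemma lip_at_diff: "lip_at f a \<Longrightarrow> lip_at g a \<Longrightarrow> lip_at (\<lambda>u. f u - g u) a"
  using lip_at_add[of f a "\<lambda>u. -1 * g u"] lip_at_mult[OF lip_at_const, of g a "-1"] by simp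

lemma lip_at_divide: "lip_at f a \<Longrightarrow> lip_at (\<lambda>u. f u / c) a"
  unfolding divide_inverse by (rule lip_at_mult[OF _ lip_at_const])

context chart
begin

text \<open>This is where the derivative is required to be locally Lipschitz.\<close>

lemma lip_at_frame:
  assumes u0: "u0 \<in> U"
  shows "lip_at (\<lambda>u. frame u a $ j) u0"
proof -
  obtain e L where e: "0 < e" "L-lipschitz_on (ball u0 e \<inter> U) \<phi>'" using lipschitz[OF u0] by blast
  have L0: "0 \<le> L" using e(2) by (rule lipschitz_on_nonneg)
  have "\<forall>\<^sub>F u in nhds u0. dist u u0 < e" using e(1) by (rule eventually_dist_less)
  moreover have "\<forall>\<^sub>F u in nhds u0. u \<in> U" using openU u0 by (rule eventually_nhds_in_open)
  ultimately have "\<forall>\<^sub>F u in nhds u0. \<bar>frame u a $ j - frame u0 a $ j\<bar> \<le> L * dist u u0"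
  proof eventually_elim
    case (elim u)
    have "\<bar>frame u a $ j - frame u0 a $ j\<bar> \<le> norm ((\<phi>' u - \<phi>' u0) (axis a 1))"
      using component_le_norm_cart[of "frame u a - frame u0 a" j] by (simp add: frame_def blinfun.diff_left)
    also have "\<dots> \<le> norm (\<phi>' u - \<phi>' u0)" using norm_blinfun[of "\<phi>' u - \<phi>' u0" "axis a 1"] by simp
    also have "\<dots> \<le> L * dist u u0"
    proof -
      have "dist (\<phi>' u) (\<phi>' u0) \<le> L * dist u u0"
        using elim u0 e(1) by (intro lipschitz_onD[OF e(2)]) (auto simp: dist_commute)
      then show ?thesis by (simp add: dist_norm)
    qed
    finally show ?case .
  qed
  then show ?thesis unfolding lip_at_def using L0 by blast
qed

lemma lip_at_phi:
  assumes u0: "u0 \<in> U"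
  shows "lip_at (\<lambda>u. \<phi> u $ j) u0"
proof -
  obtain e where e: "0 < e" "\<And>u. norm (u - u0) < e \<Longrightarrow> norm (\<phi> u - \<phi> u0 - \<phi>' u0 (u - u0)) \<le> 1 * norm (u - u0)"
    using deriv[OF u0] unfolding has_derivative_at_alt by (metis zero_less_one)
  have "\<forall>\<^sub>F u in nhds u0. dist u u0 < e" using e(1) by (rule eventually_dist_less)
  then have "\<forall>\<^sub>F u in nhds u0. \<bar>\<phi> u $ j - \<phi> u0 $ j\<bar> \<le> (norm (\<phi>' u0) + 1) * dist u u0"
  proof eventually_elim
    case (elim u)
    have "\<bar>\<phi> u $ j - \<phi> u0 $ j\<bar> \<le> norm (\<phi> u - \<phi> u0)"
      using component_le_norm_cart[of "\<phi> u - \<phi> u0" j] by simp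
    also have "\<dots> \<le> norm (\<phi>' u0 (u - u0)) + norm (\<phi> u - \<phi> u0 - \<phi>' u0 (u - u0))" by norm
    also have "\<dots> \<le> norm (\<phi>' u0) * norm (u - u0) + norm (u - u0)"
      using e(2)[of u] elim norm_blinfun[of "\<phi>' u0" "u - u0"] by (simp add: dist_norm)
    finally show ?case by (simp add: dist_norm algebra_simps)
  qed
  then show ?thesis unfolding lip_at_def by (intro exI[of _ "norm (\<phi>' u0) + 1"]) auto
qed

lemma lip_at_tangent:
  assumes u0: "u0 \<in> U"
  shows "lip_at (\<lambda>u. tangent u K) u0"
proof -
  note f = lip_at_frame[OF u0] and p = lip_at_phi[OF u0]
  have e: "lip_at (\<lambda>u. engel_coord (\<phi> u) (frame u a) $ i) u0" for a i
    using exhaust_4[of i]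
    by (elim disjE; simp add: engel_coord_eq power2_eq_square;
        intro lip_at_add lip_at_diff lip_at_mult lip_at_divide lip_at_const f p)
  show ?thesis
    unfolding tangent_eq_coord_minor coord_minor_def minor_def det_def
    by (intro lip_at_sum lip_at_mult lip_at_prod lip_at_const) (simp add: e)
qed

lemma lip_at_tangent_ratio:
  assumes "u0 \<in> U" "tangent u0 I \<noteq> 0"
  shows "lip_at (\<lambda>u. tangent u K / tangent u I) u0"
  unfolding divide_inverse by (intro lip_at_mult lip_at_inverse lip_at_tangent assms)

end

section \<open>Curves in translated submanifolds\<close>

text \<open>A curve \<open>Y\<close> from the origin whose coordinates \<open>I\<close> move with constant velocity \<open>q\<close>, and whose
  velocity in the left invariant frame is determined by its coordinates \<open>I\<close> there. These are the
  lifts of segments to the translated submanifold seen as a graph over the coordinates \<open>I\<close>.\<close>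

locale lifted_segment =
  fixes Y Y' :: "real \<Rightarrow> real^4" and I :: "'p::{finite,linorder} \<Rightarrow> 4" and q :: "'p \<Rightarrow> real"
    and A :: "real \<Rightarrow> 4 \<Rightarrow> 'p \<Rightarrow> real" and \<Lambda> :: real
  assumes deriv: "\<And>t. t \<in> {0..1} \<Longrightarrow> (Y has_vector_derivative Y' t) (at t within {0..1})"
    and start: "Y 0 = 0"
    and velocity: "\<And>t b. t \<in> {0..1} \<Longrightarrow> Y' t $ I b = q b"
    and tangency: "\<And>t j. t \<in> {0..1} \<Longrightarrow>
       engel_coord (Y t) (Y' t) $ j = (\<Sum>b\<in>UNIV. A t j b * engel_coord (Y t) (Y' t) $ I b)"
    and card: "CARD('p) \<le> 4" and \<Lambda>: "1 \<le> \<Lambda>"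
    and coeff: "\<And>t j b. t \<in> {0..1} \<Longrightarrow> \<bar>A t j b\<bar> \<le> \<Lambda>"
begin

definition \<theta> :: "real \<Rightarrow> 4 \<Rightarrow> real" where "\<theta> t j = engel_coord (Y t) (Y' t) $ j"

lemma theta: "\<theta> t 1 = Y' t $ 1" "\<theta> t 2 = Y' t $ 2" "\<theta> t 3 = Y' t $ 3 - Y t $ 1 * Y' t $ 2"
  "\<theta> t 4 = Y' t $ 4 - Y t $ 1 * Y' t $ 3 + (Y t $ 1)\<^sup>2 / 2 * Y' t $ 2"
  by (simp_all add: \<theta>_def engel_coord_eq)

lemma theta_combination: "t \<in> {0..1} \<Longrightarrow> \<theta> t j = (\<Sum>b\<in>UNIV. A t j b * \<theta> t (I b))"
  using tangency by (simp add: \<theta>_def)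

lemma position_le:
  assumes t: "t \<in> {0..1}" and B: "\<And>s. s \<in> {0..1} \<Longrightarrow> \<bar>Y' s $ k\<bar> \<le> B"
  shows "\<bar>Y t $ k\<bar> \<le> B"
proof -
  have d: "((\<lambda>t. Y t $ k) has_derivative (\<lambda>h. h * Y' s $ k)) (at s within {0..1})" if "s \<in> {0..1}" for s
    using bounded_linear.has_derivative[OF bounded_linear_vec_nth deriv[OF that, unfolded has_vector_derivative_def], of k]
    by simp
  have "norm (Y t $ k - Y 0 $ k) \<le> B * norm (t - 0)"
  proof (rule differentiable_bound[of "{0..1}" "\<lambda>t. Y t $ k" "\<lambda>s h. h * Y' s $ k"])
    show "((\<lambda>t. Y t $ k) has_derivative (\<lambda>h. h * Y' s $ k)) (at s within {0..1})" if "s \<in> {0..1}" for s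
      using that by (rule d)
    show "onorm (\<lambda>h. h * Y' s $ k) \<le> B" if "s \<in> {0..1}" for s
      using B[OF that] by (intro onorm_le) (simp add: abs_mult mult.commute[of B] mult_left_mono)
  qed (use t in auto)
  also have "B * norm (t - 0) \<le> B * 1"
    using t B[OF t] by (intro mult_left_mono) auto
  finally show ?thesis using start by simp
qed

lemma combination_le:
  assumes "t \<in> {0..1}" and "\<And>b. \<bar>A t j b * \<theta> t (I b)\<bar> \<le> B"
  shows "\<bar>\<theta> t j\<bar> \<le> 4 * B"
proof -
  have "0 \<le> B" using assms(2)[of undefined] by (metis abs_ge_zero order_trans)
  have "\<bar>\<theta> t j\<bar> \<le> (\<Sum>b\<in>UNIV. \<bar>A t j b * \<theta> t (I b)\<bar>)"
    unfolding theta_combination[OF assms(1), of j] by (rule sum_abs)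
  also have "\<dots> \<le> (\<Sum>b\<in>(UNIV :: 'p set). B)" using assms(2) by (intro sum_mono)
  also have "\<dots> \<le> 4 * B" using card \<open>0 \<le> B\<close> by (simp add: mult_right_mono)
  finally show ?thesis .
qed

lemma abs_mult_le: "\<bar>a\<bar> \<le> x \<Longrightarrow> \<bar>b\<bar> \<le> y \<Longrightarrow> \<bar>a * b\<bar> \<le> x * y" for a b x y :: real
  by (simp add: abs_mult mult_mono)

lemma theta4_le:
  assumes "\<bar>Y' t $ 4\<bar> \<le> a4" "\<bar>Y t $ 1\<bar> \<le> a1" "\<bar>Y' t $ 3\<bar> \<le> a3" "\<bar>Y' t $ 2\<bar> \<le> a2"
  shows "\<bar>\<theta> t 4\<bar> \<le> a4 + a1 * a3 + a1\<^sup>2 / 2 * a2"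
proof -
  have "\<bar>(Y t $ 1)\<^sup>2\<bar> \<le> a1\<^sup>2" unfolding power2_eq_square by (rule abs_mult_le[OF assms(2,2)])
  then have "\<bar>(Y t $ 1)\<^sup>2 / 2\<bar> \<le> a1\<^sup>2 / 2" by simp
  from abs_mult_le[OF this assms(4)] abs_mult_le[OF assms(2,3)] assms(1)
  show ?thesis unfolding theta by linarith
qed

lemma velocity4_le:
  assumes "\<bar>\<theta> t 4\<bar> \<le> a4" "\<bar>Y t $ 1\<bar> \<le> a1" "\<bar>Y' t $ 3\<bar> \<le> a3" "\<bar>Y' t $ 2\<bar> \<le> a2"
  shows "\<bar>Y' t $ 4\<bar> \<le> a4 + a1 * a3 + a1\<^sup>2 / 2 * a2"
proof -
  have "\<bar>(Y t $ 1)\<^sup>2\<bar> \<le> a1\<^sup>2" unfolding power2_eq_square by (rule abs_mult_le[OF assms(2,2)])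
  then have "\<bar>(Y t $ 1)\<^sup>2 / 2\<bar> \<le> a1\<^sup>2 / 2" by simp
  from abs_mult_le[OF this assms(4)] abs_mult_le[OF assms(2,3)] assms(1)
  show ?thesis unfolding theta by linarith
qed

lemma velocity3_le:
  assumes "\<bar>\<theta> t 3\<bar> \<le> a3" "\<bar>Y t $ 1\<bar> \<le> a1" "\<bar>Y' t $ 2\<bar> \<le> a2"
  shows "\<bar>Y' t $ 3\<bar> \<le> a3 + a1 * a2"
  using abs_mult_le[OF assms(2,3)] assms(1) unfolding theta by linarith

lemma theta3_le:
  assumes "\<bar>Y' t $ 3\<bar> \<le> a3" "\<bar>Y t $ 1\<bar> \<le> a1" "\<bar>Y' t $ 2\<bar> \<le> a2"
  shows "\<bar>\<theta> t 3\<bar> \<le> a3 + a1 * a2"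
  using abs_mult_le[OF assms(2,3)] assms(1) unfolding theta by linarith

lemma \<Lambda>_pow: "m \<le> n \<Longrightarrow> \<Lambda> ^ m \<le> \<Lambda> ^ n"
  using \<Lambda> by (rule power_increasing[rotated])

text \<open>The bound \<open>\<Lambda>\<close> depends on the point, but the final constant must not, as it enters the comparison of the
  two measures. Factors that raise the weight vanish and those that keep it are at
  most 2; only factors that lower the weight are bounded by \<open>\<Lambda>\<close>. They multiply velocities of higher order
  in \<open>r\<close>, so that they are negligible when \<open>r\<close> is small in terms of \<open>\<Lambda>\<close>.\<close>

lemma maximal_degree_box:
  assumes r: "0 < r" "10948 * \<Lambda> ^ 5 * r \<le> 1"
    and q: "\<And>b. \<bar>q b\<bar> \<le> r ^ weight (I b)"
    and apriori: "\<And>t k. t \<in> {0..1} \<Longrightarrow> \<bar>Y' t $ k\<bar> \<le> \<Lambda> * r"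
    and A0: "\<And>t j b. t \<in> {0..1} \<Longrightarrow> weight (I b) < weight j \<Longrightarrow> A t j b = 0"
    and A2: "\<And>t j b. t \<in> {0..1} \<Longrightarrow> weight (I b) = weight j \<Longrightarrow> \<bar>A t j b\<bar> \<le> 2"
  shows "\<bar>Y 1 $ k\<bar> \<le> (20 * r) ^ weight k"
proof -
  have \<Lambda>0: "0 < \<Lambda>" using \<Lambda> by simp
  have p1: "1 \<le> \<Lambda> ^ n" for n using \<Lambda> by simp
  have L5: "\<Lambda> ^ n * r \<le> 1 / 10948" if "n \<le> 5" for n
  proof -
    have "\<Lambda> ^ n * r \<le> \<Lambda> ^ 5 * r" using \<Lambda>_pow[OF that] r(1) by (intro mult_right_mono) auto
    then show ?thesis using r(2) by simp
  qed
  have r1: "r \<le> 1" using L5[of 0] by simp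
  have r32: "r ^ 3 \<le> r\<^sup>2" using r1 r(1) by (intro power_decreasing) auto
  have prior: "\<bar>Y t $ k\<bar> \<le> \<Lambda> * r" if "t \<in> {0..1}" for t k
    using position_le[OF that apriori] .
  have th3: "\<bar>\<theta> t 3\<bar> \<le> 2 * \<Lambda>\<^sup>2 * r\<^sup>2" if t: "t \<in> {0..1}" "3 = I b" for t b
  proof -
    have "\<bar>Y' t $ 3\<bar> \<le> r\<^sup>2" using velocity[OF t(1), of b] q[of b] t(2) by (metis weight_simps(3))
    from theta3_le[OF this prior[OF t(1)] apriori[OF t(1)]]
    have "\<bar>\<theta> t 3\<bar> \<le> r\<^sup>2 + \<Lambda> * r * (\<Lambda> * r)" .
    moreover have "1 * r\<^sup>2 \<le> \<Lambda>\<^sup>2 * r\<^sup>2" using p1[of 2] by (intro mult_right_mono) auto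
    ultimately show ?thesis by (simp add: power2_eq_square algebra_simps)
  qed
  have v4: "\<bar>Y' t $ 4\<bar> \<le> r ^ 3" if t: "t \<in> {0..1}" "4 = I b" for t b
    using velocity[OF t(1), of b] q[of b] t(2) by (metis weight_simps(4))
  have th4: "\<bar>\<theta> t 4\<bar> \<le> 3 * \<Lambda> ^ 3 * r\<^sup>2" if t: "t \<in> {0..1}" "4 = I b" for t b
  proof -
    have "\<bar>\<theta> t 4\<bar> \<le> r ^ 3 + \<Lambda> * r * (\<Lambda> * r) + (\<Lambda> * r)\<^sup>2 / 2 * (\<Lambda> * r)"
      by (rule theta4_le[OF v4[OF t] prior[OF t(1)] apriori[OF t(1)] apriori[OF t(1)]])
    also have "\<dots> = r ^ 3 + \<Lambda>\<^sup>2 * r\<^sup>2 + \<Lambda> ^ 3 * r ^ 3 / 2" by (simp add: power2_eq_square power3_eq_cube)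
    also have "\<dots> \<le> \<Lambda> ^ 3 * r\<^sup>2 + \<Lambda> ^ 3 * r\<^sup>2 + \<Lambda> ^ 3 * r\<^sup>2"
    proof -
      have "r ^ 3 \<le> \<Lambda> ^ 3 * r\<^sup>2" using mult_mono[OF p1[of 3] r32] r(1) \<Lambda>0 by simp
      moreover have "\<Lambda>\<^sup>2 * r\<^sup>2 \<le> \<Lambda> ^ 3 * r\<^sup>2" using \<Lambda>_pow[of 2 3] by (intro mult_right_mono) auto
      moreover have "\<Lambda> ^ 3 * r ^ 3 \<le> \<Lambda> ^ 3 * r\<^sup>2" using r32 \<Lambda>0 by (intro mult_left_mono) auto
      moreover have "0 \<le> \<Lambda> ^ 3 * r ^ 3" using \<Lambda>0 r(1) by simp
      ultimately show ?thesis by linarith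
    qed
    finally show ?thesis by simp
  qed
  have step1: "\<bar>Y' t $ k\<bar> \<le> 12 * r" if t: "t \<in> {0..1}" and k: "weight k = 1" for t k
  proof (cases "k \<in> range I")
    case True
    then obtain b where "k = I b" by blast
    then show ?thesis using velocity[OF t, of b] q[of b] k r(1) by simp
  next
    case False
    have "\<bar>A t k b * \<theta> t (I b)\<bar> \<le> 3 * r" for b
    proof -
      consider "weight (I b) = 1" | "I b = 3" | "I b = 4" using exhaust_4[of "I b"] by (auto simp: weight_def)
      then show ?thesis
      proof cases
        case 1
        then have "I b = 1 \<or> I b = 2" using exhaust_4[of "I b"] by (auto simp: weight_def)
        then have "\<theta> t (I b) = q b" using velocity[OF t, of b] theta(1,2)[of t] by metis
        then have "\<bar>\<theta> t (I b)\<bar> \<le> r" using q[of b] 1 by simp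
        from abs_mult_le[OF A2[OF t, of b k] this] 1 k r(1) show ?thesis by simp
      next
        case 2
        then have "\<bar>\<theta> t (I b)\<bar> \<le> 2 * \<Lambda>\<^sup>2 * r\<^sup>2" using th3[OF t, of b] by simp
        from abs_mult_le[OF coeff[OF t] this]
        have "\<bar>A t k b * \<theta> t (I b)\<bar> \<le> 2 * (\<Lambda> ^ 3 * r) * r"
          by (simp add: power2_eq_square power3_eq_cube mult_ac)
        also have "\<dots> \<le> 2 * (1 / 10948) * r" using L5[of 3] r(1) by (intro mult_right_mono mult_left_mono) auto
        finally show ?thesis using r(1) by simp
      next
        case 3
        then have "\<bar>\<theta> t (I b)\<bar> \<le> 3 * \<Lambda> ^ 3 * r\<^sup>2" using th4[OF t, of b] by simp
        from abs_mult_le[OF coeff[OF t] this]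
        have "\<bar>A t k b * \<theta> t (I b)\<bar> \<le> 3 * (\<Lambda> ^ 4 * r) * r"
          by (simp add: power2_eq_square power3_eq_cube power4_eq_xxxx mult_ac)
        also have "\<dots> \<le> 3 * (1 / 10948) * r" using L5[of 4] r(1) by (intro mult_right_mono mult_left_mono) auto
        finally show ?thesis using r(1) by simp
      qed
    qed
    from combination_le[OF t this] have "\<bar>\<theta> t k\<bar> \<le> 12 * r" by simp
    moreover have "k = 1 \<or> k = 2" using k exhaust_4[of k] by (auto simp: weight_def)
    then have "\<theta> t k = Y' t $ k" using theta(1,2) by metis
    ultimately show ?thesis by simp
  qed
  have pos1: "\<bar>Y t $ 1\<bar> \<le> 12 * r" if "t \<in> {0..1}" for t
    using position_le[OF that step1] by simp
  have step2: "\<bar>Y' t $ 3\<bar> \<le> 145 * r\<^sup>2" if t: "t \<in> {0..1}" for t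
  proof (cases "3 \<in> range I")
    case True
    then obtain b where "3 = I b" by blast
    then have "\<bar>Y' t $ 3\<bar> \<le> r\<^sup>2" using velocity[OF t, of b] q[of b] by (metis weight_simps(3))
    then show ?thesis using zero_le_power2[of r] by linarith
  next
    case False
    have v2: "\<bar>Y' t $ 2\<bar> \<le> 12 * r" by (rule step1[OF t]) simp
    have comb: "\<bar>A t 3 b * \<theta> t (I b)\<bar> \<le> \<Lambda> * B" if B: "0 \<le> B" "4 = I b \<Longrightarrow> \<bar>\<theta> t 4\<bar> \<le> B" for b B
    proof (cases "I b = 4")
      case True
      with abs_mult_le[OF coeff[OF t], of "\<theta> t (I b)" B] B(2) show ?thesis by simp
    next
      case False
      then have "weight (I b) < weight 3"
        using exhaust_4[of "I b"] \<open>3 \<notin> range I\<close> by (auto simp: weight_def)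
      then show ?thesis using A0[OF t, of b 3] B \<Lambda>0 by simp
    qed
    \<comment> \<open>The bound for the component 4 is bootstrapped. The a priori bound of order \<open>r\<^sup>2\<close> gives the component 3
      with a constant depending on \<open>\<Lambda>\<close>; this improves the component 4 to order \<open>r ^ 3\<close>, hence its
      contribution to the component 3 to \<open>10948 * \<Lambda> ^ 5 * r ^ 3 \<le> r\<^sup>2\<close>.\<close>
    have "\<bar>\<theta> t 3\<bar> \<le> 4 * (\<Lambda> * (3 * \<Lambda> ^ 3 * r\<^sup>2))"
      by (rule combination_le[OF t comb]) (use th4[OF t] \<Lambda>0 in auto)
    then have "\<bar>\<theta> t 3\<bar> \<le> 12 * \<Lambda> ^ 4 * r\<^sup>2" by (simp add: power3_eq_cube power4_eq_xxxx mult_ac)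
    from velocity3_le[OF this pos1[OF t] v2]
    have "\<bar>Y' t $ 3\<bar> \<le> 12 * \<Lambda> ^ 4 * r\<^sup>2 + 144 * r\<^sup>2" by (simp add: power2_eq_square)
    moreover have "1 * r\<^sup>2 \<le> \<Lambda> ^ 4 * r\<^sup>2" using p1[of 4] by (intro mult_right_mono) auto
    ultimately have v3: "\<bar>Y' t $ 3\<bar> \<le> 156 * \<Lambda> ^ 4 * r\<^sup>2" by simp
    have "\<bar>\<theta> t 4\<bar> \<le> 2737 * \<Lambda> ^ 4 * r ^ 3" if "4 = I b" for b
    proof -
      have "\<bar>\<theta> t 4\<bar> \<le> r ^ 3 + 12 * r * (156 * \<Lambda> ^ 4 * r\<^sup>2) + (12 * r)\<^sup>2 / 2 * (12 * r)"
        by (rule theta4_le[OF v4[OF t that] pos1[OF t] v3 v2])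
      also have "\<dots> = 865 * r ^ 3 + 1872 * \<Lambda> ^ 4 * r ^ 3" by (simp add: power2_eq_square power3_eq_cube)
      also have "\<dots> \<le> 2737 * \<Lambda> ^ 4 * r ^ 3"
        using mult_right_mono[OF p1[of 4], of "865 * r ^ 3"] r(1) by simp
      finally show ?thesis .
    qed
    then have "\<bar>\<theta> t 3\<bar> \<le> 4 * (\<Lambda> * (2737 * \<Lambda> ^ 4 * r ^ 3))"
      by (intro combination_le[OF t comb]) (use \<Lambda>0 r(1) in auto)
    also have "\<dots> = (10948 * \<Lambda> ^ 5 * r) * r\<^sup>2" by (simp add: power2_eq_square power3_eq_cube eval_nat_numeral)
    also have "\<dots> \<le> 1 * r\<^sup>2" using r(2) by (intro mult_right_mono) auto
    finally have "\<bar>\<theta> t 3\<bar> \<le> r\<^sup>2" by simp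
    from velocity3_le[OF this pos1[OF t] v2] show ?thesis by (simp add: power2_eq_square)
  qed
  have step3: "\<bar>Y' t $ 4\<bar> \<le> 2604 * r ^ 3" if t: "t \<in> {0..1}" for t
  proof (cases "4 \<in> range I")
    case True
    then obtain b where "4 = I b" by blast
    then have "\<bar>Y' t $ 4\<bar> \<le> r ^ 3" by (rule v4[OF t])
    moreover have "0 \<le> r ^ 3" using r(1) by simp
    ultimately show ?thesis by linarith
  next
    case False
    have "A t 4 b = 0" for b
    proof (rule A0[OF t])
      have "I b \<noteq> 4" using False by (metis rangeI)
      then show "weight (I b) < weight 4" using exhaust_4[of "I b"] by (auto simp: weight_def)
    qed
    then have "\<bar>\<theta> t 4\<bar> \<le> 0" using theta_combination[OF t, of 4] by simp
    from velocity4_le[OF this pos1[OF t] step2[OF t] step1[OF t, of 2]]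
    show ?thesis by (simp add: power2_eq_square power3_eq_cube)
  qed
  have "(1::real) \<in> {0..1}" by simp
  note pos = position_le[OF this]
  have "\<bar>Y 1 $ k\<bar> \<le> 12 * r" if "weight k = 1" using pos[OF step1[OF _ that]] .
  moreover have "\<bar>Y 1 $ 3\<bar> \<le> 145 * r\<^sup>2" by (rule pos[OF step2])
  moreover have "\<bar>Y 1 $ 4\<bar> \<le> 2604 * r ^ 3" by (rule pos[OF step3])
  moreover have "0 \<le> r ^ 3" using r(1) by simp
  ultimately show ?thesis
    using exhaust_4[of k] r(1) zero_le_power2[of r] by (auto simp: power_mult_distrib)
qed

text \<open>At points of lower degree the constant may depend on the point. Factors that raise the degree vanish
  at the point, but perhaps not nearby, where they are only of order \<open>r\<close>. Multiplied by a velocity of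
  order \<open>r\<close> this suffices for the coordinate 3, which may be of order \<open>r\<^sup>2\<close>. The coordinate 4 must be of
  order \<open>r ^ 3\<close>; so it is required to be among the coordinates \<open>I\<close>, or not to be moved by the
  components of weight one.\<close>

lemma lower_degree_box:
  assumes r: "0 < r" "r \<le> 1"
    and q: "\<And>b. \<bar>q b\<bar> \<le> r ^ weight (I b)"
    and apriori: "\<And>t k. t \<in> {0..1} \<Longrightarrow> \<bar>Y' t $ k\<bar> \<le> \<Lambda> * r"
    and A3: "\<And>t b. t \<in> {0..1} \<Longrightarrow> weight (I b) = 1 \<Longrightarrow> \<bar>A t 3 b\<bar> \<le> \<Lambda> * r"
    and A4: "4 \<in> range I \<or> (\<forall>t\<in>{0..1}. \<forall>b. (weight (I b) = 1 \<longrightarrow> A t 4 b = 0) \<and> (I b = 3 \<longrightarrow> \<bar>A t 4 b\<bar> \<le> \<Lambda> * r))"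
  shows "\<bar>Y 1 $ k\<bar> \<le> (70 * \<Lambda> ^ 5 * r) ^ weight k"
proof -
  have \<Lambda>0: "0 < \<Lambda>" using \<Lambda> by simp
  have p1: "1 \<le> \<Lambda> ^ n" for n using \<Lambda> by simp
  have r32: "r ^ 3 \<le> r\<^sup>2" using r by (intro power_decreasing) auto
  have prior: "\<bar>Y t $ k\<bar> \<le> \<Lambda> * r" if "t \<in> {0..1}" for t k
    using position_le[OF that apriori] .
  have th1: "\<bar>\<theta> t j\<bar> \<le> \<Lambda> * r" if "t \<in> {0..1}" "weight j = 1" for t j
  proof -
    have "j = 1 \<or> j = 2" using that(2) exhaust_4[of j] by (auto simp: weight_def)
    then have "\<theta> t j = Y' t $ j" using theta(1,2) by metis
    then show ?thesis using apriori[OF that(1)] by simp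
  qed
  have v4: "\<bar>Y' t $ 4\<bar> \<le> r ^ 3" if t: "t \<in> {0..1}" "4 = I b" for t b
    using velocity[OF t(1), of b] q[of b] t(2) by (metis weight_simps(4))
  have th4: "\<bar>\<theta> t 4\<bar> \<le> 3 * \<Lambda> ^ 3 * r\<^sup>2" if t: "t \<in> {0..1}" "4 = I b" for t b
  proof -
    have "\<bar>\<theta> t 4\<bar> \<le> r ^ 3 + \<Lambda> * r * (\<Lambda> * r) + (\<Lambda> * r)\<^sup>2 / 2 * (\<Lambda> * r)"
      by (rule theta4_le[OF v4[OF t] prior[OF t(1)] apriori[OF t(1)] apriori[OF t(1)]])
    also have "\<dots> = r ^ 3 + \<Lambda>\<^sup>2 * r\<^sup>2 + \<Lambda> ^ 3 * r ^ 3 / 2" by (simp add: power2_eq_square power3_eq_cube)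
    also have "\<dots> \<le> \<Lambda> ^ 3 * r\<^sup>2 + \<Lambda> ^ 3 * r\<^sup>2 + \<Lambda> ^ 3 * r\<^sup>2"
    proof -
      have "r ^ 3 \<le> \<Lambda> ^ 3 * r\<^sup>2" using mult_mono[OF p1[of 3] r32] r(1) \<Lambda>0 by simp
      moreover have "\<Lambda>\<^sup>2 * r\<^sup>2 \<le> \<Lambda> ^ 3 * r\<^sup>2" using \<Lambda>_pow[of 2 3] by (intro mult_right_mono) auto
      moreover have "\<Lambda> ^ 3 * r ^ 3 \<le> \<Lambda> ^ 3 * r\<^sup>2" using r32 \<Lambda>0 by (intro mult_left_mono) auto
      moreover have "0 \<le> \<Lambda> ^ 3 * r ^ 3" using \<Lambda>0 r(1) by simp
      ultimately show ?thesis by linarith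
    qed
    finally show ?thesis by simp
  qed
  have scale: "c * \<Lambda> ^ m * r ^ l \<le> c * \<Lambda> ^ n * r ^ l" if "m \<le> n" "0 \<le> c" for c m n l
    using \<Lambda>_pow[OF that(1)] that(2) r(1) by (intro mult_right_mono mult_left_mono) auto
  have step2: "\<bar>Y' t $ 3\<bar> \<le> 13 * \<Lambda> ^ 4 * r\<^sup>2" if t: "t \<in> {0..1}" for t
  proof (cases "3 \<in> range I")
    case True
    then obtain b where "3 = I b" by blast
    then have "\<bar>Y' t $ 3\<bar> \<le> r\<^sup>2" using velocity[OF t, of b] q[of b] by (metis weight_simps(3))
    also have "\<dots> \<le> 13 * \<Lambda> ^ 0 * r\<^sup>2" by simp
    also have "\<dots> \<le> 13 * \<Lambda> ^ 4 * r\<^sup>2" by (rule scale) auto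
    finally show ?thesis .
  next
    case False
    have "\<bar>A t 3 b * \<theta> t (I b)\<bar> \<le> 3 * \<Lambda> ^ 4 * r\<^sup>2" for b
    proof (cases "I b = 4")
      case True
      then have "\<bar>\<theta> t (I b)\<bar> \<le> 3 * \<Lambda> ^ 3 * r\<^sup>2" using th4[OF t, of b] by simp
      from abs_mult_le[OF coeff[OF t] this] show ?thesis
        by (simp add: power3_eq_cube power4_eq_xxxx mult_ac)
    next
      case b: False
      then have w: "weight (I b) = 1" using exhaust_4[of "I b"] False by (auto simp: weight_def)
      from abs_mult_le[OF A3[OF t w] th1[OF t w]]
      have "\<bar>A t 3 b * \<theta> t (I b)\<bar> \<le> 1 * \<Lambda>\<^sup>2 * r\<^sup>2" by (simp add: power2_eq_square mult_ac)
      also have "\<dots> \<le> 1 * \<Lambda> ^ 4 * r\<^sup>2" by (rule scale) auto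
      also have "\<dots> \<le> 3 * \<Lambda> ^ 4 * r\<^sup>2" using \<Lambda>0 r(1) by simp
      finally show ?thesis .
    qed
    from velocity3_le[OF combination_le[OF t this] prior[OF t] apriori[OF t]]
    have "\<bar>Y' t $ 3\<bar> \<le> 12 * \<Lambda> ^ 4 * r\<^sup>2 + 1 * \<Lambda>\<^sup>2 * r\<^sup>2" by (simp add: power2_eq_square mult_ac)
    also have "\<dots> \<le> 13 * \<Lambda> ^ 4 * r\<^sup>2" using scale[of 2 4 1 2] by linarith
    finally show ?thesis .
  qed
  have step3: "\<bar>Y' t $ 4\<bar> \<le> 70 * \<Lambda> ^ 5 * r ^ 3" if t: "t \<in> {0..1}" for t
  proof (cases "4 \<in> range I")
    case True
    then obtain b where "4 = I b" by blast
    then have "\<bar>Y' t $ 4\<bar> \<le> r ^ 3" by (rule v4[OF t])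
    also have "\<dots> \<le> 70 * \<Lambda> ^ 0 * r ^ 3" using r(1) by simp
    also have "\<dots> \<le> 70 * \<Lambda> ^ 5 * r ^ 3" by (rule scale) auto
    finally show ?thesis .
  next
    case False
    have "\<bar>A t 4 b * \<theta> t (I b)\<bar> \<le> 14 * \<Lambda> ^ 5 * r ^ 3" for b
    proof (cases "I b = 3")
      case True
      have "\<bar>\<theta> t 3\<bar> \<le> 13 * \<Lambda> ^ 4 * r\<^sup>2 + \<Lambda> * r * (\<Lambda> * r)"
        by (rule theta3_le[OF step2[OF t] prior[OF t] apriori[OF t]])
      also have "\<Lambda> * r * (\<Lambda> * r) = 1 * \<Lambda>\<^sup>2 * r\<^sup>2" by (simp add: power2_eq_square)
      also have "13 * \<Lambda> ^ 4 * r\<^sup>2 + 1 * \<Lambda>\<^sup>2 * r\<^sup>2 \<le> 14 * \<Lambda> ^ 4 * r\<^sup>2" using scale[of 2 4 1 2] by linarith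
      finally have "\<bar>\<theta> t (I b)\<bar> \<le> 14 * \<Lambda> ^ 4 * r\<^sup>2" using True by simp
      moreover have "\<bar>A t 4 b\<bar> \<le> \<Lambda> * r" using A4 False t True by blast
      ultimately show ?thesis using abs_mult_le[of "A t 4 b" "\<Lambda> * r" "\<theta> t (I b)" "14 * \<Lambda> ^ 4 * r\<^sup>2"]
        by (simp add: eval_nat_numeral mult_ac)
    next
      case b: False
      have "I b \<noteq> 4" using False by (metis rangeI)
      then have "weight (I b) = 1" using exhaust_4[of "I b"] b by (auto simp: weight_def)
      then have "A t 4 b = 0" using A4 False t by blast
      then show ?thesis using \<Lambda>0 r(1) by simp
    qed
    from velocity4_le[OF combination_le[OF t this] prior[OF t] step2[OF t] apriori[OF t]]
    have "\<bar>Y' t $ 4\<bar> \<le> 4 * (14 * \<Lambda> ^ 5 * r ^ 3) + \<Lambda> * r * (13 * \<Lambda> ^ 4 * r\<^sup>2) + (\<Lambda> * r)\<^sup>2 / 2 * (\<Lambda> * r)" .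
    also have "\<dots> = 69 * \<Lambda> ^ 5 * r ^ 3 + 1 / 2 * \<Lambda> ^ 3 * r ^ 3" by (simp add: eval_nat_numeral algebra_simps)
    also have "\<dots> \<le> 70 * \<Lambda> ^ 5 * r ^ 3"
    proof -
      have "1 / 2 * \<Lambda> ^ 3 * r ^ 3 \<le> 1 / 2 * \<Lambda> ^ 5 * r ^ 3" by (rule scale) auto
      moreover have "0 \<le> \<Lambda> ^ 5 * r ^ 3" using \<Lambda>0 r(1) by simp
      ultimately show ?thesis by linarith
    qed
    finally show ?thesis .
  qed
  have "(1::real) \<in> {0..1}" by simp
  note pos = position_le[OF this]
  have w1: "\<bar>Y 1 $ k\<bar> \<le> 70 * \<Lambda> ^ 5 * r" for k
  proof -
    have "\<bar>Y 1 $ k\<bar> \<le> 1 * \<Lambda> ^ 1 * r ^ 1" using pos[OF apriori] by simp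
    also have "\<dots> \<le> 1 * \<Lambda> ^ 5 * r ^ 1" by (rule scale) auto
    also have "\<dots> \<le> 70 * \<Lambda> ^ 5 * r" using \<Lambda>0 r(1) by simp
    finally show ?thesis .
  qed
  have "\<bar>Y 1 $ 3\<bar> \<le> 13 * \<Lambda> ^ 4 * r\<^sup>2" by (rule pos[OF step2])
  also have "\<dots> \<le> 13 * \<Lambda> ^ 10 * r\<^sup>2" by (rule scale) auto
  also have "\<dots> \<le> (70 * \<Lambda> ^ 5 * r)\<^sup>2" using \<Lambda>0 r(1) by (simp add: power_mult_distrib power_mult[symmetric])
  finally have w2: "\<bar>Y 1 $ 3\<bar> \<le> (70 * \<Lambda> ^ 5 * r)\<^sup>2" .
  have "\<bar>Y 1 $ 4\<bar> \<le> 70 * \<Lambda> ^ 5 * r ^ 3" by (rule pos[OF step3])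
  also have "\<dots> \<le> 70 * \<Lambda> ^ 15 * r ^ 3" by (rule scale) auto
  also have "\<dots> \<le> (70 * \<Lambda> ^ 5 * r) ^ 3" using \<Lambda>0 r(1) by (simp add: power_mult_distrib power_mult[symmetric])
  finally have "\<bar>Y 1 $ 4\<bar> \<le> (70 * \<Lambda> ^ 5 * r) ^ 3" .
  then show ?thesis using exhaust_4[of k] w1[of k] w2 by auto
qed

text \<open>If the components of weight one move the coordinate 4 and it is not among the coordinates \<open>I\<close>, then
  the box is made thinner. For a ball of radius comparable with \<open>e\<^sup>2\<close>, let the sides of weight one have length
  \<open>e ^ 3\<close>. Velocities and Lipschitz errors are then of order \<open>e ^ 3\<close>, and their product has
  the order \<open>e ^ 6\<close> that the coordinate 4 requires.\<close>

lemma lower_degree_thin_box: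
  assumes e: "0 < e" "e \<le> 1" and I4: "4 \<notin> range I"
    and q3: "\<And>b. I b = 3 \<Longrightarrow> \<bar>q b\<bar> \<le> e ^ 4"
    and apriori: "\<And>t k. t \<in> {0..1} \<Longrightarrow> \<bar>Y' t $ k\<bar> \<le> \<Lambda> * e ^ 3"
    and A3: "\<And>t b. t \<in> {0..1} \<Longrightarrow> weight (I b) = 1 \<Longrightarrow> \<bar>A t 3 b\<bar> \<le> \<Lambda> * e ^ 3"
    and A4: "\<And>t b. t \<in> {0..1} \<Longrightarrow> \<bar>A t 4 b\<bar> \<le> \<Lambda> * e ^ 3"
  shows "\<bar>Y 1 $ k\<bar> \<le> (10 * \<Lambda> ^ 3 * e\<^sup>2) ^ weight k"
proof -
  have \<Lambda>0: "0 < \<Lambda>" using \<Lambda> by simp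
  have prior: "\<bar>Y t $ k\<bar> \<le> \<Lambda> * e ^ 3" if "t \<in> {0..1}" for t k
    using position_le[OF that apriori] .
  have epow: "e ^ m \<le> e ^ n" if "n \<le> m" for m n using e that by (intro power_decreasing) auto
  have scale: "c * \<Lambda> ^ m * e ^ k \<le> c * \<Lambda> ^ n * e ^ l" if "m \<le> n" "l \<le> k" "0 \<le> c" for c m n l k
    using \<Lambda>_pow[OF that(1)] that(3) e(1) epow[OF that(2)] \<Lambda>0 by (intro mult_mono mult_left_mono) auto
  have th: "\<bar>\<theta> t j\<bar> \<le> 2 * \<Lambda>\<^sup>2 * e ^ 3" if t: "t \<in> {0..1}" and j: "j \<noteq> 4" for t j
  proof (cases "j = 3")
    case True
    have "\<bar>\<theta> t 3\<bar> \<le> \<Lambda> * e ^ 3 + \<Lambda> * e ^ 3 * (\<Lambda> * e ^ 3)"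
      by (rule theta3_le[OF apriori[OF t] prior[OF t] apriori[OF t]])
    also have "\<dots> = 1 * \<Lambda> ^ 1 * e ^ 3 + 1 * \<Lambda>\<^sup>2 * e ^ 6" by (simp add: eval_nat_numeral algebra_simps)
    also have "\<dots> \<le> 1 * \<Lambda>\<^sup>2 * e ^ 3 + 1 * \<Lambda>\<^sup>2 * e ^ 3" by (intro add_mono scale) auto
    finally show ?thesis using True by simp
  next
    case False
    then have "j = 1 \<or> j = 2" using exhaust_4[of j] j by auto
    then have "\<theta> t j = Y' t $ j" using theta(1,2) by metis
    then have "\<bar>\<theta> t j\<bar> \<le> 1 * \<Lambda> ^ 1 * e ^ 3" using apriori[OF t] by simp
    also have "\<dots> \<le> 1 * \<Lambda>\<^sup>2 * e ^ 3" by (intro scale) auto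
    also have "\<dots> \<le> 2 * \<Lambda>\<^sup>2 * e ^ 3" using \<Lambda>0 e by simp
    finally show ?thesis .
  qed
  have step3: "\<bar>Y' t $ 3\<bar> \<le> 5 * \<Lambda>\<^sup>2 * e ^ 4" if t: "t \<in> {0..1}" for t
  proof (cases "3 \<in> range I")
    case True
    then obtain b where b: "I b = 3" by (metis rangeE)
    then have "\<bar>Y' t $ 3\<bar> \<le> 5 * \<Lambda> ^ 0 * e ^ 4" using velocity[OF t, of b] q3[OF b] e by simp
    also have "\<dots> \<le> 5 * \<Lambda>\<^sup>2 * e ^ 4" by (rule scale) auto
    finally show ?thesis .
  next
    case False
    have "\<bar>A t 3 b * \<theta> t (I b)\<bar> \<le> \<Lambda> * e ^ 3 * (\<Lambda> * e ^ 3)" for b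
    proof -
      have "I b = 1 \<or> I b = 2" using exhaust_4[of "I b"] False I4 by (metis rangeI)
      then have "weight (I b) = 1" "\<theta> t (I b) = Y' t $ I b" using theta(1,2)[of t] by auto
      then show ?thesis using abs_mult_le[OF A3[OF t, of b] apriori[OF t, of "I b"]] by simp
    qed
    from velocity3_le[OF combination_le[OF t this] prior[OF t] apriori[OF t]]
    have "\<bar>Y' t $ 3\<bar> \<le> 5 * \<Lambda>\<^sup>2 * e ^ 6" by (simp add: eval_nat_numeral algebra_simps)
    also have "\<dots> \<le> 5 * \<Lambda>\<^sup>2 * e ^ 4" by (intro scale) auto
    finally show ?thesis .
  qed
  have step4: "\<bar>Y' t $ 4\<bar> \<le> 10 * \<Lambda> ^ 3 * e ^ 6" if t: "t \<in> {0..1}" for t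
  proof -
    have "\<bar>A t 4 b * \<theta> t (I b)\<bar> \<le> \<Lambda> * e ^ 3 * (2 * \<Lambda>\<^sup>2 * e ^ 3)" for b
      using I4 by (intro abs_mult_le A4[OF t] th[OF t]) (metis rangeI)
    from velocity4_le[OF combination_le[OF t this] prior[OF t] apriori[OF t] apriori[OF t]]
    have "\<bar>Y' t $ 4\<bar> \<le> 8 * \<Lambda> ^ 3 * e ^ 6 + 1 * \<Lambda>\<^sup>2 * e ^ 6 + 1 / 2 * \<Lambda> ^ 3 * e ^ 9"
      by (simp add: eval_nat_numeral algebra_simps)
    also have "\<dots> \<le> 8 * \<Lambda> ^ 3 * e ^ 6 + 1 * \<Lambda> ^ 3 * e ^ 6 + 1 / 2 * \<Lambda> ^ 3 * e ^ 6"
      by (intro add_mono scale order_refl) auto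
    also have "\<dots> \<le> 10 * \<Lambda> ^ 3 * e ^ 6" using \<Lambda>0 e by simp
    finally show ?thesis .
  qed
  have "(1::real) \<in> {0..1}" by simp
  note pos = position_le[OF this]
  have w1: "\<bar>Y 1 $ k\<bar> \<le> 10 * \<Lambda> ^ 3 * e\<^sup>2" for k
  proof -
    have "\<bar>Y 1 $ k\<bar> \<le> 1 * \<Lambda> ^ 1 * e ^ 3" using pos[OF apriori] by simp
    also have "\<dots> \<le> 1 * \<Lambda> ^ 3 * e\<^sup>2" by (intro scale) auto
    also have "\<dots> \<le> 10 * \<Lambda> ^ 3 * e\<^sup>2" using \<Lambda>0 e by simp
    finally show ?thesis .
  qed
  have "\<bar>Y 1 $ 3\<bar> \<le> 5 * \<Lambda>\<^sup>2 * e ^ 4" by (rule pos[OF step3])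
  also have "\<dots> \<le> 5 * \<Lambda> ^ 6 * e ^ 4" by (intro scale) auto
  also have "\<dots> \<le> (10 * \<Lambda> ^ 3 * e\<^sup>2)\<^sup>2" using \<Lambda>0 e by (simp add: power_mult_distrib power_mult[symmetric])
  finally have w2: "\<bar>Y 1 $ 3\<bar> \<le> (10 * \<Lambda> ^ 3 * e\<^sup>2)\<^sup>2" .
  have "\<bar>Y 1 $ 4\<bar> \<le> 10 * \<Lambda> ^ 3 * e ^ 6" by (rule pos[OF step4])
  also have "\<dots> \<le> 10 * \<Lambda> ^ 9 * e ^ 6" by (intro scale) auto
  also have "\<dots> \<le> (10 * \<Lambda> ^ 3 * e\<^sup>2) ^ 3" using \<Lambda>0 e by (simp add: power_mult_distrib power_mult[symmetric])
  finally have "\<bar>Y 1 $ 4\<bar> \<le> (10 * \<Lambda> ^ 3 * e\<^sup>2) ^ 3" .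
  then show ?thesis using exhaust_4[of k] w1[of k] w2 by auto
qed

end

section \<open>Submanifolds as graphs over coordinates of the frame\<close>

context chart
begin

definition slope :: "real^'p::_ \<Rightarrow> ('p \<Rightarrow> 4) \<Rightarrow> ('p \<Rightarrow> 4) \<Rightarrow> real" where
  "slope u I K = tangent u K / tangent u I"

text \<open>Cramer's rule for the components of tangent vectors in the left invariant frame. The factor \<open>slope\<close>
  belongs to a multi-index whose degree differs from that of \<open>I\<close> by \<open>weight j - weight (I b)\<close>; so the degree
  of the tangent \<open>p\<close>-vector controls which components can influence which.\<close>

lemma frame_velocity_combination:
  assumes "tangent u I \<noteq> 0"
  shows "engel_coord (\<phi> u) (\<phi>' u v) $ j = (\<Sum>b\<in>UNIV. slope u I (I(b := j)) * engel_coord (\<phi> u) (\<phi>' u v) $ I b)"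
proof -
  let ?M = "\<lambda>a i. engel_coord (\<phi> u) (frame u a) $ i"
  have e: "engel_coord (\<phi> u) (\<phi>' u v) $ i = (\<Sum>a\<in>UNIV. v $ a * ?M a i)" for i
    by (simp add: phi'_expansion linear_sum[OF engel_coord_linear] linear_cmul[OF engel_coord_linear] sum_component)
  have t: "tangent u K = minor ?M K" for K by (simp add: tangent_def wedge_minor)
  have "minor ?M I \<noteq> 0" using assms t by simp
  then have M: "?M a j = (\<Sum>b\<in>UNIV. slope u I (I(b := j)) * ?M a (I b))" for a
    unfolding slope_def t by (rule minor_cramer)
  have "engel_coord (\<phi> u) (\<phi>' u v) $ j = (\<Sum>a\<in>UNIV. \<Sum>b\<in>UNIV. slope u I (I(b := j)) * (v $ a * ?M a (I b)))"
    unfolding e by (subst M) (simp add: sum_distrib_left mult_ac)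
  also have "\<dots> = (\<Sum>b\<in>UNIV. slope u I (I(b := j)) * (\<Sum>a\<in>UNIV. v $ a * ?M a (I b)))"
    by (subst sum.swap) (simp add: sum_distrib_left)
  finally show ?thesis unfolding e .
qed

text \<open>Local inverses \<open>G\<close> of \<open>translate I (\<phi> u0)\<close> on a ball of radius \<open>\<delta>\<close>, with derivative \<open>G'\<close>: they
  parametrize the submanifold near \<open>\<phi> u0\<close> by the coordinates \<open>I\<close> of its translate. The number \<open>\<Lambda>\<close> bounds
  velocities, slopes and the Lipschitz constants of the slopes at the base point, and the last
  conjunct bounds the Jacobian from above.\<close>

definition adapted where
  "adapted u0 W I \<delta> \<Lambda> G G' \<longleftrightarrow> 0 < \<delta> \<and> 1 \<le> \<Lambda> \<and> G 0 = u0 \<and>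
    (\<forall>q\<in>ball 0 \<delta>. G q \<in> W \<and> \<bar>tangent u0 I\<bar> / 2 \<le> \<bar>tangent (G q) I\<bar> \<and>
       (G has_derivative G' q) (at q) \<and>
       (\<forall>v. translate' I (\<phi> u0) (G q) (G' q v) = v) \<and>
       (\<forall>v k. \<bar>engel_coord (\<phi> u0) (\<phi>' (G q) (G' q v)) $ k\<bar> \<le> \<Lambda> * norm v) \<and>
       (\<forall>K. \<bar>slope (G q) I K - slope u0 I K\<bar> \<le> \<Lambda> * norm q) \<and>
       (\<forall>K. \<bar>slope (G q) I K\<bar> \<le> \<Lambda>)) \<and>
    (\<forall>Q. compact Q \<longrightarrow> Q \<subseteq> ball 0 \<delta> \<longrightarrow> compact (G ` Q) \<and>
       emeasure lborel Q \<le> ennreal (2 * \<bar>tangent u0 I\<bar>) * emeasure lborel (G ` Q))"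

text \<open>The coefficient \<open>I\<close> of the tangent \<open>p\<close>-vector at \<open>u0\<close> is the Jacobian of \<open>translate I (\<phi> u0)\<close> there,
  so that the inverse function theorem applies. The Lipschitz bound of the slopes comes from \<open>lip_at_tangent_ratio\<close>.\<close>

lemma adapted_parametrization:
  fixes I :: "'p \<Rightarrow> 4"
  assumes u0: "u0 \<in> U" and nz: "tangent u0 I \<noteq> 0" and W: "open W" "u0 \<in> W" "W \<subseteq> U"
  shows "\<exists>\<delta> \<Lambda> G G'. adapted u0 W I \<delta> \<Lambda> G G'"
proof -
  define x0 where "x0 = \<phi> u0"
  define L where "L = \<bar>tangent u0 I\<bar>"
  have L: "0 < L" using nz by (simp add: L_def)
  have nz': "coord_minor x0 u0 I \<noteq> 0" using nz by (simp add: tangent_eq_coord_minor x0_def)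
  obtain c where c: "0 < c" "\<And>v. c * norm v \<le> norm (translate' I x0 u0 v)"
    using translate'_lower_bound[OF nz'] by blast
  have c2: "0 < c / 2" using c(1) by simp
  have lim: "filterlim (\<lambda>u. (x0, u)) (nhds (x0, u0)) (nhds u0)"
    by (intro tendsto_Pair tendsto_const filterlim_ident)
  have e1: "\<forall>\<^sub>F u in nhds u0. \<forall>v. norm (translate' I x0 u v - translate' I x0 u0 v) \<le> c / 2 * norm v"
    using eventually_compose_filterlim[OF translate'_uniformly_close[OF u0 c2] lim] by simp
  have "((\<lambda>u. coord_minor x0 u I) \<longlongrightarrow> coord_minor x0 u0 I) (nhds u0)"
    using filterlim_compose[OF tendsto_coord_minor[OF u0] lim] by simp
  then have "((\<lambda>u. \<bar>coord_minor x0 u I\<bar>) \<longlongrightarrow> L) (nhds u0)"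
    unfolding L_def tangent_eq_coord_minor x0_def by (rule tendsto_rabs)
  then have e2: "\<forall>\<^sub>F u in nhds u0. \<bar>coord_minor x0 u I\<bar> < 2 * L"
    using L by (intro order_tendstoD) auto
  have "isCont (\<lambda>u. \<bar>tangent u I\<bar>) u0"
    using cont_tangent openU u0 by (intro continuous_intros) (simp add: continuous_on_eq_continuous_at)
  then have "((\<lambda>u. \<bar>tangent u I\<bar>) \<longlongrightarrow> L) (nhds u0)"
    unfolding L_def isCont_def by (rule tendsto_at_iff_tendsto_nhds[THEN iffD1])
  then have e3: "\<forall>\<^sub>F u in nhds u0. L / 2 < \<bar>tangent u I\<bar>"
    using L by (intro order_tendstoD) auto
  have "isCont (\<lambda>u. norm (\<phi>' u)) u0"
    using cont_phi' openU u0 by (intro continuous_intros) (simp add: continuous_on_eq_continuous_at)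
  then have "((\<lambda>u. norm (\<phi>' u)) \<longlongrightarrow> norm (\<phi>' u0)) (nhds u0)"
    unfolding isCont_def by (rule tendsto_at_iff_tendsto_nhds[THEN iffD1])
  then have e4: "\<forall>\<^sub>F u in nhds u0. norm (\<phi>' u) < norm (\<phi>' u0) + 1"
    by (rule order_tendstoD) simp
  have "\<forall>K. \<exists>l\<ge>0. \<forall>\<^sub>F u in nhds u0. \<bar>slope u I K - slope u0 I K\<bar> \<le> l * dist u u0"
    using lip_at_tangent_ratio[OF u0 nz] unfolding lip_at_def slope_def by blast
  from choice[OF this] obtain l where l: "\<And>K. 0 \<le> l K"
    "\<And>K. \<forall>\<^sub>F u in nhds u0. \<bar>slope u I K - slope u0 I K\<bar> \<le> l K * dist u u0" by blast
  define \<l> where "\<l> = (\<Sum>K\<in>UNIV. l K)"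
  have l0: "0 \<le> \<l>" unfolding \<l>_def using l(1) by (simp add: sum_nonneg)
  have "\<forall>\<^sub>F u in nhds u0. \<forall>K. \<bar>slope u I K - slope u0 I K\<bar> \<le> l K * dist u u0"
    by (intro eventually_all_finite l(2))
  then have e5: "\<forall>\<^sub>F u in nhds u0. \<forall>K. \<bar>slope u I K - slope u0 I K\<bar> \<le> \<l> * dist u u0"
  proof eventually_elim
    case (elim u)
    have "l K * dist u u0 \<le> \<l> * dist u u0" for K
      unfolding \<l>_def using l(1) by (intro mult_right_mono member_le_sum) auto
    with elim show ?case by (meson order_trans)
  qed
  have e6: "\<forall>\<^sub>F u in nhds u0. u \<in> W" using W by (intro eventually_nhds_in_open)
  have "\<forall>\<^sub>F u in nhds u0. u \<in> W \<and> L / 2 < \<bar>tangent u I\<bar> \<and> \<bar>coord_minor x0 u I\<bar> < 2 * L \<and>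
      norm (\<phi>' u) < norm (\<phi>' u0) + 1 \<and> (\<forall>K. \<bar>slope u I K - slope u0 I K\<bar> \<le> \<l> * dist u u0) \<and>
      (\<forall>v. norm (translate' I x0 u v - translate' I x0 u0 v) \<le> c / 2 * norm v)"
    using e6 e3 e2 e4 e5 e1 by eventually_elim blast
  then obtain W1 where W1: "open W1" "u0 \<in> W1" and W1P: "\<And>u. u \<in> W1 \<Longrightarrow> u \<in> W \<and> L / 2 < \<bar>tangent u I\<bar> \<and>
      \<bar>coord_minor x0 u I\<bar> < 2 * L \<and> norm (\<phi>' u) < norm (\<phi>' u0) + 1 \<and>
      (\<forall>K. \<bar>slope u I K - slope u0 I K\<bar> \<le> \<l> * dist u u0) \<and>
      (\<forall>v. norm (translate' I x0 u v - translate' I x0 u0 v) \<le> c / 2 * norm v)"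
    unfolding eventually_nhds by auto
  have W1U: "W1 \<subseteq> U" using W1P W(3) by blast
  define P :: "(real^4) \<Rightarrow>\<^sub>L (real^'p::_)" where "P = Blinfun (\<lambda>v. project I (engel_coord x0 v))"
  have P: "blinfun_apply P v = project I (engel_coord x0 v)" for v
    unfolding P_def using linear_project_coord
    by (subst bounded_linear_Blinfun_apply) (auto simp: linear_conv_bounded_linear)
  have F': "blinfun_apply (P o\<^sub>L \<phi>' u) = translate' I x0 u" for u
    by (rule ext) (simp add: P translate'_def)
  have "inj (translate' I x0 u0)"
    using nz' det_translate'[of I x0 u0] translate'_linear[of I x0 u0] det_nz_iff_inj by metis
  then obtain B where B: "linear B" "B \<circ> translate' I x0 u0 = id"
    using linear_injective_left_inverse[OF translate'_linear] by blast
  have "blinfun_apply (Blinfun B o\<^sub>L (P o\<^sub>L \<phi>' u0)) = blinfun_apply id_blinfun"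
  proof (rule ext)
    fix v
    have "blinfun_apply (Blinfun B) w = B w" for w
      using B(1) by (subst bounded_linear_Blinfun_apply) (auto simp: linear_conv_bounded_linear)
    then have "blinfun_apply (Blinfun B o\<^sub>L (P o\<^sub>L \<phi>' u0)) v = B (translate' I x0 u0 v)"
      by (simp add: F'[symmetric])
    also have "\<dots> = v" using B(2) by (metis comp_apply id_apply)
    finally show "blinfun_apply (Blinfun B o\<^sub>L (P o\<^sub>L \<phi>' u0)) v = blinfun_apply id_blinfun v" by simp
  qed
  then have inv: "Blinfun B o\<^sub>L (P o\<^sub>L \<phi>' u0) = id_blinfun" by (rule blinfun_apply_inject[THEN iffD1])
  have contF': "continuous_on W1 (\<lambda>u. P o\<^sub>L \<phi>' u)"
    by (intro bounded_bilinear.continuous_on[OF bounded_bilinear_blinfun_compose] continuous_on_const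
        continuous_on_subset[OF cont_phi' W1U])
  have derF: "(translate I x0 has_derivative blinfun_apply (P o\<^sub>L \<phi>' u)) (at u)" if "u \<in> W1" for u
    unfolding F' using that W1U by (intro translate_has_derivative) auto
  obtain U' V' G G' where G: "open U'" "U' \<subseteq> W1" "u0 \<in> U'" "open V'" "translate I x0 u0 \<in> V'"
    "homeomorphism U' V' (translate I x0) G"
    "\<And>q. q \<in> V' \<Longrightarrow> (G has_derivative G' q) (at q)"
    "\<And>q. q \<in> V' \<Longrightarrow> G' q = inv (blinfun_apply (P o\<^sub>L \<phi>' (G q)))"
    "\<And>q. q \<in> V' \<Longrightarrow> bij (blinfun_apply (P o\<^sub>L \<phi>' (G q)))"
    using inverse_function_theorem[OF W1(1) derF contF' W1(2) inv] by metis
  have F0: "translate I x0 u0 = 0" by (simp add: translate_def x0_def engel_coord_0 vec_eq_iff)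
  have GV: "G q \<in> U'" "translate I x0 (G q) = q" if "q \<in> V'" for q
    using G(6) that by (auto simp: homeomorphism_def)
  have G0: "G 0 = u0" using G(6) G(3) F0 by (metis homeomorphism_apply1)
  have contG: "continuous_on V' G" using G(6) by (simp add: homeomorphism_def)
  obtain \<delta>0 where \<delta>0: "0 < \<delta>0" "ball 0 \<delta>0 \<subseteq> V'" using G(4,5) F0 open_contains_ball by metis
  define \<delta> where "\<delta> = min \<delta>0 1"
  have \<delta>: "0 < \<delta>" "\<delta> \<le> 1" "ball 0 \<delta> \<subseteq> V'" using \<delta>0 by (auto simp: \<delta>_def)
  have right_inverse: "translate' I x0 (G q) (G' q v) = v" if "q \<in> V'" for q v
    using G(8,9)[OF that] by (simp add: F' bij_is_surj surj_f_inv_f)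
  have G'_le: "norm (G' q v) \<le> 2 / c * norm v" if q: "q \<in> V'" for q v
  proof -
    have "G q \<in> W1" using GV(1)[OF q] G(2) by blast
    then have "c / 2 * norm (G' q v) \<le> norm (translate' I x0 (G q) (G' q v))"
      using W1P by (intro linear_lower_bound_perturbation[OF c(2)]) blast
    then show ?thesis using right_inverse[OF q] c(1) by (simp add: field_simps)
  qed
  have G_le: "dist (G q) u0 \<le> 2 / c * norm q" if q: "q \<in> ball 0 \<delta>" for q
  proof -
    have "norm (G q - G 0) \<le> 2 / c * norm (q - 0)"
    proof (rule differentiable_bound[of "ball 0 \<delta>" G G'])
      show "(G has_derivative G' x) (at x within ball 0 \<delta>)" if "x \<in> ball 0 \<delta>" for x
      proof -
        have "x \<in> V'" using that \<delta>(3) by blast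
        then show ?thesis by (rule has_derivative_at_withinI[OF G(7)])
      qed
      show "onorm (G' x) \<le> 2 / c" if "x \<in> ball 0 \<delta>" for x
      proof (rule onorm_le)
        have "x \<in> V'" using that \<delta>(3) by blast
        then show "norm (G' x v) \<le> 2 / c * norm v" for v by (rule G'_le)
      qed
    qed (use q \<delta> in auto)
    then show ?thesis by (simp add: G0 dist_norm)
  qed
  have "bounded_linear (engel_coord x0)" using engel_coord_linear by (simp add: linear_conv_bounded_linear)
  then obtain e where e: "0 < e" "\<And>v. norm (engel_coord x0 v) \<le> norm v * e"
    using bounded_linear.pos_bounded by blast
  define N where "N = norm (\<phi>' u0) + 1"
  have N: "0 < N" by (simp add: N_def add_nonneg_pos)
  define R where "R = (\<Sum>K\<in>UNIV. \<bar>slope u0 I K\<bar>)"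
  have R: "\<bar>slope u0 I K\<bar> \<le> R" for K unfolding R_def by (rule member_le_sum) auto
  have R0: "0 \<le> R" unfolding R_def by (simp add: sum_nonneg)
  define \<Lambda> where "\<Lambda> = 1 + e * N * (2 / c) + \<l> * (2 / c) + R"
  have pos: "0 \<le> e * N * (2 / c)" "0 \<le> \<l> * (2 / c)" using e N c l0 by auto
  have \<Lambda>: "1 \<le> \<Lambda>" "e * N * (2 / c) \<le> \<Lambda>" "\<l> * (2 / c) \<le> \<Lambda>" "\<l> * (2 / c) + R \<le> \<Lambda>"
    using pos R0 by (auto simp: \<Lambda>_def)
  have pt: "G q \<in> W \<and> \<bar>tangent u0 I\<bar> / 2 \<le> \<bar>tangent (G q) I\<bar> \<and>
       (G has_derivative G' q) (at q) \<and>
       (\<forall>v. translate' I (\<phi> u0) (G q) (G' q v) = v) \<and>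
       (\<forall>v k. \<bar>engel_coord (\<phi> u0) (\<phi>' (G q) (G' q v)) $ k\<bar> \<le> \<Lambda> * norm v) \<and>
       (\<forall>K. \<bar>slope (G q) I K - slope u0 I K\<bar> \<le> \<Lambda> * norm q) \<and>
       (\<forall>K. \<bar>slope (G q) I K\<bar> \<le> \<Lambda>)" if q: "q \<in> ball 0 \<delta>" for q
  proof (intro conjI allI)
    have qV: "q \<in> V'" using q \<delta>(3) by blast
    have "G q \<in> W1" using GV(1)[OF qV] G(2) by blast
    note Gq = W1P[OF this]
    show "G q \<in> W" using Gq by blast
    show "\<bar>tangent u0 I\<bar> / 2 \<le> \<bar>tangent (G q) I\<bar>" using Gq by (simp add: L_def)
    show "(G has_derivative G' q) (at q)" by (rule G(7)[OF qV])
    show "translate' I (\<phi> u0) (G q) (G' q v) = v" for v using right_inverse[OF qV] by (simp add: x0_def)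
    show "\<bar>engel_coord (\<phi> u0) (\<phi>' (G q) (G' q v)) $ k\<bar> \<le> \<Lambda> * norm v" for v k
    proof -
      have "\<bar>engel_coord x0 (\<phi>' (G q) (G' q v)) $ k\<bar> \<le> norm (engel_coord x0 (\<phi>' (G q) (G' q v)))"
        by (rule component_le_norm_cart)
      also have "\<dots> \<le> norm (\<phi>' (G q) (G' q v)) * e" by (rule e)
      also have "\<dots> \<le> (norm (\<phi>' (G q)) * norm (G' q v)) * e"
        using e(1) by (intro mult_right_mono norm_blinfun) auto
      also have "\<dots> \<le> (N * (2 / c * norm v)) * e"
        using e(1) Gq G'_le[OF qV, of v] N by (intro mult_right_mono mult_mono) (auto simp: N_def)
      also have "\<dots> = (e * N * (2 / c)) * norm v" by simp
      also have "\<dots> \<le> \<Lambda> * norm v" using \<Lambda>(2) by (rule mult_right_mono) simp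
      finally show ?thesis by (simp add: x0_def)
    qed
    have sl: "\<bar>slope (G q) I K - slope u0 I K\<bar> \<le> (\<l> * (2 / c)) * norm q" for K
    proof -
      have "\<bar>slope (G q) I K - slope u0 I K\<bar> \<le> \<l> * dist (G q) u0" using Gq by blast
      also have "\<dots> \<le> \<l> * (2 / c * norm q)" using G_le[OF q] l0 by (rule mult_left_mono)
      finally show ?thesis by (simp add: mult.assoc)
    qed
    then show "\<bar>slope (G q) I K - slope u0 I K\<bar> \<le> \<Lambda> * norm q" for K
      using mult_right_mono[OF \<Lambda>(3) norm_ge_zero[of q]] order_trans by blast
    show "\<bar>slope (G q) I K\<bar> \<le> \<Lambda>" for K
    proof -
      have "(\<l> * (2 / c)) * norm q \<le> (\<l> * (2 / c)) * 1"
        using q \<delta>(2) pos(2) by (intro mult_left_mono) auto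
      then show ?thesis using sl[of K] R[of K] \<Lambda>(4) by linarith
    qed
  qed
  have vol: "compact (G ` Q) \<and> emeasure lborel Q \<le> ennreal (2 * L) * emeasure lborel (G ` Q)"
    if Q: "compact Q" "Q \<subseteq> ball 0 \<delta>" for Q
  proof -
    have QV: "Q \<subseteq> V'" using Q(2) \<delta>(3) by blast
    have cG: "compact (G ` Q)" using QV Q(1) by (intro compact_continuous_image continuous_on_subset[OF contG])
    have GW1: "G ` Q \<subseteq> W1" using QV GV(1) G(2) by blast
    have FQ: "translate I x0 ` (G ` Q) = Q" using QV GV(2) by force
    have inj: "inj_on (translate I x0) (G ` Q)"
      using QV GV(2) by (auto simp: inj_on_def subset_iff)
    have Gb: "G ` Q \<in> sets borel" using cG by (intro borel_closed compact_imp_closed)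
    have Qb: "Q \<in> sets borel" using Q(1) by (intro borel_closed compact_imp_closed)
    have "emeasure lborel Q = (\<integral>\<^sup>+u. ennreal (indicator (G ` Q) u * \<bar>coord_minor x0 u I\<bar>) \<partial>lborel)"
      using emeasure_translate_image[OF Gb _ _ inj] GW1 W1U Qb FQ by auto
    also have "\<dots> \<le> (\<integral>\<^sup>+u. ennreal (2 * L) * indicator (G ` Q) u \<partial>lborel)"
      using GW1 W1P L by (intro nn_integral_mono) (auto simp: indicator_def subset_iff intro!: ennreal_leI less_imp_le)
    also have "\<dots> = ennreal (2 * L) * emeasure lborel (G ` Q)" using Gb by (simp add: nn_integral_cmult_indicator)
    finally show ?thesis using cG by blast
  qed
  show ?thesis
    using \<delta>(1) \<Lambda>(1) G0 pt vol unfolding L_def adapted_def by blast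
qed

text \<open>Left translation takes the frame at \<open>\<phi> u0\<close> to the one at the origin, so that lifts can be
  studied as curves from the origin.\<close>

lemma lifted_segment_of_parametrization:
  assumes G: "\<And>q. q \<in> ball 0 \<delta> \<Longrightarrow> G q \<in> U \<and> tangent (G q) I \<noteq> 0 \<and>
       (G has_derivative G' q) (at q) \<and>
       (\<forall>v. translate' I (\<phi> u0) (G q) (G' q v) = v) \<and> (\<forall>K. \<bar>slope (G q) I K\<bar> \<le> \<Lambda>)"
    and G0: "G 0 = u0" and q: "q \<in> ball 0 \<delta>" and card: "CARD('p) \<le> 4" and \<Lambda>: "1 \<le> \<Lambda>"
  shows "lifted_segment (\<lambda>t. engel_coord (\<phi> u0) (\<phi> (G (t *\<^sub>R q)) - \<phi> u0))
     (\<lambda>t. engel_coord (\<phi> u0) (\<phi>' (G (t *\<^sub>R q)) (G' (t *\<^sub>R q) q))) I (($) q)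
     (\<lambda>t j b. slope (G (t *\<^sub>R q)) I (I(b := j))) \<Lambda>"
proof
  fix t :: real assume t: "t \<in> {0..1}"
  have "norm (t *\<^sub>R q) \<le> 1 * norm q" using t by (simp add: mult_left_le_one_le)
  then have tq: "t *\<^sub>R q \<in> ball 0 \<delta>" using q by simp
  note Gt = G[OF tq]
  let ?u = "G (t *\<^sub>R q)"
  have "((\<lambda>t. t *\<^sub>R q) has_derivative (\<lambda>h. h *\<^sub>R q)) (at t)" by (auto intro!: derivative_eq_intros)
  from diff_chain_at[OF this, of G "G' (t *\<^sub>R q)"]
  have d1: "((\<lambda>t. G (t *\<^sub>R q)) has_derivative (\<lambda>h. G' (t *\<^sub>R q) (h *\<^sub>R q))) (at t)"
    using Gt by (simp add: o_def)
  have "(\<phi> has_derivative \<phi>' ?u) (at ?u)" using Gt by (intro deriv) blast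
  from diff_chain_at[OF d1 this]
  have "((\<lambda>t. \<phi> (G (t *\<^sub>R q))) has_derivative (\<lambda>h. \<phi>' ?u (G' (t *\<^sub>R q) (h *\<^sub>R q)))) (at t)"
    by (simp add: o_def)
  from has_derivative_diff[OF this has_derivative_const[of "\<phi> u0"]]
  have d2: "((\<lambda>t. \<phi> (G (t *\<^sub>R q)) - \<phi> u0) has_derivative (\<lambda>h. \<phi>' ?u (G' (t *\<^sub>R q) (h *\<^sub>R q)))) (at t)"
    by simp
  have "bounded_linear (engel_coord (\<phi> u0))" using engel_coord_linear by (simp add: linear_conv_bounded_linear)
  from bounded_linear.has_derivative[OF this d2]
  have d3: "((\<lambda>t. engel_coord (\<phi> u0) (\<phi> (G (t *\<^sub>R q)) - \<phi> u0)) has_derivative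
      (\<lambda>h. engel_coord (\<phi> u0) (\<phi>' ?u (G' (t *\<^sub>R q) (h *\<^sub>R q))))) (at t)" .
  have lG: "linear (G' (t *\<^sub>R q))" using Gt has_derivative_linear by blast
  have "(\<lambda>h. engel_coord (\<phi> u0) (\<phi>' ?u (G' (t *\<^sub>R q) (h *\<^sub>R q)))) =
      (\<lambda>h. h *\<^sub>R engel_coord (\<phi> u0) (\<phi>' ?u (G' (t *\<^sub>R q) q)))"
    by (simp add: linear_cmul[OF lG] linear_cmul[OF engel_coord_linear] blinfun.scaleR_right)
  with d3 show "((\<lambda>t. engel_coord (\<phi> u0) (\<phi> (G (t *\<^sub>R q)) - \<phi> u0)) has_vector_derivative
      engel_coord (\<phi> u0) (\<phi>' ?u (G' (t *\<^sub>R q) q))) (at t within {0..1})"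
    unfolding has_vector_derivative_def by (simp add: has_derivative_at_withinI)
  show "engel_coord (\<phi> u0) (\<phi>' ?u (G' (t *\<^sub>R q) q)) $ I b = q $ b" for b
  proof -
    have "translate' I (\<phi> u0) ?u (G' (t *\<^sub>R q) q) = q" using Gt by blast
    then show ?thesis unfolding translate'_def by (metis project_nth)
  qed
  show "engel_coord (engel_coord (\<phi> u0) (\<phi> ?u - \<phi> u0)) (engel_coord (\<phi> u0) (\<phi>' ?u (G' (t *\<^sub>R q) q))) $ j =
      (\<Sum>b\<in>UNIV. slope ?u I (I(b := j)) * engel_coord (engel_coord (\<phi> u0) (\<phi> ?u - \<phi> u0))
        (engel_coord (\<phi> u0) (\<phi>' ?u (G' (t *\<^sub>R q) q))) $ I b)" for j
    unfolding engel_coord_coord using Gt by (intro frame_velocity_combination) blast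
  show "\<bar>slope ?u I (I(b := j))\<bar> \<le> \<Lambda>" for j b using Gt by blast
next
  show "engel_coord (\<phi> u0) (\<phi> (G (0 *\<^sub>R q)) - \<phi> u0) = 0" by (simp add: G0 engel_coord_0)
qed (use card \<Lambda> in auto)

end

section \<open>Lower density\<close>

lemma index_degree_permute:
  assumes "\<sigma> permutes UNIV"
  shows "index_degree (J \<circ> \<sigma>) = index_degree J"
  unfolding index_degree_def using sum.permute[OF assms, of "\<lambda>a. weight (J a)"] by (simp add: o_def)

lemma index_degree_update: "index_degree (I(b := j)) + weight (I b) = index_degree I + weight j"
  unfolding index_degree_def by (simp add: sum.remove[of UNIV b])

lemma norm_le_of_components:
  fixes q :: "real^'p"
  assumes card: "CARD('p) \<le> 4" and q: "\<And>b. \<bar>q $ b\<bar> \<le> B" and B: "0 \<le> B"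
  shows "norm q \<le> 4 * B"
proof -
  have "norm q \<le> (\<Sum>b\<in>UNIV. \<bar>q $ b\<bar>)" by (rule norm_le_l1_cart)
  also have "\<dots> \<le> (\<Sum>b\<in>(UNIV :: 'p set). B)" using q by (intro sum_mono)
  also have "\<dots> \<le> 4 * B" using card B by (simp add: mult_right_mono)
  finally show ?thesis .
qed

lemma ennreal_mult_le_cancel:
  assumes "0 < c" "ennreal c * a \<le> ennreal c * b"
  shows "a \<le> b"
proof -
  have "ennreal (1 / c) * (ennreal c * a) \<le> ennreal (1 / c) * (ennreal c * b)"
    using assms(2) by (rule mult_left_mono) simp
  then show ?thesis using assms(1) by (simp add: mult.assoc[symmetric] flip: ennreal_mult)
qed

context chart
begin

lemma tangent_sorted:
  assumes "tangent u K \<noteq> 0"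
  obtains J where "J \<in> multi_indices" "index_degree J = index_degree K" "\<bar>tangent u K\<bar> = \<bar>tangent u J\<bar>"
proof -
  have "minor (\<lambda>a i. engel_coord (\<phi> u) (frame u a) $ i) K \<noteq> 0"
    using assms by (simp add: tangent_def wedge_minor)
  then obtain J \<sigma> where J: "strict_mono J" "\<sigma> permutes UNIV" "K = J \<circ> \<sigma>"
    "\<bar>minor (\<lambda>a i. engel_coord (\<phi> u) (frame u a) $ i) K\<bar> = \<bar>minor (\<lambda>a i. engel_coord (\<phi> u) (frame u a) $ i) J\<bar>"
    by (rule minor_sorted)
  with that[of J] show thesis
    by (simp add: multi_indices_def index_degree_permute tangent_def wedge_minor)
qed

text \<open>Slopes of high degree vanish also for unsorted multi-indices, since sorting changes neither the degree
  nor the absolute value of the coefficient.\<close>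

lemma slope_vanishes:
  assumes "\<And>J. J \<in> multi_indices \<Longrightarrow> n < index_degree J \<Longrightarrow> tangent u J = 0" and "n < index_degree K"
  shows "slope u I K = 0"
proof (rule ccontr)
  assume "slope u I K \<noteq> 0"
  then have "tangent u K \<noteq> 0" by (auto simp: slope_def)
  then obtain J where "J \<in> multi_indices" "index_degree J = index_degree K" "\<bar>tangent u K\<bar> = \<bar>tangent u J\<bar>"
    by (rule tangent_sorted)
  with assms \<open>tangent u K \<noteq> 0\<close> show False by auto
qed

lemma adapted_segment:
  assumes ad: "adapted u0 W I \<delta> \<Lambda> G G'" and W: "W \<subseteq> U" and nz: "tangent u0 I \<noteq> 0"
    and card: "CARD('p) \<le> 4" and q: "q \<in> ball 0 \<delta>" and B: "0 \<le> B" "\<And>b. \<bar>q $ b\<bar> \<le> B"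
  shows "lifted_segment (\<lambda>t. engel_coord (\<phi> u0) (\<phi> (G (t *\<^sub>R q)) - \<phi> u0))
     (\<lambda>t. engel_coord (\<phi> u0) (\<phi>' (G (t *\<^sub>R q)) (G' (t *\<^sub>R q) q))) I (($) q)
     (\<lambda>t j b. slope (G (t *\<^sub>R q)) I (I(b := j))) (4 * \<Lambda>)"
    and "\<And>t k. t \<in> {0..1} \<Longrightarrow> \<bar>engel_coord (\<phi> u0) (\<phi>' (G (t *\<^sub>R q)) (G' (t *\<^sub>R q) q)) $ k\<bar> \<le> 4 * \<Lambda> * B"
    and "\<And>t K. t \<in> {0..1} \<Longrightarrow> \<bar>slope (G (t *\<^sub>R q)) I K - slope u0 I K\<bar> \<le> 4 * \<Lambda> * B"
    and "\<And>t. t \<in> {0..1} \<Longrightarrow> G (t *\<^sub>R q) \<in> W"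
proof -
  have \<Lambda>: "1 \<le> \<Lambda>" and G0: "G 0 = u0" using ad by (auto simp: adapted_def)
  have pt: "G q \<in> W" "\<bar>tangent u0 I\<bar> / 2 \<le> \<bar>tangent (G q) I\<bar>" "(G has_derivative G' q) (at q)"
    "\<forall>v. translate' I (\<phi> u0) (G q) (G' q v) = v"
    "\<And>v k. \<bar>engel_coord (\<phi> u0) (\<phi>' (G q) (G' q v)) $ k\<bar> \<le> \<Lambda> * norm v"
    "\<And>K. \<bar>slope (G q) I K - slope u0 I K\<bar> \<le> \<Lambda> * norm q" "\<And>K. \<bar>slope (G q) I K\<bar> \<le> \<Lambda>"
    if "q \<in> ball 0 \<delta>" for q
    using ad that unfolding adapted_def by blast+
  have nq: "norm q \<le> 4 * B" using norm_le_of_components[OF card B(2,1)] .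
  have tq: "t *\<^sub>R q \<in> ball 0 \<delta>" "norm (t *\<^sub>R q) \<le> norm q" if "t \<in> {0..1}" for t :: real
  proof -
    show n: "norm (t *\<^sub>R q) \<le> norm q" using that by (simp add: mult_left_le_one_le)
    then show "t *\<^sub>R q \<in> ball 0 \<delta>" using q by simp
  qed
  show "lifted_segment (\<lambda>t. engel_coord (\<phi> u0) (\<phi> (G (t *\<^sub>R q)) - \<phi> u0))
     (\<lambda>t. engel_coord (\<phi> u0) (\<phi>' (G (t *\<^sub>R q)) (G' (t *\<^sub>R q) q))) I (($) q)
     (\<lambda>t j b. slope (G (t *\<^sub>R q)) I (I(b := j))) (4 * \<Lambda>)"
  proof (rule lifted_segment_of_parametrization[where \<delta> = \<delta> and G = G and G' = G' and I = I and q = q, OF _ G0 q card])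
    show "1 \<le> 4 * \<Lambda>" using \<Lambda> by simp
    fix q :: "real^'p::_" assume q: "q \<in> ball 0 \<delta>"
    have "\<bar>slope (G q) I K\<bar> \<le> 4 * \<Lambda>" for K using pt(7)[OF q, of K] \<Lambda> by simp
    moreover have "tangent (G q) I \<noteq> 0" using pt(2)[OF q] nz by auto
    ultimately show "G q \<in> U \<and> tangent (G q) I \<noteq> 0 \<and> (G has_derivative G' q) (at q) \<and>
       (\<forall>v. translate' I (\<phi> u0) (G q) (G' q v) = v) \<and> (\<forall>K. \<bar>slope (G q) I K\<bar> \<le> 4 * \<Lambda>)"
      using pt(1,3,4)[OF q] W by blast
  qed
  fix t :: real assume t: "t \<in> {0..1}"
  note tq = tq[OF t]
  have "\<Lambda> * norm q \<le> \<Lambda> * (4 * B)" using nq \<Lambda> by (intro mult_left_mono) auto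
  then show "\<bar>engel_coord (\<phi> u0) (\<phi>' (G (t *\<^sub>R q)) (G' (t *\<^sub>R q) q)) $ k\<bar> \<le> 4 * \<Lambda> * B" for k
    using pt(5)[OF tq(1), of q k] by simp
  have "\<Lambda> * norm (t *\<^sub>R q) \<le> \<Lambda> * (4 * B)" using nq tq(2) \<Lambda> by (intro mult_left_mono) auto
  then show "\<bar>slope (G (t *\<^sub>R q)) I K - slope u0 I K\<bar> \<le> 4 * \<Lambda> * B" for K
    using pt(6)[OF tq(1), of K] by simp
  show "G (t *\<^sub>R q) \<in> W" by (rule pt(1)[OF tq(1)])
qed

lemma adapted_box_volume:
  assumes ad: "adapted u0 W I \<delta> \<Lambda> G G'" and box: "anisotropic_box s \<subseteq> ball 0 \<delta>" and s: "\<And>b. 0 \<le> s b"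
  shows "compact (G ` anisotropic_box s)" "G ` anisotropic_box s \<subseteq> W"
    "ennreal (\<Prod>b\<in>UNIV. 2 * s b) \<le> ennreal (2 * \<bar>tangent u0 I\<bar>) * emeasure lborel (G ` anisotropic_box s)"
proof -
  have "compact (anisotropic_box s)" by (simp add: anisotropic_box_eq_cbox)
  with ad box have *: "compact (G ` anisotropic_box s) \<and>
      emeasure lborel (anisotropic_box s) \<le> ennreal (2 * \<bar>tangent u0 I\<bar>) * emeasure lborel (G ` anisotropic_box s)"
    unfolding adapted_def by blast
  then show "compact (G ` anisotropic_box s)" ..
  show "G ` anisotropic_box s \<subseteq> W" using ad box unfolding adapted_def by blast
  show "ennreal (\<Prod>b\<in>UNIV. 2 * s b) \<le> ennreal (2 * \<bar>tangent u0 I\<bar>) * emeasure lborel (G ` anisotropic_box s)"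
    using * emeasure_anisotropic_box[where s = s, OF s] by simp
qed

text \<open>The box with sides \<open>s ^ weight (I b)\<close> lifts into the ball by \<open>maximal_degree_box\<close>. The slopes that raise
  the weight have degree larger than \<open>d\<close> and vanish on the whole chart. Those that keep it are at most 1
  at the base point by the choice of \<open>I\<close>, hence at most 2 nearby. As in \<open>upper_density\<close>, the coefficient
  \<open>I\<close> enters the density and the Jacobian and cancels.\<close>

lemma lower_density_maximal:
  assumes h: "homogeneous \<rho>" and k: "1 \<le> k"
    "\<And>x z s. 0 < s \<Longrightarrow> (\<And>i. \<bar>engel_coord x (z - x) $ i\<bar> \<le> s ^ weight i) \<Longrightarrow> \<rho> x z \<le> k * s"
    and card: "CARD('p) \<le> 4"
    and u0: "u0 \<in> U" and I: "I \<in> multi_indices" "index_degree I = d" and nz: "tangent u0 I \<noteq> 0"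
    and top: "\<And>J. J \<in> multi_indices \<Longrightarrow> index_degree J = d \<Longrightarrow> \<bar>tangent u0 J\<bar> \<le> \<bar>tangent u0 I\<bar>"
    and maxdeg: "\<And>u J. u \<in> U \<Longrightarrow> J \<in> multi_indices \<Longrightarrow> d < index_degree J \<Longrightarrow> tangent u J = 0"
    and \<Omega>: "open \<Omega>" "\<phi> u0 \<in> \<Omega>"
    and a: "0 < a" "\<And>x (\<tau> :: 'p pvector). x \<in> \<Omega> \<Longrightarrow> a * coefficient_sum \<tau> \<le> pvector_norm g x \<tau>"
    and M: "\<And>A. A \<in> sets borel \<Longrightarrow> A \<subseteq> \<phi> ` U \<Longrightarrow> emeasure M A =
      (\<integral>\<^sup>+u. ennreal (indicator (U \<inter> \<phi> -` A) u * pvector_norm g (\<phi> u) (degree_component d (tangent u))) \<partial>lborel)"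
    and sM: "sets M = sets borel"
  shows "\<exists>r0>0. \<forall>r. 0 < r \<longrightarrow> r < r0 \<longrightarrow>
    ennreal (a / 4 * 2 ^ CARD('p) / (20 * k) ^ d * r ^ d) \<le> emeasure M (homogeneous.hball \<rho> (\<phi> u0) r)"
proof -
  interpret homogeneous \<rho> by (rule h)
  define W where "W = U \<inter> \<phi> -` \<Omega>"
  have W: "open W" "u0 \<in> W" "W \<subseteq> U"
    using openU cont_phi \<Omega> u0 by (auto simp: W_def continuous_open_preimage)
  obtain \<delta> \<Lambda> G G' where ad: "adapted u0 W I \<delta> \<Lambda> G G'"
    using adapted_parametrization[OF u0 nz W] by blast
  have \<delta>: "0 < \<delta>" and \<Lambda>: "1 \<le> \<Lambda>" using ad by (auto simp: adapted_def)
  \<comment> \<open>The first bound is the smallness condition of \<open>maximal_degree_box\<close>, the second one keeps the box in the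
    domain of \<open>G\<close>.\<close>
  define \<eta> where "\<eta> = min (1 / (10948 * (4 * \<Lambda>) ^ 5)) (\<delta> / 5)"
  have \<eta>: "0 < \<eta>" using \<delta> \<Lambda> by (simp add: \<eta>_def)
  have "ennreal (a / 4 * 2 ^ CARD('p) / (20 * k) ^ d * r ^ d) \<le> emeasure M (hball (\<phi> u0) r)"
    if r: "0 < r" "r < 20 * k * \<eta>" for r
  proof -
    define s where "s = r / (20 * k)"
    have s: "0 < s" "s < \<eta>" using r k(1) by (auto simp: s_def field_simps)
    have "s \<le> 1 / (10948 * (4 * \<Lambda>) ^ 5)" using s(2) by (simp add: \<eta>_def)
    then have small: "10948 * (4 * \<Lambda>) ^ 5 * s \<le> 1" using \<Lambda> by (simp add: field_simps)
    have p1: "1 \<le> (4 * \<Lambda>) ^ 4" using \<Lambda> by (intro one_le_power) simp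
    have "4 * \<Lambda> * s * 1 \<le> 4 * \<Lambda> * s * (4 * \<Lambda>) ^ 4" using p1 \<Lambda> s(1) by (intro mult_left_mono) auto
    also have "\<dots> = (4 * \<Lambda>) ^ 5 * s" by (simp add: eval_nat_numeral mult_ac)
    also have "\<dots> \<le> 1" using small \<Lambda> s(1) by simp
    finally have \<Lambda>s: "4 * \<Lambda> * s \<le> 1" by simp
    have "1 * s \<le> 4 * \<Lambda> * s" using \<Lambda> s(1) by (intro mult_right_mono) auto
    then have s1: "s \<le> 1" using \<Lambda>s by linarith
    let ?box = "anisotropic_box (\<lambda>b. s ^ weight (I b))"
    have qs: "\<bar>q $ b\<bar> \<le> s" if "q \<in> ?box" for q b
    proof -
      have "\<bar>q $ b\<bar> \<le> s ^ weight (I b)" using that by (simp add: anisotropic_box_def)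
      also have "\<dots> \<le> s ^ 1" using s s1 weight_positive[of "I b"] by (intro power_decreasing) auto
      finally show ?thesis by simp
    qed
    have box: "?box \<subseteq> ball 0 \<delta>"
    proof
      fix q assume "q \<in> ?box"
      then have "norm q \<le> 4 * s" using norm_le_of_components[OF card qs] s(1) by simp
      also have "\<dots> < \<delta>" using s by (simp add: \<eta>_def)
      finally show "q \<in> ball 0 \<delta>" by simp
    qed
    have s0: "0 \<le> s ^ weight (I b)" for b using s(1) by simp
    note vol = adapted_box_volume[OF ad box s0]
    have in_ball: "\<phi> (G q) \<in> hball (\<phi> u0) r" if q: "q \<in> ?box" for q
    proof -
      have qb: "q \<in> ball 0 \<delta>" using q box by blast
      have s00: "0 \<le> s" using s(1) by simp
      note seg = adapted_segment[OF ad W(3) nz card qb s00 qs[OF q]]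
      interpret lifted_segment "\<lambda>t. engel_coord (\<phi> u0) (\<phi> (G (t *\<^sub>R q)) - \<phi> u0)"
        "\<lambda>t. engel_coord (\<phi> u0) (\<phi>' (G (t *\<^sub>R q)) (G' (t *\<^sub>R q) q))" I "($) q"
        "\<lambda>t j b. slope (G (t *\<^sub>R q)) I (I(b := j))" "4 * \<Lambda>"
        by (rule seg(1))
      have "\<bar>engel_coord (\<phi> u0) (\<phi> (G (1 *\<^sub>R q)) - \<phi> u0) $ i\<bar> \<le> (20 * s) ^ weight i" for i
      proof (rule maximal_degree_box[OF s(1) small])
        show "\<bar>q $ b\<bar> \<le> s ^ weight (I b)" for b using q by (simp add: anisotropic_box_def)
        fix t :: real assume t: "t \<in> {0..1}"
        show "\<bar>engel_coord (\<phi> u0) (\<phi>' (G (t *\<^sub>R q)) (G' (t *\<^sub>R q) q)) $ i\<bar> \<le> 4 * \<Lambda> * s" for i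
          by (rule seg(2)[OF t])
        have GU: "G (t *\<^sub>R q) \<in> U" using seg(4)[OF t] W(3) by blast
        show "slope (G (t *\<^sub>R q)) I (I(b := j)) = 0" if "weight (I b) < weight j" for j b
          using index_degree_update[of I b j] that I(2) maxdeg[OF GU] by (intro slope_vanishes[of d]) auto
        show "\<bar>slope (G (t *\<^sub>R q)) I (I(b := j))\<bar> \<le> 2" if w: "weight (I b) = weight j" for j b
        proof -
          have "\<bar>tangent u0 (I(b := j))\<bar> \<le> \<bar>tangent u0 I\<bar>"
          proof (cases "tangent u0 (I(b := j)) = 0")
            case False
            then obtain J where "J \<in> multi_indices" "index_degree J = index_degree (I(b := j))"
              "\<bar>tangent u0 (I(b := j))\<bar> = \<bar>tangent u0 J\<bar>" by (rule tangent_sorted)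
            moreover have "index_degree (I(b := j)) = d" using index_degree_update[of I b j] w I(2) by simp
            ultimately show ?thesis using top[of J] by simp
          qed simp
          then have "\<bar>slope u0 I (I(b := j))\<bar> \<le> 1" using nz by (simp add: slope_def abs_divide)
          then show ?thesis using seg(3)[OF t, of "I(b := j)"] \<Lambda>s by linarith
        qed
      qed
      then have "\<rho> (\<phi> u0) (\<phi> (G q)) \<le> k * (20 * s)" using s(1) by (intro k(2)) auto
      also have "\<dots> = r" using k(1) by (simp add: s_def)
      finally show ?thesis by (simp add: hball_def)
    qed
    let ?P = "G ` ?box"
    have Pb: "?P \<in> sets borel" using vol(1) by (intro borel_closed compact_imp_closed)
    have PU: "?P \<subseteq> U" using vol(2) W(3) by blast
    have UP: "U \<inter> \<phi> -` (\<phi> ` ?P) = ?P" using PU inj_phi by (auto simp: inj_on_def)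
    have dens: "a * (\<bar>tangent u0 I\<bar> / 2) \<le> pvector_norm g (\<phi> u) (degree_component d (tangent u))" if uP: "u \<in> ?P" for u
    proof -
      obtain q where q: "q \<in> ball 0 \<delta>" "u = G q" using uP box by blast
      then have "\<bar>tangent u0 I\<bar> / 2 \<le> \<bar>tangent u I\<bar>" "u \<in> W" using ad unfolding adapted_def by blast+
      moreover have "\<bar>degree_component d (tangent u) I\<bar> \<le> coefficient_sum (degree_component d (tangent u))"
        using I(1) by (rule coefficient_le_sum)
      ultimately have "a * (\<bar>tangent u0 I\<bar> / 2) \<le> a * coefficient_sum (degree_component d (tangent u))"
        using a(1) I(2) by (intro mult_left_mono) (auto simp: degree_component_def)
      moreover have "\<phi> u \<in> \<Omega>" using \<open>u \<in> W\<close> by (simp add: W_def)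
      ultimately show ?thesis using a(2) order_trans by blast
    qed
    have "ennreal (a / 4 * 2 ^ CARD('p) / (20 * k) ^ d * r ^ d) = ennreal (a / 4) * ennreal (\<Prod>b\<in>UNIV. 2 * s ^ weight (I b))"
    proof -
      have "a / 4 * 2 ^ CARD('p) / (20 * k) ^ d * r ^ d = a / 4 * (2 ^ CARD('p) * s ^ d)"
        by (simp add: s_def power_divide power_mult_distrib mult_ac)
      moreover have "0 \<le> a / 4" "0 \<le> 2 ^ CARD('p) * s ^ d" using a(1) s(1) by auto
      ultimately show ?thesis unfolding prod_power_weight I(2) by (simp only: ennreal_mult)
    qed
    also have "\<dots> \<le> ennreal (a / 4) * (ennreal (2 * \<bar>tangent u0 I\<bar>) * emeasure lborel ?P)"
      using vol(3) by (rule mult_left_mono) simp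
    also have "\<dots> = ennreal (a * (\<bar>tangent u0 I\<bar> / 2)) * emeasure lborel ?P"
      using a(1) by (simp add: mult.assoc[symmetric] flip: ennreal_mult)
    also have "\<dots> = (\<integral>\<^sup>+u. ennreal (a * (\<bar>tangent u0 I\<bar> / 2)) * indicator ?P u \<partial>lborel)"
      using Pb by (simp add: nn_integral_cmult_indicator)
    also have "\<dots> \<le> (\<integral>\<^sup>+u. ennreal (indicator ?P u * pvector_norm g (\<phi> u) (degree_component d (tangent u))) \<partial>lborel)"
      using dens by (intro nn_integral_mono) (auto simp: indicator_def intro!: ennreal_leI)
    also have "\<dots> = emeasure M (\<phi> ` ?P)"
      using M[OF image_in_borel[OF Pb PU]] PU UP by (simp add: image_mono)
    also have "\<dots> \<le> emeasure M (hball (\<phi> u0) r)"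
      using in_ball sM by (intro emeasure_mono) auto
    finally show ?thesis .
  qed
  moreover have "0 < 20 * k * \<eta>" using k(1) \<eta> by simp
  ultimately show ?thesis by blast
qed

lemma volume_from_box:
  assumes ad: "adapted u0 W I \<delta> \<Lambda> G G'" and W: "W \<subseteq> U" "open W" and nz: "tangent u0 I \<noteq> 0"
    and box: "anisotropic_box s \<subseteq> ball 0 \<delta>" and s: "\<And>b. 0 \<le> s b"
    and H: "H \<in> sets borel" "\<And>q. q \<in> anisotropic_box s \<Longrightarrow> \<phi> (G q) \<in> H"
    and c: "2 * \<bar>tangent u0 I\<bar> * c \<le> (\<Prod>b\<in>UNIV. 2 * s b)" "0 \<le> c"
  shows "ennreal c \<le> emeasure lborel (W \<inter> \<phi> -` H)"
proof -
  note vol = adapted_box_volume[OF ad box s]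
  have "ennreal (2 * \<bar>tangent u0 I\<bar>) * ennreal c \<le> ennreal (\<Prod>b\<in>UNIV. 2 * s b)"
    using c by (simp add: ennreal_leI flip: ennreal_mult)
  also have "\<dots> \<le> ennreal (2 * \<bar>tangent u0 I\<bar>) * emeasure lborel (G ` anisotropic_box s)" by (rule vol(3))
  finally have "ennreal c \<le> emeasure lborel (G ` anisotropic_box s)"
    by (rule ennreal_mult_le_cancel[rotated]) (use nz in simp)
  also have "\<dots> \<le> emeasure lborel (W \<inter> \<phi> -` H)"
  proof (rule emeasure_mono)
    show "G ` anisotropic_box s \<subseteq> W \<inter> \<phi> -` H" using vol(2) H(2) by auto
    have "W \<inter> \<phi> -` H = W \<inter> (U \<inter> \<phi> -` H)" using W(1) by auto
    also have "\<dots> \<in> sets borel" using W(2) preimage_in_borel[OF H(1)] by auto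
    finally show "W \<inter> \<phi> -` H \<in> sets lborel" by simp
  qed
  finally show ?thesis .
qed

end

context chart
begin

text \<open>Let \<open>m < d\<close> be the degree of \<open>I\<close>, and let \<open>n1\<close> be the number of coordinates of weight one in \<open>I\<close>. If the box
  with sides \<open>s ^ weight (I b)\<close> lifts into a ball of radius comparable with \<open>s\<close>, then its volume \<open>s ^ m\<close> is
  much larger than \<open>s ^ d\<close>. This box can fail to fit when 4 is not among the coordinates \<open>I\<close>. The thinner box has,
  for \<open>r = e\<^sup>2\<close>, volume \<open>e ^ (2 * m + n1)\<close>, which is much larger than \<open>r ^ d = e ^ (2 * d)\<close> if
  \<open>2 * m + n1 < 2 * d\<close>. As \<open>n1\<close> is at most 2, the only exception is \<open>d = m + 1\<close> and \<open>n1 = 2\<close>; and then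
  replacing a coordinate of weight one by 4 leads to a degree larger than \<open>d\<close>, so that these slopes
  vanish and the first box fits after all.\<close>

lemma lower_density_infinite:
  assumes h: "homogeneous \<rho>" and k: "1 \<le> k"
    "\<And>x z s. 0 < s \<Longrightarrow> (\<And>i. \<bar>engel_coord x (z - x) $ i\<bar> \<le> s ^ weight i) \<Longrightarrow> \<rho> x z \<le> k * s"
    and card: "CARD('p) \<le> 4"
    and W: "open W" "u0 \<in> W" "W \<subseteq> U" and I: "I \<in> multi_indices" "index_degree I < d" and nz: "tangent u0 I \<noteq> 0"
    and deg: "\<And>J. J \<in> multi_indices \<Longrightarrow> index_degree I < index_degree J \<Longrightarrow> tangent u0 J = 0"
    and maxdeg: "\<And>u J. u \<in> U \<Longrightarrow> J \<in> multi_indices \<Longrightarrow> d < index_degree J \<Longrightarrow> tangent u J = 0"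
    and C: "0 < C"
  shows "\<exists>r0>0. \<forall>r. 0 < r \<longrightarrow> r < r0 \<longrightarrow>
    ennreal (C * r ^ d) \<le> emeasure lborel (W \<inter> \<phi> -` homogeneous.hball \<rho> (\<phi> u0) r)"
proof -
  interpret homogeneous \<rho> by (rule h)
  obtain \<delta> \<Lambda> G G' where ad: "adapted u0 W I \<delta> \<Lambda> G G'"
    using adapted_parametrization[OF W(2)[THEN subsetD[OF W(3)]] nz W] by blast
  have \<delta>: "0 < \<delta>" and \<Lambda>: "1 \<le> \<Lambda>" using ad by (auto simp: adapted_def)
  define m where "m = index_degree I"
  define n1 where "n1 = card {b. weight (I b) = 1}"
  let ?L = "\<bar>tangent u0 I\<bar>"
  have L: "0 < ?L" using nz by simp
  have flat: "slope u0 I (I(b := j)) = 0" if "weight (I b) < weight j" for j b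
    using index_degree_update[of I b j] that deg by (intro slope_vanishes[of "index_degree I"]) auto
  have injI: "inj I" using I(1) by (simp add: multi_indices_def strict_mono_imp_inj_on)
  have n1_le: "n1 \<le> 2"
  proof -
    have "I ` {b. weight (I b) = 1} \<subseteq> {1, 2}"
    proof
      fix i assume "i \<in> I ` {b. weight (I b) = 1}"
      then have "weight i = 1" by blast
      then show "i \<in> {1, 2}" using exhaust_4[of i] by (auto simp: weight_def)
    qed
    then have "card (I ` {b. weight (I b) = 1}) \<le> card {1, 2 :: 4}" by (intro card_mono) auto
    then show ?thesis using injI by (simp add: n1_def card_image inj_on_subset)
  qed
  show ?thesis
  proof (cases "4 \<notin> range I \<and> 2 * m + n1 < 2 * d")
    case False
    define \<Gamma> where "\<Gamma> = 70 * (4 * \<Lambda>) ^ 5"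
    have \<Gamma>: "0 < \<Gamma>" using \<Lambda> by (simp add: \<Gamma>_def)
    have k\<Gamma>: "0 < k * \<Gamma>" using k(1) \<Gamma> by simp
    define \<eta> where "\<eta> = min (min 1 (\<delta> / 5)) (1 / (2 * ?L * C * (k * \<Gamma>) ^ d))"
    have \<eta>: "0 < \<eta>" using \<delta> L C k\<Gamma> by (simp add: \<eta>_def)
    have "ennreal (C * r ^ d) \<le> emeasure lborel (W \<inter> \<phi> -` hball (\<phi> u0) r)"
      if r: "0 < r" "r < k * \<Gamma> * \<eta>" for r
    proof -
      define s where "s = r / (k * \<Gamma>)"
      have s: "0 < s" "s < \<eta>" using r k\<Gamma> by (auto simp: s_def field_simps)
      have rs: "r = k * \<Gamma> * s" using less_imp_neq[OF k\<Gamma>] by (auto simp: s_def)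
      have s1: "s \<le> 1" using s(2) by (simp add: \<eta>_def)
      let ?box = "anisotropic_box (\<lambda>b. s ^ weight (I b))"
      have qs: "\<bar>q $ b\<bar> \<le> s" if "q \<in> ?box" for q b
      proof -
        have "\<bar>q $ b\<bar> \<le> s ^ weight (I b)" using that by (simp add: anisotropic_box_def)
        also have "\<dots> \<le> s ^ 1" using s s1 weight_positive[of "I b"] by (intro power_decreasing) auto
        finally show ?thesis by simp
      qed
      have box: "?box \<subseteq> ball 0 \<delta>"
      proof
        fix q assume "q \<in> ?box"
        then have "norm q \<le> 4 * s" using norm_le_of_components[OF card qs] s(1) by simp
        also have "\<dots> < \<delta>" using s by (simp add: \<eta>_def)
        finally show "q \<in> ball 0 \<delta>" by simp
      qed
      have s0: "0 \<le> s ^ weight (I b)" for b using s(1) by simp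
      have in_ball: "\<phi> (G q) \<in> hball (\<phi> u0) r" if q: "q \<in> ?box" for q
      proof -
        have qb: "q \<in> ball 0 \<delta>" using q box by blast
        have s00: "0 \<le> s" using s(1) by simp
        note seg = adapted_segment[OF ad W(3) nz card qb s00 qs[OF q]]
        interpret lifted_segment "\<lambda>t. engel_coord (\<phi> u0) (\<phi> (G (t *\<^sub>R q)) - \<phi> u0)"
          "\<lambda>t. engel_coord (\<phi> u0) (\<phi>' (G (t *\<^sub>R q)) (G' (t *\<^sub>R q) q))" I "($) q"
          "\<lambda>t j b. slope (G (t *\<^sub>R q)) I (I(b := j))" "4 * \<Lambda>"
          by (rule seg(1))
        have sl: "\<bar>slope (G (t *\<^sub>R q)) I (I(b := j))\<bar> \<le> 4 * \<Lambda> * s"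
          if "t \<in> {0..1}" "weight (I b) < weight j" for t b j
          using seg(3)[OF that(1), of "I(b := j)"] flat[OF that(2)] by simp
        have "\<bar>engel_coord (\<phi> u0) (\<phi> (G (1 *\<^sub>R q)) - \<phi> u0) $ i\<bar> \<le> (70 * (4 * \<Lambda>) ^ 5 * s) ^ weight i" for i
        proof (rule lower_degree_box[OF s(1) s1])
          show "\<bar>q $ b\<bar> \<le> s ^ weight (I b)" for b using q by (simp add: anisotropic_box_def)
          show "\<bar>engel_coord (\<phi> u0) (\<phi>' (G (t *\<^sub>R q)) (G' (t *\<^sub>R q) q)) $ i\<bar> \<le> 4 * \<Lambda> * s" if "t \<in> {0..1}" for t i
            by (rule seg(2)[OF that])
          show "\<bar>slope (G (t *\<^sub>R q)) I (I(b := 3))\<bar> \<le> 4 * \<Lambda> * s" if "t \<in> {0..1}" "weight (I b) = 1" for t b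
            using that by (intro sl) auto
          show "4 \<in> range I \<or> (\<forall>t\<in>{0..1}. \<forall>b. (weight (I b) = 1 \<longrightarrow> slope (G (t *\<^sub>R q)) I (I(b := 4)) = 0) \<and>
              (I b = 3 \<longrightarrow> \<bar>slope (G (t *\<^sub>R q)) I (I(b := 4))\<bar> \<le> 4 * \<Lambda> * s))"
          proof (cases "4 \<in> range I")
            case no4: False
            have dm: "d = m + 1" using False no4 n1_le I(2) by (simp add: m_def)
            have "slope (G (t *\<^sub>R q)) I (I(b := 4)) = 0" if t: "t \<in> {0..1}" and b: "weight (I b) = 1" for t b
            proof (rule slope_vanishes[of d])
              have GU: "G (t *\<^sub>R q) \<in> U" using seg(4)[OF t] W(3) by blast
              show "tangent (G (t *\<^sub>R q)) J = 0" if "J \<in> multi_indices" "d < index_degree J" for J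
                by (rule maxdeg[OF GU that])
              show "d < index_degree (I(b := 4))" using index_degree_update[of I b 4] b dm by (simp add: m_def)
            qed
            moreover have "\<bar>slope (G (t *\<^sub>R q)) I (I(b := 4))\<bar> \<le> 4 * \<Lambda> * s" if "t \<in> {0..1}" "I b = 3" for t b
              using that by (intro sl) auto
            ultimately show ?thesis by blast
          qed simp
        qed
        then have "\<rho> (\<phi> u0) (\<phi> (G q)) \<le> k * (\<Gamma> * s)" using s(1) \<Gamma> unfolding \<Gamma>_def by (intro k(2)) auto
        then show ?thesis by (simp add: hball_def rs mult.assoc)
      qed
      show ?thesis
      proof (rule volume_from_box[OF ad W(3,1) nz box s0 hball_borel in_ball])
        have "s ^ d \<le> s ^ (m + 1)" using s(1) s1 I(2) by (intro power_decreasing) (auto simp: m_def)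
        then have "2 * ?L * (C * r ^ d) \<le> 2 * ?L * (C * ((k * \<Gamma>) ^ d * s ^ (m + 1)))"
          using L C k\<Gamma> s(1) unfolding rs power_mult_distrib[of "k * \<Gamma>"] by (intro mult_left_mono) auto
        also have "\<dots> = (2 * ?L * C * (k * \<Gamma>) ^ d * s) * s ^ m" by (simp add: mult_ac)
        also have "\<dots> \<le> 1 * s ^ m"
        proof (rule mult_right_mono)
          have "s \<le> 1 / (2 * ?L * C * (k * \<Gamma>) ^ d)" using s(2) by (simp add: \<eta>_def)
          moreover have "0 < 2 * ?L * C * (k * \<Gamma>) ^ d" using L C k\<Gamma> by simp
          ultimately show "2 * ?L * C * (k * \<Gamma>) ^ d * s \<le> 1" by (simp add: field_simps)
        qed (use s in simp)
        also have "\<dots> \<le> 2 ^ CARD('p) * s ^ m" using s(1) by (intro mult_right_mono) auto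
        also have "\<dots> = (\<Prod>b\<in>UNIV. 2 * s ^ weight (I b))" by (simp add: prod_power_weight m_def)
        finally show "2 * ?L * (C * r ^ d) \<le> (\<Prod>b\<in>UNIV. 2 * s ^ weight (I b))" .
        show "0 \<le> C * r ^ d" using C r(1) by simp
      qed
    qed
    moreover have "0 < k * \<Gamma> * \<eta>" using k\<Gamma> \<eta> by simp
    ultimately show ?thesis by blast
  next
    case True
    then have I4: "4 \<notin> range I" and mn: "2 * m + n1 < 2 * d" by auto
    define \<Gamma> where "\<Gamma> = 10 * (4 * \<Lambda>) ^ 3"
    have \<Gamma>: "0 < \<Gamma>" using \<Lambda> by (simp add: \<Gamma>_def)
    have k\<Gamma>: "0 < k * \<Gamma>" using k(1) \<Gamma> by simp
    define \<eta> where "\<eta> = min (min 1 (\<delta> / 5)) (1 / (2 * ?L * C * (k * \<Gamma>) ^ d))"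
    have \<eta>: "0 < \<eta>" using \<delta> L C k\<Gamma> by (simp add: \<eta>_def)
    \<comment> \<open>The exponents of the sides in terms of \<open>e\<close>: 3 for weight one, and \<open>e ^ 4 = r\<^sup>2\<close> for weight two.\<close>
    define l where "l b = 2 * weight (I b) + (if weight (I b) = 1 then 1 else 0)" for b
    have l3: "3 \<le> l b" for b
      using weight_positive[of "I b"] by (auto simp: l_def)
    have suml: "(\<Sum>b\<in>UNIV. l b) = 2 * m + n1"
      unfolding l_def sum.distrib n1_def m_def index_degree_def sum_distrib_left
      by (simp add: sum.If_cases)
    have "ennreal (C * r ^ d) \<le> emeasure lborel (W \<inter> \<phi> -` hball (\<phi> u0) r)"
      if r: "0 < r" "r < k * \<Gamma> * \<eta>\<^sup>2" for r
    proof -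
      define e where "e = sqrt (r / (k * \<Gamma>))"
      have e2: "e\<^sup>2 = r / (k * \<Gamma>)" using r(1) k\<Gamma> by (simp add: e_def)
      have e0: "0 < e" using r(1) k\<Gamma> by (simp add: e_def)
      have "e\<^sup>2 < \<eta>\<^sup>2" using r(2) k\<Gamma> unfolding e2 by (simp add: field_simps)
      then have e\<eta>: "e < \<eta>" using \<eta> by (simp add: power_less_imp_less_base)
      have re: "r = k * \<Gamma> * e\<^sup>2" using less_imp_neq[OF k\<Gamma>] by (auto simp: e2)
      have e1: "e \<le> 1" using e\<eta> by (simp add: \<eta>_def)
      let ?box = "anisotropic_box (\<lambda>b. e ^ l b)"
      have qs: "\<bar>q $ b\<bar> \<le> e ^ 3" if "q \<in> ?box" for q b
      proof -
        have "\<bar>q $ b\<bar> \<le> e ^ l b" using that by (simp add: anisotropic_box_def)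
        also have "\<dots> \<le> e ^ 3" using e0 e1 l3[of b] by (intro power_decreasing) auto
        finally show ?thesis .
      qed
      have box: "?box \<subseteq> ball 0 \<delta>"
      proof
        fix q assume "q \<in> ?box"
        then have "norm q \<le> 4 * e ^ 3" using norm_le_of_components[OF card qs] e0 by simp
        also have "e ^ 3 \<le> e ^ 1" using e0 e1 by (intro power_decreasing) auto
        also have "4 * e ^ 1 < \<delta>" using e\<eta> e0 by (simp add: \<eta>_def)
        finally show "q \<in> ball 0 \<delta>" by simp
      qed
      have s0: "0 \<le> e ^ l b" for b using e0 by simp
      have in_ball: "\<phi> (G q) \<in> hball (\<phi> u0) r" if q: "q \<in> ?box" for q
      proof -
        have qb: "q \<in> ball 0 \<delta>" using q box by blast
        have e30: "0 \<le> e ^ 3" using e0 by simp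
        note seg = adapted_segment[OF ad W(3) nz card qb e30 qs[OF q]]
        interpret lifted_segment "\<lambda>t. engel_coord (\<phi> u0) (\<phi> (G (t *\<^sub>R q)) - \<phi> u0)"
          "\<lambda>t. engel_coord (\<phi> u0) (\<phi>' (G (t *\<^sub>R q)) (G' (t *\<^sub>R q) q))" I "($) q"
          "\<lambda>t j b. slope (G (t *\<^sub>R q)) I (I(b := j))" "4 * \<Lambda>"
          by (rule seg(1))
        have sl: "\<bar>slope (G (t *\<^sub>R q)) I (I(b := j))\<bar> \<le> 4 * \<Lambda> * e ^ 3"
          if "t \<in> {0..1}" "weight (I b) < weight j" for t b j
          using seg(3)[OF that(1), of "I(b := j)"] flat[OF that(2)] by simp
        have "\<bar>engel_coord (\<phi> u0) (\<phi> (G (1 *\<^sub>R q)) - \<phi> u0) $ i\<bar> \<le> (10 * (4 * \<Lambda>) ^ 3 * e\<^sup>2) ^ weight i" for i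
        proof (rule lower_degree_thin_box[OF e0 e1 I4])
          show "\<bar>q $ b\<bar> \<le> e ^ 4" if "I b = 3" for b
          proof -
            have "\<bar>q $ b\<bar> \<le> e ^ l b" using q by (simp add: anisotropic_box_def)
            then show ?thesis using that by (simp add: l_def)
          qed
          show "\<bar>engel_coord (\<phi> u0) (\<phi>' (G (t *\<^sub>R q)) (G' (t *\<^sub>R q) q)) $ i\<bar> \<le> 4 * \<Lambda> * e ^ 3" if "t \<in> {0..1}" for t i
            by (rule seg(2)[OF that])
          show "\<bar>slope (G (t *\<^sub>R q)) I (I(b := 3))\<bar> \<le> 4 * \<Lambda> * e ^ 3" if "t \<in> {0..1}" "weight (I b) = 1" for t b
            using that by (intro sl) auto
          show "\<bar>slope (G (t *\<^sub>R q)) I (I(b := 4))\<bar> \<le> 4 * \<Lambda> * e ^ 3" if "t \<in> {0..1}" for t b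
          proof (rule sl[OF that])
            have "I b \<noteq> 4" using I4 by (metis rangeI)
            then show "weight (I b) < weight 4" using exhaust_4[of "I b"] by (auto simp: weight_def)
          qed
        qed
        then have "\<rho> (\<phi> u0) (\<phi> (G q)) \<le> k * (\<Gamma> * e\<^sup>2)" using e0 \<Gamma> unfolding \<Gamma>_def by (intro k(2)) auto
        then show ?thesis by (simp add: hball_def re mult.assoc)
      qed
      show ?thesis
      proof (rule volume_from_box[OF ad W(3,1) nz box s0 hball_borel in_ball])
        have "e ^ (2 * d) \<le> e ^ (2 * m + n1 + 1)" using e0 e1 mn by (intro power_decreasing) auto
        then have "2 * ?L * (C * r ^ d) \<le> 2 * ?L * (C * ((k * \<Gamma>) ^ d * e ^ (2 * m + n1 + 1)))"
          using L C k\<Gamma> e0 unfolding re power_mult_distrib[of "k * \<Gamma>"] power_mult[symmetric] by (intro mult_left_mono) auto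
        also have "\<dots> = (2 * ?L * C * (k * \<Gamma>) ^ d * e) * e ^ (2 * m + n1)" by (simp add: mult_ac)
        also have "\<dots> \<le> 1 * e ^ (2 * m + n1)"
        proof (rule mult_right_mono)
          have "e \<le> 1 / (2 * ?L * C * (k * \<Gamma>) ^ d)" using e\<eta> by (simp add: \<eta>_def)
          moreover have "0 < 2 * ?L * C * (k * \<Gamma>) ^ d" using L C k\<Gamma> by simp
          ultimately show "2 * ?L * C * (k * \<Gamma>) ^ d * e \<le> 1" by (simp add: field_simps)
        qed (use e0 in simp)
        also have "\<dots> \<le> 2 ^ CARD('p) * e ^ (2 * m + n1)" using e0 by (intro mult_right_mono) auto
        also have "\<dots> = (\<Prod>b\<in>UNIV. 2 * e ^ l b)" by (simp add: prod.distrib power_sum[symmetric] suml)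
        finally show "2 * ?L * (C * r ^ d) \<le> (\<Prod>b\<in>UNIV. 2 * e ^ l b)" .
        show "0 \<le> C * r ^ d" using C r(1) by simp
      qed
    qed
    moreover have "0 < k * \<Gamma> * \<eta>\<^sup>2" using k\<Gamma> \<eta> by simp
    ultimately show ?thesis by blast
  qed
qed

end

section \<open>Comparison with measures that are finite on a countable open cover\<close>

context homogeneous
begin

text \<open>The restriction of \<open>\<nu>\<close> to \<open>T\<close> is a finite Borel measure and so outer regular, which allows
  replacing the open set in \<open>spherical_hausdorff_le_of_density\<close> by \<open>A\<close>.\<close>

lemma spherical_hausdorff_le_of_density_finite:
  assumes sets: "sets \<nu> = sets borel" and T: "open T" "emeasure \<nu> T < \<infinity>" and A: "A \<in> sets borel" "A \<subseteq> T"
    and c: "0 < c"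
    and dens: "\<And>x. x \<in> A \<Longrightarrow> \<exists>r0>0. \<forall>r. 0 < r \<longrightarrow> r < r0 \<longrightarrow> ennreal (c * r ^ d) \<le> emeasure \<nu> (hball x r)"
  shows "spherical_hausdorff \<rho> d A \<le> ennreal (3 ^ d / c) * emeasure \<nu> A"
proof (rule ennreal_le_epsilon)
  fix e :: real assume e: "0 < e"
  define \<nu>' where "\<nu>' = density \<nu> (indicator T)"
  have \<nu>': "emeasure \<nu>' B = emeasure \<nu> (T \<inter> B)" if "B \<in> sets borel" for B
    unfolding \<nu>'_def using T(1) that by (intro emeasure_restricted) (auto simp: sets)
  have s': "sets \<nu>' = sets borel" by (simp add: \<nu>'_def sets)
  then have sp: "space \<nu>' = UNIV" by (simp add: sets_eq_imp_space_eq)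
  have fin: "emeasure \<nu>' (space \<nu>') \<noteq> \<infinity>" using T(2) by (simp add: sp \<nu>')
  define K where "K = 3 ^ d / c"
  have K: "0 < K" using c by (simp add: K_def)
  have AT: "T \<inter> A = A" using A(2) by blast
  have \<nu>A: "emeasure \<nu>' A = emeasure \<nu> A" using A(1) by (simp add: \<nu>' AT)
  have "emeasure \<nu>' A \<le> emeasure \<nu>' (space \<nu>')" using A(1) by (intro emeasure_mono) (auto simp: sp s')
  then have "emeasure \<nu>' A < \<infinity>" using fin by (simp add: less_top[symmetric] top_unique) (metis top_unique)
  moreover have "0 < ennreal (e / K)" using e K by simp
  ultimately have "emeasure \<nu>' A < emeasure \<nu>' A + ennreal (e / K)"
    using ennreal_add_left_cancel_less[of "emeasure \<nu>' A" 0 "ennreal (e / K)"] by simp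
  moreover have "emeasure \<nu>' A = (INF V\<in>{V. A \<subseteq> V \<and> open V}. emeasure \<nu>' V)"
    by (rule outer_regular[OF s' fin A(1)])
  ultimately have "(INF V\<in>{V. A \<subseteq> V \<and> open V}. emeasure \<nu>' V) < emeasure \<nu>' A + ennreal (e / K)" by simp
  then obtain V where V: "A \<subseteq> V" "open V" "emeasure \<nu>' V < emeasure \<nu>' A + ennreal (e / K)"
    unfolding INF_less_iff by blast
  have "spherical_hausdorff \<rho> d A \<le> ennreal K * emeasure \<nu> (T \<inter> V)"
    unfolding K_def using T(1) V(1,2) A(2) by (intro spherical_hausdorff_le_of_density[OF sets _ _ c dens]) auto
  also have "emeasure \<nu> (T \<inter> V) \<le> emeasure \<nu> A + ennreal (e / K)"
    using V(2,3) \<nu>A by (simp add: \<nu>')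
  also have "ennreal K * (emeasure \<nu> A + ennreal (e / K)) = ennreal K * emeasure \<nu> A + ennreal e"
    using K e by (simp add: distrib_left flip: ennreal_mult)
  finally show "spherical_hausdorff \<rho> d A \<le> ennreal (3 ^ d / c) * emeasure \<nu> A + ennreal e"
    by (simp add: K_def mult_left_mono)
qed

lemma spherical_hausdorff_le_of_density_sigma_finite:
  assumes sets: "sets \<nu> = sets borel" and T: "\<And>k::nat. open (T k)" "\<And>k. emeasure \<nu> (T k) < \<infinity>"
    and A: "A \<in> sets borel" "A \<subseteq> (\<Union>k. T k)" and c: "0 < c"
    and dens: "\<And>x. x \<in> A \<Longrightarrow> \<exists>r0>0. \<forall>r. 0 < r \<longrightarrow> r < r0 \<longrightarrow> ennreal (c * r ^ d) \<le> emeasure \<nu> (hball x r)"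
  shows "spherical_hausdorff \<rho> d A \<le> ennreal (3 ^ d / c) * emeasure \<nu> A"
proof -
  define D where "D k = A \<inter> disjointed T k" for k
  have disT: "disjointed T k \<subseteq> T k" for k by (rule disjointed_subset)
  have DB: "D k \<in> sets borel" for k
    using A(1) T(1) unfolding D_def disjointed_def by (intro sets.Int sets.Diff sets.finite_UN) auto
  have DA: "(\<Union>k. D k) = A"
    using A(2) UN_disjointed_eq[of T] unfolding D_def by blast
  have dD: "disjoint_family D"
    using disjoint_family_disjointed[of T] unfolding D_def disjoint_family_on_def by blast
  have "spherical_hausdorff \<rho> d A \<le> (\<Sum>k. spherical_hausdorff \<rho> d (D k))"
    by (rule spherical_hausdorff_countably_subadditive) (simp add: DA)
  also have "\<dots> \<le> (\<Sum>k. ennreal (3 ^ d / c) * emeasure \<nu> (D k))"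
  proof (rule suminf_le)
    show "spherical_hausdorff \<rho> d (D k) \<le> ennreal (3 ^ d / c) * emeasure \<nu> (D k)" for k
    proof (rule spherical_hausdorff_le_of_density_finite[OF sets T(1,2)[of k] DB _ c])
      show "D k \<subseteq> T k" using disT by (auto simp: D_def)
      show "\<exists>r0>0. \<forall>r. 0 < r \<longrightarrow> r < r0 \<longrightarrow> ennreal (c * r ^ d) \<le> emeasure \<nu> (hball x r)" if "x \<in> D k" for x
        using that by (intro dens) (simp add: D_def)
    qed
  qed auto
  also have "\<dots> = ennreal (3 ^ d / c) * (\<Sum>k. emeasure \<nu> (D k))" by (rule ennreal_suminf_cmult)
  also have "(\<Sum>k. emeasure \<nu> (D k)) = emeasure \<nu> A"
    using suminf_emeasure[of D \<nu>] DB dD DA sets by auto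
  finally show ?thesis .
qed

lemma spherical_hausdorff_null_of_infinite_density:
  assumes sets: "sets \<nu> = sets borel" and fin: "emeasure \<nu> UNIV < \<infinity>"
    and dens: "\<And>x C. x \<in> A \<Longrightarrow> 0 < C \<Longrightarrow>
      \<exists>r0>0. \<forall>r. 0 < r \<longrightarrow> r < r0 \<longrightarrow> ennreal (C * r ^ d) \<le> emeasure \<nu> (hball x r)"
  shows "spherical_hausdorff \<rho> d A = 0"
proof -
  obtain m where m: "emeasure \<nu> UNIV = ennreal m" "0 \<le> m"
    using fin by (cases "emeasure \<nu> UNIV") auto
  have "spherical_hausdorff \<rho> d A \<le> 0 + ennreal e" if e: "0 < e" for e
  proof -
    define C where "C = 3 ^ d * (m + 1) / e"
    have C: "0 < C" using e m by (simp add: C_def add_nonneg_pos)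
    have "spherical_hausdorff \<rho> d A \<le> ennreal (3 ^ d / C) * emeasure \<nu> UNIV"
      by (rule spherical_hausdorff_le_of_density[OF sets _ _ C dens[OF _ C]]) auto
    also have "\<dots> = ennreal (3 ^ d / C * m)" using C m by (simp flip: ennreal_mult)
    also have "3 ^ d / C * m = e * (m / (m + 1))" by (simp add: C_def)
    also have "ennreal (e * (m / (m + 1))) \<le> ennreal e"
    proof (rule ennreal_leI)
      have "e * (m / (m + 1)) \<le> e * 1" using e m by (intro mult_left_mono) (auto simp: field_simps)
      then show "e * (m / (m + 1)) \<le> e" by simp
    qed
    finally show ?thesis by simp
  qed
  then have "spherical_hausdorff \<rho> d A \<le> 0" by (rule ennreal_le_epsilon)
  then show ?thesis by simp
qed

end

section \<open>Points of maximal degree\<close>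

lemma pvector_degree_ge:
  assumes "J \<in> multi_indices" "\<tau> J \<noteq> 0"
  shows "index_degree J \<le> pvector_degree \<tau>"
  unfolding pvector_degree_def using assms by (intro Max_ge) auto

lemma pvector_degree_attained:
  assumes "J \<in> multi_indices" "\<tau> J \<noteq> 0"
  shows "\<exists>I\<in>multi_indices. \<tau> I \<noteq> 0 \<and> index_degree I = pvector_degree \<tau>"
proof -
  have "pvector_degree \<tau> \<in> {index_degree I | I. I \<in> multi_indices \<and> \<tau> I \<noteq> 0}"
    unfolding pvector_degree_def using assms by (intro Max_in) auto
  then show ?thesis by auto
qed

lemma pointwise_degree_le:
  assumes S: "C11_submanifold TYPE('p::{finite,linorder}) S" and x: "x \<in> S"
  shows "pointwise_degree TYPE('p) S x \<le> submanifold_degree TYPE('p) S"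
proof -
  have "pointwise_degree TYPE('p) S ` S \<subseteq> index_degree ` (multi_indices :: ('p \<Rightarrow> 4) set)"
  proof
    fix n assume "n \<in> pointwise_degree TYPE('p) S ` S"
    then obtain y where y: "y \<in> S" "n = pointwise_degree TYPE('p) S y" by blast
    obtain U :: "(real^'p::{finite,linorder}) set" and \<phi> where "C11_param U \<phi> S" and yU: "y \<in> \<phi> ` U"
      using S y(1) unfolding C11_submanifold_def by blast
    then obtain V \<psi> \<phi>' where c: "chart S U \<phi> V \<psi> \<phi>'" unfolding C11_param_iff_chart by blast
    interpret chart S U \<phi> V \<psi> \<phi>' by (rule c)
    obtain u where u: "u \<in> U" "y = \<phi> u" using yU by blast
    obtain J where "J \<in> multi_indices" "tangent u J \<noteq> 0" using u(1) by (rule tangent_nonzero)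
    then show "n \<in> index_degree ` (multi_indices :: ('p \<Rightarrow> 4) set)"
      using pvector_degree_attained[of J "tangent u"] pointwise_degree_eq[OF u(1)] y(2) u(2) by force
  qed
  then have "finite (pointwise_degree TYPE('p) S ` S)" by (rule finite_subset) simp
  then show ?thesis unfolding submanifold_degree_def using x by (intro Max_ge) auto
qed

context chart
begin

lemma phi_in: "u \<in> U \<Longrightarrow> \<phi> u \<in> S"
  using image by blast

text \<open>The maximum defining the degree of \<open>S\<close> is taken over a finite set, so that it bounds the pointwise
  degrees.\<close>

lemma tangent_above_degree:
  assumes S: "C11_submanifold TYPE('p) S" and u: "u \<in> U"
    and J: "J \<in> multi_indices" "submanifold_degree TYPE('p) S < index_degree J"
  shows "tangent u J = 0"
proof (rule ccontr)
  assume "tangent u J \<noteq> 0"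
  then have "index_degree J \<le> pointwise_degree TYPE('p) S (\<phi> u)"
    unfolding pointwise_degree_eq[OF u] by (rule pvector_degree_ge[OF J(1)])
  also have "\<dots> \<le> submanifold_degree TYPE('p) S" by (rule pointwise_degree_le[OF S phi_in[OF u]])
  finally show False using J(2) by simp
qed

lemma pointwise_degree_attained:
  assumes u: "u \<in> U"
  shows "\<exists>I\<in>multi_indices. tangent u I \<noteq> 0 \<and> index_degree I = pointwise_degree TYPE('p) S (\<phi> u)"
proof -
  obtain J where "J \<in> multi_indices" "tangent u J \<noteq> 0" using u by (rule tangent_nonzero)
  then show ?thesis unfolding pointwise_degree_eq[OF u] by (rule pvector_degree_attained)
qed

text \<open>This is the multi-index used in both density estimates at points of maximal degree.\<close>

lemma largest_coefficient:
  assumes u: "u \<in> U" and d: "pointwise_degree TYPE('p) S (\<phi> u) = d"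
  obtains I where "I \<in> multi_indices" "index_degree I = d" "tangent u I \<noteq> 0"
    "\<And>J. J \<in> multi_indices \<Longrightarrow> index_degree J = d \<Longrightarrow> \<bar>tangent u J\<bar> \<le> \<bar>tangent u I\<bar>"
proof -
  let ?T = "{J \<in> multi_indices :: ('p \<Rightarrow> 4) set. index_degree J = d}"
  obtain I0 where I0: "I0 \<in> multi_indices" "tangent u I0 \<noteq> 0" "index_degree I0 = d"
    using pointwise_degree_attained[OF u] d by blast
  have fin: "finite ((\<lambda>J. \<bar>tangent u J\<bar>) ` ?T)" by simp
  have ne: "(\<lambda>J. \<bar>tangent u J\<bar>) ` ?T \<noteq> {}" using I0 by blast
  obtain I where I: "I \<in> ?T" "\<bar>tangent u I\<bar> = Max ((\<lambda>J. \<bar>tangent u J\<bar>) ` ?T)"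
    using Max_in[OF fin ne] by (metis (no_types, lifting) imageE)
  have top: "\<bar>tangent u J\<bar> \<le> \<bar>tangent u I\<bar>" if "J \<in> multi_indices" "index_degree J = d" for J
    unfolding I(2) using that fin by (intro Max_ge) auto
  then have "tangent u I \<noteq> 0" using I0 by fastforce
  then show thesis using that I(1) top by blast
qed

lemma degree_component_below:
  assumes u: "u \<in> U" and d: "pointwise_degree TYPE('p) S (\<phi> u) < d"
  shows "pvector_norm g (\<phi> u) (degree_component d (tangent u)) = 0"
proof -
  have "degree_component d (tangent u) J = 0" if "J \<in> multi_indices" for J
  proof (rule ccontr)
    assume "degree_component d (tangent u) J \<noteq> 0"
    then have "index_degree J = d" "tangent u J \<noteq> 0" by (auto simp: degree_component_def split: if_splits)
    then show False using pvector_degree_ge[OF that, of "tangent u"] d pointwise_degree_eq[OF u] by simp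
  qed
  then show ?thesis by (simp add: pvector_norm_def)
qed

text \<open>The part with bounded parameters is null since there the image under \<open>\<phi>\<close> of Lebesgue measure is
  finite and has infinite density.\<close>

lemma lower_degree_points_null:
  assumes h: "homogeneous \<rho>" and S: "C11_submanifold TYPE('p) S" and card: "CARD('p) \<le> 4"
    and d: "d = submanifold_degree TYPE('p) S"
  shows "spherical_hausdorff \<rho> d {x \<in> \<phi> ` U. pointwise_degree TYPE('p) S x < d} = 0"
proof -
  interpret homogeneous \<rho> by (rule h)
  obtain k where k: "1 \<le> k"
    and "\<And>x z r i. \<rho> x z \<le> r \<Longrightarrow> \<bar>engel_coord x (z - x) $ i\<bar> \<le> (k * r) ^ weight i"
    and k2: "\<And>x z s. 0 < s \<Longrightarrow> (\<And>i. \<bar>engel_coord x (z - x) $ i\<bar> \<le> s ^ weight i) \<Longrightarrow> \<rho> x z \<le> k * s"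
    using ball_box by metis
  define W where "W n = U \<inter> ball 0 (real n)" for n
  define A where "A n = {x \<in> \<phi> ` W n. pointwise_degree TYPE('p) S x < d}" for n
  have W: "open (W n)" "W n \<subseteq> U" for n using openU by (auto simp: W_def)
  have "spherical_hausdorff \<rho> d (A n) = 0" for n
  proof -
    define \<nu> where "\<nu> = distr (restrict_space lborel (W n)) borel \<phi>"
    have "continuous_on (W n) \<phi>" using cont_phi W(2) by (rule continuous_on_subset)
    then have "\<phi> \<in> borel_measurable (restrict_space borel (W n))" by (rule borel_measurable_continuous_on_restrict)
    moreover have "sets (restrict_space lborel (W n)) = sets (restrict_space borel (W n))"
      by (rule sets_restrict_space_cong) simp
    ultimately have meas: "\<phi> \<in> borel_measurable (restrict_space lborel (W n))"
      using measurable_cong_sets[OF _ refl] by blast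
    have \<nu>: "emeasure \<nu> B = emeasure lborel (W n \<inter> \<phi> -` B)" if "B \<in> sets borel" for B
    proof -
      have "emeasure \<nu> B = emeasure (restrict_space lborel (W n)) (\<phi> -` B \<inter> W n)"
        unfolding \<nu>_def using that meas by (simp add: emeasure_distr space_restrict_space)
      also have "\<dots> = emeasure lborel (\<phi> -` B \<inter> W n)"
        using W(1)[of n] by (intro emeasure_restrict_space) auto
      finally show ?thesis by (simp add: Int_commute)
    qed
    have sets\<nu>: "sets \<nu> = sets borel" by (simp add: \<nu>_def)
    have "emeasure \<nu> UNIV \<le> emeasure lborel (ball (0 :: real^'p::_) (real n))"
      using \<nu>[of UNIV] by (simp add: W_def) (intro emeasure_mono, auto)
    also have "\<dots> < \<infinity>" by (rule emeasure_lborel_ball_finite)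
    finally have fin: "emeasure \<nu> UNIV < \<infinity>" .
    show ?thesis
    proof (rule spherical_hausdorff_null_of_infinite_density[OF sets\<nu> fin])
      fix x :: "real^4" and C :: real assume x: "x \<in> A n" and C: "0 < C"
      obtain u where u: "u \<in> W n" "x = \<phi> u" and lt: "pointwise_degree TYPE('p) S (\<phi> u) < d"
        using x unfolding A_def by blast
      have uU: "u \<in> U" using u(1) W(2) by blast
      obtain I where I: "I \<in> multi_indices" "tangent u I \<noteq> 0" "index_degree I = pointwise_degree TYPE('p) S (\<phi> u)"
        using pointwise_degree_attained[OF uU] by blast
      have deg: "tangent u J = 0" if "J \<in> multi_indices" "index_degree I < index_degree J" for J
        using pvector_degree_ge[OF that(1), of "tangent u"] that(2) I(3) pointwise_degree_eq[OF uU] by fastforce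
      have "\<exists>r0>0. \<forall>r. 0 < r \<longrightarrow> r < r0 \<longrightarrow> ennreal (C * r ^ d) \<le> emeasure lborel (W n \<inter> \<phi> -` hball (\<phi> u) r)"
        using lt I(3) d by (intro lower_density_infinite[OF h k k2 card W(1) u(1) W(2) I(1) _ I(2) deg _ C]
          tangent_above_degree[OF S]) auto
      then show "\<exists>r0>0. \<forall>r. 0 < r \<longrightarrow> r < r0 \<longrightarrow> ennreal (C * r ^ d) \<le> emeasure \<nu> (hball x r)"
        by (simp add: \<nu>[OF hball_borel] u(2))
    qed
  qed
  moreover have "{x \<in> \<phi> ` U. pointwise_degree TYPE('p) S x < d} \<subseteq> (\<Union>n. A n)"
  proof
    fix x assume "x \<in> {x \<in> \<phi> ` U. pointwise_degree TYPE('p) S x < d}"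
    then obtain u where u: "u \<in> U" "x = \<phi> u" "pointwise_degree TYPE('p) S x < d" by blast
    obtain n where "norm u < real n" using reals_Archimedean2 by blast
    then have "u \<in> W n" using u(1) by (simp add: W_def)
    then show "x \<in> (\<Union>n. A n)" using u by (auto simp: A_def)
  qed
  ultimately have "spherical_hausdorff \<rho> d {x \<in> \<phi> ` U. pointwise_degree TYPE('p) S x < d} \<le> 0"
    using spherical_hausdorff_countably_subadditive[of _ A d] by simp
  then show ?thesis by simp
qed

end

section \<open>The comparison of the two measures\<close>

lemma degree_measure_concentrated:
  assumes S: "C11_submanifold TYPE('p::{finite,linorder}) S" and g: "riemannian_metric g" and A: "A \<in> sets borel"
  shows "emeasure (degree_measure TYPE('p) g d S) A = emeasure (degree_measure TYPE('p) g d S) (A \<inter> S)"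
proof -
  have "A \<inter> S \<in> sets borel" using A submanifold_borel[OF S] by simp
  then show ?thesis
    unfolding emeasure_degree_measure[OF S g A] emeasure_degree_measure[OF S g \<open>A \<inter> S \<in> sets borel\<close>]
    by (intro nn_integral_cong) (simp add: indicator_def)
qed

context chart
begin

lemma maximal_degree_points_borel:
  assumes S: "C11_submanifold TYPE('p) S" and d: "d = submanifold_degree TYPE('p) S"
  shows "{x \<in> \<phi> ` U. pointwise_degree TYPE('p) S x = d} \<in> sets borel"
proof -
  let ?D = "\<Union>I\<in>{I \<in> multi_indices. index_degree I = d}. {u \<in> U. tangent u I \<noteq> 0}"
  have "open {u \<in> U. tangent u I \<noteq> 0}" for I
  proof -
    have "open (U \<inter> (\<lambda>u. tangent u I) -` (- {0}))"
      by (rule continuous_open_preimage[OF cont_tangent openU]) auto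
    moreover have "U \<inter> (\<lambda>u. tangent u I) -` (- {0}) = {u \<in> U. tangent u I \<noteq> 0}" by auto
    ultimately show ?thesis by simp
  qed
  then have "open ?D" by blast
  then have "\<phi> ` ?D \<in> sets borel" by (intro image_in_borel borel_open) auto
  moreover have "(pointwise_degree TYPE('p) S (\<phi> u) = d) = (u \<in> ?D)" if u: "u \<in> U" for u
  proof
    assume "pointwise_degree TYPE('p) S (\<phi> u) = d"
    then show "u \<in> ?D" using pointwise_degree_attained[OF u] u by auto
  next
    assume "u \<in> ?D"
    then obtain I where "I \<in> multi_indices" "index_degree I = d" "tangent u I \<noteq> 0" by blast
    then have "d \<le> pointwise_degree TYPE('p) S (\<phi> u)"
      using pvector_degree_ge[of I "tangent u"] pointwise_degree_eq[OF u] by simp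
    then show "pointwise_degree TYPE('p) S (\<phi> u) = d"
      using pointwise_degree_le[OF S phi_in[OF u]] d by simp
  qed
  then have "{x \<in> \<phi> ` U. pointwise_degree TYPE('p) S x = d} = \<phi> ` ?D" by blast
  ultimately show ?thesis by simp
qed

lemma degree_measure_below:
  assumes S: "C11_submanifold TYPE('p) S" and g: "riemannian_metric g" and A: "A \<in> sets borel" "A \<subseteq> \<phi> ` U"
    and low: "\<And>x. x \<in> A \<Longrightarrow> pointwise_degree TYPE('p) S x < d"
  shows "emeasure (degree_measure TYPE('p) g d S) A = 0"
proof -
  have zero: "indicator (U \<inter> \<phi> -` A) u * pvector_norm g (\<phi> u) (degree_component d (tangent u)) = 0" for u
  proof (cases "u \<in> U \<inter> \<phi> -` A")
    case True
    then show ?thesis using low by (simp add: degree_component_below)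
  qed simp
  show ?thesis unfolding degree_measure_in_chart[OF S g chart_axioms A] zero by simp
qed

text \<open>The open parts of the chart with bounded parameters and bounded density have finite measure.\<close>

lemma degree_measure_finite_cover:
  assumes S: "C11_submanifold TYPE('p) S" and g: "riemannian_metric g"
  shows "\<exists>T::nat \<Rightarrow> _. (\<forall>n. open (T n) \<and> emeasure (degree_measure TYPE('p) g d S) (T n) < \<infinity>) \<and> \<phi> ` U \<subseteq> (\<Union>n. T n)"
proof -
  let ?N = "\<lambda>u. pvector_norm g (\<phi> u) (degree_component d (tangent u))"
  define D where "D n = (U \<inter> ?N -` {..< real n}) \<inter> ball 0 (real n)" for n
  have oD: "open (D n)" and DU: "D n \<subseteq> U" for n
    using continuous_open_preimage[OF cont_degree_component_norm[OF g] openU, of "{..< real n}" d]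
    by (auto simp: D_def)
  have "\<forall>n. \<exists>T. open T \<and> \<phi> ` D n = S \<inter> T" using relatively_open_image[OF oD DU] by metis
  then obtain T where T: "\<And>n. open (T n)" "\<And>n. \<phi> ` D n = S \<inter> T n" by metis
  have "emeasure (degree_measure TYPE('p) g d S) (T n) < \<infinity>" for n
  proof -
    have DB: "\<phi> ` D n \<in> sets borel" using oD DU by (intro image_in_borel borel_open)
    have UD: "U \<inter> \<phi> -` \<phi> ` D n = D n" using DU inj_phi by (auto simp: inj_on_def)
    have "emeasure (degree_measure TYPE('p) g d S) (T n) = emeasure (degree_measure TYPE('p) g d S) (T n \<inter> S)"
      using T(1) by (intro degree_measure_concentrated[OF S g] borel_open)
    also have "T n \<inter> S = \<phi> ` D n" using T(2) by blast
    also have "emeasure (degree_measure TYPE('p) g d S) (\<phi> ` D n) = (\<integral>\<^sup>+u. ennreal (indicator (D n) u * ?N u) \<partial>lborel)"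
      using degree_measure_in_chart[OF S g chart_axioms DB] DU UD by (simp add: image_mono)
    also have "\<dots> \<le> (\<integral>\<^sup>+u. ennreal (real n) * indicator (ball (0 :: real^'p::_) (real n)) u \<partial>lborel)"
      by (intro nn_integral_mono) (auto simp: indicator_def D_def intro!: ennreal_leI)
    also have "\<dots> = ennreal (real n) * emeasure lborel (ball (0 :: real^'p::_) (real n))"
      by (simp add: nn_integral_cmult_indicator)
    also have "\<dots> < \<infinity>" by (simp add: ennreal_mult_less_top emeasure_lborel_ball_finite[simplified])
    finally show ?thesis .
  qed
  moreover have "\<phi> ` U \<subseteq> (\<Union>n. T n)"
  proof
    fix x assume "x \<in> \<phi> ` U"
    then obtain u where u: "u \<in> U" "x = \<phi> u" by blast
    obtain n where n: "max (norm u) (?N u) < real n" using reals_Archimedean2 by blast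
    then have "u \<in> D n" using u(1) by (simp add: D_def)
    then show "x \<in> (\<Union>n. T n)" using T(2) u(2) by blast
  qed
  ultimately show ?thesis using T(1) by blast
qed

end

text \<open>The density estimates are used on \<open>S - Z\<close> only, where \<open>Z\<close> is the set of points of lower degree, which
  is null for both measures.\<close>

theorem spherical_hausdorff_comparison:
  assumes h: "homogeneous \<rho>" and S: "C11_submanifold TYPE('p::{finite,linorder}) S" and g: "riemannian_metric g"
    and card: "CARD('p) \<le> 4" and d: "d = submanifold_degree TYPE('p) S"
    and \<Omega>: "open \<Omega>" and ab: "0 < a" "0 < b"
    and bounds: "\<And>x (\<tau> :: 'p pvector). x \<in> \<Omega> \<Longrightarrow>
      a * coefficient_sum \<tau> \<le> pvector_norm g x \<tau> \<and> pvector_norm g x \<tau> \<le> b * coefficient_sum \<tau>"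
  shows "\<exists>c C :: real. 0 < c \<and> c \<le> C \<and> (\<forall>A\<in>sets borel. A \<subseteq> S \<inter> \<Omega> \<longrightarrow>
    ennreal c * intrinsic_measure TYPE('p) g d S A \<le> spherical_hausdorff \<rho> d A \<and>
    spherical_hausdorff \<rho> d A \<le> ennreal C * intrinsic_measure TYPE('p) g d S A)"
proof -
  interpret homogeneous \<rho> by (rule h)
  obtain k where k: "1 \<le> k"
    and k1: "\<And>x z r i. \<rho> x z \<le> r \<Longrightarrow> \<bar>engel_coord x (z - x) $ i\<bar> \<le> (k * r) ^ weight i"
    and k2: "\<And>x z s. 0 < s \<Longrightarrow> (\<And>i. \<bar>engel_coord x (z - x) $ i\<bar> \<le> s ^ weight i) \<Longrightarrow> \<rho> x z \<le> k * s"
    using ball_box by metis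
  have k0: "0 < k" using k by simp
  let ?m = "degree_measure TYPE('p) g d S"
  have sm: "sets ?m = sets borel" by (rule sets_degree_measure[OF S g])
  have lower: "pvector_norm g x \<tau> \<le> b * coefficient_sum \<tau>" and upper: "a * coefficient_sum \<tau> \<le> pvector_norm g x \<tau>"
    if "x \<in> \<Omega>" for x and \<tau> :: "'p pvector" using bounds[OF that] by auto
  obtain U :: "nat \<Rightarrow> (real^'p::{finite,linorder}) set" and \<phi> V \<psi> \<phi>'
    where ch: "\<And>i. chart S (U i) (\<phi> i) (V i) (\<psi> i) (\<phi>' i)" and SU: "S = (\<Union>i. \<phi> i ` U i)"
    using countable_atlas[OF S] by blast
  have pd: "pointwise_degree TYPE('p) S x \<le> d" if "x \<in> S" for x
    using pointwise_degree_le[OF S that] d by simp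
  define Z where "Z = {x \<in> S. pointwise_degree TYPE('p) S x < d}"
  have ZB: "S - Z \<in> sets borel"
  proof -
    have "S - Z = (\<Union>i. {x \<in> \<phi> i ` U i. pointwise_degree TYPE('p) S x = d})"
      using pd unfolding Z_def SU by (auto simp: le_less) 
    moreover have "{x \<in> \<phi> i ` U i. pointwise_degree TYPE('p) S x = d} \<in> sets borel" for i
      by (rule chart.maximal_degree_points_borel[OF ch S d])
    ultimately show ?thesis by simp
  qed
  have Z0: "spherical_hausdorff \<rho> d Z = 0"
  proof -
    have "Z \<subseteq> (\<Union>i. {x \<in> \<phi> i ` U i. pointwise_degree TYPE('p) S x < d})" unfolding Z_def SU by blast
    then have "spherical_hausdorff \<rho> d Z \<le> (\<Sum>i. spherical_hausdorff \<rho> d {x \<in> \<phi> i ` U i. pointwise_degree TYPE('p) S x < d})"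
      by (rule spherical_hausdorff_countably_subadditive)
    also have "\<dots> = 0" by (simp add: chart.lower_degree_points_null[OF ch h S card d])
    finally show ?thesis by simp
  qed
  have mZ: "emeasure ?m A = emeasure ?m (A - Z)" if A: "A \<in> sets borel" "A \<subseteq> S" for A
  proof -
    have AZB: "A - Z \<in> sets borel"
    proof -
      have "A - Z = A \<inter> (S - Z)" using A(2) by blast
      then show ?thesis using A(1) ZB by simp
    qed
    define N where "N i = (A - (A - Z)) \<inter> \<phi> i ` U i" for i
    have UB: "\<phi> i ` U i \<in> sets borel" for i
      using chart.openU[OF ch] by (intro chart.image_in_borel[OF ch] borel_open order_refl)
    have NB: "N i \<in> sets borel" for i unfolding N_def by (rule sets.Int[OF sets.Diff[OF A(1) AZB] UB])
    have "emeasure ?m (N i) = 0" for i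
      by (rule chart.degree_measure_below[OF ch S g NB]) (auto simp: N_def Z_def)
    then have "emeasure ?m (\<Union>i. N i) = 0" using NB sm by (intro emeasure_UN_eq_0) auto
    moreover have "(\<Union>i. N i) = A - (A - Z)" using A(2) unfolding N_def SU by blast
    ultimately have "A - (A - Z) \<in> null_sets ?m" using A(1) AZB sm by (intro null_setsI) auto
    then have "emeasure ?m ((A - Z) \<union> (A - (A - Z))) = emeasure ?m (A - Z)"
      using AZB sm by (intro emeasure_Un_null_set) auto
    moreover have "(A - Z) \<union> (A - (A - Z)) = A" by blast
    ultimately show ?thesis by simp
  qed
  have cover: "\<exists>i u. u \<in> U i \<and> x = \<phi> i u" if "x \<in> S" for x using that SU by blast
  define c1 where "c1 = 4 * b * real (card (multi_indices :: ('p \<Rightarrow> 4) set)) * (2 ^ CARD('p) * k ^ d) + 1"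
  have c1: "0 < c1" using ab k by (simp add: c1_def add_nonneg_pos)
  define c2 where "c2 = a / 4 * 2 ^ CARD('p) / (20 * k) ^ d"
  have c2: "0 < c2" using ab k by (simp add: c2_def)
  have below: "emeasure ?m A \<le> ennreal (c1 * 2 ^ d) * spherical_hausdorff \<rho> d A"
    if A: "A \<in> sets borel" "A \<subseteq> S \<inter> \<Omega>" for A
  proof -
    have AZB: "A - Z \<in> sets borel"
    proof -
      have "A - Z = A \<inter> (S - Z)" using A(2) by blast
      then show ?thesis using A(1) ZB by simp
    qed
    have "emeasure ?m (A - Z) \<le> ennreal (c1 * 2 ^ d) * spherical_hausdorff \<rho> d (A - Z)"
    proof (rule measure_le_spherical_hausdorff[OF sm AZB c1])
      fix x assume x: "x \<in> A - Z"
      then have xS: "x \<in> S" and x\<Omega>: "x \<in> \<Omega>" using A(2) by auto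
      then have xd: "pointwise_degree TYPE('p) S x = d" using x pd[OF xS] by (auto simp: Z_def)
      obtain i u where u: "u \<in> U i" "x = \<phi> i u" using cover[OF xS] by blast
      interpret chart S "U i" "\<phi> i" "V i" "\<psi> i" "\<phi>' i" by (rule ch)
      obtain I where I: "I \<in> multi_indices" "index_degree I = d" "tangent u I \<noteq> 0"
        and top: "\<And>J. J \<in> multi_indices \<Longrightarrow> index_degree J = d \<Longrightarrow> \<bar>tangent u J\<bar> \<le> \<bar>tangent u I\<bar>"
        using largest_coefficient[OF u(1)] xd u(2) by blast
      have "\<exists>N r0. open N \<and> \<phi> i u \<in> N \<and> 0 < r0 \<and> (\<forall>x\<in>N. \<forall>r. 0 < r \<longrightarrow> r < r0 \<longrightarrow>
        emeasure ?m (hball x r) \<le>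
          ennreal (4 * b * real (card (multi_indices :: ('p \<Rightarrow> 4) set)) * (2 ^ CARD('p) * k ^ d) * r ^ d))"
        by (rule upper_density[OF h k0 k1 u(1) I(2,3) top \<Omega> x\<Omega>[unfolded u(2)] ab(2) lower
            degree_measure_in_chart[OF S g chart_axioms] degree_measure_concentrated[OF S g] submanifold_borel[OF S]])
      then obtain N r0 where N: "open N" "\<phi> i u \<in> N" "0 < r0" and
        up: "\<And>x r. x \<in> N \<Longrightarrow> 0 < r \<Longrightarrow> r < r0 \<Longrightarrow> emeasure ?m (hball x r) \<le>
          ennreal (4 * b * real (card (multi_indices :: ('p \<Rightarrow> 4) set)) * (2 ^ CARD('p) * k ^ d) * r ^ d)" by blast
      have "emeasure ?m (hball y r) \<le> ennreal (c1 * r ^ d)" if "y \<in> N" "0 < r" "r < r0" for y r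
      proof (rule order_trans[OF up[OF that]], rule ennreal_leI)
        show "4 * b * real (card (multi_indices :: ('p \<Rightarrow> 4) set)) * (2 ^ CARD('p) * k ^ d) * r ^ d \<le> c1 * r ^ d"
          using that(2) unfolding c1_def by (intro mult_right_mono) auto
      qed
      then show "\<exists>N r0. open N \<and> x \<in> N \<and> 0 < r0 \<and>
          (\<forall>y\<in>N. \<forall>r. 0 < r \<longrightarrow> r < r0 \<longrightarrow> emeasure ?m (hball y r) \<le> ennreal (c1 * r ^ d))"
        using N u(2) by blast
    qed
    also have "\<dots> \<le> ennreal (c1 * 2 ^ d) * spherical_hausdorff \<rho> d A"
      by (intro mult_left_mono spherical_hausdorff_mono) auto
    finally show ?thesis using mZ[OF A(1)] A(2) by simp
  qed
  have "\<forall>i. \<exists>T::nat \<Rightarrow> _. (\<forall>n. open (T n) \<and> emeasure ?m (T n) < \<infinity>) \<and> \<phi> i ` U i \<subseteq> (\<Union>n. T n)"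
    using chart.degree_measure_finite_cover[OF ch S g] by blast
  from choice[OF this] obtain T :: "nat \<Rightarrow> nat \<Rightarrow> (real^4) set" where
    T0: "\<forall>i. (\<forall>n. open (T i n) \<and> emeasure ?m (T i n) < \<infinity>) \<and> \<phi> i ` U i \<subseteq> (\<Union>n. T i n)" ..
  then have T: "open (T i n)" "emeasure ?m (T i n) < \<infinity>" "\<phi> i ` U i \<subseteq> (\<Union>n. T i n)" for i n
    by simp_all
  define T' where "T' j = T (fst (prod_decode j)) (snd (prod_decode j))" for j
  have T': "open (T' j)" "emeasure ?m (T' j) < \<infinity>" for j using T(1,2) by (auto simp: T'_def)
  have ST': "S \<subseteq> (\<Union>j. T' j)"
  proof
    fix x assume "x \<in> S"
    then obtain i n where "x \<in> T i n" using T(3) unfolding SU by blast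
    then have "x \<in> T' (prod_encode (i, n))" by (simp add: T'_def)
    then show "x \<in> (\<Union>j. T' j)" by blast
  qed
  have above: "spherical_hausdorff \<rho> d A \<le> ennreal (3 ^ d / c2) * emeasure ?m A"
    if A: "A \<in> sets borel" "A \<subseteq> S \<inter> \<Omega>" for A
  proof -
    have AZB: "A - Z \<in> sets borel"
    proof -
      have "A - Z = A \<inter> (S - Z)" using A(2) by blast
      then show ?thesis using A(1) ZB by simp
    qed
    have AZT: "A - Z \<subseteq> (\<Union>j. T' j)" using A(2) ST' by blast
    have "spherical_hausdorff \<rho> d A \<le> spherical_hausdorff \<rho> d ((A - Z) \<union> Z)"
      by (rule spherical_hausdorff_mono) blast
    also have "\<dots> \<le> spherical_hausdorff \<rho> d (A - Z) + spherical_hausdorff \<rho> d Z" by (rule spherical_hausdorff_Un)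
    also have "\<dots> = spherical_hausdorff \<rho> d (A - Z)" by (simp add: Z0)
    also have "\<dots> \<le> ennreal (3 ^ d / c2) * emeasure ?m (A - Z)"
    proof (rule spherical_hausdorff_le_of_density_sigma_finite[OF sm T' AZB AZT c2])
      fix x assume x: "x \<in> A - Z"
      then have xS: "x \<in> S" and x\<Omega>: "x \<in> \<Omega>" using A(2) by auto
      then have xd: "pointwise_degree TYPE('p) S x = d" using x pd[OF xS] by (auto simp: Z_def)
      obtain i u where u: "u \<in> U i" "x = \<phi> i u" using cover[OF xS] by blast
      interpret chart S "U i" "\<phi> i" "V i" "\<psi> i" "\<phi>' i" by (rule ch)
      obtain I where I: "I \<in> multi_indices" "index_degree I = d" "tangent u I \<noteq> 0"
        and top: "\<And>J. J \<in> multi_indices \<Longrightarrow> index_degree J = d \<Longrightarrow> \<bar>tangent u J\<bar> \<le> \<bar>tangent u I\<bar>"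
        using largest_coefficient[OF u(1)] xd u(2) by blast
      have "\<exists>r0>0. \<forall>r. 0 < r \<longrightarrow> r < r0 \<longrightarrow>
        ennreal (a / 4 * 2 ^ CARD('p) / (20 * k) ^ d * r ^ d) \<le> emeasure ?m (hball (\<phi> i u) r)"
        by (rule lower_density_maximal[OF h k k2 card u(1) I top tangent_above_degree[OF S, folded d] \<Omega>
            x\<Omega>[unfolded u(2)] ab(1) upper degree_measure_in_chart[OF S g chart_axioms] sm])
      then show "\<exists>r0>0. \<forall>r. 0 < r \<longrightarrow> r < r0 \<longrightarrow> ennreal (c2 * r ^ d) \<le> emeasure ?m (hball x r)"
        by (simp add: c2_def u(2))
    qed
    finally show ?thesis using mZ[OF A(1)] A(2) by simp
  qed
  define c where "c = 1 / (c1 * 2 ^ d)"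
  define C where "C = max c (3 ^ d / c2)"
  have c: "0 < c" using c1 by (simp add: c_def)
  have "ennreal c * intrinsic_measure TYPE('p) g d S A \<le> spherical_hausdorff \<rho> d A \<and>
    spherical_hausdorff \<rho> d A \<le> ennreal C * intrinsic_measure TYPE('p) g d S A"
    if A: "A \<in> sets borel" "A \<subseteq> S \<inter> \<Omega>" for A
  proof -
    have AS: "A \<subseteq> S" using A(2) by blast
    have "ennreal c * emeasure ?m A \<le> ennreal c * (ennreal (c1 * 2 ^ d) * spherical_hausdorff \<rho> d A)"
      by (intro mult_left_mono below A) simp
    also have "\<dots> = ennreal (c * (c1 * 2 ^ d)) * spherical_hausdorff \<rho> d A"
      using c c1 by (simp add: mult.assoc[symmetric] ennreal_mult)
    also have "c * (c1 * 2 ^ d) = 1" using c1 by (simp add: c_def)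
    finally have "ennreal c * emeasure ?m A \<le> spherical_hausdorff \<rho> d A" by simp
    moreover have "spherical_hausdorff \<rho> d A \<le> ennreal C * emeasure ?m A"
      using above[OF A] by (rule order_trans) (intro mult_right_mono ennreal_leI, auto simp: C_def)
    ultimately show ?thesis unfolding intrinsic_measure_eq[OF S g A(1) AS] by blast
  qed
  then show ?thesis using c by (intro exI[of _ c] exI[of _ C]) (auto simp: C_def)
qed

theorem mainTheorem3:
  fixes \<rho> :: "real^4 \<Rightarrow> real^4 \<Rightarrow> real"
    and g :: "real^4 \<Rightarrow> real^4 \<Rightarrow> real^4 \<Rightarrow> real"
    and S :: "(real^4) set"
    and p d :: nat
  assumes "homogeneous_distance \<rho>"
    and "riemannian_metric g"
    and "p = CARD('p::{finite,linorder})" and "1 \<le> p" and "p \<le> 4"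
    and "C11_submanifold TYPE('p) S"
    and "d = submanifold_degree TYPE('p) S"
  shows "(left_invariant_metric g \<longrightarrow>
            (\<exists>c C :: real. 0 < c \<and> c \<le> C \<and>
              (\<forall>A\<in>sets borel. A \<subseteq> S \<longrightarrow>
                 ennreal c * intrinsic_measure TYPE('p) g d S A \<le> spherical_hausdorff \<rho> d A \<and>
                 spherical_hausdorff \<rho> d A \<le> ennreal C * intrinsic_measure TYPE('p) g d S A))) \<and>
         (\<forall>K. compact K \<longrightarrow>
            (\<exists>c C :: real. 0 < c \<and> c \<le> C \<and>
              (\<forall>A\<in>sets borel. A \<subseteq> S \<inter> K \<longrightarrow>
                 ennreal c * intrinsic_measure TYPE('p) g d S A \<le> spherical_hausdorff \<rho> d A \<and>
                 spherical_hausdorff \<rho> d A \<le> ennreal C * intrinsic_measure TYPE('p) g d S A)))"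
proof -
  have h: "homogeneous \<rho>" using assms(1) by unfold_locales
  have card: "CARD('p) \<le> 4" using assms(3,5) by simp
  note comparison = spherical_hausdorff_comparison[OF h assms(6,2) card assms(7)]
  show ?thesis
  proof (intro conjI impI allI)
    assume inv: "left_invariant_metric g"
    have K: "compact {0 :: real^4}" by simp
    obtain a b where ab: "0 < a" "0 < b" and bounds: "\<And>x (\<tau> :: 'p pvector). x \<in> {0} \<Longrightarrow>
       a * coefficient_sum \<tau> \<le> pvector_norm g x \<tau> \<and> pvector_norm g x \<tau> \<le> b * coefficient_sum \<tau>"
      using pvector_norm_bounds_compact[where 'p='p, OF assms(2) K] by blast
    have bounds': "a * coefficient_sum \<tau> \<le> pvector_norm g x \<tau> \<and> pvector_norm g x \<tau> \<le> b * coefficient_sum \<tau>"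
      if "x \<in> UNIV" for x and \<tau> :: "'p pvector"
      unfolding left_invariant_pvector_norm[OF inv, of x] by (rule bounds) simp
    show "\<exists>c C :: real. 0 < c \<and> c \<le> C \<and> (\<forall>A\<in>sets borel. A \<subseteq> S \<longrightarrow>
        ennreal c * intrinsic_measure TYPE('p) g d S A \<le> spherical_hausdorff \<rho> d A \<and>
        spherical_hausdorff \<rho> d A \<le> ennreal C * intrinsic_measure TYPE('p) g d S A)"
      using comparison[OF open_UNIV ab bounds'] by simp
  next
    fix K :: "(real^4) set" assume "compact K"
    then obtain R where R: "K \<subseteq> ball 0 R"
      using compact_imp_bounded bounded_subset_ballD by blast
    have "compact (cball (0 :: real^4) R)" by simp
    obtain a b where ab: "0 < a" "0 < b" and bounds: "\<And>x (\<tau> :: 'p pvector). x \<in> cball 0 R \<Longrightarrow>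
       a * coefficient_sum \<tau> \<le> pvector_norm g x \<tau> \<and> pvector_norm g x \<tau> \<le> b * coefficient_sum \<tau>"
      using pvector_norm_bounds_compact[where 'p='p, OF assms(2) \<open>compact (cball 0 R)\<close>] by blast
    have bounds': "a * coefficient_sum \<tau> \<le> pvector_norm g x \<tau> \<and> pvector_norm g x \<tau> \<le> b * coefficient_sum \<tau>"
      if "x \<in> ball 0 R" for x and \<tau> :: "'p pvector"
      by (rule bounds) (use that in auto)
    obtain c C :: real where cC: "0 < c" "c \<le> C" and
      cmp: "\<forall>A\<in>sets borel. A \<subseteq> S \<inter> ball 0 R \<longrightarrow>
        ennreal c * intrinsic_measure TYPE('p) g d S A \<le> spherical_hausdorff \<rho> d A \<and>
        spherical_hausdorff \<rho> d A \<le> ennreal C * intrinsic_measure TYPE('p) g d S A"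
      using comparison[where \<Omega> = "ball 0 R", OF open_ball ab] bounds' by blast
    have sub: "A \<subseteq> S \<inter> ball 0 R" if "A \<subseteq> S \<inter> K" for A using that R by blast
    show "\<exists>c C :: real. 0 < c \<and> c \<le> C \<and> (\<forall>A\<in>sets borel. A \<subseteq> S \<inter> K \<longrightarrow>
        ennreal c * intrinsic_measure TYPE('p) g d S A \<le> spherical_hausdorff \<rho> d A \<and>
        spherical_hausdorff \<rho> d A \<le> ennreal C * intrinsic_measure TYPE('p) g d S A)"
    proof (rule exI[of _ c], rule exI[of _ C], intro conjI[OF cC(1)] conjI[OF cC(2)] ballI impI)
      fix A :: "(real^4) set" assume "A \<in> sets borel" "A \<subseteq> S \<inter> K"
      then show "ennreal c * intrinsic_measure TYPE('p) g d S A \<le> spherical_hausdorff \<rho> d A \<and>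
          spherical_hausdorff \<rho> d A \<le> ennreal C * intrinsic_measure TYPE('p) g d S A"
        using cmp[rule_format] sub[of A] by simp
    qed
  qed
qed

end
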